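(* Let $N\ge1$ and let $0<\gamma\le 1/2$ be given. Then, for any $\boldsymbol{\xi}\in(\overline{\mathbb{Q}}^{\times})^N$ and any $F\in\mathcal{A}$, we have $$\mathcal{E}(F,\boldsymbol{\xi})\le C(F)\,h_{\mathcal{D}}(\boldsymbol{\xi})^{\gamma},$$ with $$C(F):=\sum_{\boldsymbol{n}\in\mathbb{Z}^N}\int_{\mathbb{R}^N}\big|\widehat{F}(\boldsymbol{n},\boldsymbol{t})\big|\Big(2(8\pi)^{\gamma}\|\boldsymbol{t}\|_\infty^{\gamma}+24^{\gamma}\|\boldsymbol{n}\|_1^{\gamma}\Big)\,d\boldsymbol{t}.$$ Moreover, the exponent $\gamma$ is sharp in the following sense: there exist a function $F\in\mathcal{A}$ with $C(F)<\infty$ and a sequence $\{\boldsymbol{\xi}_k\}_{k\ge1}\subset(\overline{\mathbb{Q}}^{\times})^N$ with $\lim_{k\to\infty}h_{\mathcal{D}}(\boldsymbol{\xi}_k)=0$ for which, for every $k\geq 1$, $$\mathcal{E}(F,\boldsymbol{\xi}_k)\ge\frac{h_{\mathcal{D}}(\boldsymbol{\xi}_k)^{\gamma}}{|\log h_{\mathcal{D}}(\boldsymbol{\xi}_k)|\,\big(\log|\log h_{\mathcal{D}}(\boldsymbol{\xi}_k)|\big)^2}.$$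
   Context: Fix $\overline{\mathbb{Q}}\subset\mathbb{C}$, the algebraic closure of $\mathbb{Q}$; $\overline{\mathbb{Q}}^\times$, $\mathbb{C}^\times$ are the multiplicative groups. Heights. For $\xi\in\overline{\mathbb{Q}}$ let $P_\xi(x)=c_d\prod_{j=1}^d(x-\alpha_j)\in\mathbb{Z}[x]$ be its minimal polynomial (primitive, with integer coefficients), $d=\deg(\xi)=[\mathbb{Q}(\xi):\mathbb{Q}]$. Its Weil height is $h(\xi)=\frac1d\big(\log|c_d|+\sum_{j=1}^d\log^+|\alpha_j|\big)$, where $\log^+x=\max\{0,\log x\}$ (and $\log^+0=0$). For $\boldsymbol{\xi}=(\xi_1,\dots,\xi_N)\in(\overline{\mathbb{Q}}^\times)^N$, $h(\boldsymbol{\xi}):=h(\xi_1)+\dots+h(\xi_N)$. For $\boldsymbol{n}\in\mathbb{Z}^N$, $\chi^{\boldsymbol{n}}(\boldsymbol{\xi}):=\xi_1^{n_1}\cdots\xi_N^{n_N}$. The generalized degree is $\mathcal{D}(\boldsymbol{\xi}):=\min_{\boldsymbol{n}\in\mathbb{Z}^N\setminus\{\boldsymbol{0}\}}\{\|\boldsymbol{n}\|_1\deg(\chi^{\boldsymbol{n}}(\boldsymbol{\xi}))\}$, and $h_{\mathcal{D}}(\boldsymbol{\xi}):=h(\boldsymbol{\xi})+\frac{\log(2\mathcal{D}(\boldsymbol{\xi}))}{3\mathcal{D}(\boldsymbol{\xi})}$. Here $\|\boldsymbol{n}\|_1=\sum_j|n_j|$, $\|\boldsymbol{t}\|_\infty=\max_j|t_j|$.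 Equidistribution error. Let $\mathbb{T}=\mathbb{R}/\mathbb{Z}$. The space $\mathbb{T}^N\times\mathbb{R}^N$ is identified with $(\mathbb{C}^\times)^N$ via $(\boldsymbol{\theta},\boldsymbol{s})\mapsto(e^{2\pi i\theta_1+s_1},\dots,e^{2\pi i\theta_N+s_N})$, and test functions are viewed as functions $F(\boldsymbol{\theta},\boldsymbol{s})$ on $\mathbb{T}^N\times\mathbb{R}^N$. Let $S=\{(\sigma\xi_1,\dots,\sigma\xi_N):\sigma\in\mathrm{Gal}(\overline{\mathbb{Q}}/\mathbb{Q})\}$ be the (finite) Galois orbit of $\boldsymbol{\xi}$. For $\boldsymbol{\alpha}\in S$ let $(\boldsymbol{\theta}(\boldsymbol{\alpha}),\boldsymbol{s}(\boldsymbol{\alpha}))$ be the corresponding point of $\mathbb{T}^N\times\mathbb{R}^N$, i.e. $\boldsymbol{\theta}(\boldsymbol{\alpha})=(\arg(\alpha_j)/2\pi)_j$, $\boldsymbol{s}(\boldsymbol{\alpha})=(\log|\alpha_j|)_j$. Then $$\mathcal{E}(F,\boldsymbol{\xi}):=\Big|\frac1{|S|}\sum_{\boldsymbol{\alpha}\in S}F(\boldsymbol{\theta}(\boldsymbol{\alpha}),\boldsymbol{s}(\boldsymbol{\alpha}))-\int_{\mathbb{T}^N}F(\boldsymbol{\theta},\boldsymbol{0})\,d\boldsymbol{\theta}\Big|,$$ that is, the absolute difference of the integrals of $F$ against the uniform probability measure on $S$ and the Haar probability measure on the unit polycircle $(\mathbb{S}^1)^N$. Fourier transform. For $F\in L^1(\mathbb{T}^N\times\mathbb{R}^N)$,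 $\widehat{F}(\boldsymbol{n},\boldsymbol{t})=\int_{\mathbb{T}^N}\int_{\mathbb{R}^N}F(\boldsymbol{\theta},\boldsymbol{s})e^{-2\pi i\boldsymbol{n}\cdot\boldsymbol{\theta}}e^{-2\pi i\boldsymbol{t}\cdot\boldsymbol{s}}\,d\boldsymbol{s}\,d\boldsymbol{\theta}$ for $(\boldsymbol{n},\boldsymbol{t})\in\mathbb{Z}^N\times\mathbb{R}^N$, extended to $L^2$ by Plancherel. Class of test functions. $\mathcal{A}$ is the set of continuous $F:\mathbb{T}^N\times\mathbb{R}^N\to\mathbb{C}$ with $F\in L^2(\mathbb{T}^N\times\mathbb{R}^N)$ and $\widehat{F}\in L^1(\mathbb{Z}^N\times\mathbb{R}^N)$ (counting measure times Lebesgue measure). Convention. If $C(F)=\infty$ the upper bound is trivially true. *)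

theory Defs
  imports
    "HOL-Analysis.Analysis"
    "HOL-Computational_Algebra.Computational_Algebra"
begin

section \<open>Heights and the generalized degree\<close>

abbreviation complex_poly :: "int poly \<Rightarrow> complex poly" where
  "complex_poly \<equiv> map_poly of_int"

text \<open>Meaningful for algebraic arguments only; the sign of the leading coefficient is
  normalised to make the polynomial unique.\<close>

definition int_minpoly :: "complex \<Rightarrow> int poly" where
  "int_minpoly \<xi> = (THE p. p \<noteq> 0 \<and> poly (complex_poly p) \<xi> = 0 \<and>
     (\<forall>q. q \<noteq> 0 \<and> poly (complex_poly q) \<xi> = 0 \<longrightarrow> degree p \<le> degree q) \<and>
     content p = 1 \<and> lead_coeff p > 0)"

definition alg_degree :: "complex \<Rightarrow> nat" where
  "alg_degree \<xi> = degree (int_minpoly \<xi>)"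

text \<open>Since \<^term>\<open>ln (0::real) = 0\<close> in the library, this yields the value 0 at 0.\<close>

definition log_plus :: "real \<Rightarrow> real" where
  "log_plus x = max 0 (ln x)"

definition weil_height :: "complex \<Rightarrow> real" where
  "weil_height \<xi> = 1 / real (alg_degree \<xi>) *
     (ln \<bar>real_of_int (lead_coeff (int_minpoly \<xi>))\<bar> +
      (\<Sum>\<alpha>\<in>#proots (complex_poly (int_minpoly \<xi>)). log_plus (cmod \<alpha>)))"

definition height :: "complex ^ 'n \<Rightarrow> real" where
  "height \<xi> = (\<Sum>j\<in>UNIV. weil_height (\<xi> $ j))"

definition monomial_char :: "int ^ 'n \<Rightarrow> complex ^ 'n \<Rightarrow> complex" where
  "monomial_char n \<xi> = (\<Prod>j\<in>UNIV. (\<xi> $ j) powi (n $ j))"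

definition l1_norm :: "int ^ 'n \<Rightarrow> int" where
  "l1_norm n = (\<Sum>j\<in>UNIV. \<bar>n $ j\<bar>)"

text \<open>The infimum is over a nonempty set of natural numbers, hence a minimum.\<close>

definition gen_degree :: "complex ^ 'n \<Rightarrow> nat" where
  "gen_degree \<xi> = (INF n \<in> - {0}. nat (l1_norm n) * alg_degree (monomial_char n \<xi>))"

definition height_D :: "complex ^ 'n \<Rightarrow> real" where
  "height_D \<xi> = height \<xi> + ln (2 * real (gen_degree \<xi>)) / (3 * real (gen_degree \<xi>))"


section \<open>Galois orbits\<close>

abbreviation Qbar :: "complex set" where
  "Qbar \<equiv> {z. algebraic z}"

text \<open>Maps on \<^typ>\<open>complex\<close> that restrict to automorphisms of the field of algebraic numbers
  over the rationals; their values elsewhere are irrelevant.\<close>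

definition gal_Qbar :: "(complex \<Rightarrow> complex) set" where
  "gal_Qbar = {\<sigma>. bij_betw \<sigma> Qbar Qbar \<and> (\<forall>q\<in>\<rat>. \<sigma> q = q) \<and>
     (\<forall>x\<in>Qbar. \<forall>y\<in>Qbar. \<sigma> (x + y) = \<sigma> x + \<sigma> y \<and> \<sigma> (x * y) = \<sigma> x * \<sigma> y)}"

definition galois_orbit :: "complex ^ 'n \<Rightarrow> (complex ^ 'n) set" where
  "galois_orbit \<xi> = (\<lambda>\<sigma>. \<chi> j. \<sigma> (\<xi> $ j)) ` gal_Qbar"


section \<open>Functions on the product of the torus and Euclidean space\<close>

text \<open>A function on \<open>T^N \<times> R^N\<close>, with \<open>T = R/Z\<close>, is a function on \<open>R^N \<times> R^N\<close> that is
  1-periodic in the first \<open>N\<close> coordinates. The measure on \<open>T^N\<close> is Lebesgue measure on the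
  fundamental domain \<open>[0,1)^N\<close>.\<close>

definition torus_periodic :: "((real ^ 'n) \<times> (real ^ 'n) \<Rightarrow> complex) \<Rightarrow> bool" where
  "torus_periodic F \<longleftrightarrow> (\<forall>\<theta> s j. F (\<theta> + axis j 1, s) = F (\<theta>, s))"

definition torus :: "(real ^ 'n) measure" where
  "torus = restrict_space lborel {\<theta>. \<forall>j. 0 \<le> \<theta> $ j \<and> \<theta> $ j < 1}"

abbreviation phase_space :: "((real ^ 'n) \<times> (real ^ 'n)) measure" where
  "phase_space \<equiv> torus \<Otimes>\<^sub>M lborel"

abbreviation dual_space :: "((int ^ 'n) \<times> (real ^ 'n)) measure" where
  "dual_space \<equiv> count_space UNIV \<Otimes>\<^sub>M lborel"

definition angles :: "complex ^ 'n \<Rightarrow> real ^ 'n" where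
  "angles \<alpha> = (\<chi> j. Arg (\<alpha> $ j) / (2 * pi))"

definition log_moduli :: "complex ^ 'n \<Rightarrow> real ^ 'n" where
  "log_moduli \<alpha> = (\<chi> j. ln (cmod (\<alpha> $ j)))"

definition equidist_error ::
  "((real ^ 'n) \<times> (real ^ 'n) \<Rightarrow> complex) \<Rightarrow> complex ^ 'n \<Rightarrow> real" where
  "equidist_error F \<xi> =
     cmod (1 / of_nat (card (galois_orbit \<xi>)) *
             (\<Sum>\<alpha>\<in>galois_orbit \<xi>. F (angles \<alpha>, log_moduli \<alpha>))
           - (LINT \<theta>|torus. F (\<theta>, 0)))"


section \<open>Fourier transform\<close>

definition square_integrable :: "'a measure \<Rightarrow> ('a \<Rightarrow> complex) \<Rightarrow> bool" where
  "square_integrable M f \<longleftrightarrow>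
     f \<in> borel_measurable M \<and> integrable M (\<lambda>x. (cmod (f x))\<^sup>2)"

definition L2_converges ::
  "'a measure \<Rightarrow> (nat \<Rightarrow> 'a \<Rightarrow> complex) \<Rightarrow> ('a \<Rightarrow> complex) \<Rightarrow> bool" where
  "L2_converges M f g \<longleftrightarrow>
     (\<lambda>k. \<integral>\<^sup>+x. ennreal ((cmod (f k x - g x))\<^sup>2) \<partial>M) \<longlonglongrightarrow> 0"

definition fourier_L1 ::
  "((real ^ 'n) \<times> (real ^ 'n) \<Rightarrow> complex) \<Rightarrow> (int ^ 'n) \<times> (real ^ 'n) \<Rightarrow> complex" where
  "fourier_L1 F = (\<lambda>(n, t). LINT (\<theta>, s)|phase_space. F (\<theta>, s) *
      exp (- 2 * pi * \<i> * (\<Sum>j\<in>UNIV. of_int (n $ j) * of_real (\<theta> $ j))) *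
      exp (- 2 * pi * \<i> * of_real (t \<bullet> s)))"

text \<open>The Plancherel extension: the Fourier transform on \<open>L^1 \<inter> L^2\<close>, which is dense in
  \<open>L^2\<close>, is isometric for the \<open>L^2\<close> norms, and its continuous extension to \<open>L^2\<close> sends \<open>F\<close> to
  the \<open>L^2\<close> limit of the transforms of any approximating sequence. The value \<open>G\<close> is determined
  up to null sets, so the extension is given first as a relation, and \<open>fourier\<close> picks a
  representative.\<close>

definition has_fourier ::
  "((real ^ 'n) \<times> (real ^ 'n) \<Rightarrow> complex) \<Rightarrow> ((int ^ 'n) \<times> (real ^ 'n) \<Rightarrow> complex) \<Rightarrow> bool"
where
  "has_fourier F G \<longleftrightarrow>
     square_integrable phase_space F \<and> square_integrable dual_space G \<and>
     (\<exists>f. (\<forall>k. integrable phase_space (f k) \<and> square_integrable phase_space (f k)) \<and>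
          L2_converges phase_space f F \<and>
          L2_converges dual_space (\<lambda>k. fourier_L1 (f k)) G)"

definition fourier ::
  "((real ^ 'n) \<times> (real ^ 'n) \<Rightarrow> complex) \<Rightarrow> (int ^ 'n) \<times> (real ^ 'n) \<Rightarrow> complex" where
  "fourier F = (SOME G. has_fourier F G)"


section \<open>Test functions\<close>

text \<open>Integrability does not depend on the choice of the representative \<open>G\<close> of the transform.\<close>

definition test_functions :: "((real ^ 'n) \<times> (real ^ 'n) \<Rightarrow> complex) set" where
  "test_functions = {F. torus_periodic F \<and> continuous_on UNIV F \<and>
     square_integrable phase_space F \<and> (\<exists>G. has_fourier F G \<and> integrable dual_space G)}"

text \<open>Extended nonnegative valued; \<^const>\<open>infnorm\<close> is the maximum norm.\<close>

definition bound_const ::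
  "real \<Rightarrow> ((real ^ 'n) \<times> (real ^ 'n) \<Rightarrow> complex) \<Rightarrow> ennreal" where
  "bound_const \<gamma> F =
     (\<integral>\<^sup>+n. (\<integral>\<^sup>+t. ennreal (cmod (fourier F (n, t)) *
        (2 * (8 * pi) powr \<gamma> * infnorm t powr \<gamma> + 24 powr \<gamma> * real_of_int (l1_norm n) powr \<gamma>))
        \<partial>lborel) \<partial>count_space UNIV)"

end

theory Submission
  imports Defs "HOL-Probability.Characteristic_Functions" "HOL-Real_Asymp.Real_Asymp"
begin

text \<open>
  \<^bold>\<open>Upper bound.\<close> Let \<open>x \<mapsto> wave \<zeta> x\<close> be the characters of the group \<open>T^N \<times> R^N\<close>, for \<open>\<zeta> = (n, t)\<close>. Fourier
  inversion writes a test function as a superposition of waves with integrable density (theorem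
  \<open>fourier_inversion\<close>), so it suffices to bound the error for a single wave by
  the weight in the constant times \<open>height_D \<xi> powr \<gamma>\<close> (lemma \<open>wave_average_bound\<close>). At a
  point \<open>\<alpha>\<close> of the orbit the wave is the direction of the algebraic number \<open>\<chi>\<^sup>n(\<alpha>)\<close> times a phase depending on
  the logarithmic moduli. The phase is close to \<open>1\<close> on average, since the mean of the absolute
  logarithmic moduli is at most twice the height.

  It remains to see that for \<open>n \<noteq> 0\<close> the directions of the conjugates of \<open>\<chi>\<^sup>n(\<xi>)\<close> have a small mean
  (lemma \<open>character_average_bound\<close>). This is a comparison of two estimates for a logarithmic
  energy. The kernel \<open>- ln \<bar>1 - r u\<bar>\<close>, where \<open>0 < r < 1\<close> and \<open>u\<close> is the ratio of two points brought into the unit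
  disc, is positive definite, and its energy is at least a multiple of the squared mean of the
  directions. On the other hand its energy is a discriminant up to terms
  controlled by the height, and a suitable multiple of the discriminant is a nonzero integer. The
  multiplier is bounded by the heights of the coordinates, by the
  theory of the denominators of products of conjugates (lemmas \<open>subproduct_integral\<close> and
  \<open>character_denominator\<close>). The diagonal contributes \<open>ln (2 d) / d\<close> with the degree \<open>d\<close> of
  \<open>\<chi>\<^sup>n(\<xi>)\<close>, which is where the generalized degree enters.

  The Galois-theoretic input is that the values of a character along the orbit run through the
  conjugates of one value with equal multiplicities, and that a number fixed by all automorphisms is
  rational. Both rest on the extension of isomorphisms between number fields to automorphisms of \<open>Qbar\<close>
  (lemma \<open>galois_transitive\<close>), by Zorn's lemma.

  \<^bold>\<open>Sharpness.\<close> For distinct primes \<open>q\<^sub>j\<close> and a prime \<open>p\<close> the point with coordinates \<open>q\<^sub>j\<^bsup>1/p\<^esup>\<close> has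
  generalized degree at least \<open>p\<close> and \<open>height_D\<close> at most of the order \<open>ln p / p\<close>, while its whole orbit has the
  logarithmic moduli \<open>ln q\<^sub>j / p\<close>. A function that oscillates in one logarithmic modulus with
  half period \<open>ln q\<^sub>j / p\<close> and amplitude \<open>c\<close> therefore has error at least \<open>c\<close>. Summing
  such oscillations over a very sparse sequence of primes, with the amplitudes
  prescribed by the claimed lower bound, and damping by a Gaussian gives a single test function with finite
  constant; the logarithmic factors in the lower bound are what makes the sum converge.\<close>

section \<open>Integral elements over a subring of the complex numbers\<close>

definition is_subring :: "complex set \<Rightarrow> bool" where
  "is_subring A \<longleftrightarrow> 0 \<in> A \<and> 1 \<in> A \<and> (\<forall>x\<in>A. \<forall>y\<in>A. x + y \<in> A \<and> x * y \<in> A \<and> - x \<in> A)"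

lemma is_subring_Ints: "is_subring \<int>" and is_subring_Rats: "is_subring \<rat>"
  by (auto simp: is_subring_def)

lemma is_subring_sum: "is_subring A \<Longrightarrow> (\<And>i. i \<in> I \<Longrightarrow> f i \<in> A) \<Longrightarrow> sum f I \<in> A"
  by (induction I rule: infinite_finite_induct) (auto simp: is_subring_def)

lemma is_subring_prod: "is_subring A \<Longrightarrow> (\<And>i. i \<in> I \<Longrightarrow> f i \<in> A) \<Longrightarrow> prod f I \<in> A"
  by (induction I rule: infinite_finite_induct) (auto simp: is_subring_def)

lemma is_subring_power: "is_subring A \<Longrightarrow> x \<in> A \<Longrightarrow> x ^ k \<in> A"
  by (induction k) (auto simp: is_subring_def)

inductive_set span_over :: "complex set \<Rightarrow> complex set \<Rightarrow> complex set" for A V where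
  zero: "0 \<in> span_over A V"
| add: "a \<in> A \<Longrightarrow> v \<in> V \<Longrightarrow> x \<in> span_over A V \<Longrightarrow> a * v + x \<in> span_over A V"

lemma span_over_plus: "x \<in> span_over A V \<Longrightarrow> y \<in> span_over A V \<Longrightarrow> x + y \<in> span_over A V"
  by (induction rule: span_over.induct) (auto simp: add.assoc intro: span_over.add)

lemma span_over_sum: "(\<And>i. i \<in> I \<Longrightarrow> f i \<in> span_over A V) \<Longrightarrow> sum f I \<in> span_over A V"
  by (induction I rule: infinite_finite_induct) (auto intro: span_over.zero span_over_plus)

lemma span_over_mult:
  assumes "is_subring A" "x \<in> span_over A V" "y \<in> span_over A W"
  shows "x * y \<in> span_over A ((\<lambda>(v, w). v * w) ` (V \<times> W))" (is "_ \<in> ?S")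
  using assms(2)
proof induction
  case zero
  show ?case by (simp add: span_over.zero)
next
  case (add a v x)
  have "a * v * y \<in> ?S" using assms(3)
  proof induction
    case zero
    show ?case by (simp add: span_over.zero)
  next
    case (add b w y)
    have "a * b \<in> A" using assms(1) \<open>a \<in> A\<close> \<open>b \<in> A\<close> by (simp add: is_subring_def)
    moreover have "v * w \<in> (\<lambda>(v, w). v * w) ` (V \<times> W)" using \<open>v \<in> V\<close> \<open>w \<in> W\<close> by auto
    ultimately have "(a * b) * (v * w) + a * v * y \<in> ?S" using add.IH by (rule span_over.add)
    thus ?case by (simp add: algebra_simps)
  qed
  from span_over_plus[OF this add.IH] show ?case by (simp add: algebra_simps)
qed

text \<open>Integrality of \<open>z\<close> is membership in a ring contained in a finitely generated module, rather
  than annihilation by a monic polynomial: two such rings generate a third one, so closure under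
  sums and products needs no resultants, and over \<open>\<rat>\<close> and \<open>\<int>\<close> the same notion yields the
  algebraic numbers and the algebraic integers.\<close>

definition module_finite :: "complex set \<Rightarrow> complex set \<Rightarrow> bool" where
  "module_finite A R \<longleftrightarrow> is_subring R \<and> (\<exists>V. finite V \<and> R \<subseteq> span_over A V)"

definition integral_over :: "complex set \<Rightarrow> complex \<Rightarrow> bool" where
  "integral_over A z \<longleftrightarrow> (\<exists>R. module_finite A R \<and> z \<in> R)"

definition adjoin :: "complex set \<Rightarrow> complex \<Rightarrow> complex set" where
  "adjoin R b = {poly p b | p. \<forall>i. coeff p i \<in> R}"

lemma subring_coeff_mult:
  "is_subring R \<Longrightarrow> \<forall>i. coeff p i \<in> R \<Longrightarrow> \<forall>i. coeff q i \<in> R \<Longrightarrow> coeff (p * q) i \<in> R"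
  unfolding coeff_mult by (rule is_subring_sum) (auto simp: is_subring_def)

lemma is_subring_adjoin:
  assumes R: "is_subring R"
  shows "is_subring (adjoin R b)" "R \<subseteq> adjoin R b" "b \<in> adjoin R b"
proof -
  have *: "poly p b \<in> adjoin R b" if "\<forall>i. coeff p i \<in> R" for p
    using that by (auto simp: adjoin_def)
  have C: "c \<in> adjoin R b" if "c \<in> R" for c
    using *[of "[:c:]"] that R by (auto simp: coeff_pCons is_subring_def split: nat.splits)
  show "R \<subseteq> adjoin R b" using C by auto
  show "b \<in> adjoin R b"
    using *[of "[:0,1:]"] R by (auto simp: coeff_pCons is_subring_def split: nat.splits)
  show "is_subring (adjoin R b)"
    unfolding is_subring_def
  proof (intro conjI ballI)
    show "0 \<in> adjoin R b" "1 \<in> adjoin R b" using C R by (auto simp: is_subring_def)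
    fix x y assume "x \<in> adjoin R b" "y \<in> adjoin R b"
    then obtain p q where pq: "x = poly p b" "\<forall>i. coeff p i \<in> R" "y = poly q b" "\<forall>i. coeff q i \<in> R"
      by (auto simp: adjoin_def)
    show "x + y \<in> adjoin R b" using *[of "p + q"] pq R by (auto simp: is_subring_def)
    show "- x \<in> adjoin R b" using *[of "- p"] pq R by (auto simp: is_subring_def)
    show "x * y \<in> adjoin R b" using *[of "p * q"] pq subring_coeff_mult[OF R] by auto
  qed
qed

lemma adjoin_subset_span:
  assumes A: "is_subring A" and RV: "R \<subseteq> span_over A V" and bW: "\<And>k. b ^ k \<in> span_over A W"
  shows "adjoin R b \<subseteq> span_over A ((\<lambda>(v, w). v * w) ` (V \<times> W))"
proof
  fix x assume "x \<in> adjoin R b"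
  then obtain p where "x = poly p b" "\<forall>i. coeff p i \<in> R" by (auto simp: adjoin_def)
  thus "x \<in> span_over A ((\<lambda>(v, w). v * w) ` (V \<times> W))"
    unfolding poly_altdef using RV bW by (auto intro!: span_over_sum span_over_mult[OF A])
qed

text \<open>Products of the generators of \<open>R\<close> with those of a ring witnessing that \<open>z\<close> is integral span
  all polynomials in \<open>z\<close> over \<open>R\<close>.\<close>

lemma module_finite_adjoin:
  assumes "is_subring A" "module_finite A R" "integral_over A z"
  shows "module_finite A (adjoin R z)"
proof -
  obtain R' V W where R: "is_subring R" "finite V" "R \<subseteq> span_over A V"
    "is_subring R'" "finite W" "R' \<subseteq> span_over A W" "z \<in> R'"
    using assms(2,3) by (auto simp: module_finite_def integral_over_def)
  have "adjoin R z \<subseteq> span_over A ((\<lambda>(v, w). v * w) ` (V \<times> W))"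
    using R is_subring_power by (intro adjoin_subset_span[OF assms(1)]) blast+
  moreover have "finite ((\<lambda>(v, w). v * w) ` (V \<times> W))" using R by simp
  ultimately show ?thesis
    unfolding module_finite_def using is_subring_adjoin(1)[OF R(1)] by metis
qed

lemma module_finite_base: "is_subring A \<Longrightarrow> module_finite A A"
  unfolding module_finite_def
  using span_over.add[OF _ _ span_over.zero, of _ A 1 "{1}"] by (intro conjI exI[of _ "{1}"]) auto

lemma finite_integral_in_module_finite:
  assumes A: "is_subring A" and "finite B" "\<And>b. b \<in> B \<Longrightarrow> integral_over A b"
  obtains R where "module_finite A R" "B \<subseteq> R"
  using assms(2,3)
proof (induction arbitrary: thesis)
  case empty
  thus ?case using module_finite_base[OF A] by auto
next
  case (insert b B)
  obtain R where R: "module_finite A R" "B \<subseteq> R" using insert by auto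
  show ?case
  proof (rule insert.prems(1)[of "adjoin R b"])
    show "module_finite A (adjoin R b)" using module_finite_adjoin[OF A R(1)] insert.prems by auto
    show "insert b B \<subseteq> adjoin R b"
      using is_subring_adjoin[of R b] R by (auto simp: module_finite_def)
  qed
qed

lemma integral_over_base: "is_subring A \<Longrightarrow> a \<in> A \<Longrightarrow> integral_over A a"
  unfolding integral_over_def using module_finite_base by blast

lemma is_subring_integral_over:
  assumes A: "is_subring A"
  shows "is_subring (Collect (integral_over A))"
proof -
  have "integral_over A (x + y) \<and> integral_over A (x * y) \<and> integral_over A (- x)"
    if xy: "integral_over A x" "integral_over A y" for x y
  proof -
    obtain R where "module_finite A R" "{x, y} \<subseteq> R"
      by (rule finite_integral_in_module_finite[OF A, of "{x, y}"]) (use xy in auto)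
    moreover from this have "x + y \<in> R" "x * y \<in> R" "- x \<in> R"
      by (auto simp: module_finite_def is_subring_def)
    ultimately show ?thesis unfolding integral_over_def by blast
  qed
  thus ?thesis using integral_over_base[OF A] A by (auto simp: is_subring_def)
qed

text \<open>Division with remainder by a monic polynomial stays inside the coefficient ring.\<close>

lemma reduce_mod_monic:
  assumes R: "is_subring R" and p: "\<forall>i. coeff p i \<in> R" "lead_coeff p = 1" "poly p x = 0"
    and q: "\<forall>i. coeff q i \<in> R"
  shows "\<exists>r. (\<forall>i. coeff r i \<in> R) \<and> (r = 0 \<or> degree r < degree p) \<and> poly r x = poly q x"
  using q
proof (induction "degree q" arbitrary: q rule: less_induct)
  case less
  show ?case
  proof (cases "degree q < degree p \<or> q = 0")
    case True
    thus ?thesis using less.prems by blast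
  next
    case False
    have p0: "p \<noteq> 0" using p by auto
    define s where "s = monom (lead_coeff q) (degree q - degree p)"
    have s: "\<forall>i. coeff s i \<in> R" using less.prems R by (auto simp: s_def is_subring_def)
    define q' where "q' = q - s * p"
    have c': "\<forall>i. coeff q' i \<in> R"
    proof
      fix i
      have "coeff q i + - coeff (s * p) i \<in> R"
        using less.prems subring_coeff_mult[OF R s p(1)] R unfolding is_subring_def by blast
      thus "coeff q' i \<in> R" by (simp add: q'_def)
    qed
    have e: "poly q' x = poly q x" using p by (simp add: q'_def)
    have dsp: "degree (s * p) = degree q"
      using False p0 by (auto simp: s_def degree_mult_eq degree_monom_eq monom_eq_0_iff)
    have "lead_coeff (s * p) = lead_coeff q"
      using p(2) unfolding lead_coeff_mult s_def lead_coeff_monom by simp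
    hence csp: "coeff (s * p) (degree q) = lead_coeff q" using dsp by simp
    show ?thesis
    proof (cases "q' = 0")
      case True
      thus ?thesis using e c' by (intro exI[of _ 0]) auto
    next
      case q': False
      have "degree q' \<le> degree q" unfolding q'_def using dsp by (metis degree_diff_le order_refl)
      moreover have "coeff q' (degree q) = 0" using csp by (simp add: q'_def)
      ultimately have "degree q' < degree q" using q'
        by (metis le_neq_implies_less leading_coeff_0_iff)
      from less.hyps[OF this c'] show ?thesis using e by auto
    qed
  qed
qed

text \<open>Roots of monic polynomials with integral coefficients are integral: all coefficients lie in a
  single module-finite ring \<open>R\<close>, and reduction modulo the polynomial leaves only the powers
  of \<open>x\<close> below its degree as generators of \<open>R[x]\<close>.\<close>

lemma integral_over_root:
  assumes A: "is_subring A" and p: "\<And>i. integral_over A (coeff p i)" "lead_coeff p = 1" "poly p x = 0"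
  shows "integral_over A x"
proof -
  obtain R where R: "module_finite A R" "coeff p ` {..degree p} \<subseteq> R"
    by (rule finite_integral_in_module_finite[OF A, of "coeff p ` {..degree p}"]) (use p(1) in auto)
  then obtain V where V: "is_subring R" "finite V" "R \<subseteq> span_over A V"
    by (auto simp: module_finite_def)
  have pR: "\<forall>i. coeff p i \<in> R"
  proof
    fix i show "coeff p i \<in> R"
      using R(2) V(1) by (cases "i \<le> degree p") (auto simp: is_subring_def coeff_eq_0)
  qed
  define W where "W = (\<lambda>i. x ^ i) ` {..degree p}"
  have "adjoin R x \<subseteq> span_over A ((\<lambda>(v, w). v * w) ` (V \<times> W))"
  proof
    fix y assume "y \<in> adjoin R x"
    then obtain q where q: "y = poly q x" "\<forall>i. coeff q i \<in> R" by (auto simp: adjoin_def)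
    obtain r where r: "\<forall>i. coeff r i \<in> R" "r = 0 \<or> degree r < degree p" "poly r x = poly q x"
      using reduce_mod_monic[OF V(1) pR p(2,3) q(2)] by blast
    have xi: "x ^ i \<in> span_over A W" if "i \<le> degree p" for i
      using span_over.add[OF _ _ span_over.zero, of 1 A "x ^ i" W] A that
      by (auto simp: W_def is_subring_def)
    have "poly r x \<in> span_over A ((\<lambda>(v, w). v * w) ` (V \<times> W))"
      unfolding poly_altdef using V r xi xi[of 0] by (intro span_over_sum span_over_mult[OF A]) auto
    thus "y \<in> span_over A ((\<lambda>(v, w). v * w) ` (V \<times> W))" using q r by simp
  qed
  hence "module_finite A (adjoin R x)"
    using V is_subring_adjoin(1)[OF V(1)] unfolding module_finite_def W_def
    by (metis finite_SigmaI finite_atMost finite_imageI)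
  thus ?thesis using is_subring_adjoin(3)[OF V(1)] by (auto simp: integral_over_def)
qed

interpretation rat_vs: vector_space "\<lambda>(q :: rat) (x :: complex). of_rat q * x"
  by unfold_locales (auto simp: algebra_simps of_rat_add of_rat_mult)

interpretation rat_pair: vector_space_pair "\<lambda>(q :: rat) (x :: complex). of_rat q * x"
    "\<lambda>(q :: rat) (x :: rat). q * x"
  by unfold_locales (auto simp: algebra_simps)

lemma span_over_Rats: "span_over \<rat> V \<subseteq> rat_vs.span V"
proof
  fix x assume "x \<in> span_over \<rat> V"
  thus "x \<in> rat_vs.span V"
  proof induction
    case zero
    show ?case by (rule rat_vs.span_zero)
  next
    case (add a v x)
    obtain q where "a = of_rat q" using add by (auto elim: Rats_cases)
    thus ?case using add
      using rat_vs.span_add[OF rat_vs.span_scale[OF rat_vs.span_base]] by simp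
  qed
qed

text \<open>From right to left: the powers of \<open>z\<close> lie in a finite-dimensional rational vector space, so
  they repeat or satisfy a linear relation.\<close>

lemma algebraic_iff_integral_over_Rats: "algebraic z \<longleftrightarrow> integral_over \<rat> z"
proof
  assume "algebraic z"
  then obtain p where p: "\<And>i. coeff p i \<in> \<rat>" "p \<noteq> 0" "poly p z = 0"
    by (auto simp: algebraic_altdef)
  show "integral_over \<rat> z"
  proof (rule integral_over_root[OF is_subring_Rats])
    show "integral_over \<rat> (coeff (smult (inverse (lead_coeff p)) p) i)" for i
      using p by (intro integral_over_base[OF is_subring_Rats]) (auto intro!: Rats_mult Rats_inverse)
  qed (use p in auto)
next
  assume "integral_over \<rat> z"
  then obtain R V where R: "is_subring R" "z \<in> R" "finite V" "R \<subseteq> span_over \<rat> V"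
    by (auto simp: integral_over_def module_finite_def)
  hence pow: "z ^ i \<in> rat_vs.span V" for i
    using is_subring_power span_over_Rats by blast
  define n where "n = card V"
  show "algebraic z"
  proof (cases "inj_on (\<lambda>i. z ^ i) {..n}")
    case False
    then obtain i j where ij: "i \<noteq> j" "z ^ i = z ^ j" by (auto simp: inj_on_def)
    show ?thesis
    proof (rule algebraicI)
      show "coeff (monom 1 i - monom 1 j :: complex poly) k \<in> \<int>" for k by auto
      have "coeff (monom 1 i - monom 1 j :: complex poly) i = 1" using ij by simp
      thus "(monom 1 i - monom 1 j :: complex poly) \<noteq> 0" by (metis coeff_0 zero_neq_one)
    qed (use ij in \<open>simp add: poly_monom\<close>)
  next
    case True
    define S where "S = (\<lambda>i. z ^ i) ` {..n}"
    have "\<not> rat_vs.independent S"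
      using rat_vs.independent_span_bound[of V S] R(3) pow True
      by (auto simp: S_def card_image n_def)
    then obtain u where u: "\<exists>v\<in>S. u v \<noteq> 0" "(\<Sum>v\<in>S. of_rat (u v) * v) = 0"
      unfolding rat_vs.dependent_finite[OF finite_imageI[OF finite_atMost], of "\<lambda>i. z ^ i" n, folded S_def]
      by blast
    define p where "p = (\<Sum>i\<le>n. monom (of_rat (u (z ^ i)) :: complex) i)"
    have cp: "coeff p k = (if k \<le> n then of_rat (u (z ^ k)) else 0)" for k
      by (simp add: p_def coeff_sum sum.delta')
    show ?thesis
    proof (rule algebraicI')
      show "coeff p i \<in> \<rat>" for i by (auto simp: cp)
      show "p \<noteq> 0" using u(1) by (auto simp: S_def poly_eq_iff cp)
      have "poly p z = (\<Sum>i\<le>n. of_rat (u (z ^ i)) * z ^ i)"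
        by (simp add: p_def poly_sum poly_monom)
      also have "\<dots> = (\<Sum>v\<in>S. of_rat (u v) * v)"
        unfolding S_def using True by (subst sum.reindex) auto
      finally show "poly p z = 0" using u by simp
    qed
  qed
qed

lemma is_subring_Qbar: "is_subring Qbar"
  using is_subring_integral_over[OF is_subring_Rats] algebraic_iff_integral_over_Rats
  by (simp add: algebraic_iff_integral_over_Rats)

lemma algebraic_arith:
  fixes x y :: complex
  assumes "algebraic x" "algebraic y"
  shows "algebraic (x + y)" "algebraic (x * y)" "algebraic (x - y)"
proof -
  have "\<forall>x\<in>Qbar. \<forall>y\<in>Qbar. x + y \<in> Qbar \<and> x * y \<in> Qbar \<and> - x \<in> Qbar"
    using is_subring_Qbar by (simp add: is_subring_def)
  moreover from this have "x + - y \<in> Qbar" using assms by blast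
  ultimately show "algebraic (x + y)" "algebraic (x * y)" "algebraic (x - y)" using assms by auto
qed

text \<open>All powers of \<open>x\<close> lie in a finitely generated group of complex numbers, which a
  \<open>\<rat>\<close>-linear functional fixing \<open>\<rat>\<close> maps to rationals with a common denominator \<open>D\<close>. If
  \<open>x = a / b\<close> in lowest terms, every power of \<open>b\<close> divides \<open>D\<close>.\<close>

lemma integral_rational_imp_Ints:
  assumes "integral_over \<int> x" "x \<in> \<rat>"
  shows "x \<in> \<int>"
proof -
  obtain R V where R: "is_subring R" "x \<in> R" "finite V" "R \<subseteq> span_over \<int> V"
    using assms by (auto simp: integral_over_def module_finite_def)
  obtain q where q: "x = of_rat q" using assms by (auto elim: Rats_cases)
  have "rat_vs.independent {1 :: complex}" by simp
  from rat_pair.linear_independent_extend[OF this, of "\<lambda>_. 1"]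
  obtain f where f: "Vector_Spaces.linear (\<lambda>(q :: rat) (x :: complex). of_rat q * x) (*) f" "f 1 = (1::rat)"
    by auto
  interpret f: Vector_Spaces.linear "\<lambda>(q :: rat) (x :: complex). of_rat q * x" "(*)" f by fact
  have fq: "f (of_rat r) = r" for r using f.scale[of r 1] f(2) by simp
  have fa: "f (x + y) = f x + f y" for x y by (rule f.add)
  define D where "D = (\<Prod>v\<in>V. snd (quotient_of (f v)))"
  have D0: "D > 0" unfolding D_def by (intro prod_pos) (simp add: quotient_of_denom_pos')
  have Dv: "of_int D * f v \<in> \<int>" if v: "v \<in> V" for v
  proof -
    obtain a b where ab: "quotient_of (f v) = (a, b)" by force
    hence fv: "f v = of_int a / of_int b" "b > 0" by (auto simp: quotient_of_div quotient_of_denom_pos)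
    have "D = b * (\<Prod>v\<in>V-{v}. snd (quotient_of (f v)))"
      unfolding D_def using R(3) v ab by (subst prod.remove[of _ v]) auto
    thus ?thesis using fv by (simp del: of_int_prod)
  qed
  have Dy: "of_int D * f y \<in> \<int>" if "y \<in> span_over \<int> V" for y
    using that
  proof induction
    case zero
    show ?case by (simp add: f.zero)
  next
    case (add a v x)
    obtain n where n: "a = of_int n" using add by (auto elim: Ints_cases)
    have "f (a * v) = of_int n * f v" using f.scale[of "of_int n" v] n by simp
    hence "of_int D * f (a * v + x) = of_int n * (of_int D * f v) + of_int D * f x"
      by (simp add: fa algebra_simps)
    thus ?case using add Dv by auto
  qed
  have Dk: "of_int D * q ^ k \<in> \<int>" for k
  proof -
    have "x ^ k \<in> span_over \<int> V" using R is_subring_power by blast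
    from Dy[OF this] show ?thesis using fq[of "q ^ k"] q by (simp add: of_rat_power)
  qed
  obtain a b where ab: "quotient_of q = (a, b)" by force
  hence qab: "q = of_int a / of_int b" "b > 0" "coprime a b"
    by (auto simp: quotient_of_div quotient_of_denom_pos quotient_of_coprime)
  have "b ^ k dvd D" for k
  proof -
    obtain m where m: "of_int D * q ^ k = (of_int m :: rat)" using Dk[of k] by (auto elim: Ints_cases)
    hence "of_int (D * a ^ k) = (of_int (m * b ^ k) :: rat)"
      using qab by (simp add: power_divide field_simps)
    hence "D * a ^ k = m * b ^ k" by (simp only: of_int_eq_iff)
    hence "b ^ k dvd D * a ^ k" by simp
    moreover have "coprime (b ^ k) (a ^ k)" using qab(3) by (simp add: ac_simps)
    ultimately show ?thesis by (simp add: coprime_dvd_mult_left_iff)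
  qed
  hence "b ^ nat D \<le> D" using D0 zdvd_imp_le by blast
  moreover have "b \<ge> 2 \<Longrightarrow> D < b ^ nat D"
  proof -
    assume "b \<ge> 2"
    have "D = int (nat D)" using D0 by simp
    also have "\<dots> < 2 ^ nat D" by (metis of_nat_less_two_power)
    also have "\<dots> \<le> b ^ nat D" using \<open>b \<ge> 2\<close> by (simp add: power_mono)
    finally show ?thesis .
  qed
  ultimately have "b = 1" using qab(2) by linarith
  thus ?thesis using q qab by simp
qed


section \<open>Minimal polynomials over the integers\<close>

lemma complex_poly_diff: "complex_poly (p - q) = complex_poly p - complex_poly q"
  and complex_poly_smult: "complex_poly (smult c p) = smult (of_int c) (complex_poly p)"
  and complex_poly_mult: "complex_poly (p * q) = complex_poly p * complex_poly q"
  by (auto intro!: poly_eqI simp: coeff_map_poly coeff_mult)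

lemma complex_poly_eq_0_iff [simp]: "complex_poly p = 0 \<longleftrightarrow> p = 0"
  by (auto simp: poly_eq_iff coeff_map_poly)

lemma degree_complex_poly [simp]: "degree (complex_poly p) = degree p"
  by (rule degree_map_poly) simp

lemma coeff_complex_poly [simp]: "coeff (complex_poly p) i = of_int (coeff p i)"
  by (simp add: coeff_map_poly)

lemma complex_poly_power: "complex_poly (p ^ k) = complex_poly p ^ k"
  by (induction k) (auto simp: complex_poly_mult)

definition is_minpoly :: "complex \<Rightarrow> int poly \<Rightarrow> bool" where
  "is_minpoly \<xi> p \<longleftrightarrow> p \<noteq> 0 \<and> poly (complex_poly p) \<xi> = 0 \<and>
     (\<forall>q. q \<noteq> 0 \<and> poly (complex_poly q) \<xi> = 0 \<longrightarrow> degree p \<le> degree q) \<and>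
     content p = 1 \<and> lead_coeff p > 0"

text \<open>Pseudo-division shows that \<open>m\<close> divides a multiple of \<open>f\<close>. Since \<open>m\<close> is primitive, the content
  of the quotient absorbs the factor, as in the lemma of Gauss.\<close>

lemma minpoly_dvd:
  assumes m: "is_minpoly \<xi> m" and f: "poly (complex_poly f) \<xi> = 0"
  shows "m dvd f"
proof (cases "f = 0")
  case False
  have m0: "m \<noteq> 0" using m by (auto simp: is_minpoly_def)
  from pseudo_mod[OF this, of f] obtain a q where
    aq: "a \<noteq> 0" "smult a f = m * q + pseudo_mod f m"
      "pseudo_mod f m = 0 \<or> degree (pseudo_mod f m) < degree m" by auto
  have "poly (complex_poly (pseudo_mod f m)) \<xi> = poly (complex_poly (smult a f - m * q)) \<xi>"
    using aq(2) by simp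
  also have "\<dots> = 0"
    using f m by (simp add: complex_poly_diff complex_poly_mult complex_poly_smult is_minpoly_def)
  finally have "pseudo_mod f m = 0" using aq(3) m unfolding is_minpoly_def by (metis not_less)
  hence e: "smult a f = m * q" using aq by simp
  have "content (smult a f) = content m * content q" unfolding e by (rule content_mult)
  hence "content q = \<bar>a\<bar> * content f" using m by (simp add: is_minpoly_def)
  hence "a dvd content q" by simp
  hence "[:a:] dvd q" by (simp add: const_poly_dvd_iff_dvd_content)
  then obtain g where "q = smult a g" by (auto elim: dvdE)
  hence "smult a f = smult a (m * g)" using e by simp
  hence "f = m * g" using aq(1) by (metis smult_cancel)
  thus ?thesis by simp
qed auto

lemma is_minpoly_unique: "is_minpoly \<xi> p \<Longrightarrow> is_minpoly \<xi> q \<Longrightarrow> p = q"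
proof -
  assume a: "is_minpoly \<xi> p" "is_minpoly \<xi> q"
  have "p dvd q" "q dvd p"
    using a minpoly_dvd[of \<xi> p q] minpoly_dvd[of \<xi> q p] by (auto simp: is_minpoly_def)
  then obtain u where u: "q = p * u" by (auto elim: dvdE)
  have nz: "p \<noteq> 0" "q \<noteq> 0" "u \<noteq> 0" using a u by (auto simp: is_minpoly_def)
  have "degree p = degree q" using a by (auto simp: is_minpoly_def intro!: antisym)
  hence "degree u = 0" using u nz by (simp add: degree_mult_eq)
  then obtain c where "u = [:c:]" by (auto elim: degree_eq_zeroE)
  hence q: "q = smult c p" using u by simp
  hence "\<bar>c\<bar> = 1" using a by (auto simp: is_minpoly_def)
  moreover have "c > 0" using a q by (auto simp: is_minpoly_def zero_less_mult_iff)
  ultimately show "p = q" using q by simp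
qed

lemma ex_minpoly:
  assumes "algebraic \<xi>"
  shows "\<exists>p. is_minpoly \<xi> p"
proof -
  have "\<exists>p. p \<noteq> 0 \<and> poly (complex_poly p) \<xi> = 0" using algebraicE'[OF assms] by metis
  from ex_has_least_nat[of "\<lambda>p. p \<noteq> 0 \<and> poly (complex_poly p) \<xi> = 0", of _ degree]
  obtain f where f: "f \<noteq> 0" "poly (complex_poly f) \<xi> = 0"
    "\<And>q. q \<noteq> 0 \<and> poly (complex_poly q) \<xi> = 0 \<Longrightarrow> degree f \<le> degree q"
    using \<open>\<exists>p. _\<close> by metis
  define s where "s = (if lead_coeff f > 0 then 1 else - 1 :: int)"
  define p where "p = smult s (primitive_part f)"
  have fp: "f = smult (s * content f) p"
    by (simp add: p_def s_def mult.assoc flip: smult_smult)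
  have c0: "content f > 0" 
    using f(1) normalize_content[of f] by (simp add: order_less_le)
  have "is_minpoly \<xi> p"
    unfolding is_minpoly_def
  proof (intro conjI)
    show "p \<noteq> 0" using f fp by auto
    have "poly (complex_poly f) \<xi> = of_int (s * content f) * poly (complex_poly p) \<xi>"
      by (subst fp) (simp only: complex_poly_smult poly_smult)
    thus "poly (complex_poly p) \<xi> = 0" using f(2) c0 by (auto simp: s_def split: if_splits)
    have dp: "degree p = degree f" by (simp add: p_def s_def)
    thus "\<forall>q. q \<noteq> 0 \<and> poly (complex_poly q) \<xi> = 0 \<longrightarrow> degree p \<le> degree q" using f(3) by auto
    show "content p = 1" using f(1) by (auto simp: p_def s_def)
    have "lead_coeff f = s * content f * lead_coeff p"
      using arg_cong[OF fp, of "\<lambda>g. coeff g (degree f)"] dp by simp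
    moreover have "s * lead_coeff f > 0"
      using f(1) leading_coeff_0_iff[of f] unfolding s_def by (cases "lead_coeff f" "0::int" rule: linorder_cases) simp_all
    moreover have "s * s = 1" by (simp add: s_def)
    ultimately have "content f * lead_coeff p > 0" by (metis mult.assoc mult_1)
    thus "lead_coeff p > 0" using c0 by (simp add: zero_less_mult_iff)
  qed
  thus ?thesis ..
qed

lemma int_minpoly: "algebraic \<xi> \<Longrightarrow> is_minpoly \<xi> (int_minpoly \<xi>)"
  unfolding int_minpoly_def is_minpoly_def[symmetric]
  using ex_minpoly is_minpoly_unique by (metis theI)

lemma int_minpoly_eqI: "is_minpoly \<xi> p \<Longrightarrow> int_minpoly \<xi> = p"
  unfolding int_minpoly_def is_minpoly_def[symmetric]
  using is_minpoly_unique by blast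

lemma is_minpoly_algebraic: "is_minpoly \<xi> m \<Longrightarrow> algebraic \<xi>"
  by (rule algebraicI[of "complex_poly m"]) (auto simp: is_minpoly_def)

text \<open>Otherwise the minimal polynomial of \<open>y\<close> would be a proper factor of \<open>m\<close>, and one of the two
  factors would vanish at \<open>\<xi>\<close>.\<close>

lemma is_minpoly_root:
  assumes m: "is_minpoly \<xi> m" and y: "poly (complex_poly m) y = 0"
  shows "is_minpoly y m"
proof -
  have "algebraic y"
    by (rule algebraicI[of "complex_poly m"]) (use m y in \<open>auto simp: is_minpoly_def\<close>)
  then obtain q where q: "is_minpoly y q" using ex_minpoly by blast
  obtain g where g: "m = q * g" using minpoly_dvd[OF q y] by (auto elim: dvdE)
  have nz: "q \<noteq> 0" "g \<noteq> 0" using m g by (auto simp: is_minpoly_def)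
  have dq: "degree q > 0"
  proof (rule ccontr)
    assume "\<not> degree q > 0"
    then obtain c where "q = [:c:]" by (auto elim: degree_eq_zeroE)
    thus False using q nz by (auto simp: is_minpoly_def map_poly_pCons)
  qed
  have dm: "degree m = degree q + degree g" using nz g by (simp add: degree_mult_eq)
  have "poly (complex_poly q) \<xi> * poly (complex_poly g) \<xi> = 0"
    using m by (simp add: is_minpoly_def g complex_poly_mult)
  moreover have "poly (complex_poly g) \<xi> \<noteq> 0"
    using m nz dm dq unfolding is_minpoly_def by force
  ultimately have "poly (complex_poly q) \<xi> = 0" by simp
  hence "degree m \<le> degree q" using m nz by (auto simp: is_minpoly_def)
  hence "degree m = degree q" using dm by simp
  thus ?thesis using q m y by (auto simp: is_minpoly_def)
qed

lemma minpoly_degree_pos: "is_minpoly \<xi> m \<Longrightarrow> degree m > 0"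
  by (rule ccontr) (auto simp: is_minpoly_def map_poly_pCons elim!: degree_eq_zeroE)

text \<open>A multiple root would also be a root of the derivative, whose degree is too small, since \<open>m\<close> is
  minimal for each of its roots.\<close>

lemma rsquarefree_minpoly:
  assumes m: "is_minpoly \<xi> m"
  shows "rsquarefree (complex_poly m)"
  unfolding rsquarefree_roots
proof safe
  fix y assume y: "poly (complex_poly m) y = 0" "poly (pderiv (complex_poly m)) y = 0"
  have "pderiv (complex_poly m) = complex_poly (pderiv m)"
    by (auto intro!: poly_eqI simp: coeff_pderiv)
  moreover have "pderiv m \<noteq> 0" using minpoly_degree_pos[OF m] by (simp add: pderiv_eq_0_iff)
  ultimately have "degree m \<le> degree (pderiv m)"
    using is_minpoly_root[OF m y(1)] y(2) by (auto simp: is_minpoly_def)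
  thus False using minpoly_degree_pos[OF m] by (simp add: degree_pderiv)
qed

definition conjugates :: "complex \<Rightarrow> complex set" where
  "conjugates \<xi> = {y. poly (complex_poly (int_minpoly \<xi>)) y = 0}"

context
  fixes \<xi> :: complex
  assumes alg: "algebraic \<xi>"
begin

lemma int_minpoly_nz: "int_minpoly \<xi> \<noteq> 0"
  using int_minpoly[OF alg] by (auto simp: is_minpoly_def)

lemma finite_conjugates: "finite (conjugates \<xi>)"
  unfolding conjugates_def using int_minpoly_nz by (intro poly_roots_finite) auto

lemma self_conjugate: "\<xi> \<in> conjugates \<xi>"
  using int_minpoly[OF alg] by (simp add: conjugates_def is_minpoly_def)

lemma proots_int_minpoly: "proots (complex_poly (int_minpoly \<xi>)) = mset_set (conjugates \<xi>)"
proof (rule multiset_eqI)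
  fix x
  have r: "rsquarefree (complex_poly (int_minpoly \<xi>))" by (rule rsquarefree_minpoly[OF int_minpoly[OF alg]])
  show "count (proots (complex_poly (int_minpoly \<xi>))) x = count (mset_set (conjugates \<xi>)) x"
  proof (cases "x \<in> conjugates \<xi>")
    case True
    hence "order x (complex_poly (int_minpoly \<xi>)) = 1"
      using rsquarefree_root_order[OF r] int_minpoly_nz by (simp add: conjugates_def)
    thus ?thesis using True finite_conjugates int_minpoly_nz by simp
  next
    case False
    thus ?thesis using finite_conjugates int_minpoly_nz by (simp add: conjugates_def order_0I)
  qed
qed

lemma card_conjugates: "card (conjugates \<xi>) = alg_degree \<xi>"
  using size_proots_complex[of "complex_poly (int_minpoly \<xi>)"]
  by (simp add: proots_int_minpoly alg_degree_def)

lemma alg_degree_pos: "alg_degree \<xi> > 0"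
  using minpoly_degree_pos[OF int_minpoly[OF alg]] by (simp add: alg_degree_def)

lemma int_minpoly_decompose:
  "complex_poly (int_minpoly \<xi>) =
     smult (of_int (lead_coeff (int_minpoly \<xi>))) (\<Prod>y\<in>conjugates \<xi>. [:- y, 1:])"
  using complex_poly_decompose_rsquarefree[OF rsquarefree_minpoly[OF int_minpoly[OF alg]]]
  by (simp add: conjugates_def)

lemma conjugates_conjugate: "y \<in> conjugates \<xi> \<Longrightarrow> int_minpoly y = int_minpoly \<xi>"
  using is_minpoly_root[OF int_minpoly[OF alg]] int_minpoly_eqI by (simp add: conjugates_def)

lemma algebraic_conjugate: "y \<in> conjugates \<xi> \<Longrightarrow> algebraic y"
  using is_minpoly_root[OF int_minpoly[OF alg]] is_minpoly_algebraic by (auto simp: conjugates_def)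

lemma lead_coeff_int_minpoly_pos: "lead_coeff (int_minpoly \<xi>) > 0"
  using int_minpoly[OF alg] by (auto simp: is_minpoly_def)

lemma weil_height_conjugates:
  "real (alg_degree \<xi>) * weil_height \<xi> =
     ln (real_of_int (lead_coeff (int_minpoly \<xi>))) + (\<Sum>y\<in>conjugates \<xi>. log_plus (cmod y))"
  using alg_degree_pos lead_coeff_int_minpoly_pos
  by (simp add: weil_height_def proots_int_minpoly sum_unfold_sum_mset)

end

section \<open>Extending partial automorphisms\<close>

text \<open>The graph of an embedding into \<open>Qbar\<close> of a subring of \<open>Qbar\<close> containing the rationals; the
  last clause makes the relation single-valued. As a graph, the union of a chain of embeddings is a
  plain union, and polynomials over the ring are transported along the embedding by
  relating them coefficientwise.\<close>

definition pair_ring :: "(complex \<times> complex) set \<Rightarrow> bool" where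
  "pair_ring R \<longleftrightarrow> R \<subseteq> Qbar \<times> Qbar \<and> (\<forall>q\<in>\<rat>. (q, q) \<in> R) \<and>
     (\<forall>a a' b b'. (a, a') \<in> R \<longrightarrow> (b, b') \<in> R \<longrightarrow> (a + b, a' + b') \<in> R \<and> (a * b, a' * b') \<in> R) \<and>
     (\<forall>y. (0, y) \<in> R \<longrightarrow> y = 0)"

definition pair_poly :: "(complex \<times> complex) set \<Rightarrow> complex poly \<Rightarrow> complex poly \<Rightarrow> bool" where
  "pair_poly R p q \<longleftrightarrow> (\<forall>i. (coeff p i, coeff q i) \<in> R)"

definition pair_adjoin :: "(complex \<times> complex) set \<Rightarrow> complex \<Rightarrow> complex \<Rightarrow> (complex \<times> complex) set" where
  "pair_adjoin R a b = {(poly p a, poly q b) | p q. pair_poly R p q}"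

context
  fixes R assumes R: "pair_ring R"
begin

lemma pair_ring_rat: "q \<in> \<rat> \<Longrightarrow> (q, q) \<in> R"
  and pair_ring_add: "(a, a') \<in> R \<Longrightarrow> (b, b') \<in> R \<Longrightarrow> (a + b, a' + b') \<in> R"
  and pair_ring_mult: "(a, a') \<in> R \<Longrightarrow> (b, b') \<in> R \<Longrightarrow> (a * b, a' * b') \<in> R"
  and pair_ring_zero: "(0, y) \<in> R \<Longrightarrow> y = 0"
  and pair_ring_algebraic: "(a, a') \<in> R \<Longrightarrow> algebraic a \<and> algebraic a'"
  using R by (auto simp: pair_ring_def)

lemma pair_ring_uminus: "(a, a') \<in> R \<Longrightarrow> (- a, - a') \<in> R"
  using pair_ring_mult[OF pair_ring_rat[of "-1"]] by simp

lemma pair_ring_diff: "(a, a') \<in> R \<Longrightarrow> (b, b') \<in> R \<Longrightarrow> (a - b, a' - b') \<in> R"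
  using pair_ring_add[OF _ pair_ring_uminus, of a a' b b'] by simp

lemma pair_ring_sum: "(\<And>i. i \<in> I \<Longrightarrow> (f i, g i) \<in> R) \<Longrightarrow> (sum f I, sum g I) \<in> R"
  by (induction I rule: infinite_finite_induct) (auto intro: pair_ring_rat pair_ring_add)

lemma pair_ring_unique: "(a, b) \<in> R \<Longrightarrow> (a, b') \<in> R \<Longrightarrow> b = b'"
  using pair_ring_diff[of a b a b'] pair_ring_zero by force

lemma pair_ring_poly:
  assumes "pair_poly R p q" "(a, b) \<in> R"
  shows "(poly p a, poly q b) \<in> R"
  using assms(1)
proof (induction p arbitrary: q)
  case 0
  hence "coeff q i = 0" for i using pair_ring_zero by (auto simp: pair_poly_def)
  hence "q = 0" by (simp add: poly_eq_iff)
  thus ?case by (simp add: pair_ring_rat)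
next
  case (pCons c p)
  obtain c' q' where q: "q = pCons c' q'" by (cases q) auto
  have "pair_poly R p q'" "(c, c') \<in> R"
    using spec[OF pCons.prems[unfolded pair_poly_def], of "Suc _"]
      spec[OF pCons.prems[unfolded pair_poly_def], of 0] by (auto simp: pair_poly_def q)
  thus ?case using pCons.IH[of q'] assms(2) by (auto simp: q intro: pair_ring_add pair_ring_mult)
qed

lemma pair_poly_int: "pair_poly R (complex_poly f) (complex_poly f)"
  by (auto simp: pair_poly_def intro: pair_ring_rat)

lemma pair_poly_const: "(a, b) \<in> R \<Longrightarrow> pair_poly R [:a:] [:b:]"
  by (auto simp: pair_poly_def coeff_pCons pair_ring_rat split: nat.splits)

lemma pair_poly_monom: "(a, b) \<in> R \<Longrightarrow> pair_poly R (monom a n) (monom b n)"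
  by (auto simp: pair_poly_def pair_ring_rat)

lemma pair_poly_add: "pair_poly R p q \<Longrightarrow> pair_poly R p' q' \<Longrightarrow> pair_poly R (p + p') (q + q')"
  by (auto simp: pair_poly_def pair_ring_add)

lemma pair_poly_diff: "pair_poly R p q \<Longrightarrow> pair_poly R p' q' \<Longrightarrow> pair_poly R (p - p') (q - q')"
  by (auto simp: pair_poly_def pair_ring_diff)

lemma pair_poly_mult: "pair_poly R p q \<Longrightarrow> pair_poly R p' q' \<Longrightarrow> pair_poly R (p * p') (q * q')"
  by (auto simp: pair_poly_def coeff_mult intro!: pair_ring_sum pair_ring_mult)

lemma pair_poly_0: "pair_poly R 0 q \<Longrightarrow> q = 0"
  using pair_ring_zero by (auto simp: pair_poly_def poly_eq_iff)

text \<open>An algebraic number is a root of an integer polynomial with nonzero constant coefficient, which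
  expresses its inverse as a polynomial in it. So the domain of an embedding is a field and
  the embedding is injective.\<close>

lemma pair_ring_inverse:
  assumes ab: "(a, b) \<in> R" "a \<noteq> 0"
  shows "b \<noteq> 0" "(inverse a, inverse b) \<in> R"
proof -
  obtain h where h: "coeff h 0 \<noteq> 0" "poly (complex_poly h) a = 0"
    using algebraicE'_nonzero[of a] ab pair_ring_algebraic by metis
  obtain c g where hc: "h = pCons c g" by (cases h) auto
  have c: "c \<noteq> 0" using h hc by simp
  have ha: "of_int c + a * poly (complex_poly g) a = 0"
    using h(2) unfolding hc by (simp add: map_poly_pCons)
  have "(0, poly (complex_poly h) b) \<in> R"
    using pair_ring_poly[OF pair_poly_int ab(1), of h] h(2) by simp
  hence "poly (complex_poly h) b = 0" by (rule pair_ring_zero)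
  hence hb: "of_int c + b * poly (complex_poly g) b = 0"
    unfolding hc by (simp add: map_poly_pCons)
  thus b0: "b \<noteq> 0" using c by auto
  have inv: "inverse x = (- 1 / of_int c) * poly (complex_poly g) x"
    if "of_int c + x * poly (complex_poly g) x = 0" "x \<noteq> 0" for x :: complex
  proof -
    have "x * poly (complex_poly g) x = - of_int c" using that(1) by (simp add: eq_neg_iff_add_eq_0 add.commute)
    hence "x * ((- 1 / of_int c) * poly (complex_poly g) x) = 1" using c by (simp add: field_simps)
    thus ?thesis by (rule inverse_unique)
  qed
  have "((- 1 / of_int c) * poly (complex_poly g) a, (- 1 / of_int c) * poly (complex_poly g) b) \<in> R"
    by (intro pair_ring_mult pair_ring_poly pair_poly_int ab pair_ring_rat) auto
  thus "(inverse a, inverse b) \<in> R" using inv[OF ha ab(2)] inv[OF hb b0] by simp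
qed

lemma pair_poly_division:
  assumes m: "pair_poly R m m'" "m \<noteq> 0" and "pair_poly R p q"
  shows "\<exists>g g' r r'. pair_poly R g g' \<and> pair_poly R r r' \<and> p = g * m + r \<and> q = g' * m' + r' \<and>
           (r = 0 \<or> degree r < degree m)"
  using assms(3)
proof (induction "degree p" arbitrary: p q rule: less_induct)
  case less
  show ?case
  proof (cases "degree p < degree m \<or> p = 0")
    case True
    have "pair_poly R 0 0" by (simp add: pair_poly_def pair_ring_rat)
    thus ?thesis using less.prems True
      by (intro exI[of _ 0] exI[of _ p] exI[of _ 0] exI[of _ q]) auto
  next
    case False
    define c where "c = inverse (lead_coeff m) * lead_coeff p"
    define c' where "c' = inverse (coeff m' (degree m)) * coeff q (degree p)"
    have mR: "(lead_coeff m, coeff m' (degree m)) \<in> R" "(lead_coeff p, coeff q (degree p)) \<in> R"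
      using m(1) less.prems by (simp_all add: pair_poly_def)
    have lm: "lead_coeff m \<noteq> 0" using m by simp
    have cc: "(c, c') \<in> R" unfolding c_def c'_def
      by (rule pair_ring_mult[OF pair_ring_inverse(2)[OF mR(1) lm] mR(2)])
    define s where "s = monom c (degree p - degree m)"
    define s' where "s' = monom c' (degree p - degree m)"
    have ss: "pair_poly R s s'" unfolding s_def s'_def by (rule pair_poly_monom[OF cc])
    have c0: "c \<noteq> 0" using False m by (auto simp: c_def)
    have dsm: "degree (s * m) = degree p"
      using False m c0 by (auto simp: s_def degree_mult_eq degree_monom_eq monom_eq_0_iff)
    have "lead_coeff (s * m) = lead_coeff p"
      unfolding lead_coeff_mult s_def lead_coeff_monom using m by (simp add: c_def)
    hence csm: "coeff (s * m) (degree p) = lead_coeff p" using dsm by simp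
    have pp: "pair_poly R (p - s * m) (q - s' * m')"
      by (intro pair_poly_diff pair_poly_mult ss m less.prems)
    show ?thesis
    proof (cases "p - s * m = 0")
      case True
      hence "q - s' * m' = 0" using pair_poly_0[of "q - s' * m'"] pp by simp
      thus ?thesis using True ss pp by (intro exI[of _ s] exI[of _ s'] exI[of _ 0] exI[of _ 0]) auto
    next
      case nz: False
      have "degree (p - s * m) \<le> degree p" using dsm by (metis degree_diff_le order_refl)
      moreover have "coeff (p - s * m) (degree p) = 0" using csm by simp
      ultimately have "degree (p - s * m) < degree p" using nz
        by (metis le_neq_implies_less leading_coeff_0_iff)
      from less.hyps[OF this pp] obtain g g' r r' where
        g: "pair_poly R g g'" "pair_poly R r r'" "p - s * m = g * m + r" "q - s' * m' = g' * m' + r'"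
          "r = 0 \<or> degree r < degree m" by blast
      show ?thesis
        using g pair_poly_add[OF g(1) ss]
        by (intro exI[of _ "g + s"] exI[of _ "g' + s'"] exI[of _ r] exI[of _ r'])
          (auto simp: algebra_simps)
    qed
  qed
qed

text \<open>An embedding of a field extends to the field generated by a root \<open>a\<close> of a polynomial \<open>m\<close> of
  minimal degree, with any root \<open>b\<close> of the transported polynomial as image: a polynomial
  vanishing at \<open>a\<close> is a multiple of \<open>m\<close>, so its transport vanishes at \<open>b\<close>.\<close>

lemma pair_ring_adjoin:
  assumes m: "pair_poly R m m'" "m \<noteq> 0" "poly m a = 0" "poly m' b = 0"
    and min: "\<And>p q. pair_poly R p q \<Longrightarrow> p \<noteq> 0 \<Longrightarrow> poly p a = 0 \<Longrightarrow> degree m \<le> degree p"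
    and alg: "algebraic a" "algebraic b"
  shows "pair_ring (pair_adjoin R a b)" "R \<subseteq> pair_adjoin R a b" "(a, b) \<in> pair_adjoin R a b"
proof -
  have I: "(poly p a, poly q b) \<in> pair_adjoin R a b" if "pair_poly R p q" for p q
    using that by (auto simp: pair_adjoin_def)
  show sub: "R \<subseteq> pair_adjoin R a b"
  proof
    fix z assume z: "z \<in> R"
    obtain x y where xy: "z = (x, y)" by (cases z)
    thus "z \<in> pair_adjoin R a b" using I[OF pair_poly_const[of x y]] z by simp
  qed
  have "pair_poly R [:0, 1:] [:0, 1:]"
    by (auto simp: pair_poly_def coeff_pCons pair_ring_rat split: nat.splits)
  from I[OF this] show "(a, b) \<in> pair_adjoin R a b" by simp
  have algp: "algebraic (poly p x)" if "\<And>i. algebraic (coeff p i)" "algebraic x" for p :: "complex poly" and x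
    unfolding poly_altdef
    using that is_subring_sum[OF is_subring_Qbar] is_subring_power[OF is_subring_Qbar, of x]
      algebraic_arith(2) by (metis (no_types, lifting) mem_Collect_eq)
  show "pair_ring (pair_adjoin R a b)"
    unfolding pair_ring_def
  proof (intro conjI allI impI ballI)
    show "pair_adjoin R a b \<subseteq> Qbar \<times> Qbar"
      using alg pair_ring_algebraic by (auto simp: pair_adjoin_def pair_poly_def intro!: algp)
    show "(q, q) \<in> pair_adjoin R a b" if "q \<in> \<rat>" for q using sub pair_ring_rat[OF that] by auto
    fix x x' y y' assume "(x, x') \<in> pair_adjoin R a b" "(y, y') \<in> pair_adjoin R a b"
    then obtain p q p' q' where "pair_poly R p q" "pair_poly R p' q'"
      "x = poly p a" "x' = poly q b" "y = poly p' a" "y' = poly q' b" by (auto simp: pair_adjoin_def)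
    thus "(x + y, x' + y') \<in> pair_adjoin R a b" "(x * y, x' * y') \<in> pair_adjoin R a b"
      using I[OF pair_poly_add[of p q p' q']] I[OF pair_poly_mult[of p q p' q']] by auto
  next
    fix y assume "(0, y) \<in> pair_adjoin R a b"
    then obtain p q where pq: "pair_poly R p q" "poly p a = 0" "y = poly q b"
      by (auto simp: pair_adjoin_def)
    from pair_poly_division[OF m(1,2) pq(1)] obtain g g' r r' where
      g: "pair_poly R r r'" "p = g * m + r" "q = g' * m' + r'" "r = 0 \<or> degree r < degree m" by blast
    have "poly r a = 0" using g(2) pq(2) m(3) by simp
    hence "r = 0" using g min by fastforce
    hence "r' = 0" using g(1) pair_poly_0 by simp
    thus "y = 0" using pq(3) g(3) m(4) by simp
  qed
qed

lemma pair_ring_extend: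
  assumes a: "algebraic a"
  shows "\<exists>R' b. pair_ring R' \<and> R \<subseteq> R' \<and> (a, b) \<in> R'"
proof -
  let ?P = "\<lambda>(p, q). pair_poly R p q \<and> p \<noteq> 0 \<and> poly p a = 0"
  obtain f where f: "f \<noteq> 0" "poly (complex_poly f) a = 0" using algebraicE'[OF a] by metis
  hence "?P (complex_poly f, complex_poly f)" using pair_poly_int[of f] by simp
  from ex_has_least_nat[of ?P, OF this, of "degree \<circ> fst"]
  obtain m m' where m: "pair_poly R m m'" "m \<noteq> 0" "poly m a = 0"
    and min: "\<And>p q. pair_poly R p q \<Longrightarrow> p \<noteq> 0 \<Longrightarrow> poly p a = 0 \<Longrightarrow> degree m \<le> degree p"
    by (auto simp: case_prod_beta)
  have "(lead_coeff m, coeff m' (degree m)) \<in> R" using m by (auto simp: pair_poly_def)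
  from pair_ring_inverse(1)[OF this] have "coeff m' (degree m) \<noteq> 0" using m by simp
  moreover have "degree m > 0"
    using m by (metis degree_eq_zeroE gr0I pCons_eq_0_iff poly_0 poly_const_conv)
  ultimately have "degree m' > 0" using le_degree by fastforce
  then obtain b where b: "poly m' b = 0" using alg_closed_imp_poly_has_root by blast
  from pair_poly_division[OF m(1,2) pair_poly_int, of f] obtain g g' r r' where
    g: "pair_poly R r r'" "complex_poly f = g * m + r" "complex_poly f = g' * m' + r'"
      "r = 0 \<or> degree r < degree m" by blast
  have "poly r a = 0" using arg_cong[OF g(2), of "\<lambda>p. poly p a"] f(2) m(3) by simp
  hence "r = 0" using g min by fastforce
  hence "r' = 0" using g(1) pair_poly_0 by simp
  hence "poly (complex_poly f) b = 0" using g(3) b by simp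
  hence "algebraic b" using f by (intro algebraicI[of "complex_poly f"]) auto
  note adj = pair_ring_adjoin[OF m b _ a this]
  have "pair_ring (pair_adjoin R a b)" by (rule adj(1)) (rule min)
  moreover have "R \<subseteq> pair_adjoin R a b" by (rule adj(2)) (rule min)
  moreover have "(a, b) \<in> pair_adjoin R a b" by (rule adj(3)) (rule min)
  ultimately show ?thesis by blast
qed

end

lemma pair_ring_Union:
  assumes "C \<noteq> {}" "\<And>R. R \<in> C \<Longrightarrow> pair_ring R" "\<And>R S. R \<in> C \<Longrightarrow> S \<in> C \<Longrightarrow> R \<subseteq> S \<or> S \<subseteq> R"
  shows "pair_ring (\<Union>C)"
  unfolding pair_ring_def
proof (intro conjI allI impI ballI)
  show "\<Union>C \<subseteq> Qbar \<times> Qbar"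
    by (rule Union_least) (use assms(2) in \<open>simp add: pair_ring_def\<close>)
  show "(q, q) \<in> \<Union>C" if "q \<in> \<rat>" for q using assms(1,2) pair_ring_rat that by fastforce
  show "y = 0" if "(0, y) \<in> \<Union>C" for y using that assms(2) pair_ring_zero by blast
  fix a a' b b' assume "(a, a') \<in> \<Union>C" "(b, b') \<in> \<Union>C"
  then obtain R S where "R \<in> C" "S \<in> C" "(a, a') \<in> R" "(b, b') \<in> S" by blast
  then obtain T where "T \<in> C" "(a, a') \<in> T" "(b, b') \<in> T" using assms(3)[of R S] by blast
  thus "(a + b, a' + b') \<in> \<Union>C" "(a * b, a' * b') \<in> \<Union>C"
    using pair_ring_add pair_ring_mult assms(2) by blast+
qed

text \<open>Surjectivity: an injective map that permutes the finitely many roots of an integer polynomial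
  among themselves hits all of them.\<close>

lemma pair_ring_total_automorphism:
  assumes R: "pair_ring R" and tot: "\<And>a. algebraic a \<Longrightarrow> \<exists>b. (a, b) \<in> R"
  shows "\<exists>\<sigma>\<in>gal_Qbar. \<forall>(a, b)\<in>R. \<sigma> a = b"
proof -
  define \<sigma> where "\<sigma> a = (THE b. (a, b) \<in> R)" for a
  have \<sigma>: "\<sigma> a = b" if "(a, b) \<in> R" for a b
    unfolding \<sigma>_def by (rule the_equality) (use that pair_ring_unique[OF R] in auto)
  have \<sigma>R: "(a, \<sigma> a) \<in> R" if "algebraic a" for a using tot[OF that] \<sigma> by blast
  have "\<sigma> \<in> gal_Qbar"
    unfolding gal_Qbar_def
  proof (intro CollectI conjI ballI)
    show "\<sigma> q = q" if "q \<in> \<rat>" for q using \<sigma> pair_ring_rat[OF R that] by blast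
    show "\<sigma> (x + y) = \<sigma> x + \<sigma> y" "\<sigma> (x * y) = \<sigma> x * \<sigma> y" if "x \<in> Qbar" "y \<in> Qbar" for x y
      using that by (auto intro!: \<sigma> pair_ring_add[OF R] pair_ring_mult[OF R] \<sigma>R)
    have inj: "inj_on \<sigma> Qbar"
    proof (rule inj_onI)
      fix x y assume xy: "x \<in> Qbar" "y \<in> Qbar" "\<sigma> x = \<sigma> y"
      hence "(x - y, 0) \<in> R" using pair_ring_diff[OF R \<sigma>R \<sigma>R, of x y] by simp
      thus "x = y" using pair_ring_inverse(1)[OF R] by force
    qed
    have "\<sigma> ` Qbar = Qbar"
    proof
      show "\<sigma> ` Qbar \<subseteq> Qbar" using \<sigma>R pair_ring_algebraic[OF R] by blast
      show "Qbar \<subseteq> \<sigma> ` Qbar"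
      proof
        fix y assume y: "y \<in> Qbar"
        then obtain f where f: "f \<noteq> 0" "poly (complex_poly f) y = 0" by (auto elim: algebraicE')
        define Z where "Z = {z. poly (complex_poly f) z = 0}"
        have Zf: "finite Z" unfolding Z_def using f by (intro poly_roots_finite) auto
        have ZQ: "Z \<subseteq> Qbar" using f by (auto simp: Z_def intro!: algebraicI[of "complex_poly f"])
        have "\<sigma> ` Z \<subseteq> Z"
        proof
          fix w assume "w \<in> \<sigma> ` Z"
          then obtain z where z: "z \<in> Z" "w = \<sigma> z" by blast
          have "(0, poly (complex_poly f) w) \<in> R"
            using pair_ring_poly[OF R pair_poly_int[OF R] \<sigma>R, of z f] z ZQ by (auto simp: Z_def)
          thus "w \<in> Z" using pair_ring_zero[OF R] by (simp add: Z_def)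
        qed
        hence "\<sigma> ` Z = Z" using Zf inj ZQ by (intro endo_inj_surj) (auto intro: inj_on_subset)
        thus "y \<in> \<sigma> ` Qbar" using f ZQ by (auto simp: Z_def)
      qed
    qed
    thus "bij_betw \<sigma> Qbar Qbar" using inj by (simp add: bij_betw_def)
  qed
  thus ?thesis using \<sigma> by auto
qed

lemma pair_ring_extends_to_automorphism:
  assumes "pair_ring R"
  shows "\<exists>\<sigma>\<in>gal_Qbar. \<forall>(a, b)\<in>R. \<sigma> a = b"
proof -
  let ?A = "{S. pair_ring S \<and> R \<subseteq> S}"
  have "\<exists>M\<in>?A. \<forall>X\<in>?A. M \<subseteq> X \<longrightarrow> X = M"
  proof (rule subset_Zorn_nonempty)
    show "?A \<noteq> {}" using assms by blast
    fix C assume C: "C \<noteq> {}" "subset.chain ?A C"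
    hence "pair_ring (\<Union>C)"
      by (intro pair_ring_Union) (auto simp: subset_chain_def)
    moreover have "R \<subseteq> \<Union>C" using C unfolding subset_chain_def by blast
    ultimately show "\<Union>C \<in> ?A" by simp
  qed
  then obtain M where M: "pair_ring M" "R \<subseteq> M" "\<And>X. pair_ring X \<Longrightarrow> M \<subseteq> X \<Longrightarrow> X = M" by fastforce
  have "\<exists>b. (a, b) \<in> M" if alg: "algebraic a" for a
  proof -
    obtain R' b where "pair_ring R'" "M \<subseteq> R'" "(a, b) \<in> R'"
      using pair_ring_extend[OF M(1) alg] by blast
    thus ?thesis using M(3)[of R'] by blast
  qed
  hence "\<exists>\<sigma>\<in>gal_Qbar. \<forall>(a, b)\<in>M. \<sigma> a = b" by (rule pair_ring_total_automorphism[OF M(1)])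
  then obtain \<sigma> where \<sigma>: "\<sigma> \<in> gal_Qbar" "\<forall>(a, b)\<in>M. \<sigma> a = b" by (elim bexE)
  have "\<forall>(a, b)\<in>R. \<sigma> a = b" using \<sigma>(2) M(2) by (auto dest!: bspec)
  thus ?thesis using \<sigma>(1) by (intro bexI[of _ \<sigma>])
qed

text \<open>Zorn's lemma extends the isomorphism between the fields generated by \<open>x\<close> and \<open>y\<close> to an
  automorphism of \<open>Qbar\<close>.\<close>

lemma galois_transitive:
  assumes x: "algebraic x" and y: "y \<in> conjugates x"
  shows "\<exists>\<sigma>\<in>gal_Qbar. \<sigma> x = y"
proof -
  define R where "R = (\<lambda>q. (q :: complex, q)) ` \<rat>"
  have R: "pair_ring R"
    unfolding pair_ring_def R_def by (auto intro: rat_imp_algebraic)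
  let ?m = "complex_poly (int_minpoly x)"
  have m: "is_minpoly x (int_minpoly x)" by (rule int_minpoly[OF x])
  have min: "degree ?m \<le> degree p" if p: "pair_poly R p q" "p \<noteq> 0" "poly p x = 0" for p q
  proof -
    have "\<And>i. coeff p i \<in> \<rat>" using p(1) by (fastforce simp: pair_poly_def R_def)
    then obtain g where g: "p = map_poly of_rat g" by (elim ratpolyE)
    define d where "d = (\<Prod>i\<le>degree p. snd (quotient_of (coeff g i)))"
    have d0: "d > 0" unfolding d_def by (intro prod_pos) (simp add: quotient_of_denom_pos')
    have "coeff (smult (of_int d) p) i \<in> \<int>" for i
    proof (cases "i \<le> degree p")
      case True
      obtain a b where ab: "quotient_of (coeff g i) = (a, b)" by force
      have "d = b * (\<Prod>i\<in>{..degree p}-{i}. snd (quotient_of (coeff g i)))"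
        unfolding d_def using True ab by (subst prod.remove[of _ i]) auto
      moreover have "coeff p i = of_int a / of_int b" "b > 0"
        using ab quotient_of_div[OF ab]
        by (auto simp: g coeff_map_poly of_rat_divide quotient_of_denom_pos)
      ultimately show ?thesis by (simp del: of_int_prod)
    qed (auto simp: coeff_eq_0)
    then obtain f where f: "smult (of_int d) p = complex_poly f" by (elim intpolyE)
    have "smult (of_int d) p \<noteq> 0" using p(2) d0 by simp
    hence "f \<noteq> 0" unfolding f by auto
    moreover have "poly (complex_poly f) x = 0" using p by (simp flip: f)
    ultimately have fx: "f \<noteq> 0" "poly (complex_poly f) x = 0" by auto
    have "degree (int_minpoly x) \<le> degree f" using m fx by (auto simp: is_minpoly_def)
    also have "degree f = degree (complex_poly f)" by simp
    also have "\<dots> = degree p" using d0 by (simp flip: f)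
    finally show ?thesis by simp
  qed
  have alg: "algebraic y" by (rule algebraic_conjugate[OF x y])
  have mx: "?m \<noteq> 0" "poly ?m x = 0" using m by (auto simp: is_minpoly_def)
  have my: "poly ?m y = 0" using y by (simp add: conjugates_def)
  note adj = pair_ring_adjoin[OF R pair_poly_int[OF R] mx my _ x alg]
  have "pair_ring (pair_adjoin R x y)" by (rule adj(1)) (rule min)
  from pair_ring_extends_to_automorphism[OF this] obtain \<sigma>
    where \<sigma>: "\<sigma> \<in> gal_Qbar" "\<forall>(a, b)\<in>pair_adjoin R x y. \<sigma> a = b" by blast
  have "(x, y) \<in> pair_adjoin R x y" by (rule adj(3)) (rule min)
  with \<sigma>(2) have "\<sigma> x = y" by (auto dest!: bspec)
  thus ?thesis using \<sigma>(1) by (intro bexI[of _ \<sigma>])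
qed


section \<open>The Galois action\<close>

context
  fixes \<sigma> assumes \<sigma>: "\<sigma> \<in> gal_Qbar"
begin

lemma gal_add: "algebraic x \<Longrightarrow> algebraic y \<Longrightarrow> \<sigma> (x + y) = \<sigma> x + \<sigma> y"
  and gal_mult: "algebraic x \<Longrightarrow> algebraic y \<Longrightarrow> \<sigma> (x * y) = \<sigma> x * \<sigma> y"
  and gal_rat: "q \<in> \<rat> \<Longrightarrow> \<sigma> q = q"
  and gal_algebraic: "algebraic x \<Longrightarrow> algebraic (\<sigma> x)"
  and gal_inj: "algebraic x \<Longrightarrow> algebraic y \<Longrightarrow> \<sigma> x = \<sigma> y \<longleftrightarrow> x = y"
  using \<sigma> by (auto simp: gal_Qbar_def bij_betw_def inj_on_def)

lemma gal_eq_0_iff: "algebraic x \<Longrightarrow> \<sigma> x = 0 \<longleftrightarrow> x = 0"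
  using gal_inj[of x 0] gal_rat[of 0] by simp

lemma gal_diff:
  assumes "algebraic x" "algebraic y"
  shows "\<sigma> (x - y) = \<sigma> x - \<sigma> y"
  using gal_add[OF algebraic_arith(3)[OF assms] assms(2)] by simp

lemma gal_prod: "(\<And>i. i \<in> I \<Longrightarrow> algebraic (f i)) \<Longrightarrow> \<sigma> (prod f I) = (\<Prod>i\<in>I. \<sigma> (f i))"
proof (induction I rule: infinite_finite_induct)
  case (insert i I)
  have "algebraic (prod f I)" using is_subring_prod[OF is_subring_Qbar, of I f] insert.prems by auto
  thus ?case using insert by (simp add: gal_mult)
qed (auto simp: gal_rat)

lemma gal_power: "algebraic x \<Longrightarrow> \<sigma> (x ^ k) = \<sigma> x ^ k"
  using gal_prod[of "{..<k}" "\<lambda>_. x"] by simp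

lemma gal_inverse:
  assumes "algebraic x"
  shows "\<sigma> (inverse x) = inverse (\<sigma> x)"
proof (cases "x = 0")
  case False
  hence "\<sigma> x * \<sigma> (inverse x) = 1"
    using gal_mult[of x "inverse x"] assms gal_rat[of 1] by (simp add: algebraic_inverse)
  thus ?thesis by (simp add: inverse_unique)
qed (simp add: gal_rat)

lemma gal_powi: "algebraic x \<Longrightarrow> \<sigma> (x powi k) = \<sigma> x powi k"
  by (auto simp: power_int_def gal_power gal_inverse algebraic_inverse)

lemma gal_poly:
  assumes "algebraic x"
  shows "\<sigma> (poly (complex_poly f) x) = poly (complex_poly f) (\<sigma> x)"
proof (induction f)
  case (pCons c f)
  have "algebraic (poly (complex_poly f) x)"
    using is_subring_Qbar assms is_subring_adjoin(1)
    unfolding poly_altdef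
    using is_subring_sum[OF is_subring_Qbar, of "{..degree (complex_poly f)}" "\<lambda>i. coeff (complex_poly f) i * x ^ i"]
      is_subring_power[OF is_subring_Qbar, of x] algebraic_arith(2) by auto
  thus ?case using pCons assms
    by (simp add: map_poly_pCons gal_add gal_mult algebraic_arith gal_rat)
qed (simp add: gal_rat)

lemma gal_conjugate:
  assumes "algebraic x"
  shows "\<sigma> x \<in> conjugates x"
  using gal_poly[OF assms, of "int_minpoly x"] self_conjugate[OF assms] gal_rat[of 0]
  by (simp add: conjugates_def)

end

lemma id_gal: "id \<in> gal_Qbar" by (auto simp: gal_Qbar_def)

lemma comp_gal:
  assumes "\<sigma> \<in> gal_Qbar" "\<tau> \<in> gal_Qbar"
  shows "\<sigma> \<circ> \<tau> \<in> gal_Qbar"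
  unfolding gal_Qbar_def
proof (intro CollectI conjI ballI)
  show "bij_betw (\<sigma> \<circ> \<tau>) Qbar Qbar"
    using assms by (auto simp: gal_Qbar_def intro: bij_betw_trans)
qed (use assms in \<open>auto simp: gal_add gal_mult gal_algebraic gal_rat\<close>)

text \<open>A number fixed by the Galois group is its only conjugate, hence has degree one.\<close>

lemma rational_if_gal_fixed:
  assumes x: "algebraic x" and inv: "\<And>\<sigma>. \<sigma> \<in> gal_Qbar \<Longrightarrow> \<sigma> x = x"
  shows "x \<in> \<rat>"
proof -
  have "conjugates x = {x}" using galois_transitive[OF x] inv self_conjugate[OF x] by force
  hence "degree (int_minpoly x) = 1" using card_conjugates[OF x] by (simp add: alg_degree_def)
  moreover obtain a q where q: "int_minpoly x = pCons a q" by (cases "int_minpoly x") auto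
  ultimately have "degree q = 0" "q \<noteq> 0" by (auto split: if_splits)
  then obtain b where ab: "int_minpoly x = [:a, b:]" "b \<noteq> 0" using q by (auto elim: degree_eq_zeroE)
  have "of_int a + x * of_int b = 0"
    using self_conjugate[OF x] ab by (simp add: conjugates_def map_poly_pCons)
  hence "x = - of_int a / of_int b" using ab(2) by (simp add: field_simps eq_neg_iff_add_eq_0)
  thus ?thesis by simp
qed

definition gal_act :: "(complex \<Rightarrow> complex) \<Rightarrow> complex ^ 'n \<Rightarrow> complex ^ 'n" where
  "gal_act \<sigma> \<alpha> = (\<chi> j. \<sigma> (\<alpha> $ j))"

lemma galois_orbit_eq: "galois_orbit \<xi> = (\<lambda>\<sigma>. gal_act \<sigma> \<xi>) ` gal_Qbar"
  by (simp add: galois_orbit_def gal_act_def)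

definition torus_point :: "complex ^ 'n \<Rightarrow> bool" where
  "torus_point \<xi> \<longleftrightarrow> (\<forall>j. algebraic (\<xi> $ j) \<and> \<xi> $ j \<noteq> 0)"

text \<open>Functions of the coordinates that commute with the Galois action. Coordinates and characters are
  the instances that matter: their values along an orbit run through all conjugates of
  the value at one point, each conjugate equally often.\<close>

definition equivariant :: "(complex ^ 'n \<Rightarrow> complex) \<Rightarrow> bool" where
  "equivariant \<phi> \<longleftrightarrow> (\<forall>\<alpha>. torus_point \<alpha> \<longrightarrow> algebraic (\<phi> \<alpha>) \<and>
     (\<forall>\<sigma>\<in>gal_Qbar. \<phi> (gal_act \<sigma> \<alpha>) = \<sigma> (\<phi> \<alpha>)))"

lemma equivariant_coordinate: "equivariant (\<lambda>\<alpha>. \<alpha> $ j)"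
  by (auto simp: equivariant_def gal_act_def torus_point_def)

lemma algebraic_powi: "algebraic (x :: complex) \<Longrightarrow> algebraic (x powi k)"
  using is_subring_power[OF is_subring_Qbar] by (auto simp: power_int_def algebraic_inverse)

lemma equivariant_monomial:
  fixes n :: "int ^ 'n"
  shows "equivariant (monomial_char n)"
proof -
  have "algebraic (monomial_char n \<alpha>)" if "torus_point \<alpha>" for \<alpha> :: "complex ^ 'n"
    unfolding monomial_char_def
    using is_subring_prod[OF is_subring_Qbar, of UNIV "\<lambda>j. (\<alpha> $ j) powi (n $ j)"] that
    by (auto simp: torus_point_def algebraic_powi)
  thus ?thesis
    unfolding equivariant_def
    by (auto simp: gal_act_def monomial_char_def gal_prod gal_powi torus_point_def algebraic_powi)
qed

context
  fixes \<xi> :: "complex ^ 'n"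
  assumes \<xi>: "torus_point \<xi>"
begin

lemma finite_galois_orbit: "finite (galois_orbit \<xi>)"
proof -
  have "(\<lambda>\<alpha>. ($) \<alpha>) ` galois_orbit \<xi> \<subseteq> PiE UNIV (\<lambda>j. conjugates (\<xi> $ j))"
    using \<xi> by (auto simp: galois_orbit_eq gal_act_def gal_conjugate torus_point_def)
  moreover have "finite (PiE UNIV (\<lambda>j. conjugates (\<xi> $ j)))"
    using \<xi> by (intro finite_PiE) (auto simp: finite_conjugates torus_point_def)
  moreover have "inj_on (\<lambda>\<alpha>. ($) \<alpha>) (galois_orbit \<xi>)"
    by (auto simp: inj_on_def vec_nth_inject)
  ultimately show ?thesis using finite_subset finite_imageD by blast
qed

lemma self_galois_orbit: "\<xi> \<in> galois_orbit \<xi>"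
  using id_gal by (force simp: galois_orbit_eq gal_act_def)

lemma card_galois_orbit_pos: "card (galois_orbit \<xi>) > 0"
  using finite_galois_orbit self_galois_orbit card_gt_0_iff by blast

lemma torus_point_orbit: "\<alpha> \<in> galois_orbit \<xi> \<Longrightarrow> torus_point \<alpha>"
  using \<xi> by (auto simp: galois_orbit_eq gal_act_def torus_point_def gal_algebraic gal_eq_0_iff)

lemma gal_act_bij:
  assumes "\<sigma> \<in> gal_Qbar"
  shows "bij_betw (gal_act \<sigma>) (galois_orbit \<xi>) (galois_orbit \<xi>)"
proof -
  have sub: "gal_act \<sigma> ` galois_orbit \<xi> \<subseteq> galois_orbit \<xi>"
  proof
    fix \<beta> assume "\<beta> \<in> gal_act \<sigma> ` galois_orbit \<xi>"
    then obtain \<tau> where "\<tau> \<in> gal_Qbar" "\<beta> = gal_act (\<sigma> \<circ> \<tau>) \<xi>"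
      by (auto simp: galois_orbit_eq gal_act_def)
    thus "\<beta> \<in> galois_orbit \<xi>" using comp_gal[OF assms] by (auto simp: galois_orbit_eq)
  qed
  have inj: "inj_on (gal_act \<sigma>) (galois_orbit \<xi>)"
  proof (rule inj_onI)
    fix \<alpha> \<beta> assume "\<alpha> \<in> galois_orbit \<xi>" "\<beta> \<in> galois_orbit \<xi>" "gal_act \<sigma> \<alpha> = gal_act \<sigma> \<beta>"
    thus "\<alpha> = \<beta>" using torus_point_orbit gal_inj[OF assms]
      by (auto simp: gal_act_def vec_eq_iff torus_point_def)
  qed
  show ?thesis using endo_inj_surj[OF finite_galois_orbit sub inj] inj by (simp add: bij_betw_def)
qed

context
  fixes \<phi> :: "complex ^ 'n \<Rightarrow> complex" assumes \<phi>: "equivariant \<phi>"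
begin

lemma equivariant_image: "\<phi> ` galois_orbit \<xi> = conjugates (\<phi> \<xi>)"
proof -
  have "\<phi> ` galois_orbit \<xi> = (\<lambda>\<sigma>. \<sigma> (\<phi> \<xi>)) ` gal_Qbar"
    using \<phi> \<xi> by (auto simp: galois_orbit_eq equivariant_def image_image)
  also have "\<dots> = conjugates (\<phi> \<xi>)"
    using galois_transitive[of "\<phi> \<xi>"] gal_conjugate[of _ "\<phi> \<xi>"] \<phi> \<xi>
    by (fastforce simp: equivariant_def)
  finally show ?thesis .
qed

text \<open>An automorphism taking \<open>y\<close> to \<open>z\<close> maps the fibre over \<open>y\<close> injectively into the one over \<open>z\<close>.\<close>

lemma equivariant_fibre_le:
  assumes y: "y \<in> conjugates (\<phi> \<xi>)" and z: "z \<in> conjugates (\<phi> \<xi>)"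
  shows "card {\<alpha>\<in>galois_orbit \<xi>. \<phi> \<alpha> = y} \<le> card {\<alpha>\<in>galois_orbit \<xi>. \<phi> \<alpha> = z}"
proof -
  have alg: "algebraic (\<phi> \<xi>)" using \<phi> \<xi> by (simp add: equivariant_def)
  have "z \<in> conjugates y" using z conjugates_conjugate[OF alg y] by (simp add: conjugates_def)
  then obtain \<sigma> where \<sigma>: "\<sigma> \<in> gal_Qbar" "\<sigma> y = z"
    using galois_transitive algebraic_conjugate[OF alg y] by blast
  have b: "bij_betw (gal_act \<sigma>) (galois_orbit \<xi>) (galois_orbit \<xi>)" by (rule gal_act_bij[OF \<sigma>(1)])
  have "gal_act \<sigma> \<alpha> \<in> {\<alpha>\<in>galois_orbit \<xi>. \<phi> \<alpha> = z}" if "\<alpha> \<in> {\<alpha>\<in>galois_orbit \<xi>. \<phi> \<alpha> = y}" for \<alpha>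
    using that \<phi> \<sigma> torus_point_orbit bij_betwE[OF b] by (auto simp: equivariant_def)
  thus ?thesis
    using b finite_galois_orbit
    by (intro card_inj_on_le[where f = "gal_act \<sigma>"]) (auto simp: bij_betw_def inj_on_def)
qed

text \<open>This turns sums and products over the orbit into sums and products over conjugates, and gives the
  size of the diagonal contribution in the energy estimate.\<close>

lemma equivariant_fibres:
  obtains e where "e > 0" "card (galois_orbit \<xi>) = e * alg_degree (\<phi> \<xi>)"
    "\<And>y. y \<in> conjugates (\<phi> \<xi>) \<Longrightarrow> card {\<alpha>\<in>galois_orbit \<xi>. \<phi> \<alpha> = y} = e"
proof
  define e where "e = card {\<alpha>\<in>galois_orbit \<xi>. \<phi> \<alpha> = \<phi> \<xi>}"
  have alg: "algebraic (\<phi> \<xi>)" using \<phi> \<xi> by (simp add: equivariant_def)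
  show c: "card {\<alpha>\<in>galois_orbit \<xi>. \<phi> \<alpha> = y} = e" if "y \<in> conjugates (\<phi> \<xi>)" for y
    unfolding e_def using equivariant_fibre_le that self_conjugate[OF alg] by (intro antisym) auto
  have "card (galois_orbit \<xi>) = (\<Sum>\<alpha>\<in>galois_orbit \<xi>. 1)" by simp
  also have "\<dots> = (\<Sum>y\<in>conjugates (\<phi> \<xi>). \<Sum>\<alpha>\<in>{\<alpha>\<in>galois_orbit \<xi>. \<phi> \<alpha> = y}. 1)"
    by (subst sum.image_gen[OF finite_galois_orbit, of _ \<phi>]) (simp add: equivariant_image)
  also have "\<dots> = e * alg_degree (\<phi> \<xi>)" using c by (simp add: card_conjugates[OF alg])
  finally show *: "card (galois_orbit \<xi>) = e * alg_degree (\<phi> \<xi>)" .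
  show "e > 0" using * card_galois_orbit_pos by (cases e) auto
qed

end

end

section \<open>Algebraic integers and deflation\<close>

lemmas is_subring_algints = is_subring_integral_over[OF is_subring_Ints]

lemma algints_add: "integral_over \<int> x \<Longrightarrow> integral_over \<int> y \<Longrightarrow> integral_over \<int> (x + y)"
  and algints_mult: "integral_over \<int> x \<Longrightarrow> integral_over \<int> y \<Longrightarrow> integral_over \<int> (x * y)"
  and algints_uminus: "integral_over \<int> x \<Longrightarrow> integral_over \<int> (- x)"
  and algints_0: "integral_over \<int> 0" and algints_1: "integral_over \<int> 1"
  using is_subring_algints by (auto simp: is_subring_def)

lemma algints_power: "integral_over \<int> x \<Longrightarrow> integral_over \<int> (x ^ k)"
  using is_subring_power[OF is_subring_algints] by simp

lemma algints_diff: "integral_over \<int> x \<Longrightarrow> integral_over \<int> y \<Longrightarrow> integral_over \<int> (x - y)"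
  using algints_add[of x "- y"] algints_uminus by simp

lemma algints_sum: "(\<And>i. i \<in> I \<Longrightarrow> integral_over \<int> (f i)) \<Longrightarrow> integral_over \<int> (sum f I)"
  using is_subring_sum[OF is_subring_algints, of I f] by simp

lemma algints_prod: "(\<And>i. i \<in> I \<Longrightarrow> integral_over \<int> (f i)) \<Longrightarrow> integral_over \<int> (prod f I)"
  using is_subring_prod[OF is_subring_algints, of I f] by simp

text \<open>Multiplying \<open>poly f b = 0\<close> by the power \<open>n - 1\<close> of the leading coefficient \<open>a\<close> gives a monic
  equation for \<open>a * b\<close>.\<close>

lemma lead_coeff_times_root_integral:
  assumes f: "\<And>i. integral_over \<int> (coeff f i)" and b: "poly f b = 0" and d: "degree f > 0"
  shows "integral_over \<int> (lead_coeff f * b)"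
proof -
  define n where "n = degree f"
  define a where "a = lead_coeff f"
  define r where "r = (\<Sum>i<n. monom (coeff f i * a ^ (n - 1 - i)) i)"
  define p where "p = monom 1 n + r"
  have cr: "coeff r k = (if k < n then coeff f k * a ^ (n - 1 - k) else 0)" for k
    by (simp add: r_def coeff_sum sum.delta')
  have cp: "coeff p k = (if k < n then coeff f k * a ^ (n - 1 - k) else if k = n then 1 else 0)" for k
    by (simp add: p_def cr)
  have "degree p = n"
    by (intro antisym degree_le le_degree) (auto simp: cp)
  hence lc: "lead_coeff p = 1" by (simp add: cp)
  have "poly p (a * b) = (a * b) ^ n + (\<Sum>i<n. coeff f i * a ^ (n - 1 - i) * (a * b) ^ i)"
    by (simp add: p_def r_def poly_sum poly_monom)
  also have "(\<Sum>i<n. coeff f i * a ^ (n - 1 - i) * (a * b) ^ i) = (\<Sum>i<n. a ^ (n - 1) * (coeff f i * b ^ i))"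
  proof (rule sum.cong)
    fix i assume "i \<in> {..<n}"
    hence "a ^ (n - 1) = a ^ (n - 1 - i) * a ^ i" by (simp flip: power_add)
    thus "coeff f i * a ^ (n - 1 - i) * (a * b) ^ i = a ^ (n - 1) * (coeff f i * b ^ i)"
      by (simp add: power_mult_distrib)
  qed simp
  also have "(a * b) ^ n = a ^ (n - 1) * (coeff f n * b ^ n)"
  proof -
    obtain m where "n = Suc m" using d n_def gr0_implies_Suc by blast
    moreover have "coeff f n = a" by (simp add: a_def n_def)
    ultimately show ?thesis by (simp add: power_mult_distrib)
  qed
  also have "\<dots> + (\<Sum>i<n. a ^ (n - 1) * (coeff f i * b ^ i)) = a ^ (n - 1) * poly f b"
  proof -
    have "poly f b = (\<Sum>i<Suc n. coeff f i * b ^ i)"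
      by (simp only: poly_altdef n_def lessThan_Suc_atMost)
    thus ?thesis by (simp add: sum_distrib_left distrib_left)
  qed
  finally have "poly p (a * b) = 0" using b by simp
  moreover have "integral_over \<int> (coeff p i)" for i
    using f by (auto simp: cp a_def algints_0 algints_1 intro: algints_mult algints_power)
  ultimately show ?thesis
    using integral_over_root[OF is_subring_Ints _ lc] by (simp add: a_def)
qed

text \<open>Dividing out a linear factor keeps coefficients integral: subtracting the leading term of
  the quotient changes the product only by \<open>a * X^(n+1) - (a * b) * X^n\<close>, where \<open>a\<close> is the leading
  coefficient and \<open>a * b\<close> is integral, so induction on the degree applies.\<close>

lemma deflate_integral:
  assumes "\<And>i. integral_over \<int> (coeff ([:- b, 1:] * g) i)"
  shows "integral_over \<int> (coeff g i)"
  using assms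
proof (induction "degree g" arbitrary: g i rule: less_induct)
  case less
  show ?case
  proof (cases "g = 0")
    case False
    define f where "f = [:- b, 1:] * g"
    define n where "n = degree g"
    define a where "a = lead_coeff g"
    have df: "degree f = Suc n" using False by (simp add: f_def n_def degree_mult_eq del: mult_pCons_left)
    have lf: "lead_coeff f = a" unfolding f_def lead_coeff_mult by (simp add: a_def)
    have ab: "integral_over \<int> (a * b)"
      using lead_coeff_times_root_integral[of f b] less.prems df lf by (simp add: f_def)
    have a: "integral_over \<int> a" using less.prems lf unfolding f_def by metis
    define g' where "g' = g - monom a n"
    have c: "integral_over \<int> (coeff ([:- b, 1:] * g') k)" for k
    proof -
      have "[:- b, 1:] * g' = f - [:- b, 1:] * monom a n" by (simp only: g'_def f_def right_diff_distrib)
      also have "[:- b, 1:] * monom a n = monom a (Suc n) - monom (a * b) n"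
        by (simp add: monom_Suc smult_monom mult.commute flip: minus_monom)
      finally have "coeff ([:- b, 1:] * g') k = coeff f k - (coeff (monom a (Suc n)) k - coeff (monom (a * b) n) k)"
        by simp
      also have "integral_over \<int> \<dots>"
        using less.prems[of k] a ab unfolding f_def[symmetric]
        by (intro algints_diff) (auto simp: algints_0)
      finally show ?thesis .
    qed
    have "integral_over \<int> (coeff g' i)"
    proof (cases "g' = 0")
      case nz: False
      have "degree g' \<le> n" unfolding g'_def n_def
        by (intro degree_diff_le) (auto simp: degree_monom_le)
      moreover have "coeff g' n = 0" by (simp add: g'_def a_def n_def)
      ultimately have "degree g' < n" using nz by (metis le_neq_implies_less leading_coeff_0_iff)
      thus ?thesis using less.hyps[of g'] c by (simp add: n_def)
    qed (simp add: algints_0)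
    moreover have "coeff g i = coeff g' i + (if i = n then a else 0)" by (simp add: g'_def)
    ultimately show ?thesis using a by (auto simp: algints_0 intro: algints_add)
  qed (simp add: algints_0)
qed

text \<open>The classical fact that the leading coefficient clears the denominator of every product of
  distinct roots: divide out the linear factors of the other roots and look at the constant
  coefficient.\<close>

lemma subproduct_integral:
  assumes S: "finite S" and T: "T \<subseteq> S"
    and f: "\<And>i. integral_over \<int> (coeff (smult c (\<Prod>s\<in>S. [:- x s, 1:])) i)"
  shows "integral_over \<int> (c * (\<Prod>s\<in>T. x s))"
proof -
  have "finite U \<Longrightarrow> U \<inter> T = {} \<Longrightarrow>
      (\<And>i. integral_over \<int> (coeff (smult c (\<Prod>s\<in>U \<union> T. [:- x s, 1:])) i)) \<Longrightarrow>
      integral_over \<int> (coeff (smult c (\<Prod>s\<in>T. [:- x s, 1:])) i)" for U i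
  proof (induction arbitrary: i rule: finite_induct)
    case (insert u U)
    have eq: "smult c (\<Prod>s\<in>insert u U \<union> T. [:- x s, 1:]) = [:- x u, 1:] * smult c (\<Prod>s\<in>U \<union> T. [:- x s, 1:])"
      using insert T S finite_subset[OF T S]
      by (subst Un_insert_left, subst prod.insert) (auto simp: mult_smult_right)
    have "integral_over \<int> (coeff (smult c (\<Prod>s\<in>U \<union> T. [:- x s, 1:])) i)" for i
      by (rule deflate_integral[of "x u"], rule insert.prems(2)[unfolded eq])
    thus ?case using insert.IH insert.prems(1) by auto
  qed simp
  note * = this
  have ST: "S - T \<union> T = S" using T by blast
  have "integral_over \<int> (coeff (smult c (\<Prod>s\<in>T. [:- x s, 1:])) 0)"
    by (rule *[of "S - T"]) (use S f ST in auto)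
  hence "integral_over \<int> (c * poly (\<Prod>s\<in>T. [:- x s, 1:]) 0)" by (simp add: poly_0_coeff_0)
  also have "poly (\<Prod>s\<in>T. [:- x s, 1:]) 0 = (- 1) ^ card T * (\<Prod>s\<in>T. x s)"
    by (simp add: poly_prod prod_uminus)
  finally have "integral_over \<int> ((- 1) ^ card T * (c * (\<Prod>s\<in>T. x s)))" by (simp add: ac_simps)
  moreover have "integral_over \<int> ((- 1) ^ card T)" by (intro algints_power algints_uminus algints_1)
  ultimately have "integral_over \<int> ((- 1) ^ card T * ((- 1) ^ card T * (c * (\<Prod>s\<in>T. x s))))"
    by (rule algints_mult[rotated])
  thus ?thesis by (simp flip: mult.assoc power_mult_distrib)
qed

text \<open>Expanding the product of differences, each monomial \<open>\<Prod> x\<^sub>i\<^bsup>e i\<^esup>\<close> with exponents at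
  most \<open>D\<close> is a product of \<open>D\<close> squarefree monomials, and each of these is integral after
  multiplication by \<open>B\<close>.\<close>

lemma monomial_integral:
  assumes S: "finite S" and B: "\<And>T. T \<subseteq> S \<Longrightarrow> integral_over \<int> (B * (\<Prod>s\<in>T. x s))"
    and e: "\<And>s. s \<in> S \<Longrightarrow> e s \<le> D"
  shows "integral_over \<int> (B ^ D * (\<Prod>s\<in>S. x s ^ e s))"
proof -
  have "(\<Prod>s\<in>S. x s ^ e s) = (\<Prod>s\<in>S. \<Prod>l<D. if l < e s then x s else 1)"
  proof (rule prod.cong)
    fix s assume "s \<in> S"
    hence "{..<D} \<inter> {l. l < e s} = {..<e s}" using e[of s] by auto
    thus "x s ^ e s = (\<Prod>l<D. if l < e s then x s else 1)"
      by (simp add: prod.If_cases)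
  qed simp
  also have "\<dots> = (\<Prod>l<D. \<Prod>s\<in>S. if l < e s then x s else 1)" by (rule prod.swap)
  also have "B ^ D * \<dots> = (\<Prod>l<D. B * (\<Prod>s\<in>S \<inter> {s. l < e s}. x s))"
    using S by (simp add: prod.distrib prod.If_cases)
  finally show ?thesis using B by (simp add: algints_prod)
qed

text \<open>Each index occurs in at most \<open>2 * card S\<close> of the factors, so this many copies of \<open>B\<close> clear
  all denominators.\<close>

lemma difference_product_integral:
  assumes S: "finite S" and B: "\<And>T. T \<subseteq> S \<Longrightarrow> integral_over \<int> (B * (\<Prod>s\<in>T. x s))"
    and E: "E \<subseteq> S \<times> S"
  shows "integral_over \<int> (B ^ (2 * card S) * (\<Prod>(s, t)\<in>E. x s - x t))"
proof -
  have fE: "finite E" using E S finite_subset by blast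
  have expand: "(\<Prod>p\<in>F. f p + g p) = (\<Sum>P\<in>Pow F. prod f P * prod g (F - P))"
    if "finite F" for F and f g :: "'a \<times> 'a \<Rightarrow> complex"
    using that by (rule prod_add)
  have powers: "(\<Prod>p\<in>P. x (h p)) = (\<Prod>s\<in>S. x s ^ card {p\<in>P. h p = s})"
    if "P \<subseteq> E" "\<And>p. p \<in> P \<Longrightarrow> h p \<in> S" for P h
  proof -
    have fP: "finite P" using that fE finite_subset by blast
    have "(\<Prod>p\<in>P. x (h p)) = (\<Prod>s\<in>S. \<Prod>p\<in>{p\<in>P. h p = s}. x (h p))"
      using that by (intro prod.group[symmetric] fP S) auto
    also have "\<dots> = (\<Prod>s\<in>S. x s ^ card {p\<in>P. h p = s})"
      by (intro prod.cong) (auto simp: prod_constant[symmetric] simp del: prod_constant intro!: prod.cong)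
    finally show ?thesis .
  qed
  have "(\<Prod>(s, t)\<in>E. x s - x t) = (\<Prod>p\<in>E. x (fst p) + - x (snd p))"
    by (simp add: case_prod_beta)
  also have "\<dots> = (\<Sum>P\<in>Pow E. (\<Prod>p\<in>P. x (fst p)) * (\<Prod>p\<in>E - P. - x (snd p)))"
    by (rule expand[OF fE])
  finally have "B ^ (2 * card S) * (\<Prod>(s, t)\<in>E. x s - x t) =
      (\<Sum>P\<in>Pow E. B ^ (2 * card S) * ((\<Prod>p\<in>P. x (fst p)) * (\<Prod>p\<in>E - P. - x (snd p))))"
    by (simp add: sum_distrib_left)
  also have "integral_over \<int> \<dots>"
  proof (rule algints_sum)
    fix P assume P: "P \<in> Pow E"
    define e where "e s = card {p\<in>P. fst p = s} + card {p\<in>E - P. snd p = s}" for s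
    have "card {p\<in>P. fst p = s} \<le> card S" for s
      using P E S by (intro card_inj_on_le[where f = snd]) (auto simp: inj_on_def)
    moreover have "card {p\<in>E - P. snd p = s} \<le> card S" for s
      using P E S by (intro card_inj_on_le[where f = fst]) (auto simp: inj_on_def)
    ultimately have e: "e s \<le> 2 * card S" for s
      unfolding e_def mult_2 by (intro add_mono)
    have 1: "(\<Prod>p\<in>P. x (fst p)) = (\<Prod>s\<in>S. x s ^ card {p\<in>P. fst p = s})"
      using P E by (intro powers) auto
    have 2: "(\<Prod>p\<in>E - P. x (snd p)) = (\<Prod>s\<in>S. x s ^ card {p\<in>E - P. snd p = s})"
      using P E by (intro powers) auto
    have "(\<Prod>p\<in>P. x (fst p)) * (\<Prod>p\<in>E - P. - x (snd p)) =
        (- 1) ^ card (E - P) * (\<Prod>s\<in>S. x s ^ e s)"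
      unfolding prod_uminus 1 2 by (simp add: e_def power_add prod.distrib)
    hence "B ^ (2 * card S) * ((\<Prod>p\<in>P. x (fst p)) * (\<Prod>p\<in>E - P. - x (snd p))) =
        (- 1) ^ card (E - P) * (B ^ (2 * card S) * (\<Prod>s\<in>S. x s ^ e s))"
      by (simp add: ac_simps)
    also have "integral_over \<int> \<dots>"
      by (intro algints_mult algints_power algints_uminus algints_1 monomial_integral S B e)
    finally show "integral_over \<int> (B ^ (2 * card S) * ((\<Prod>p\<in>P. x (fst p)) * (\<Prod>p\<in>E - P. - x (snd p))))" .
  qed
  finally show ?thesis .
qed


section \<open>Denominators and heights along an orbit\<close>

lemma log_plus_power: "x > 0 \<Longrightarrow> log_plus (x ^ m) = real m * log_plus x"
  by (cases "ln x \<ge> 0") (auto simp: log_plus_def ln_realpow max_def mult_le_0_iff zero_le_mult_iff)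

lemma log_plus_nonneg: "log_plus x \<ge> 0"
  by (simp add: log_plus_def)

lemma log_plus_inverse: "x > 0 \<Longrightarrow> ln x + log_plus (inverse x) = log_plus x"
  by (simp add: log_plus_def ln_inverse max_def)

lemma abs_ln_eq: "x > 0 \<Longrightarrow> \<bar>ln x\<bar> = 2 * log_plus x - ln x"
  by (simp add: log_plus_def max_def)

lemma log_plus_prod_le:
  assumes "finite J" "\<And>j. j \<in> J \<Longrightarrow> x j > 0"
  shows "log_plus (\<Prod>j\<in>J. x j) \<le> (\<Sum>j\<in>J. log_plus (x j))"
proof -
  have "ln (\<Prod>j\<in>J. x j) = (\<Sum>j\<in>J. ln (x j))" by (rule ln_prod) (metis assms less_irrefl)+
  also have "\<dots> \<le> (\<Sum>j\<in>J. log_plus (x j))" by (intro sum_mono) (simp add: log_plus_def)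
  finally show ?thesis
    unfolding log_plus_def[of "prod x J"] using sum_nonneg[of J "\<lambda>j. log_plus (x j)"] log_plus_nonneg by auto
qed

lemma integral_rational_nonzero_ge_1:
  assumes "integral_over \<int> z" "z \<in> \<rat>" "z \<noteq> 0"
  shows "cmod z \<ge> 1"
proof -
  obtain m where "z = of_int m" using integral_rational_imp_Ints[OF assms(1,2)] by (auto elim: Ints_cases)
  thus ?thesis using assms(3) by simp
qed

context
  fixes \<xi> :: "complex ^ 'n"
  assumes \<xi>: "torus_point \<xi>"
begin

abbreviation (input) "orb \<equiv> galois_orbit \<xi>"

text \<open>The polynomial is a power of the minimal polynomial of the coordinate. The last equation is the
  Mahler measure formula for the height, summed over the orbit.\<close>

lemma coordinate_polynomial:
  obtains C :: int and f where "C > 0"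
    "complex_poly f = smult (of_int C) (\<Prod>\<alpha>\<in>orb. [:- (\<alpha> $ j), 1:])"
    "ln (real_of_int C) + (\<Sum>\<alpha>\<in>orb. log_plus (cmod (\<alpha> $ j))) = real (card orb) * weil_height (\<xi> $ j)"
proof -
  let ?m = "int_minpoly (\<xi> $ j)"
  have alg: "algebraic (\<xi> $ j)" using \<xi> by (simp add: torus_point_def)
  obtain e where e: "e > 0" "card orb = e * alg_degree (\<xi> $ j)"
    "\<And>y. y \<in> conjugates (\<xi> $ j) \<Longrightarrow> card {\<alpha>\<in>orb. \<alpha> $ j = y} = e"
    using equivariant_fibres[OF \<xi> equivariant_coordinate] by metis
  have fin: "finite orb" "finite (conjugates (\<xi> $ j))"
    using finite_galois_orbit[OF \<xi>] finite_conjugates[OF alg] by auto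
  have img: "(\<lambda>\<alpha>. \<alpha> $ j) ` orb \<subseteq> conjugates (\<xi> $ j)"
    using equivariant_image[OF \<xi> equivariant_coordinate] by simp
  have "(\<Prod>\<alpha>\<in>orb. [:- (\<alpha> $ j), 1:]) = (\<Prod>y\<in>conjugates (\<xi> $ j). \<Prod>\<alpha>\<in>{\<alpha>\<in>orb. \<alpha> $ j = y}. [:- (\<alpha> $ j), 1:])"
    by (rule prod.group[OF fin img, symmetric])
  also have "\<dots> = (\<Prod>y\<in>conjugates (\<xi> $ j). [:- y, 1:] ^ e)"
  proof (rule prod.cong)
    fix y assume y: "y \<in> conjugates (\<xi> $ j)"
    have "(\<Prod>\<alpha>\<in>{\<alpha>\<in>orb. \<alpha> $ j = y}. [:- (\<alpha> $ j), 1:]) = (\<Prod>\<alpha>\<in>{\<alpha>\<in>orb. \<alpha> $ j = y}. [:- y, 1:])"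
      by (intro prod.cong) auto
    thus "(\<Prod>\<alpha>\<in>{\<alpha>\<in>orb. \<alpha> $ j = y}. [:- (\<alpha> $ j), 1:]) = [:- y, 1:] ^ e" using e(3)[OF y] by simp
  qed simp
  finally have P: "(\<Prod>\<alpha>\<in>orb. [:- (\<alpha> $ j), 1:]) = (\<Prod>y\<in>conjugates (\<xi> $ j). [:- y, 1:]) ^ e"
    by (simp add: prod_power_distrib)
  have "(\<Sum>\<alpha>\<in>orb. log_plus (cmod (\<alpha> $ j))) = (\<Sum>y\<in>conjugates (\<xi> $ j). \<Sum>\<alpha>\<in>{\<alpha>\<in>orb. \<alpha> $ j = y}. log_plus (cmod (\<alpha> $ j)))"
    by (rule sum.group[OF fin img, symmetric])
  also have "\<dots> = (\<Sum>y\<in>conjugates (\<xi> $ j). real e * log_plus (cmod y))"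
    using e(3) by (intro sum.cong) auto
  finally have L: "(\<Sum>\<alpha>\<in>orb. log_plus (cmod (\<alpha> $ j))) = real e * (\<Sum>y\<in>conjugates (\<xi> $ j). log_plus (cmod y))"
    by (simp add: sum_distrib_left)
  have lc: "lead_coeff ?m > 0" by (rule lead_coeff_int_minpoly_pos[OF alg])
  show ?thesis
  proof
    show "lead_coeff ?m ^ e > 0" using lc by simp
    show "complex_poly (?m ^ e) = smult (of_int (lead_coeff ?m ^ e)) (\<Prod>\<alpha>\<in>orb. [:- (\<alpha> $ j), 1:])"
      unfolding complex_poly_power P by (subst int_minpoly_decompose[OF alg]) (simp add: smult_power)
    show "ln (real_of_int (lead_coeff ?m ^ e)) + (\<Sum>\<alpha>\<in>orb. log_plus (cmod (\<alpha> $ j))) =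
        real (card orb) * weil_height (\<xi> $ j)"
      using weil_height_conjugates[OF alg] lc
      by (simp add: L e(2) ln_realpow mult.assoc distrib_left)
  qed
qed

lemma weil_height_nonneg: "weil_height (\<xi> $ j) \<ge> 0"
proof -
  obtain C :: int and f where C: "C > 0"
    "ln (real_of_int C) + (\<Sum>\<alpha>\<in>orb. log_plus (cmod (\<alpha> $ j))) = real (card orb) * weil_height (\<xi> $ j)"
    using coordinate_polynomial by metis
  have "ln (real_of_int C) \<ge> 0" using C(1) by simp
  hence "real (card orb) * weil_height (\<xi> $ j) \<ge> 0"
    using C(2) sum_nonneg[of orb "\<lambda>\<alpha>. log_plus (cmod (\<alpha> $ j))"] log_plus_nonneg by (metis add_nonneg_nonneg)
  thus ?thesis using card_galois_orbit_pos[OF \<xi>] by (simp add: zero_le_mult_iff)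
qed

lemma orbit_coord_nz: "\<alpha> \<in> orb \<Longrightarrow> \<alpha> $ j \<noteq> 0"
  using torus_point_orbit[OF \<xi>] by (simp add: torus_point_def)

text \<open>Denominators of the powers of a coordinate. For negative exponents the constant coefficient
  takes the place of the leading one.\<close>

lemma coordinate_power_denominator:
  obtains A where "A \<in> \<rat>" "A \<noteq> 0"
    "\<And>T. T \<subseteq> orb \<Longrightarrow> integral_over \<int> (A * (\<Prod>\<alpha>\<in>T. (\<alpha> $ j) powi k))"
    "ln (cmod A) + (\<Sum>\<alpha>\<in>orb. log_plus (cmod ((\<alpha> $ j) powi k))) =
       real_of_int \<bar>k\<bar> * (real (card orb) * weil_height (\<xi> $ j))"
    "(\<Sum>\<alpha>\<in>orb. \<bar>ln (cmod ((\<alpha> $ j) powi k))\<bar>) \<le> 2 * (real_of_int \<bar>k\<bar> * (real (card orb) * weil_height (\<xi> $ j)))"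
proof -
  obtain C :: int and f where C: "C > 0"
    "complex_poly f = smult (of_int C) (\<Prod>\<alpha>\<in>orb. [:- (\<alpha> $ j), 1:])"
    "ln (real_of_int C) + (\<Sum>\<alpha>\<in>orb. log_plus (cmod (\<alpha> $ j))) = real (card orb) * weil_height (\<xi> $ j)"
    by (rule coordinate_polynomial)
  have fin: "finite orb" by (rule finite_galois_orbit[OF \<xi>])
  have nz: "\<alpha> $ j \<noteq> 0" if "\<alpha> \<in> orb" for \<alpha> by (rule orbit_coord_nz[OF that])
  define m where "m = nat \<bar>k\<bar>"
  have coeff_int: "integral_over \<int> (coeff (smult (of_int C) (\<Prod>\<alpha>\<in>orb. [:- (\<alpha> $ j), 1:])) i)" for i
    unfolding C(2)[symmetric] by (auto intro: integral_over_base[OF is_subring_Ints])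
  have sub: "integral_over \<int> (of_int C * (\<Prod>\<alpha>\<in>T. \<alpha> $ j))" if "T \<subseteq> orb" for T
    by (rule subproduct_integral[OF fin that coeff_int])
  \<comment> \<open>Up to sign the constant coefficient of \<open>f\<close>, which clears denominators of products of inverses.\<close>
  define D where "D = of_int C * (\<Prod>\<alpha>\<in>orb. \<alpha> $ j)"
  have D0: "D \<noteq> 0" using C(1) nz fin by (auto simp: D_def)
  have "of_int (coeff f 0) = coeff (smult (of_int C) (\<Prod>\<alpha>\<in>orb. [:- (\<alpha> $ j), 1:])) 0"
    using C(2) by (metis coeff_complex_poly)
  also have "\<dots> = (- 1) ^ card orb * D"
    by (simp add: D_def poly_0_coeff_0[symmetric] poly_prod prod_uminus ac_simps)
  finally have Dc: "(- 1) ^ card orb * D = of_int (coeff f 0)" ..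
  have "D = (- 1) ^ card orb * ((- 1) ^ card orb * D)" by (simp flip: mult.assoc power_mult_distrib)
  hence DR: "D \<in> \<rat>" unfolding Dc by (metis Rats_mult Rats_of_int Rats_power Rats_1 Rats_minus_iff)
  have D1: "cmod D \<ge> 1"
    by (rule integral_rational_nonzero_ge_1[OF _ DR D0]) (simp add: D_def sub)
  have lnD: "ln (cmod D) = ln (real_of_int C) + (\<Sum>\<alpha>\<in>orb. ln (cmod (\<alpha> $ j)))"
    using C(1) nz fin by (simp add: D_def norm_mult prod_norm[symmetric] ln_mult ln_prod prod_pos)
  have abs_sum: "(\<Sum>\<alpha>\<in>orb. \<bar>ln (cmod (\<alpha> $ j))\<bar>) \<le> 2 * (real (card orb) * weil_height (\<xi> $ j))"
  proof -
    have "(\<Sum>\<alpha>\<in>orb. \<bar>ln (cmod (\<alpha> $ j))\<bar>) = (\<Sum>\<alpha>\<in>orb. 2 * log_plus (cmod (\<alpha> $ j)) - ln (cmod (\<alpha> $ j)))"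
      using nz by (intro sum.cong abs_ln_eq) auto
    also have "\<dots> = 2 * (\<Sum>\<alpha>\<in>orb. log_plus (cmod (\<alpha> $ j))) - (\<Sum>\<alpha>\<in>orb. ln (cmod (\<alpha> $ j)))"
      by (simp add: sum_subtractf sum_distrib_left)
    also have "\<dots> \<le> 2 * (\<Sum>\<alpha>\<in>orb. log_plus (cmod (\<alpha> $ j))) + ln (real_of_int C)"
      using lnD ln_ge_zero[OF D1] by simp
    also have "\<dots> \<le> 2 * (real (card orb) * weil_height (\<xi> $ j))"
    proof -
      have "ln (real_of_int C) \<ge> 0" using C(1) by simp
      thus ?thesis using C(3) by linarith
    qed
    finally show ?thesis .
  qed
  have abs_pow: "\<bar>ln (cmod (z powi k))\<bar> = real_of_int \<bar>k\<bar> * \<bar>ln (cmod z)\<bar>" if "z \<noteq> 0" for z :: complex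
    using that by (auto simp: power_int_def norm_power norm_inverse ln_realpow ln_inverse abs_mult)
  have abs_sum_k: "(\<Sum>\<alpha>\<in>orb. \<bar>ln (cmod ((\<alpha> $ j) powi k))\<bar>) \<le> 2 * (real_of_int \<bar>k\<bar> * (real (card orb) * weil_height (\<xi> $ j)))"
  proof -
    have "(\<Sum>\<alpha>\<in>orb. \<bar>ln (cmod ((\<alpha> $ j) powi k))\<bar>) = real_of_int \<bar>k\<bar> * (\<Sum>\<alpha>\<in>orb. \<bar>ln (cmod (\<alpha> $ j))\<bar>)"
      using nz by (simp add: abs_pow sum_distrib_left)
    also have "\<dots> \<le> real_of_int \<bar>k\<bar> * (2 * (real (card orb) * weil_height (\<xi> $ j)))"
      by (intro mult_left_mono abs_sum) auto
    finally show ?thesis by simp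
  qed
  show ?thesis
  proof (cases "k \<ge> 0")
    case True
    hence k: "z powi k = z ^ m" for z :: complex by (simp add: power_int_def m_def)
    have km: "\<bar>real_of_int k\<bar> = real m" by (simp add: m_def)
    show ?thesis
    proof (rule that[of "of_int C ^ m"])
      show "integral_over \<int> (of_int C ^ m * (\<Prod>\<alpha>\<in>T. (\<alpha> $ j) powi k))" if "T \<subseteq> orb" for T
        using algints_power[OF sub[OF that], of m] by (simp add: k prod_power_distrib power_mult_distrib)
      have "(\<Sum>\<alpha>\<in>orb. log_plus (cmod ((\<alpha> $ j) powi k))) = real m * (\<Sum>\<alpha>\<in>orb. log_plus (cmod (\<alpha> $ j)))"
        using nz by (simp add: k norm_power log_plus_power sum_distrib_left)
      thus "ln (cmod (of_int C ^ m)) + (\<Sum>\<alpha>\<in>orb. log_plus (cmod ((\<alpha> $ j) powi k))) =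
          real_of_int \<bar>k\<bar> * (real (card orb) * weil_height (\<xi> $ j))"
        using C(1) by (simp add: km norm_power ln_realpow C(3)[symmetric] distrib_left)
    qed (use C(1) abs_sum_k in auto)
  next
    case False
    hence k: "z powi k = inverse z ^ m" for z :: complex by (simp add: power_int_def m_def)
    have km: "\<bar>real_of_int k\<bar> = real m" by (simp add: m_def)
    show ?thesis
    proof (rule that[of "D ^ m"])
      show "integral_over \<int> (D ^ m * (\<Prod>\<alpha>\<in>T. (\<alpha> $ j) powi k))" if "T \<subseteq> orb" for T
      proof -
        have "(\<Prod>\<alpha>\<in>orb. \<alpha> $ j) = (\<Prod>\<alpha>\<in>orb - T. \<alpha> $ j) * (\<Prod>\<alpha>\<in>T. \<alpha> $ j)"
          by (rule prod.subset_diff[OF that fin])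
        moreover have "(\<Prod>\<alpha>\<in>T. \<alpha> $ j) * (\<Prod>\<alpha>\<in>T. inverse (\<alpha> $ j)) = 1"
          using nz that by (simp add: prod.distrib[symmetric] subset_iff)
        ultimately have "D * (\<Prod>\<alpha>\<in>T. inverse (\<alpha> $ j)) = of_int C * (\<Prod>\<alpha>\<in>orb - T. \<alpha> $ j)"
          by (simp add: D_def mult.assoc)
        hence "integral_over \<int> (D * (\<Prod>\<alpha>\<in>T. inverse (\<alpha> $ j)))" using sub[of "orb - T"] by simp
        from algints_power[OF this, of m] show ?thesis
          by (simp add: k prod_power_distrib power_mult_distrib)
      qed
      have "(\<Sum>\<alpha>\<in>orb. log_plus (cmod ((\<alpha> $ j) powi k))) = real m * (\<Sum>\<alpha>\<in>orb. log_plus (inverse (cmod (\<alpha> $ j))))"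
        using nz unfolding k norm_power norm_inverse sum_distrib_left
        by (intro sum.cong refl log_plus_power) auto
      hence "ln (cmod (D ^ m)) + (\<Sum>\<alpha>\<in>orb. log_plus (cmod ((\<alpha> $ j) powi k))) =
          real m * (ln (real_of_int C) + (\<Sum>\<alpha>\<in>orb. ln (cmod (\<alpha> $ j)) + log_plus (inverse (cmod (\<alpha> $ j)))))"
        using D0 by (simp add: norm_power ln_realpow lnD sum.distrib distrib_left)
      also have "(\<Sum>\<alpha>\<in>orb. ln (cmod (\<alpha> $ j)) + log_plus (inverse (cmod (\<alpha> $ j)))) = (\<Sum>\<alpha>\<in>orb. log_plus (cmod (\<alpha> $ j)))"
        using nz by (intro sum.cong log_plus_inverse) auto
      finally show "ln (cmod (D ^ m)) + (\<Sum>\<alpha>\<in>orb. log_plus (cmod ((\<alpha> $ j) powi k))) =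
          real_of_int \<bar>k\<bar> * (real (card orb) * weil_height (\<xi> $ j))"
        by (simp add: C(3) km)
    qed (use D0 DR abs_sum_k in auto)
  qed
qed

definition weighted_height :: "int ^ 'n \<Rightarrow> real" where
  "weighted_height n = (\<Sum>j\<in>UNIV. real_of_int \<bar>n $ j\<bar> * weil_height (\<xi> $ j))"

text \<open>The product of the denominators of the powers of the coordinates. The second bound controls the
  distance of the orbit from the unit polycircle: the moduli of the conjugates can deviate from \<open>1\<close>
  on average by at most twice the height.\<close>

lemma character_denominator:
  obtains B where "B \<in> \<rat>" "B \<noteq> 0"
    "\<And>T. T \<subseteq> orb \<Longrightarrow> integral_over \<int> (B * (\<Prod>\<alpha>\<in>T. monomial_char n \<alpha>))"
    "ln (cmod B) + (\<Sum>\<alpha>\<in>orb. log_plus (cmod (monomial_char n \<alpha>))) \<le> real (card orb) * weighted_height n"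
    "(\<Sum>\<alpha>\<in>orb. \<bar>ln (cmod (monomial_char n \<alpha>))\<bar>) \<le> 2 * (real (card orb) * weighted_height n)"
proof -
  let ?P = "\<lambda>j A. A \<in> \<rat> \<and> A \<noteq> 0 \<and>
    (\<forall>T. T \<subseteq> orb \<longrightarrow> integral_over \<int> (A * (\<Prod>\<alpha>\<in>T. (\<alpha> $ j) powi (n $ j)))) \<and>
    ln (cmod A) + (\<Sum>\<alpha>\<in>orb. log_plus (cmod ((\<alpha> $ j) powi (n $ j)))) =
       real_of_int \<bar>n $ j\<bar> * (real (card orb) * weil_height (\<xi> $ j)) \<and>
    (\<Sum>\<alpha>\<in>orb. \<bar>ln (cmod ((\<alpha> $ j) powi (n $ j)))\<bar>) \<le> 2 * (real_of_int \<bar>n $ j\<bar> * (real (card orb) * weil_height (\<xi> $ j)))"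
  have "\<exists>A. ?P j A" for j by (rule coordinate_power_denominator[of j "n $ j"]) blast
  then obtain A where A: "\<And>j. ?P j (A j)" by metis
  define B where "B = (\<Prod>j\<in>UNIV. A j)"
  have nz: "\<alpha> $ j \<noteq> 0" if "\<alpha> \<in> orb" for \<alpha> :: "complex ^ 'n" and j by (rule orbit_coord_nz[OF that])
  have W: "(\<Sum>j\<in>UNIV. real_of_int \<bar>n $ j\<bar> * (real (card orb) * weil_height (\<xi> $ j))) = real (card orb) * weighted_height n"
    by (simp add: weighted_height_def sum_distrib_left ac_simps)
  have chi: "cmod (monomial_char n \<alpha>) = (\<Prod>j\<in>UNIV. cmod ((\<alpha> $ j) powi (n $ j)))" for \<alpha>
    by (simp add: monomial_char_def prod_norm)
  have pos: "cmod ((\<alpha> $ j) powi (n $ j)) > 0" if "\<alpha> \<in> orb" for \<alpha> j using nz[OF that] by simp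
  show ?thesis
  proof (rule that[of B])
    show "B \<in> \<rat>" unfolding B_def using is_subring_prod[OF is_subring_Rats, of UNIV A] A by blast
    show "B \<noteq> 0" unfolding B_def using A by simp
    show "integral_over \<int> (B * (\<Prod>\<alpha>\<in>T. monomial_char n \<alpha>))" if "T \<subseteq> orb" for T
    proof -
      have "B * (\<Prod>\<alpha>\<in>T. monomial_char n \<alpha>) = (\<Prod>j\<in>UNIV. A j * (\<Prod>\<alpha>\<in>T. (\<alpha> $ j) powi (n $ j)))"
        unfolding monomial_char_def B_def by (subst prod.swap) (simp add: prod.distrib)
      thus ?thesis using A that by (simp add: algints_prod)
    qed
    have "ln (cmod B) = (\<Sum>j\<in>UNIV. ln (cmod (A j)))"
      unfolding B_def prod_norm[symmetric] by (rule ln_prod) (use A in auto)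
    moreover have "(\<Sum>\<alpha>\<in>orb. log_plus (cmod (monomial_char n \<alpha>))) \<le>
        (\<Sum>\<alpha>\<in>orb. \<Sum>j\<in>UNIV. log_plus (cmod ((\<alpha> $ j) powi (n $ j))))"
      unfolding chi using pos by (intro sum_mono log_plus_prod_le) auto
    ultimately have "ln (cmod B) + (\<Sum>\<alpha>\<in>orb. log_plus (cmod (monomial_char n \<alpha>))) \<le>
        (\<Sum>j\<in>UNIV. ln (cmod (A j)) + (\<Sum>\<alpha>\<in>orb. log_plus (cmod ((\<alpha> $ j) powi (n $ j)))))"
      by (subst (asm) sum.swap) (simp add: sum.distrib)
    also have "\<dots> = real (card orb) * weighted_height n"
      unfolding W[symmetric] by (intro sum.cong) (use A in auto)
    finally show "ln (cmod B) + (\<Sum>\<alpha>\<in>orb. log_plus (cmod (monomial_char n \<alpha>))) \<le> real (card orb) * weighted_height n" .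
    have "(\<Sum>\<alpha>\<in>orb. \<bar>ln (cmod (monomial_char n \<alpha>))\<bar>) \<le> (\<Sum>\<alpha>\<in>orb. \<Sum>j\<in>UNIV. \<bar>ln (cmod ((\<alpha> $ j) powi (n $ j)))\<bar>)"
    proof (rule sum_mono)
      fix \<alpha> assume "\<alpha> \<in> orb"
      hence "ln (cmod (monomial_char n \<alpha>)) = (\<Sum>j\<in>UNIV. ln (cmod ((\<alpha> $ j) powi (n $ j))))"
        unfolding chi by (intro ln_prod) (use pos in auto)
      thus "\<bar>ln (cmod (monomial_char n \<alpha>))\<bar> \<le> (\<Sum>j\<in>UNIV. \<bar>ln (cmod ((\<alpha> $ j) powi (n $ j)))\<bar>)" by simp
    qed
    also have "\<dots> = (\<Sum>j\<in>UNIV. \<Sum>\<alpha>\<in>orb. \<bar>ln (cmod ((\<alpha> $ j) powi (n $ j)))\<bar>)" by (rule sum.swap)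
    also have "\<dots> \<le> (\<Sum>j\<in>UNIV. 2 * (real_of_int \<bar>n $ j\<bar> * (real (card orb) * weil_height (\<xi> $ j))))"
      by (intro sum_mono) (use A in blast)
    also have "\<dots> = 2 * (real (card orb) * weighted_height n)" unfolding W[symmetric] by (simp add: sum_distrib_left)
    finally show "(\<Sum>\<alpha>\<in>orb. \<bar>ln (cmod (monomial_char n \<alpha>))\<bar>) \<le> 2 * (real (card orb) * weighted_height n)" .
  qed
qed

text \<open>The discriminant argument. The product over all ordered pairs of distinct values is permuted by
  the Galois group, hence rational; multiplied by \<open>B\<close> to the power \<open>2 * card orb\<close> it becomes
  integral. A nonzero rational integer has absolute value at least \<open>1\<close>.\<close>

lemma sum_ln_difference_bound:
  assumes B: "B \<in> \<rat>" "B \<noteq> 0"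
    "\<And>T. T \<subseteq> orb \<Longrightarrow> integral_over \<int> (B * (\<Prod>\<alpha>\<in>T. monomial_char n \<alpha>))"
  defines "E \<equiv> {(\<alpha>, \<beta>) \<in> orb \<times> orb. monomial_char n \<alpha> \<noteq> monomial_char n \<beta>}"
  shows "(\<Sum>(\<alpha>, \<beta>)\<in>E. - ln (cmod (monomial_char n \<alpha> - monomial_char n \<beta>))) \<le>
           2 * real (card orb) * ln (cmod B)"
proof -
  let ?x = "\<lambda>\<alpha>. monomial_char n \<alpha>"
  have fin: "finite orb" by (rule finite_galois_orbit[OF \<xi>])
  have ES: "E \<subseteq> orb \<times> orb" by (auto simp: E_def)
  have fE: "finite E" using ES fin finite_subset by blast
  define \<Delta> where "\<Delta> = (\<Prod>(\<alpha>, \<beta>)\<in>E. ?x \<alpha> - ?x \<beta>)"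
  define Z where "Z = B ^ (2 * card orb) * \<Delta>"
  have x_alg: "algebraic (?x \<alpha>)" if "\<alpha> \<in> orb" for \<alpha>
    using equivariant_monomial[of n] torus_point_orbit[OF \<xi> that] by (simp add: equivariant_def)
  have "integral_over \<int> Z" unfolding Z_def \<Delta>_def
    by (rule difference_product_integral[OF fin B(3) ES])
  have "algebraic \<Delta>"
    unfolding \<Delta>_def using is_subring_prod[OF is_subring_Qbar, of E "\<lambda>(\<alpha>, \<beta>). ?x \<alpha> - ?x \<beta>"] x_alg ES
    by (auto simp: subset_iff intro: algebraic_arith)
  moreover have "\<sigma> \<Delta> = \<Delta>" if \<sigma>: "\<sigma> \<in> gal_Qbar" for \<sigma>
  proof -
    have eq: "?x (gal_act \<sigma> \<alpha>) = \<sigma> (?x \<alpha>)" if "\<alpha> \<in> orb" for \<alpha>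
      using equivariant_monomial[of n] torus_point_orbit[OF \<xi> that] \<sigma> by (simp add: equivariant_def)
    have b: "bij_betw (gal_act \<sigma>) orb orb" by (rule gal_act_bij[OF \<xi> \<sigma>])
    have "\<sigma> \<Delta> = (\<Prod>(\<alpha>, \<beta>)\<in>E. ?x (gal_act \<sigma> \<alpha>) - ?x (gal_act \<sigma> \<beta>))"
      unfolding \<Delta>_def
      by (subst gal_prod[OF \<sigma>])
        (use ES x_alg in \<open>auto simp: subset_iff eq gal_diff[OF \<sigma>] intro!: algebraic_arith prod.cong\<close>)
    also have "\<dots> = \<Delta>"
      unfolding \<Delta>_def
    proof (rule prod.reindex_bij_betw[of "map_prod (gal_act \<sigma>) (gal_act \<sigma>)" E E "\<lambda>(\<alpha>, \<beta>). ?x \<alpha> - ?x \<beta>", unfolded case_prod_map_prod, THEN trans[rotated], OF _ refl, symmetric, THEN sym])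
      have inj: "inj_on (map_prod (gal_act \<sigma>) (gal_act \<sigma>)) E"
        using b ES by (auto simp: inj_on_def bij_betw_def subset_iff)
      have "map_prod (gal_act \<sigma>) (gal_act \<sigma>) ` E \<subseteq> E"
        using bij_betwE[OF b] by (auto simp: E_def eq gal_inj[OF \<sigma>] x_alg)
      thus "bij_betw (map_prod (gal_act \<sigma>) (gal_act \<sigma>)) E E"
        using endo_inj_surj[OF fE] inj by (simp add: bij_betw_def)
    qed
    finally show ?thesis .
  qed
  ultimately have "\<Delta> \<in> \<rat>" by (rule rational_if_gal_fixed)
  hence "Z \<in> \<rat>" using B(1) by (auto simp: Z_def)
  have \<Delta>0: "\<Delta> \<noteq> 0" using fE by (auto simp: \<Delta>_def E_def)
  hence "Z \<noteq> 0" using B(2) by (simp add: Z_def)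
  have "cmod Z \<ge> 1"
    by (rule integral_rational_nonzero_ge_1) fact+
  hence "0 \<le> ln (cmod Z)" by simp
  also have "\<dots> = 2 * real (card orb) * ln (cmod B) + ln (cmod \<Delta>)"
    using B(2) \<Delta>0 by (simp add: Z_def norm_mult norm_power ln_mult ln_realpow)
  also have "ln (cmod \<Delta>) = (\<Sum>p\<in>E. ln (cmod (case p of (\<alpha>, \<beta>) \<Rightarrow> ?x \<alpha> - ?x \<beta>)))"
    unfolding \<Delta>_def prod_norm[symmetric] by (rule ln_prod) (use fE in \<open>auto simp: E_def\<close>)
  finally show ?thesis by (simp add: case_prod_beta sum_negf)
qed

end


section \<open>Energy on the cylinder\<close>

text \<open>Positive semidefiniteness of the kernel \<open>min\<close> on nonnegative reals, strengthened for
  induction: adding a point below all others completes a square.\<close>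

lemma min_kernel_lower_bound:
  fixes a c :: "'i \<Rightarrow> real"
  assumes "finite A" "\<And>i. i \<in> A \<Longrightarrow> m \<le> a i"
  shows "m * (\<Sum>i\<in>A. c i)\<^sup>2 \<le> (\<Sum>i\<in>A. \<Sum>k\<in>A. c i * c k * min (a i) (a k))"
  using assms
proof (induction arbitrary: m rule: finite_ranking_induct[where f = "\<lambda>i. - a i"])
  case (insert x S)
  show ?case
  proof (cases "x \<in> S")
    case False
    define \<Sigma> where "\<Sigma> = (\<Sum>i\<in>S. c i)"
    have mn: "min (a i) (a x) = a x" "min (a x) (a i) = a x" if "i \<in> S" for i
      using insert(2)[OF that] by auto
    have "(\<Sum>i\<in>insert x S. \<Sum>k\<in>insert x S. c i * c k * min (a i) (a k)) =
        c x * c x * a x + (\<Sum>k\<in>S. c x * c k * min (a x) (a k)) + (\<Sum>i\<in>S. c i * c x * min (a i) (a x))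
        + (\<Sum>i\<in>S. \<Sum>k\<in>S. c i * c k * min (a i) (a k))"
      using insert(1) False by (simp add: sum.distrib)
    also have "(\<Sum>k\<in>S. c x * c k * min (a x) (a k)) = c x * a x * \<Sigma>"
      unfolding \<Sigma>_def sum_distrib_left by (intro sum.cong) (simp_all add: mn)
    also have "(\<Sum>i\<in>S. c i * c x * min (a i) (a x)) = c x * a x * \<Sigma>"
      unfolding \<Sigma>_def sum_distrib_left by (intro sum.cong) (simp_all add: mn)
    finally have eq: "(\<Sum>i\<in>insert x S. \<Sum>k\<in>insert x S. c i * c k * min (a i) (a k)) =
        c x * c x * a x + 2 * (c x * a x * \<Sigma>) + (\<Sum>i\<in>S. \<Sum>k\<in>S. c i * c k * min (a i) (a k))" by simp
    have "a x * \<Sigma>\<^sup>2 \<le> (\<Sum>i\<in>S. \<Sum>k\<in>S. c i * c k * min (a i) (a k))"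
      unfolding \<Sigma>_def using insert(2) by (intro insert(3)) auto
    hence "a x * (c x + \<Sigma>)\<^sup>2 \<le> (\<Sum>i\<in>insert x S. \<Sum>k\<in>insert x S. c i * c k * min (a i) (a k))"
      unfolding eq by (simp add: power2_eq_square algebra_simps)
    moreover have "m * (c x + \<Sigma>)\<^sup>2 \<le> a x * (c x + \<Sigma>)\<^sup>2"
      using insert(4) by (intro mult_right_mono) auto
    ultimately show ?thesis using insert(1) False by (simp add: \<Sigma>_def)
  qed (use insert in \<open>simp add: insert_absorb\<close>)
qed simp

text \<open>With \<open>u = exp (2 * \<kappa> * s)\<close>, the exponential kernel is the kernel \<open>min\<close> in \<open>u\<close> up to a factor of
  rank one.\<close>

lemma exp_kernel_nonneg:
  fixes s c :: "'i \<Rightarrow> real"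
  assumes "finite A" "\<kappa> \<ge> 0"
  shows "0 \<le> (\<Sum>i\<in>A. \<Sum>k\<in>A. c i * c k * exp (- \<kappa> * \<bar>s i - s k\<bar>))"
proof -
  have "exp (- \<kappa> * \<bar>x - y\<bar>) = exp (- \<kappa> * x) * exp (- \<kappa> * y) * min (exp (2 * \<kappa> * x)) (exp (2 * \<kappa> * y))"
    for x y :: real
    using assms(2) mult_left_mono[of x y \<kappa>] mult_left_mono[of y x \<kappa>]
    by (cases "x \<le> y") (auto simp: min_def abs_if algebra_simps simp flip: exp_add)
  hence "(\<Sum>i\<in>A. \<Sum>k\<in>A. c i * c k * exp (- \<kappa> * \<bar>s i - s k\<bar>)) =
      (\<Sum>i\<in>A. \<Sum>k\<in>A. (c i * exp (- \<kappa> * s i)) * (c k * exp (- \<kappa> * s k)) *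
         min (exp (2 * \<kappa> * s i)) (exp (2 * \<kappa> * s k)))"
    by (simp only: ac_simps)
  also have "\<dots> \<ge> 0 * (\<Sum>i\<in>A. c i * exp (- \<kappa> * s i))\<^sup>2"
    by (rule min_kernel_lower_bound[OF assms(1)]) simp
  finally show ?thesis by simp
qed

text \<open>For a point with logarithmic modulus \<open>s\<close> and direction \<open>z\<close>, and another one with \<open>s'\<close> and
  \<open>z'\<close>, this is \<open>exp (- \<bar>s - s'\<bar>) * z * cnj z'\<close>, the ratio of the two points,
  or the conjugate of its inverse, whichever lies in the unit disc. Its powers are positive
  definite kernels on the cylinder, and \<open>- ln \<bar>1 - cyl x y\<bar>\<close> differs from \<open>- ln \<bar>x - y\<bar>\<close> only by
  a term depending on the moduli.\<close>

definition cyl :: "complex \<Rightarrow> complex \<Rightarrow> complex" where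
  "cyl x y = of_real (exp (- \<bar>ln (cmod x) - ln (cmod y)\<bar>)) * (sgn x * cnj (sgn y))"

lemma norm_cyl_le: "cmod (cyl x y) \<le> 1"
  by (simp add: cyl_def norm_mult norm_sgn)

lemma norm_one_minus_cyl:
  assumes "x \<noteq> 0" "y \<noteq> 0"
  shows "cmod (1 - cyl x y) = cmod (x - y) / max (cmod x) (cmod y)"
proof -
  have gen: "cmod (1 - of_real (cmod v / cmod u) * (sgn u * cnj (sgn v))) = cmod (u - v) / cmod u"
    if "u \<noteq> 0" "v \<noteq> 0" for u v
  proof -
    have "of_real (cmod v / cmod u) * (sgn u * cnj (sgn v)) = u * cnj v / (of_real (cmod u))\<^sup>2"
      using that by (simp add: sgn_div_norm scaleR_conv_of_real field_simps power2_eq_square)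
    also have "1 - \<dots> = u * (cnj u - cnj v) / (of_real (cmod u))\<^sup>2"
      using that complex_norm_square[of u] by (simp add: field_simps)
    also have "cmod \<dots> = cmod (u - v) / cmod u"
      using that by (simp add: norm_mult norm_divide norm_power power2_eq_square flip: complex_cnj_diff)
    finally show ?thesis .
  qed
  show ?thesis
  proof (cases "cmod y \<le> cmod x")
    case True
    have "exp (- \<bar>ln (cmod x) - ln (cmod y)\<bar>) = cmod y / cmod x"
      using True assms by (simp add: abs_if exp_diff)
    thus ?thesis using gen[of x y] True assms by (simp add: cyl_def max_def)
  next
    case False
    have "exp (- \<bar>ln (cmod x) - ln (cmod y)\<bar>) = cmod x / cmod y"
      using False assms by (simp add: abs_if exp_diff)
    hence "cnj (cyl x y) = of_real (cmod x / cmod y) * (sgn y * cnj (sgn x))"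
      by (simp add: cyl_def ac_simps)
    moreover have "cmod (1 - cyl x y) = cmod (1 - cnj (cyl x y))"
      by (metis complex_cnj_diff complex_cnj_one complex_mod_cnj)
    ultimately show ?thesis using gen[of y x] False assms
      by (simp add: max_def norm_minus_commute)
  qed
qed

text \<open>The damping factor \<open>r\<close> makes the energy of a point with itself finite; off the diagonal it costs
  only \<open>- ln r / 2\<close>.\<close>

lemma damped_log_le:
  assumes "cmod u \<le> 1" "u \<noteq> 1" "0 < r" "r < 1"
  shows "- ln (cmod (1 - of_real r * u)) \<le> ln (1 / r) / 2 - ln (cmod (1 - u))"
proof -
  have "(cmod (1 - of_real r * u))\<^sup>2 - r * (cmod (1 - u))\<^sup>2 = (1 - r) * (1 - r * (cmod u)\<^sup>2)"
    unfolding cmod_power2 by (simp add: power2_eq_square algebra_simps)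
  also have "\<dots> \<ge> 0"
    using assms by (intro mult_nonneg_nonneg) (auto simp: mult_le_one power_le_one)
  finally have le: "r * (cmod (1 - u))\<^sup>2 \<le> (cmod (1 - of_real r * u))\<^sup>2" by simp
  have pos: "0 < r * (cmod (1 - u))\<^sup>2" using assms by simp
  hence "(cmod (1 - of_real r * u))\<^sup>2 > 0" using le by linarith
  hence nz: "cmod (1 - of_real r * u) > 0" by simp
  have "ln (r * (cmod (1 - u))\<^sup>2) \<le> ln ((cmod (1 - of_real r * u))\<^sup>2)"
    using le pos order_less_le_trans[OF pos le] by simp
  also have "\<dots> = 2 * ln (cmod (1 - of_real r * u))" using nz by (simp add: ln_realpow)
  finally show ?thesis using assms by (simp add: ln_mult ln_realpow ln_div)
qed

lemma cyl_log_sums: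
  assumes "0 < r" "r < 1"
  shows "(\<lambda>n. Re ((of_real r * cyl x y) ^ n) / real n) sums (- ln (cmod (1 - of_real r * cyl x y)))"
proof -
  let ?w = "of_real r * cyl x y"
  have "cmod ?w \<le> r" using norm_cyl_le[of x y] assms by (simp add: norm_mult mult_left_le)
  hence w: "cmod (- ?w) < 1" using assms by simp
  have nz: "1 - ?w \<noteq> 0" using w by auto
  have "(\<lambda>n. - ((- (- ?w)) ^ n) / of_nat n) sums ln (1 + - ?w)"
    using Ln_series'[OF w] by simp
  from sums_minus[OF sums_Re[OF this]] show ?thesis
    using nz by (simp add: Re_Ln)
qed

text \<open>Expanding the logarithm into a power series, every term is a nonnegative quadratic form in the
  real and imaginary parts of the directions. Only the term of degree one is kept.\<close>

lemma damped_energy_lower_bound: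
  assumes S: "finite S" and r: "0 < r" "r < 1"
  shows "r * (\<Sum>i\<in>S. \<Sum>k\<in>S. Re (cyl (x i) (x k))) \<le>
    (\<Sum>i\<in>S. \<Sum>k\<in>S. - ln (cmod (1 - of_real r * cyl (x i) (x k))))"
proof -
  define f where "f n = (\<Sum>i\<in>S. \<Sum>k\<in>S. Re ((of_real r * cyl (x i) (x k)) ^ n) / real n)" for n
  have sums: "f sums (\<Sum>i\<in>S. \<Sum>k\<in>S. - ln (cmod (1 - of_real r * cyl (x i) (x k))))"
    unfolding f_def by (intro sums_sum cyl_log_sums r)
  have nonneg: "f n \<ge> 0" for n
  proof -
    define s where "s i = ln (cmod (x i))" for i
    define c where "c i = Re (sgn (x i) ^ n)" for i
    define c' where "c' i = Im (sgn (x i) ^ n)" for i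
    have "Re ((of_real r * cyl (x i) (x k)) ^ n) =
        r ^ n * (c i * c k * exp (- real n * \<bar>s i - s k\<bar>) + c' i * c' k * exp (- real n * \<bar>s i - s k\<bar>))" for i k
    proof -
      have eq: "(of_real r * cyl (x i) (x k)) ^ n =
        of_real (r ^ n * exp (- real n * \<bar>s i - s k\<bar>)) * (sgn (x i) ^ n * cnj (sgn (x k) ^ n))"
      proof -
        have "exp (- real n * \<bar>s i - s k\<bar>) = exp (- \<bar>s i - s k\<bar>) ^ n"
          using exp_of_nat_mult[of n "- \<bar>s i - s k\<bar>"] by simp
        thus ?thesis by (simp add: cyl_def power_mult_distrib s_def)
      qed
      show ?thesis unfolding eq by (simp add: c_def c'_def algebra_simps del: complex_cnj_power)
    qed
    hence "f n = r ^ n / real n * ((\<Sum>i\<in>S. \<Sum>k\<in>S. c i * c k * exp (- real n * \<bar>s i - s k\<bar>)) +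
        (\<Sum>i\<in>S. \<Sum>k\<in>S. c' i * c' k * exp (- real n * \<bar>s i - s k\<bar>)))"
      unfolding f_def by (simp add: sum.distrib sum_distrib_left distrib_left add_divide_distrib)
    also have "\<dots> \<ge> 0"
      using r exp_kernel_nonneg[OF S, of "real n"] by (intro mult_nonneg_nonneg add_nonneg_nonneg) auto
    finally show ?thesis .
  qed
  have "f 1 \<le> (\<Sum>i\<in>S. \<Sum>k\<in>S. - ln (cmod (1 - of_real r * cyl (x i) (x k))))"
    using sum_le_suminf[OF sums_summable[OF sums], of "{1}"] nonneg sums_unique[OF sums] by simp
  thus ?thesis by (simp add: f_def sum_distrib_left)
qed

text \<open>The quantitative equidistribution estimate of Erdos-Turan type for the directions
  \<open>sgn (x i)\<close>, by a comparison of energies. The energy of the damped kernel is at least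
  \<open>r\<close> times the sum of all \<open>Re (cyl (x i) (x k))\<close>. From above, the pairs with distinct values contribute
  the logarithmic discriminant, at most \<open>2 * M * b\<close>, and the logarithmic moduli,
  while the coincident pairs contribute \<open>- ln (1 - r)\<close> each, and by the bound on the
  fibres there are at most \<open>M\<^sup>2 / d\<close> of them. Replacing \<open>cyl x y\<close> by \<open>sgn x * cnj (sgn y)\<close> costs the average size of the logarithmic moduli.\<close>

lemma phase_sum_bound:
  fixes x :: "'i \<Rightarrow> complex" and d :: nat
  assumes S: "finite S" and x: "\<And>i. i \<in> S \<Longrightarrow> x i \<noteq> 0" and d: "d \<ge> 1"
    and fibres: "\<And>i. i \<in> S \<Longrightarrow> real d * real (card {k\<in>S. x k = x i}) \<le> M"
    and M: "M = real (card S)"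
    and disc: "(\<Sum>(i, k)\<in>{(i, k) \<in> S \<times> S. x i \<noteq> x k}. - ln (cmod (x i - x k))) \<le> 2 * M * b"
    and ht: "b + (\<Sum>i\<in>S. log_plus (cmod (x i))) \<le> M * H"
    and abs: "(\<Sum>i\<in>S. \<bar>ln (cmod (x i))\<bar>) \<le> 2 * (M * H)"
  shows "(cmod (\<Sum>i\<in>S. sgn (x i)))\<^sup>2 \<le> M\<^sup>2 * (8 * H + 4 * ln (2 * real d) / real d)"
proof -
  \<comment> \<open>This choice balances the diagonal term against the loss off the diagonal.\<close>
  define r where "r = 1 - 1 / (2 * real d)"
  have r: "1 / 2 \<le> r" "r < 1" "0 < r" using d by (auto simp: r_def field_simps)
  define E where "E = {(i, k) \<in> S \<times> S. x i \<noteq> x k}"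
  define F where "F = {(i, k) \<in> S \<times> S. x i = x k}"
  have SS: "S \<times> S = E \<union> F" "E \<inter> F = {}" by (auto simp: E_def F_def)
  have fin: "finite E" "finite F" 
    by (rule finite_subset[of _ "S \<times> S"]; use S in \<open>auto simp: E_def F_def\<close>)+
  have M0: "M \<ge> 0" by (simp add: M)
  define lp where "lp i = log_plus (cmod (x i))" for i
  define T where "T = (\<Sum>i\<in>S. \<Sum>k\<in>S. - ln (cmod (1 - of_real r * cyl (x i) (x k))))"
  have l0: "ln (1 / r) \<ge> 0" using r by simp
  have "T = (\<Sum>(i, k)\<in>S \<times> S. - ln (cmod (1 - of_real r * cyl (x i) (x k))))"
    unfolding T_def by (rule sum.cartesian_product)
  also have "\<dots> = (\<Sum>(i, k)\<in>E. - ln (cmod (1 - of_real r * cyl (x i) (x k)))) +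
      (\<Sum>(i, k)\<in>F. - ln (cmod (1 - of_real r * cyl (x i) (x k))))"
    unfolding SS(1) by (rule sum.union_disjoint[OF fin SS(2)])
  also have "(\<Sum>(i, k)\<in>E. - ln (cmod (1 - of_real r * cyl (x i) (x k)))) \<le>
      (\<Sum>(i, k)\<in>E. ln (1 / r) / 2 + (lp i + lp k) + - ln (cmod (x i - x k)))"
  proof (rule sum_mono, clarify)
    fix i k assume "(i, k) \<in> E"
    hence ik: "x i \<noteq> 0" "x k \<noteq> 0" "x i \<noteq> x k" using x by (auto simp: E_def)
    have "cmod (1 - cyl (x i) (x k)) \<noteq> 0" unfolding norm_one_minus_cyl[OF ik(1,2)] using ik by (simp add: max_def)
    hence "- ln (cmod (1 - of_real r * cyl (x i) (x k))) \<le> ln (1 / r) / 2 - ln (cmod (1 - cyl (x i) (x k)))"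
      by (intro damped_log_le norm_cyl_le r) auto
    also have "ln (cmod (1 - cyl (x i) (x k))) = ln (cmod (x i - x k)) - ln (max (cmod (x i)) (cmod (x k)))"
    proof -
      have "max (cmod (x i)) (cmod (x k)) > 0" "cmod (x i - x k) > 0" using ik by (auto simp: less_max_iff_disj)
      thus ?thesis unfolding norm_one_minus_cyl[OF ik(1,2)] by (simp add: ln_div)
    qed
    finally show "- ln (cmod (1 - of_real r * cyl (x i) (x k))) \<le>
        ln (1 / r) / 2 + (lp i + lp k) + - ln (cmod (x i - x k))"
      by (auto simp: lp_def log_plus_def max_def split: if_splits)
  qed
  also have "\<dots> = real (card E) * (ln (1 / r) / 2) + (\<Sum>(i, k)\<in>E. lp i + lp k) + (\<Sum>(i, k)\<in>E. - ln (cmod (x i - x k)))"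
    by (simp add: case_prod_beta sum.distrib sum_subtractf sum_negf)
  also have "real (card E) \<le> M\<^sup>2"
  proof -
    have "card E \<le> card (S \<times> S)" using S by (intro card_mono) (auto simp: E_def)
    hence "real (card E) \<le> real (card (S \<times> S))" by (rule of_nat_mono)
    thus ?thesis by (simp add: M card_cartesian_product power2_eq_square)
  qed
  also have "(\<Sum>(i, k)\<in>E. lp i + lp k) \<le> (\<Sum>(i, k)\<in>S \<times> S. lp i + lp k)"
    using S by (intro sum_mono2) (auto simp: E_def lp_def log_plus_nonneg)
  also have "\<dots> = 2 * M * (\<Sum>i\<in>S. lp i)"
    by (simp add: sum.cartesian_product[symmetric] sum.distrib M sum_distrib_left[symmetric])
  also have "(\<Sum>(i, k)\<in>E. - ln (cmod (x i - x k))) \<le> 2 * M * b" using disc by (simp add: E_def)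
  also have "(\<Sum>(i, k)\<in>F. - ln (cmod (1 - of_real r * cyl (x i) (x k)))) = real (card F) * - ln (1 - r)"
  proof -
    have "- ln (cmod (1 - of_real r * cyl (x i) (x k))) = - ln (1 - r)" if "(i, k) \<in> F" for i k
    proof -
      have ik: "x i \<noteq> 0" "x k = x i" using that x by (auto simp: F_def)
      have "cyl (x i) (x k) = 1" using norm_one_minus_cyl[of "x i" "x k"] ik by simp
      moreover have "cmod (1 - of_real r) = 1 - r" using r by (metis abs_of_pos diff_gt_0_iff_gt norm_of_real of_real_1 of_real_diff)
      ultimately show ?thesis by simp
    qed
    thus ?thesis by (simp add: case_prod_beta)
  qed
  finally have T1: "T \<le> M\<^sup>2 * (ln (1 / r) / 2) + 2 * M * (\<Sum>i\<in>S. lp i) + 2 * M * b + real (card F) * - ln (1 - r)"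
    using l0 by (simp add: mult_right_mono)
  have "F = (SIGMA i:S. {k\<in>S. x k = x i})" by (auto simp: F_def)
  hence "real d * real (card F) = (\<Sum>i\<in>S. real d * real (card {k\<in>S. x k = x i}))"
    using S by (simp add: card_SigmaI sum_distrib_left)
  also have "\<dots> \<le> (\<Sum>i\<in>S. M)" by (intro sum_mono fibres)
  also have "\<dots> = M\<^sup>2" by (simp add: M power2_eq_square)
  finally have cF: "real (card F) \<le> M\<^sup>2 / real d" using d by (simp add: field_simps)
  have lnr: "- ln (1 - r) = ln (2 * real d)" using d by (simp add: r_def ln_div)
  have "real (card F) * - ln (1 - r) \<le> M\<^sup>2 / real d * ln (2 * real d)"
    unfolding lnr using d by (intro mult_right_mono cF) auto
  moreover have "2 * M * (\<Sum>i\<in>S. lp i) + 2 * M * b \<le> 2 * M\<^sup>2 * H"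
  proof -
    have "2 * M * (b + (\<Sum>i\<in>S. lp i)) \<le> 2 * M * (M * H)"
      using ht M0 by (intro mult_left_mono) (auto simp: lp_def)
    thus ?thesis by (simp add: algebra_simps power2_eq_square)
  qed
  moreover have "M\<^sup>2 * (ln (1 / r) / 2) \<le> M\<^sup>2 / real d * ln (2 * real d)"
  proof -
    have "ln (1 / r) \<le> 1 / r - 1" using r by (intro ln_le_minus_one) auto
    also have "\<dots> = 1 / (2 * real d - 1)" using d by (simp add: r_def field_simps)
    also have "\<dots> \<le> 1 / real d" using d by (intro divide_left_mono) auto
    finally have "ln (1 / r) / 2 \<le> (1 / 2) / real d" by simp
    also have "(1 / 2 :: real) \<le> ln 2" using ln2_ge_two_thirds by simp
    also have "ln (2 :: real) \<le> ln (2 * real d)" using d by simp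
    finally have "ln (1 / r) / 2 \<le> ln (2 * real d) / real d" using d by (simp add: divide_right_mono)
    from mult_left_mono[OF this, of "M\<^sup>2"] show ?thesis by simp
  qed
  ultimately have T2: "T \<le> 2 * M\<^sup>2 * H + 2 * (M\<^sup>2 / real d * ln (2 * real d))" using T1 by linarith
  have "(cmod (\<Sum>i\<in>S. sgn (x i)))\<^sup>2 = (\<Sum>i\<in>S. \<Sum>k\<in>S. Re (sgn (x i) * cnj (sgn (x k))))"
  proof -
    have "of_real ((cmod (\<Sum>i\<in>S. sgn (x i)))\<^sup>2) = (\<Sum>i\<in>S. sgn (x i)) * cnj (\<Sum>i\<in>S. sgn (x i))"
      by (rule complex_norm_square)
    also have "\<dots> = (\<Sum>i\<in>S. \<Sum>k\<in>S. sgn (x i) * cnj (sgn (x k)))"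
      by (simp add: sum_product)
    finally have "Re (of_real ((cmod (\<Sum>i\<in>S. sgn (x i)))\<^sup>2)) = Re (\<Sum>i\<in>S. \<Sum>k\<in>S. sgn (x i) * cnj (sgn (x k)))"
      by (rule arg_cong)
    thus ?thesis by simp
  qed
  also have "\<dots> \<le> (\<Sum>i\<in>S. \<Sum>k\<in>S. Re (cyl (x i) (x k)) + (\<bar>ln (cmod (x i))\<bar> + \<bar>ln (cmod (x k))\<bar>))"
  proof (intro sum_mono)
    fix i k
    define t where "t = \<bar>ln (cmod (x i)) - ln (cmod (x k))\<bar>"
    define c where "c = Re (sgn (x i) * cnj (sgn (x k)))"
    have e: "Re (cyl (x i) (x k)) = exp (- t) * c" by (simp add: cyl_def t_def c_def)
    have "c \<le> 1" unfolding c_def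
      by (rule order_trans[OF complex_Re_le_cmod]) (simp add: norm_mult norm_sgn)
    hence "(1 - exp (- t)) * c \<le> (1 - exp (- t)) * 1" by (intro mult_left_mono) (auto simp: t_def)
    hence "c - exp (- t) * c \<le> 1 - exp (- t)" by (simp add: left_diff_distrib)
    moreover have "1 - exp (- t) \<le> t" using exp_ge_add_one_self[of "- t"] by simp
    moreover have "t \<le> \<bar>ln (cmod (x i))\<bar> + \<bar>ln (cmod (x k))\<bar>" unfolding t_def by linarith
    ultimately show "Re (sgn (x i) * cnj (sgn (x k))) \<le> Re (cyl (x i) (x k)) + (\<bar>ln (cmod (x i))\<bar> + \<bar>ln (cmod (x k))\<bar>)"
      unfolding e c_def[symmetric] by linarith
  qed
  also have "\<dots> = (\<Sum>i\<in>S. \<Sum>k\<in>S. Re (cyl (x i) (x k))) + 2 * M * (\<Sum>i\<in>S. \<bar>ln (cmod (x i))\<bar>)"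
    by (simp add: sum.distrib M sum_distrib_left[symmetric])
  also have "(\<Sum>i\<in>S. \<Sum>k\<in>S. Re (cyl (x i) (x k))) \<le> 2 * (2 * M\<^sup>2 * H + 2 * (M\<^sup>2 / real d * ln (2 * real d)))"
  proof -
    have B0: "0 \<le> 2 * M\<^sup>2 * H + 2 * (M\<^sup>2 / real d * ln (2 * real d))"
    proof -
      have "0 \<le> 2 * (M * H)" using abs by (rule order_trans[rotated]) (simp add: sum_nonneg)
      hence "0 \<le> M * H" by (simp add: mult.commute)
      hence "0 \<le> M * (M * H)" by (rule mult_nonneg_nonneg[OF M0])
      hence "0 \<le> 2 * M\<^sup>2 * H" by (simp add: power2_eq_square mult.assoc)
      moreover have "0 \<le> ln (2 * real d)" using d by simp
      hence "0 \<le> 2 * (M\<^sup>2 / real d * ln (2 * real d))" by simp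
      ultimately show ?thesis by linarith
    qed
    have "(\<Sum>i\<in>S. \<Sum>k\<in>S. Re (cyl (x i) (x k))) \<le> T / r"
      using damped_energy_lower_bound[OF S r(3,2), of x] r by (simp add: T_def field_simps)
    also have "\<dots> \<le> (2 * M\<^sup>2 * H + 2 * (M\<^sup>2 / real d * ln (2 * real d))) / r"
      using T2 r by (intro divide_right_mono) auto
    also have "\<dots> \<le> (2 * M\<^sup>2 * H + 2 * (M\<^sup>2 / real d * ln (2 * real d))) / (1 / 2)"
      using B0 r by (intro divide_left_mono) auto
    finally show ?thesis by simp
  qed
  also have "2 * M * (\<Sum>i\<in>S. \<bar>ln (cmod (x i))\<bar>) \<le> 2 * M * (2 * (M * H))"
    using abs M0 by (intro mult_left_mono) auto
  finally show ?thesis by (simp add: algebra_simps power2_eq_square)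
qed


section \<open>Averages of characters over an orbit\<close>

lemma ln_div_antimono:
  assumes "1 \<le> (D::nat)" "D \<le> m"
  shows "ln (2 * real m) / real m \<le> ln (2 * real D) / real D"
  using assms(2)
proof (induction rule: dec_induct)
  case (step m)
  have m1: "m \<ge> 1" using step assms by simp
  have "real m * ln (1 + 1 / real m) \<le> ln (2 * real m)"
  proof (cases "m = 1")
    case False
    hence m: "m \<ge> 2" using m1 by simp
    have "ln (1 + 1 / real m) \<le> 1 / real m" using m by (intro ln_add_one_self_le_self) auto
    hence "real m * ln (1 + 1 / real m) \<le> real m * (1 / real m)" by (intro mult_left_mono) auto
    also have "\<dots> = 1" using m by simp
    also have "1 \<le> 2 * ln (2::real)" using ln2_ge_two_thirds by simp
    also have "\<dots> = ln (2 * 2 :: real)" by (subst ln_mult) auto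
    also have "\<dots> \<le> ln (2 * real m)" using m by (subst ln_le_cancel_iff) auto
    finally show ?thesis .
  qed simp
  moreover have "ln (2 * real (Suc m)) = ln (2 * real m) + ln (1 + 1 / real m)"
  proof -
    have "2 * real (Suc m) = (2 * real m) * (1 + 1 / real m)" using m1 by (simp add: field_simps)
    thus ?thesis using m1 by (simp only:) (subst ln_mult_pos, auto intro: add_pos_nonneg)
  qed
  ultimately have "real m * ln (2 * real (Suc m)) \<le> real (Suc m) * ln (2 * real m)"
    by (simp add: algebra_simps)
  hence "ln (2 * real (Suc m)) / real (Suc m) \<le> ln (2 * real m) / real m"
    using m1 by (simp add: field_simps)
  thus ?case using step.IH by linarith
qed simp

lemma l1_norm_pos:
  assumes "(n :: int ^ 'n) \<noteq> 0"
  shows "l1_norm n \<ge> 1"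
proof -
  obtain j where "n $ j \<noteq> 0" using assms by (auto simp: vec_eq_iff)
  hence "1 \<le> \<bar>n $ j\<bar>" by simp
  also have "\<dots> \<le> l1_norm n" unfolding l1_norm_def by (rule member_le_sum) auto
  finally show ?thesis .
qed

context
  fixes \<xi> :: "complex ^ 'n"
  assumes \<xi>: "torus_point \<xi>"
begin

lemma monomial_algebraic: "algebraic (monomial_char n \<xi>)"
  using equivariant_monomial[of n] \<xi> by (simp add: equivariant_def)

lemma gen_degree_le: "n \<noteq> 0 \<Longrightarrow> gen_degree \<xi> \<le> nat (l1_norm n) * alg_degree (monomial_char n \<xi>)"
  unfolding gen_degree_def by (intro cINF_lower) auto

lemma gen_degree_pos: "gen_degree \<xi> \<ge> 1"
proof -
  have "axis undefined 1 \<in> - {0 :: int ^ 'n}" by (simp add: axis_eq_0_iff)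
  hence "(\<lambda>n. nat (l1_norm n) * alg_degree (monomial_char n \<xi>)) ` (- {0}) \<noteq> {}" by blast
  from Inf_nat_def1[OF this] obtain n where n: "n \<noteq> 0"
    "gen_degree \<xi> = nat (l1_norm n) * alg_degree (monomial_char n \<xi>)"
    unfolding gen_degree_def by auto
  thus ?thesis using l1_norm_pos[OF n(1)] alg_degree_pos[OF monomial_algebraic, of n] by simp
qed

lemma height_nonneg: "height \<xi> \<ge> 0"
  unfolding height_def by (intro sum_nonneg weil_height_nonneg[OF \<xi>])

lemma height_D_pos: "height_D \<xi> > 0"
proof -
  have "ln (2 * real (gen_degree \<xi>)) > 0" using gen_degree_pos by simp
  thus ?thesis using gen_degree_pos height_nonneg by (auto simp: height_D_def intro!: add_nonneg_pos)
qed

lemma weighted_height_le: "weighted_height \<xi> n \<le> real_of_int (l1_norm n) * height \<xi>"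
proof -
  have "real_of_int \<bar>n $ j\<bar> \<le> real_of_int (l1_norm n)" for j
    unfolding l1_norm_def of_int_le_iff by (rule member_le_sum) auto
  thus ?thesis
    unfolding weighted_height_def[OF \<xi>] height_def sum_distrib_left
    by (intro sum_mono mult_right_mono weil_height_nonneg[OF \<xi>])
qed

text \<open>The energy estimate applied to the values of a character along the orbit.\<close>

lemma character_average_squared:
  shows "(cmod (\<Sum>\<alpha>\<in>galois_orbit \<xi>. sgn (monomial_char n \<alpha>)))\<^sup>2 \<le> (real (card (galois_orbit \<xi>)))\<^sup>2 *
    (8 * weighted_height \<xi> n + 4 * ln (2 * real (alg_degree (monomial_char n \<xi>))) / real (alg_degree (monomial_char n \<xi>)))"
proof -
  obtain B where B: "B \<in> \<rat>" "B \<noteq> 0"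
    "\<And>T. T \<subseteq> galois_orbit \<xi> \<Longrightarrow> integral_over \<int> (B * (\<Prod>\<alpha>\<in>T. monomial_char n \<alpha>))"
    "ln (cmod B) + (\<Sum>\<alpha>\<in>galois_orbit \<xi>. log_plus (cmod (monomial_char n \<alpha>))) \<le> real (card (galois_orbit \<xi>)) * weighted_height \<xi> n"
    "(\<Sum>\<alpha>\<in>galois_orbit \<xi>. \<bar>ln (cmod (monomial_char n \<alpha>))\<bar>) \<le> 2 * (real (card (galois_orbit \<xi>)) * weighted_height \<xi> n)"
    by (rule character_denominator[OF \<xi>, of n]) blast
  obtain e where e: "e > 0" "card (galois_orbit \<xi>) = e * alg_degree (monomial_char n \<xi>)"
    "\<And>y. y \<in> conjugates (monomial_char n \<xi>) \<Longrightarrow> card {\<alpha>\<in>galois_orbit \<xi>. monomial_char n \<alpha> = y} = e"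
    by (rule equivariant_fibres[OF \<xi> equivariant_monomial[of n]]) blast
  show ?thesis
  proof (rule phase_sum_bound[OF finite_galois_orbit[OF \<xi>], where b = "ln (cmod B)"])
    show "monomial_char n \<alpha> \<noteq> 0" if "\<alpha> \<in> galois_orbit \<xi>" for \<alpha>
      using orbit_coord_nz[OF \<xi> that] by (simp add: monomial_char_def)
    show "real (alg_degree (monomial_char n \<xi>)) * real (card {\<beta> \<in> galois_orbit \<xi>. monomial_char n \<beta> = monomial_char n \<alpha>})
      \<le> real (card (galois_orbit \<xi>))" if "\<alpha> \<in> galois_orbit \<xi>" for \<alpha>
    proof -
      have "monomial_char n \<alpha> \<in> conjugates (monomial_char n \<xi>)"
        using equivariant_image[OF \<xi> equivariant_monomial[of n]] that by blast
      from e(3)[OF this] show ?thesis using e(2) by simp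
    qed
    show "1 \<le> alg_degree (monomial_char n \<xi>)" using alg_degree_pos[OF monomial_algebraic, of n] by simp
  qed (use B sum_ln_difference_bound[OF \<xi> B(1-3)] in simp_all)
qed

text \<open>If \<open>d\<close> is the degree of the character value and \<open>k\<close> the norm of \<open>n\<close>, then \<open>ln (2 * d) / d\<close> is at
  most \<open>k\<close> times its value at the generalized degree \<open>D \<le> k * d\<close>, because
  \<open>ln (2 * D) / D\<close> decreases. This gives the bound for the exponent one half. Since the average is
  also at most \<open>1\<close>, the bound holds for all smaller exponents.\<close>

lemma character_average_bound:
  assumes n: "n \<noteq> 0" and \<gamma>: "0 < \<gamma>" "\<gamma> \<le> 1 / 2"
  shows "cmod ((\<Sum>\<alpha>\<in>galois_orbit \<xi>. sgn (monomial_char n \<alpha>)) / of_nat (card (galois_orbit \<xi>))) \<le>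
    (24 * real_of_int (l1_norm n) * height_D \<xi>) powr \<gamma>"
proof -
  define M where "M = real (card (galois_orbit \<xi>))"
  define d where "d = alg_degree (monomial_char n \<xi>)"
  define k where "k = nat (l1_norm n)"
  define X where "X = 24 * real_of_int (l1_norm n) * height_D \<xi>"
  define a where "a = cmod ((\<Sum>\<alpha>\<in>galois_orbit \<xi>. sgn (monomial_char n \<alpha>)) / of_nat (card (galois_orbit \<xi>)))"
  have M: "M > 0" using card_galois_orbit_pos[OF \<xi>] by (simp add: M_def)
  have k: "k \<ge> 1" "real_of_int (l1_norm n) = real k" using l1_norm_pos[OF n] by (auto simp: k_def)
  have d: "d \<ge> 1" using alg_degree_pos[OF monomial_algebraic, of n] by (simp add: d_def)
  have aM: "a = cmod (\<Sum>\<alpha>\<in>galois_orbit \<xi>. sgn (monomial_char n \<alpha>)) / M"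
    by (simp add: a_def M_def norm_divide)
  have a0: "a \<ge> 0" by (simp add: a_def)
  have "cmod (\<Sum>\<alpha>\<in>galois_orbit \<xi>. sgn (monomial_char n \<alpha>)) \<le> (\<Sum>\<alpha>\<in>galois_orbit \<xi>. 1)"
    by (rule sum_norm_le) (simp add: norm_sgn)
  hence a1: "a \<le> 1" using M unfolding aM by (simp add: M_def)
  have "a\<^sup>2 \<le> 8 * weighted_height \<xi> n + 4 * (ln (2 * real d) / real d)"
    using character_average_squared[of n] M unfolding aM M_def[symmetric] d_def[symmetric]
    by (simp add: power_divide field_simps)
  also have "weighted_height \<xi> n \<le> real k * height \<xi>" using weighted_height_le[of n] k by simp
  also have "ln (2 * real d) / real d \<le> real k * (ln (2 * real (gen_degree \<xi>)) / real (gen_degree \<xi>))"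
  proof -
    have "ln (2 * real d) \<le> ln (2 * real (k * d))"
      using k(1) d by (subst ln_le_cancel_iff) auto
    hence "ln (2 * real d) / real d \<le> ln (2 * real (k * d)) / real d"
      by (intro divide_right_mono) auto
    also have "\<dots> = real k * (ln (2 * real (k * d)) / real (k * d))" using k(1) d by simp
    also have "\<dots> \<le> real k * (ln (2 * real (gen_degree \<xi>)) / real (gen_degree \<xi>))"
      using gen_degree_le[OF n] gen_degree_pos
      by (intro mult_left_mono ln_div_antimono) (auto simp: k_def d_def)
    finally show ?thesis .
  qed
  finally have "a\<^sup>2 \<le> 8 * (real k * height \<xi>) + 4 * (real k * (ln (2 * real (gen_degree \<xi>)) / real (gen_degree \<xi>)))"
    by simp
  also have "\<dots> \<le> X"
  proof -
    have "X = 24 * (real k * height \<xi>) + 8 * (real k * (ln (2 * real (gen_degree \<xi>)) / real (gen_degree \<xi>)))"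
      by (simp add: X_def k(2) height_D_def algebra_simps)
    moreover have "0 \<le> real k * height \<xi>" using height_nonneg by simp
    moreover have "0 \<le> real k * (ln (2 * real (gen_degree \<xi>)) / real (gen_degree \<xi>))"
      using gen_degree_pos by simp
    moreover have "8 * Y + 4 * Z \<le> x" if "x = 24 * Y + 8 * Z" "0 \<le> Y" "0 \<le> Z" for x Y Z :: real
      using that by linarith
    ultimately show ?thesis by blast
  qed
  finally have a2: "a\<^sup>2 \<le> X" .
  have X: "X > 0" using height_D_pos k by (simp add: X_def)
  show ?thesis unfolding a_def[symmetric] X_def[symmetric]
  proof (cases "X \<le> 1")
    case True
    have "a = (a\<^sup>2) powr (1 / 2)" using a0 by (simp add: powr_half_sqrt)
    also have "\<dots> \<le> X powr (1 / 2)" using a2 by (intro powr_mono2) auto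
    also have "\<dots> \<le> X powr \<gamma>" using \<gamma> True X by (intro powr_mono') auto
    finally show "a \<le> X powr \<gamma>" .
  next
    case False
    hence "1 \<le> X powr \<gamma>" using \<gamma> by (intro ge_one_powr_ge_zero) auto
    thus "a \<le> X powr \<gamma>" using a1 by linarith
  qed
qed

text \<open>Together with the previous bound this covers a general wave: its value at a
  point of the orbit is a character value times a factor that is close to \<open>1\<close> when the
  logarithmic moduli are small.\<close>

lemma average_log_moduli:
  "(\<Sum>\<alpha>\<in>galois_orbit \<xi>. \<Sum>j\<in>UNIV. \<bar>log_moduli \<alpha> $ j\<bar>) \<le> 2 * real (card (galois_orbit \<xi>)) * height \<xi>"
proof -
  have "(\<Sum>\<alpha>\<in>galois_orbit \<xi>. \<bar>ln (cmod (\<alpha> $ j))\<bar>) \<le> 2 * (real (card (galois_orbit \<xi>)) * weil_height (\<xi> $ j))" for j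
    by (rule coordinate_power_denominator[OF \<xi>, of j 1]) simp
  hence "(\<Sum>j\<in>UNIV. \<Sum>\<alpha>\<in>galois_orbit \<xi>. \<bar>ln (cmod (\<alpha> $ j))\<bar>) \<le>
      (\<Sum>j\<in>UNIV. 2 * (real (card (galois_orbit \<xi>)) * weil_height (\<xi> $ j)))"
    by (intro sum_mono)
  thus ?thesis by (subst sum.swap) (simp add: log_moduli_def height_def sum_distrib_left mult.assoc)
qed

end


section \<open>Integrals of products\<close>

lemma pair_product_integral:
  fixes f :: "'a \<Rightarrow> 'c::{real_normed_field,banach,second_countable_topology}" and g :: "'b \<Rightarrow> 'c"
  assumes "sigma_finite_measure M" "sigma_finite_measure N"
    and f: "integrable M f" and g: "integrable N g"
  shows "integrable (M \<Otimes>\<^sub>M N) (\<lambda>x. f (fst x) * g (snd x))"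
    and "(\<integral>x. f (fst x) * g (snd x) \<partial>(M \<Otimes>\<^sub>M N)) = integral\<^sup>L M f * integral\<^sup>L N g"
proof -
  interpret pair_sigma_finite M N using assms by (simp add: pair_sigma_finite_def)
  have [measurable]: "f \<in> borel_measurable M" "g \<in> borel_measurable N"
    using f g by auto
  show int: "integrable (M \<Otimes>\<^sub>M N) (\<lambda>x. f (fst x) * g (snd x))"
    by (rule Fubini_integrable) (use f g in \<open>auto simp: norm_mult\<close>)
  show "(\<integral>x. f (fst x) * g (snd x) \<partial>(M \<Otimes>\<^sub>M N)) = integral\<^sup>L M f * integral\<^sup>L N g"
    using integral_fst[of "\<lambda>x y. f x * g y"] int by (simp add: case_prod_unfold)
qed

lemma vec_product_integral:
  fixes f :: "'n::finite \<Rightarrow> real \<Rightarrow> 'c::{real_normed_field,banach,second_countable_topology}"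
  assumes f: "\<And>j. integrable lborel (f j)"
  shows "integrable lborel (\<lambda>x :: real ^ 'n. \<Prod>j\<in>UNIV. f j (x $ j))"
    and "integral\<^sup>L lborel (\<lambda>x :: real ^ 'n. \<Prod>j\<in>UNIV. f j (x $ j)) = (\<Prod>j\<in>UNIV. integral\<^sup>L lborel (f j))"
proof -
  interpret product_sigma_finite "\<lambda>_ :: real ^ 'n. lborel :: real measure" by standard
  have [measurable]: "f j \<in> borel_measurable borel" for j using f[of j] by auto
  let ?T = "\<lambda>h. \<Sum>b\<in>(Basis :: (real ^ 'n) set). h b *\<^sub>R b"
  define ax where "ax = (\<lambda>j :: 'n. axis j (1 :: real))"
  have inj: "inj ax" by (auto simp: ax_def inj_def axis_eq_axis)
  have B: "Basis = range ax" by (auto simp: Basis_vec_def ax_def)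
  define g where "g b = f (inv ax b)" for b
  have comp: "?T h $ j = h (ax j)" for h j
  proof -
    have "?T h $ j = (\<Sum>i\<in>UNIV. h (ax i) * ax i $ j)"
      using inj by (simp add: B sum.reindex)
    also have "\<dots> = (\<Sum>i\<in>UNIV. if i = j then h (ax i) else 0)"
      by (intro sum.cong) (auto simp: ax_def axis_def)
    finally show ?thesis by simp
  qed
  have eq: "(\<Prod>j\<in>UNIV. f j (?T h $ j)) = (\<Prod>b\<in>Basis. g b (h b))" for h
  proof -
    have "(\<Prod>j\<in>UNIV. f j (?T h $ j)) = (\<Prod>j\<in>UNIV. f j (h (ax j)))" by (simp only: comp)
    also have "\<dots> = (\<Prod>b\<in>range ax. g b (h b))" using inj by (simp add: prod.reindex g_def)
    finally show ?thesis by (simp only: B)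
  qed
  have meas: "(\<lambda>x :: real ^ 'n. \<Prod>j\<in>UNIV. f j (x $ j)) \<in> borel_measurable borel" by measurable
  have meas': "?T \<in> measurable (Pi\<^sub>M Basis (\<lambda>_. lborel)) borel" by measurable
  have "integrable (Pi\<^sub>M Basis (\<lambda>_. lborel)) (\<lambda>h. \<Prod>b\<in>Basis. g b (h b))"
    by (intro product_integrable_prod) (auto simp: g_def f)
  thus "integrable lborel (\<lambda>x :: real ^ 'n. \<Prod>j\<in>UNIV. f j (x $ j))"
    by (subst lborel_eq, subst integrable_distr_eq[OF meas' meas]) (simp only: eq)
  have "integral\<^sup>L lborel (\<lambda>x :: real ^ 'n. \<Prod>j\<in>UNIV. f j (x $ j)) =
      (\<integral>h. (\<Prod>b\<in>Basis. g b (h b)) \<partial>(Pi\<^sub>M Basis (\<lambda>_. lborel)))"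
    by (subst lborel_eq, subst integral_distr[OF meas' meas]) (simp only: eq)
  also have "\<dots> = (\<Prod>b\<in>Basis. integral\<^sup>L lborel (g b))"
    by (intro product_integral_prod) (auto simp: g_def f)
  also have "\<dots> = (\<Prod>j\<in>UNIV. integral\<^sup>L lborel (f j))"
    unfolding B using inj by (simp add: prod.reindex g_def)
  finally show "integral\<^sup>L lborel (\<lambda>x :: real ^ 'n. \<Prod>j\<in>UNIV. f j (x $ j)) = (\<Prod>j\<in>UNIV. integral\<^sup>L lborel (f j))" .
qed

abbreviation cube :: "(real ^ 'n) set" where
  "cube \<equiv> {\<theta>. \<forall>j. 0 \<le> \<theta> $ j \<and> \<theta> $ j < 1}"

lemma cube_sets: "cube \<in> sets (lborel :: (real ^ 'n) measure)"
  by measurable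

lemma indicator_cube: "(indicator cube (\<theta> :: real ^ 'n) :: real) = (\<Prod>j\<in>UNIV. indicator {0..<1} (\<theta> $ j))"
proof (cases "\<theta> \<in> cube")
  case False
  then obtain j where "\<theta> $ j \<notin> {0..<1}" by auto
  hence "indicator {0..<1} (\<theta> $ j) = (0::real)" by (simp add: indicator_def)
  hence "(\<Prod>j\<in>UNIV. indicator {0..<1} (\<theta> $ j)) = (0::real)" by (intro prod_zero bexI[of _ j]) auto
  thus ?thesis using False by simp
qed (simp add: indicator_def)

lemma torus_product_integral:
  fixes f :: "'n::finite \<Rightarrow> real \<Rightarrow> 'c::{real_normed_field,banach,second_countable_topology}"
  assumes f: "\<And>j. integrable lborel (\<lambda>x. indicator {0..<1} x *\<^sub>R f j x)"
  shows "integrable torus (\<lambda>\<theta> :: real ^ 'n. \<Prod>j\<in>UNIV. f j (\<theta> $ j))"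
    and "integral\<^sup>L torus (\<lambda>\<theta> :: real ^ 'n. \<Prod>j\<in>UNIV. f j (\<theta> $ j)) =
           (\<Prod>j\<in>UNIV. \<integral>x. indicator {0..<1} x *\<^sub>R f j x \<partial>lborel)"
proof -
  have eq: "indicator cube \<theta> *\<^sub>R (\<Prod>j\<in>UNIV. f j (\<theta> $ j)) =
      (\<Prod>j\<in>UNIV. indicator {0..<1} (\<theta> $ j) *\<^sub>R f j (\<theta> $ j))" for \<theta> :: "real ^ 'n"
    unfolding indicator_cube scaleR_conv_of_real by (simp add: prod.distrib)
  have c: "cube \<inter> space lborel \<in> sets (lborel :: (real ^ 'n) measure)" using cube_sets by simp
  show "integrable torus (\<lambda>\<theta> :: real ^ 'n. \<Prod>j\<in>UNIV. f j (\<theta> $ j))"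
    unfolding torus_def integrable_restrict_space[OF c] eq by (rule vec_product_integral(1)[OF f])
  show "integral\<^sup>L torus (\<lambda>\<theta> :: real ^ 'n. \<Prod>j\<in>UNIV. f j (\<theta> $ j)) =
      (\<Prod>j\<in>UNIV. \<integral>x. indicator {0..<1} x *\<^sub>R f j x \<partial>lborel)"
    unfolding torus_def integral_restrict_space[OF c] eq by (rule vec_product_integral(2)[OF f])
qed

lemma finite_measure_torus: "finite_measure (torus :: (real ^ 'n) measure)"
proof
  have "emeasure (torus :: (real ^ 'n) measure) (space torus) = emeasure lborel (cube :: (real ^ 'n) set)"
    unfolding torus_def using cube_sets by (simp add: emeasure_restrict_space space_restrict_space)
  also have "\<dots> \<le> emeasure lborel (cbox 0 (\<chi> j. 1) :: (real ^ 'n) set)"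
    by (intro emeasure_mono) (auto simp: mem_box_cart less_imp_le)
  also have "\<dots> < \<infinity>" by (rule emeasure_bounded_finite[OF bounded_cbox])
  finally show "emeasure (torus :: (real ^ 'n) measure) (space torus) \<noteq> \<infinity>" by simp
qed

lemma sigma_finite_torus: "sigma_finite_measure (torus :: (real ^ 'n) measure)"
  using finite_measure_torus by (rule finite_measure.axioms(1))

lemma sigma_finite_phase: "sigma_finite_measure (phase_space :: ((real ^ 'n) \<times> (real ^ 'n)) measure)"
  by (intro sigma_finite_pair_measure sigma_finite_torus lborel.sigma_finite_measure_axioms)

lemma sigma_finite_count: "sigma_finite_measure (count_space (UNIV :: (int ^ 'n) set))"
  by (rule sigma_finite_measure_count_space_countable) auto

lemma sigma_finite_dual: "sigma_finite_measure (dual_space :: ((int ^ 'n) \<times> (real ^ 'n)) measure)"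
  by (intro sigma_finite_pair_measure sigma_finite_count lborel.sigma_finite_measure_axioms)

lemma measurable_torus_borel: "f \<in> borel_measurable borel \<Longrightarrow> f \<in> borel_measurable torus"
  unfolding torus_def by (intro measurable_restrict_space1) simp

lemma sets_torus_id: "(\<lambda>x. x) \<in> measurable torus borel"
  by (rule measurable_torus_borel) simp

section \<open>Waves\<close>

text \<open>The characters of the group \<open>T^N \<times> R^N\<close>, indexed by its dual.\<close>

definition wave :: "(int ^ 'n) \<times> (real ^ 'n) \<Rightarrow> (real ^ 'n) \<times> (real ^ 'n) \<Rightarrow> complex" where
  "wave \<xi> x = cis (2 * pi * ((\<Sum>j\<in>UNIV. real_of_int (fst \<xi> $ j) * (fst x $ j)) + snd \<xi> \<bullet> snd x))"

lemma norm_wave [simp]: "cmod (wave \<xi> x) = 1"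
  by (simp add: wave_def)

lemma wave_diff: "wave \<xi> (x - y) = wave \<xi> x * cnj (wave \<xi> y)"
  by (simp add: wave_def cis_cnj cis_mult right_diff_distrib sum_subtractf inner_diff_right algebra_simps)

lemma wave_0 [simp]: "wave \<xi> 0 = 1"
  by (simp add: wave_def)

lemma cis_sum: "cis (sum f A) = (\<Prod>a\<in>A. cis (f a))"
  by (induction A rule: infinite_finite_induct) (auto simp: cis_mult[symmetric])

lemma wave_split: "wave (n, t) (\<theta>, s) =
    (\<Prod>j\<in>UNIV. cis (2 * pi * (real_of_int (n $ j) * \<theta> $ j))) * (\<Prod>j\<in>UNIV. cis (2 * pi * (t $ j * s $ j)))"
  by (simp add: wave_def inner_vec_def sum_distrib_left distrib_left flip: cis_mult cis_sum)

lemma fourier_L1_wave: "fourier_L1 F \<xi> = (LINT x|phase_space. F x * cnj (wave \<xi> x))"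
proof -
  have eq: "exp (- 2 * pi * \<i> * (\<Sum>j\<in>UNIV. of_int (fst \<xi> $ j) * of_real (fst x $ j))) *
      exp (- 2 * pi * \<i> * of_real (snd \<xi> \<bullet> snd x)) = cnj (wave \<xi> x)" for x
  proof -
    have X: "(\<Sum>j\<in>UNIV. of_int (fst \<xi> $ j) * complex_of_real (fst x $ j)) =
        of_real (\<Sum>j\<in>UNIV. real_of_int (fst \<xi> $ j) * fst x $ j)" by simp
    show ?thesis unfolding X exp_add[symmetric] wave_def cis_cnj unfolding cis_conv_exp
      by (rule arg_cong[where f = exp]) (simp add: algebra_simps del: of_real_sum)
  qed
  show ?thesis
    unfolding fourier_L1_def case_prod_unfold prod.collapse mult.assoc[of "F _"] eq ..
qed

lemma wave_measurable [measurable]: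
  "(\<lambda>p. wave (fst p) (snd p)) \<in> borel_measurable (dual_space \<Otimes>\<^sub>M (phase_space :: ((real ^ 'n) \<times> (real ^ 'n)) measure))"
proof -
  have 1: "(\<lambda>n :: int ^ 'n. real_of_int (n $ j)) \<in> borel_measurable (count_space UNIV)" for j by simp
  have 2: "(\<lambda>\<theta> :: real ^ 'n. \<theta> $ j) \<in> borel_measurable torus" for j
    by (rule measurable_torus_borel) simp
  have [measurable]: "(\<lambda>p. real_of_int (fst (fst p) $ j)) \<in>
      borel_measurable (dual_space \<Otimes>\<^sub>M (phase_space :: ((real ^ 'n) \<times> (real ^ 'n)) measure))" for j
    using 1 by measurable
  have [measurable]: "(\<lambda>p. fst (snd p) $ j) \<in>
      borel_measurable (dual_space \<Otimes>\<^sub>M (phase_space :: ((real ^ 'n) \<times> (real ^ 'n)) measure))" for j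
    by (rule measurable_compose[OF measurable_compose[OF measurable_snd measurable_fst] 2[of j]])
  have [measurable]: "cis \<in> borel_measurable borel"
    by (intro borel_measurable_continuous_onI continuous_intros)
  show ?thesis unfolding wave_def by measurable
qed

lemma wave_measurable_dual [measurable]:
  "(\<lambda>\<xi>. wave \<xi> (x :: (real ^ 'n) \<times> (real ^ 'n))) \<in> borel_measurable dual_space"
proof -
  have 1: "(\<lambda>n :: int ^ 'n. real_of_int (n $ j)) \<in> borel_measurable (count_space UNIV)" for j by simp
  have [measurable]: "(\<lambda>p. real_of_int (fst p $ j)) \<in> borel_measurable (dual_space :: ((int ^ 'n) \<times> (real ^ 'n)) measure)" for j
    using 1 by measurable
  have [measurable]: "cis \<in> borel_measurable borel"
    by (intro borel_measurable_continuous_onI continuous_intros)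
  show ?thesis unfolding wave_def by measurable
qed

lemma wave_measurable_phase [measurable]:
  "wave \<xi> \<in> borel_measurable (phase_space :: ((real ^ 'n) \<times> (real ^ 'n)) measure)"
proof -
  have 2: "(\<lambda>\<theta> :: real ^ 'n. \<theta> $ j) \<in> borel_measurable torus" for j
    by (rule measurable_torus_borel) simp
  have [measurable]: "(\<lambda>p. fst p $ j) \<in> borel_measurable (phase_space :: ((real ^ 'n) \<times> (real ^ 'n)) measure)" for j
    by (rule measurable_compose[OF measurable_fst 2[of j]])
  have [measurable]: "cis \<in> borel_measurable borel"
    by (intro borel_measurable_continuous_onI continuous_intros)
  show ?thesis unfolding wave_def by measurable
qed

section \<open>Gaussians\<close>

lemma gaussian_transform_1d:
  fixes m t :: real
  assumes m: "m > 0"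
  shows "has_bochner_integral lborel (\<lambda>x. of_real (exp (- pi * (x / m)\<^sup>2)) * cis (2 * pi * (t * x)))
           (of_real (m * exp (- pi * (m * t)\<^sup>2)))"
proof -
  define c where "c = m / sqrt (2 * pi)"
  have c: "c > 0" using m by (simp add: c_def)
  define f where "f = (\<lambda>y. std_normal_density y *\<^sub>R iexp ((2 * pi * t * c) * y))"
  have A: "integrable lborel (\<lambda>y. std_normal_density y *\<^sub>R iexp ((2 * pi * t * c) * y))"
    by (rule Bochner_Integration.integrable_bound[OF integrable_normal_density[of 1 0]]) (auto simp: norm_exp_i_times)
  have B: "(\<integral>y. std_normal_density y *\<^sub>R iexp ((2 * pi * t * c) * y) \<partial>lborel) =
      of_real (exp (- (2 * pi * t * c)\<^sup>2 / 2))"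
  proof -
    have "char std_normal_distribution (2 * pi * t * c) = (\<integral>y. std_normal_density y *\<^sub>R iexp ((2 * pi * t * c) * y) \<partial>lborel)"
      unfolding char_def by (subst integral_density) auto
    thus ?thesis unfolding char_std_normal_distribution by simp
  qed
  have "- (2 * pi * t * c)\<^sup>2 / 2 = - pi * (m * t)\<^sup>2"
    by (simp add: c_def power_mult_distrib power_divide) (simp add: power2_eq_square)
  from B[unfolded this] A have "has_bochner_integral lborel f (of_real (exp (- pi * (m * t)\<^sup>2)))"
    unfolding has_bochner_integral_iff f_def by blast
  hence "has_bochner_integral lborel (\<lambda>x. f (0 + (1 / c) * x)) (of_real (exp (- pi * (m * t)\<^sup>2)) /\<^sub>R \<bar>1 / c\<bar>)"
    using c lborel_has_bochner_integral_real_affine_iff[of "1 / c" f "of_real (exp (- pi * (m * t)\<^sup>2))" 0] by simp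
  from has_bochner_integral_mult_right[OF this, of "of_real (sqrt (2 * pi))"]
  have "has_bochner_integral lborel (\<lambda>x. of_real (sqrt (2 * pi)) * f ((1 / c) * x))
      (of_real (sqrt (2 * pi)) * (of_real (exp (- pi * (m * t)\<^sup>2)) /\<^sub>R \<bar>1 / c\<bar>))" by simp
  moreover have "of_real (sqrt (2 * pi)) * f ((1 / c) * x) =
      of_real (exp (- pi * (x / m)\<^sup>2)) * cis (2 * pi * (t * x))" for x
  proof -
    have "(x / c)\<^sup>2 / 2 = pi * (x / m)\<^sup>2"
      by (simp add: c_def power_divide power_mult_distrib)
    hence "std_normal_density (x / c) = exp (- pi * (x / m)\<^sup>2) / sqrt (2 * pi)"
      by (simp add: std_normal_density_def)
    hence "sqrt (2 * pi) * std_normal_density (x / c) = exp (- pi * (x / m)\<^sup>2)" by simp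
    hence "of_real (sqrt (2 * pi)) * complex_of_real (std_normal_density (x / c)) = of_real (exp (- pi * (x / m)\<^sup>2))"
      by (metis of_real_mult)
    moreover have "f ((1 / c) * x) = complex_of_real (std_normal_density (x / c)) * cis (2 * pi * (t * x))"
    proof -
      have arg: "(2 * pi * t * c) * ((1 / c) * x) = 2 * pi * (t * x)" using c by simp
      show ?thesis unfolding f_def arg cis_conv_exp[symmetric] by (simp add: scaleR_conv_of_real)
    qed
    ultimately show ?thesis by (simp only: mult.assoc[symmetric])
  qed
  moreover have "of_real (sqrt (2 * pi)) * (of_real (exp (- pi * (m * t)\<^sup>2)) /\<^sub>R \<bar>1 / c\<bar>) =
      complex_of_real (m * exp (- pi * (m * t)\<^sup>2))"
    using c by (simp add: scaleR_conv_of_real c_def field_simps)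
  ultimately show ?thesis by simp
qed

lemma exp_norm_vec: "exp (- pi * (c * norm (s :: real ^ 'n))\<^sup>2) = (\<Prod>j\<in>UNIV. exp (- pi * (c * s $ j)\<^sup>2))"
proof -
  have "(norm s)\<^sup>2 = (\<Sum>j\<in>UNIV. (s $ j)\<^sup>2)"
    unfolding norm_vec_def L2_set_def by (simp add: sum_nonneg)
  thus ?thesis by (simp add: power_mult_distrib sum_distrib_left exp_sum[symmetric] flip: sum_negf)
qed

lemma gaussian_transform:
  fixes s :: "real ^ 'n"
  assumes m: "m > 0"
  shows "has_bochner_integral lborel
      (\<lambda>t :: real ^ 'n. of_real (exp (- pi * (norm t / m)\<^sup>2)) * (\<Prod>j\<in>UNIV. cis (2 * pi * (t $ j * s $ j))))
      (of_real (m ^ CARD('n) * exp (- pi * (m * norm s)\<^sup>2)))"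
proof -
  define f where "f j x = of_real (exp (- pi * (x / m)\<^sup>2)) * cis (2 * pi * (s $ j * x))" for j :: 'n and x
  have int: "integrable lborel (f j)" "integral\<^sup>L lborel (f j) = of_real (m * exp (- pi * (m * s $ j)\<^sup>2))" for j
    using gaussian_transform_1d[OF m, of "s $ j"] by (auto simp: has_bochner_integral_iff f_def[abs_def])
  have "of_real (exp (- pi * (norm t / m)\<^sup>2)) * (\<Prod>j\<in>UNIV. cis (2 * pi * (t $ j * s $ j))) =
      (\<Prod>j\<in>UNIV. f j (t $ j))" for t :: "real ^ 'n"
    using exp_norm_vec[of "1 / m" t] by (simp add: f_def prod.distrib mult.commute)
  moreover have "(\<Prod>j\<in>UNIV. complex_of_real (m * exp (- pi * (m * s $ j)\<^sup>2))) =
      of_real (m ^ CARD('n) * exp (- pi * (m * norm s)\<^sup>2))"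
    unfolding exp_norm_vec by (simp add: prod.distrib)
  ultimately show ?thesis
    using vec_product_integral[of f] int by (simp add: has_bochner_integral_iff)
qed

section \<open>A kernel on the torus\<close>

lemma integral_wave_1d:
  fixes n :: int
  shows "integrable lborel (\<lambda>x :: real. indicator {0..<1} x *\<^sub>R (c * cis (2 * pi * (real_of_int n * x))))"
    and "(\<integral>x. indicator {0..<1} x *\<^sub>R cis (2 * pi * (real_of_int n * x)) \<partial>lborel) = (if n = 0 then 1 else 0)"
proof -
  let ?f = "\<lambda>x. cis (2 * pi * (real_of_int n * x))"
  have AE: "AE x in lborel. indicator {0..1} x *\<^sub>R ?f x = indicator {0..<1::real} x *\<^sub>R ?f x"
    using AE_lborel_singleton[of "1::real"] by eventually_elim (auto simp: indicator_def)
  have [measurable]: "cis \<in> borel_measurable borel"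
    by (intro borel_measurable_continuous_onI continuous_intros)
  have has: "has_bochner_integral lborel (\<lambda>x. indicator {0..1} x *\<^sub>R ?f x) (if n = 0 then 1 else 0)"
  proof (cases "n = 0")
    case True
    have "has_bochner_integral lborel (\<lambda>x :: real. indicator {0..1} x *\<^sub>R (1::complex)) (of_real 1 - of_real 0)"
      by (rule has_bochner_integral_FTC_Icc[of 0 1 "of_real :: real \<Rightarrow> complex" "\<lambda>_. 1"])
        (auto intro!: derivative_eq_intros)
    thus ?thesis using True by simp
  next
    case False
    define w where "w = 2 * pi * real_of_int n"
    have w: "w \<noteq> 0" using False by (simp add: w_def)
    have "has_bochner_integral lborel (\<lambda>x. indicator {0..1} x *\<^sub>R ?f x)
        (exp (\<i> * of_real (w * 1)) / (\<i> * of_real w) - exp (\<i> * of_real (w * 0)) / (\<i> * of_real w))"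
    proof (rule has_bochner_integral_FTC_Icc)
      fix x
      have "((\<lambda>z. exp (\<i> * (of_real w * z)) / (\<i> * of_real w)) has_field_derivative exp (\<i> * (of_real w * of_real x))) (at (of_real x))"
        using w by (auto intro!: derivative_eq_intros) (simp add: algebra_simps)
      hence "((\<lambda>z. exp (\<i> * (of_real w * of_real z)) / (\<i> * of_real w)) has_vector_derivative exp (\<i> * (of_real w * of_real x))) (at x within {0..1})"
        by (rule has_vector_derivative_real_field)
      thus "((\<lambda>z. exp (\<i> * of_real (w * z)) / (\<i> * of_real w)) has_vector_derivative ?f x) (at x within {0..1})"
        by (simp add: cis_conv_exp w_def mult.assoc)
    qed (auto intro!: continuous_intros)
    moreover have "exp (\<i> * of_real (w * 1)) = 1"
      unfolding exp_eq_1 by (auto simp: w_def)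
    ultimately show ?thesis using False by simp
  qed
  have "integrable lborel (\<lambda>x. indicator {0..<1} x *\<^sub>R ?f x)"
    using has integrable_cong_AE[OF _ _ AE] by (auto simp: has_bochner_integral_iff)
  from integrable_mult_right[OF this, of c]
  show "integrable lborel (\<lambda>x :: real. indicator {0..<1} x *\<^sub>R (c * ?f x))" by simp
  show "(\<integral>x. indicator {0..<1} x *\<^sub>R ?f x \<partial>lborel) = (if n = 0 then 1 else 0)"
    using has integral_cong_AE[OF _ _ AE] by (auto simp: has_bochner_integral_iff)
qed

text \<open>The Fourier coefficients of the kernel \<open>cosk\<close> below, a normalized even power of the cosine. This
  kernel of de la Vallee Poussin is a nonnegative trigonometric polynomial whose Fourier
  expansion is the binomial theorem.\<close>

definition cosw :: "nat \<Rightarrow> int \<Rightarrow> real" where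
  "cosw M n = (if \<bar>n\<bar> \<le> int M then real ((2 * M) choose nat (n + int M)) / real ((2 * M) choose M) else 0)"

definition cosk :: "nat \<Rightarrow> real \<Rightarrow> real" where
  "cosk M \<theta> = 4 ^ M * cos (pi * \<theta>) ^ (2 * M) / real ((2 * M) choose M)"

lemma cosw_bounds: "0 \<le> cosw M n" "cosw M n \<le> 1"
  using binomial_maximum'[of M "nat (n + int M)"] by (auto simp: cosw_def divide_le_eq)

lemma cosw_0: "cosw M 0 = 1"
  by (simp add: cosw_def)

lemma cosk_expansion:
  "(\<Sum>n\<in>{- int M..int M}. of_real (cosw M n) * cis (2 * pi * (real_of_int n * \<theta>))) = complex_of_real (cosk M \<theta>)"
proof -
  have "(\<Sum>n\<in>{- int M..int M}. of_real (cosw M n) * cis (2 * pi * (real_of_int n * \<theta>))) =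
      (\<Sum>k\<le>2 * M. of_real (cosw M (int k - int M)) * cis (2 * pi * (real_of_int (int k - int M) * \<theta>)))"
    by (rule sum.reindex_bij_witness[of _ "\<lambda>k. int k - int M" "\<lambda>n. nat (n + int M)"]) auto
  also have "\<dots> = (\<Sum>k\<le>2 * M. of_nat ((2 * M) choose k) * cis (2 * pi * \<theta>) ^ k) * cis (- (2 * pi * M * \<theta>)) / of_nat ((2 * M) choose M)"
    unfolding sum_distrib_right sum_divide_distrib
  proof (intro sum.cong refl)
    fix k assume "k \<in> {..2 * M}"
    moreover have "cis (2 * pi * \<theta>) ^ k * cis (- (2 * pi * M * \<theta>)) = cis (2 * pi * (real_of_int (int k - int M) * \<theta>))"
      unfolding Complex.DeMoivre cis_mult by (rule arg_cong[where f = cis]) (simp add: algebra_simps)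
    ultimately show "of_real (cosw M (int k - int M)) * cis (2 * pi * (real_of_int (int k - int M) * \<theta>)) =
        of_nat ((2 * M) choose k) * cis (2 * pi * \<theta>) ^ k * cis (- (2 * pi * M * \<theta>)) / of_nat ((2 * M) choose M)"
      by (simp add: cosw_def abs_le_iff mult.assoc)
  qed
  also have "(\<Sum>k\<le>2 * M. of_nat ((2 * M) choose k) * cis (2 * pi * \<theta>) ^ k) = (cis (2 * pi * \<theta>) + 1) ^ (2 * M)"
    using binomial_ring[of "cis (2 * pi * \<theta>)" 1 "2 * M"] by simp
  also have "cis (2 * pi * \<theta>) + 1 = of_real (2 * cos (pi * \<theta>)) * cis (pi * \<theta>)"
  proof -
    have "cis (2 * pi * \<theta>) + 1 = cis (pi * \<theta>) * (cis (pi * \<theta>) + cis (- (pi * \<theta>)))"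
      by (simp add: distrib_left cis_mult mult.assoc)
    thus ?thesis by (simp add: complex_eq_iff)
  qed
  also have "(of_real (2 * cos (pi * \<theta>)) * cis (pi * \<theta>)) ^ (2 * M) * cis (- (2 * pi * M * \<theta>)) =
      of_real ((2 * cos (pi * \<theta>)) ^ (2 * M))"
  proof -
    have "cis (pi * \<theta>) ^ (2 * M) * cis (- (2 * pi * M * \<theta>)) = 1"
      unfolding Complex.DeMoivre cis_mult by (simp add: algebra_simps)
    thus ?thesis by (simp add: power_mult_distrib mult.assoc)
  qed
  finally show ?thesis by (simp add: cosk_def power_mult_distrib power_mult)
qed

lemma cosk_nonneg: "cosk M \<theta> \<ge> 0"
  by (simp add: cosk_def power_mult)

text \<open>The central binomial coefficient is at least \<open>4 ^ M / (2 * M)\<close>, so away from the integers the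
  kernel decays exponentially in \<open>M\<close>.\<close>

lemma cosk_le: "M \<ge> 1 \<Longrightarrow> cosk M \<theta> \<le> 2 * real M * (cos (pi * \<theta>))\<^sup>2 ^ M"
proof -
  assume M: "M \<ge> 1"
  have "4 ^ M \<le> 2 * real M * real ((2 * M) choose M)"
    using central_binomial_lower_bound[of M] M by (simp add: field_simps)
  hence "4 ^ M * (cos (pi * \<theta>))\<^sup>2 ^ M \<le> (2 * real M * real ((2 * M) choose M)) * (cos (pi * \<theta>))\<^sup>2 ^ M"
    by (intro mult_right_mono) auto
  thus ?thesis unfolding cosk_def power_mult[of _ 2 M]
    by (subst pos_divide_le_eq) (auto simp: ac_simps)
qed

lemma cosk_minus: "cosk M (- \<theta>) = cosk M \<theta>"
  by (simp add: cosk_def)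

lemma cosk_measurable [measurable]: "cosk M \<in> borel_measurable borel"
  unfolding cosk_def by measurable

lemma cosk_integral:
  "integrable lborel (\<lambda>x. indicator {0..<1} x *\<^sub>R complex_of_real (cosk M (a - x)))"
  "(\<integral>x. indicator {0..<1} x *\<^sub>R complex_of_real (cosk M (a - x)) \<partial>lborel) = 1"
proof -
  have eq: "indicator {0..<1} x *\<^sub>R complex_of_real (cosk M (a - x)) =
      (\<Sum>n\<in>{- int M..int M}. indicator {0..<1} x *\<^sub>R ((of_real (cosw M n) * cis (2 * pi * (real_of_int n * a))) *
         cis (2 * pi * (real_of_int (- n) * x))))" for x
    unfolding cosk_expansion[symmetric] scaleR_sum_right
    by (intro sum.cong) (auto simp: cis_mult mult.assoc algebra_simps)
  show "integrable lborel (\<lambda>x. indicator {0..<1} x *\<^sub>R complex_of_real (cosk M (a - x)))"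
    unfolding eq by (intro Bochner_Integration.integrable_sum integral_wave_1d(1))
  have "(\<integral>x. indicator {0..<1} x *\<^sub>R complex_of_real (cosk M (a - x)) \<partial>lborel) =
      (\<Sum>n\<in>{- int M..int M}. (of_real (cosw M n) * cis (2 * pi * (real_of_int n * a))) *
         (\<integral>x. indicator {0..<1} x *\<^sub>R cis (2 * pi * (real_of_int (- n) * x)) \<partial>lborel))"
    unfolding eq
    by (subst Bochner_Integration.integral_sum[OF integral_wave_1d(1)]) (simp flip: integral_mult_right_zero)
  also have "\<dots> = (\<Sum>n\<in>{- int M..int M}. if n = 0 then 1 else 0)"
    unfolding integral_wave_1d(2) by (intro sum.cong) (auto simp: cosw_0)
  also have "\<dots> = 1" by simp
  finally show "(\<integral>x. indicator {0..<1} x *\<^sub>R complex_of_real (cosk M (a - x)) \<partial>lborel) = 1" .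
qed

text \<open>Consecutive coefficients have the ratio \<open>(M - k) / (M + k + 1)\<close>.\<close>

lemma cosw_tendsto: "(\<lambda>M. cosw M n) \<longlonglongrightarrow> 1"
proof -
  have nat: "(\<lambda>M. cosw M (int k)) \<longlonglongrightarrow> 1" for k
  proof (induction k)
    case (Suc k)
    have "eventually (\<lambda>M. cosw M (int k) * ((real M - real k) / (real M + real k + 1)) = cosw M (int (Suc k))) sequentially"
      using eventually_ge_at_top[of "Suc k"]
    proof eventually_elim
      case (elim M)
      have n1: "nat (int k + int M) = k + M" "nat (int (Suc k) + int M) = Suc (k + M)" by auto
      have "Suc (k + M) * ((2 * M) choose Suc (k + M)) = (2 * M - (k + M)) * ((2 * M) choose (k + M))"
        using binomial_absorption[of "k + M" "2 * M"] binomial_absorb_comp[of "2 * M" "k + M"]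
        by (rule trans[OF _ sym])
      hence "real (Suc (k + M)) * real ((2 * M) choose Suc (k + M)) = (real M - real k) * real ((2 * M) choose (k + M))"
        using elim by (metis of_nat_mult of_nat_diff diff_add_inverse2 mult_2 add.commute diff_diff_left add_diff_cancel_left' Suc_leD)
      hence "real ((2 * M) choose Suc (k + M)) =
          real ((2 * M) choose (k + M)) * ((real M - real k) / (real M + real k + 1))"
        by (simp add: field_simps del: binomial_Suc_Suc)
      moreover have c1: "cosw M (int k) = real ((2 * M) choose (k + M)) / real ((2 * M) choose M)"
        unfolding cosw_def n1 using elim by simp
      moreover have c2: "cosw M (int (Suc k)) = real ((2 * M) choose Suc (k + M)) / real ((2 * M) choose M)"
        unfolding cosw_def n1 using elim by simp
      ultimately show ?case
        unfolding c1 c2 by simp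
    qed
    moreover have "(\<lambda>M. (real M - real k) / (real M + real k + 1)) \<longlonglongrightarrow> 1" by real_asymp
    from tendsto_mult[OF Suc this]
    have "(\<lambda>M. cosw M (int k) * ((real M - real k) / (real M + real k + 1))) \<longlonglongrightarrow> 1" by simp
    ultimately show ?case by (rule Lim_transform_eventually[rotated])
  qed (simp add: cosw_0)
  have sym: "cosw M (- n) = cosw M n" for M n
  proof (cases "\<bar>n\<bar> \<le> int M")
    case True
    hence "(2 * M) choose nat (n + int M) = (2 * M) choose (2 * M - nat (n + int M))"
      by (intro binomial_symmetric) auto
    also have "2 * M - nat (n + int M) = nat (- n + int M)" using True by auto
    finally show ?thesis by (simp add: cosw_def)
  qed (simp add: cosw_def)
  hence "cosw M n = cosw M (int (nat \<bar>n\<bar>))" for M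
    using sym[of M n] by (simp add: abs_if)
  thus ?thesis using nat[of "nat \<bar>n\<bar>"] by simp
qed


section \<open>An approximate identity\<close>

text \<open>A family of multipliers on the dual group and their Fourier transforms \<open>pker\<close> on
  \<open>T^N \<times> R^N\<close>. Both are nonnegative; the multipliers are at most \<open>1\<close> and tend to \<open>1\<close>, and the transforms form an approximate identity. Bessel's inequality, uniqueness and inversion all
  follow from this one family.\<close>

definition dker :: "nat \<Rightarrow> (int ^ 'n) \<times> (real ^ 'n) \<Rightarrow> real" where
  "dker M \<xi> = (\<Prod>j\<in>UNIV. cosw M (fst \<xi> $ j)) * exp (- pi * (norm (snd \<xi>) / real M)\<^sup>2)"

definition pker :: "nat \<Rightarrow> (real ^ 'n) \<times> (real ^ 'n) \<Rightarrow> real" where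
  "pker M x = (\<Prod>j\<in>UNIV. cosk M (fst x $ j)) * (real M ^ CARD('n) * exp (- pi * (real M * norm (snd x))\<^sup>2))"

lemma phase_measurableI:
  fixes f :: "(real ^ 'n) \<times> (real ^ 'n) \<Rightarrow> 'c::topological_space"
  assumes "f \<in> borel_measurable borel"
  shows "f \<in> borel_measurable phase_space"
proof -
  have "(\<lambda>x. (fst x, snd x)) \<in> measurable (phase_space :: ((real ^ 'n) \<times> (real ^ 'n)) measure) (borel \<Otimes>\<^sub>M borel)"
    by (intro measurable_Pair measurable_compose[OF measurable_fst sets_torus_id]
        measurable_compose[OF measurable_snd]) simp
  hence "(\<lambda>x. x) \<in> measurable (phase_space :: ((real ^ 'n) \<times> (real ^ 'n)) measure) borel"
    by (simp add: borel_prod)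
  from measurable_compose[OF this assms] show ?thesis .
qed

lemma cnj_measurable [measurable]: "cnj \<in> borel_measurable borel"
  by (intro borel_measurable_continuous_onI continuous_intros)

lemma pker_measurable_borel [measurable]: "pker M \<in> borel_measurable borel"
  unfolding pker_def cosk_def
  by (intro borel_measurable_continuous_onI) (auto intro!: continuous_intros)

lemma pker_shift_measurable: "(\<lambda>y. pker M (x - y)) \<in> borel_measurable phase_space"
  by (rule phase_measurableI) measurable

lemma dker_measurable [measurable]:
  "dker M \<in> borel_measurable (dual_space :: ((int ^ 'n) \<times> (real ^ 'n)) measure)"
proof -
  have 1: "(\<lambda>n :: int ^ 'n. cosw M (n $ j)) \<in> borel_measurable (count_space UNIV)" for j by simp
  have [measurable]: "(\<lambda>p. cosw M (fst p $ j)) \<in> borel_measurable (dual_space :: ((int ^ 'n) \<times> (real ^ 'n)) measure)" for j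
    using 1 by measurable
  show ?thesis unfolding dker_def by measurable
qed

lemma dker_bounds: "0 \<le> dker M \<xi>" "dker M \<xi> \<le> 1"
proof -
  show "0 \<le> dker M \<xi>" by (auto simp: dker_def intro!: mult_nonneg_nonneg prod_nonneg cosw_bounds)
  have "(\<Prod>j\<in>UNIV. cosw M (fst \<xi> $ j)) \<le> 1"
    by (rule prod_le_1) (use cosw_bounds in auto)
  thus "dker M \<xi> \<le> 1" unfolding dker_def
    by (intro mult_le_one) auto
qed

lemma pker_nonneg: "0 \<le> pker M x"
  by (auto simp: pker_def intro!: mult_nonneg_nonneg prod_nonneg cosk_nonneg)

lemma pker_minus: "pker M (- x) = pker M x"
  by (simp add: pker_def cosk_minus)

lemma dker_tendsto:
  fixes \<xi> :: "(int ^ 'n) \<times> (real ^ 'n)"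
  shows "(\<lambda>M. dker M \<xi>) \<longlonglongrightarrow> 1"
proof -
  have "(\<lambda>M. exp (- pi * (norm (snd \<xi>) / real M)\<^sup>2)) \<longlonglongrightarrow> 1"
    using tendsto_exp[OF tendsto_mult[OF tendsto_const[of "- pi"]
        tendsto_power[OF lim_const_over_n[of "norm (snd \<xi>)"], of 2]]] by simp
  moreover have "(\<lambda>M. \<Prod>j\<in>UNIV. cosw M (fst \<xi> $ j)) \<longlonglongrightarrow> (\<Prod>j\<in>(UNIV :: 'n set). 1)"
    by (rule tendsto_prod) (rule cosw_tendsto)
  ultimately show ?thesis unfolding dker_def using tendsto_mult by fastforce
qed

lemma count_space_finite_support:
  fixes f :: "'a \<Rightarrow> 'b::{banach,second_countable_topology}"
  assumes "finite B" "\<And>a. a \<notin> B \<Longrightarrow> f a = 0"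
  shows "integrable (count_space UNIV) f" "integral\<^sup>L (count_space UNIV) f = sum f B"
proof -
  have sub: "{a. f a \<noteq> 0} \<subseteq> B" using assms(2) by auto
  hence fin: "finite {a. f a \<noteq> 0}" using assms(1) finite_subset by blast
  have "(\<integral>\<^sup>+a. ennreal (norm (f a)) \<partial>count_space UNIV) = (\<Sum>a | 0 < norm (f a). ennreal (norm (f a)))"
    by (subst nn_integral_count_space) (use fin in auto)
  thus "integrable (count_space UNIV) f" by (simp add: integrable_iff_bounded)
  have "integral\<^sup>L (count_space UNIV) f = (\<Sum>a | f a \<noteq> 0. f a)"
    by (subst lebesgue_integral_count_space_finite_support) (use fin in auto)
  also have "\<dots> = sum f B" by (rule sum.mono_neutral_left[OF assms(1) sub]) auto
  finally show "integral\<^sup>L (count_space UNIV) f = sum f B" .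
qed

lemma dker_transform:
  fixes x :: "(real ^ 'n) \<times> (real ^ 'n)"
  assumes M: "M \<ge> 1"
  shows "integrable dual_space (\<lambda>\<xi>. of_real (dker M \<xi>) * wave \<xi> x)"
    and "(\<integral>\<xi>. of_real (dker M \<xi>) * wave \<xi> x \<partial>dual_space) = of_real (pker M x)"
proof -
  define f where "f n = (\<Prod>j\<in>UNIV. of_real (cosw M (n $ j)) * cis (2 * pi * (real_of_int (n $ j) * fst x $ j)))"
    for n :: "int ^ 'n"
  define g where "g t = of_real (exp (- pi * (norm t / real M)\<^sup>2)) * (\<Prod>j\<in>UNIV. cis (2 * pi * (t $ j * snd x $ j)))"
    for t :: "real ^ 'n"
  define B where "B = {n :: int ^ 'n. \<forall>j. n $ j \<in> {- int M..int M}}"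
  have fin: "finite (PiE (UNIV :: 'n set) (\<lambda>_. {- int M..int M}))" by (intro finite_PiE) auto
  have bij: "bij_betw (\<lambda>h. \<chi> j. h j) (PiE (UNIV :: 'n set) (\<lambda>_. {- int M..int M})) B"
    by (rule bij_betw_byWitness[where f' = "\<lambda>(n :: int ^ 'n) j. n $ j"]) (auto simp: B_def)
  have B: "finite B" using bij fin bij_betw_finite by blast
  have supp: "f n = 0" if nB: "n \<notin> B" for n
  proof -
    obtain j where "n $ j \<notin> {- int M..int M}" using nB unfolding B_def by blast
    hence "cosw M (n $ j) = 0" by (auto simp: cosw_def)
    thus ?thesis unfolding f_def by (intro prod_zero bexI[of _ j]) auto
  qed
  have "sum f B = (\<Sum>h\<in>PiE (UNIV :: 'n set) (\<lambda>_. {- int M..int M}). f (\<chi> j. h j))"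
    by (rule sum.reindex_bij_betw[OF bij, symmetric])
  also have "\<dots> = (\<Prod>j\<in>UNIV. \<Sum>k\<in>{- int M..int M}. of_real (cosw M k) * cis (2 * pi * (real_of_int k * fst x $ j)))"
    by (subst prod_sum_PiE) (auto simp: f_def)
  also have "\<dots> = of_real (\<Prod>j\<in>UNIV. cosk M (fst x $ j))" by (simp add: cosk_expansion)
  finally have If: "integral\<^sup>L (count_space UNIV) f = of_real (\<Prod>j\<in>UNIV. cosk M (fst x $ j))"
    using count_space_finite_support[of B f] B supp by simp
  have intf: "integrable (count_space UNIV) f" using count_space_finite_support[of B f] B supp by simp
  have "real M > 0" using M by simp
  note G = gaussian_transform[OF this, of "snd x"]
  have intg: "integrable lborel g" and Ig: "integral\<^sup>L lborel g = of_real (real M ^ CARD('n) * exp (- pi * (real M * norm (snd x))\<^sup>2))"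
    using G by (simp_all add: has_bochner_integral_iff g_def[abs_def])
  have eq: "of_real (dker M \<xi>) * wave \<xi> x = f (fst \<xi>) * g (snd \<xi>)" for \<xi>
    using wave_split[of "fst \<xi>" "snd \<xi>" "fst x" "snd x"] by (simp add: dker_def f_def g_def prod.distrib ac_simps)
  show "integrable dual_space (\<lambda>\<xi>. of_real (dker M \<xi>) * wave \<xi> x)"
    unfolding eq by (rule pair_product_integral(1)[OF sigma_finite_count lborel.sigma_finite_measure_axioms intf intg])
  show "(\<integral>\<xi>. of_real (dker M \<xi>) * wave \<xi> x \<partial>dual_space) = of_real (pker M x)"
    unfolding eq pair_product_integral(2)[OF sigma_finite_count lborel.sigma_finite_measure_axioms intf intg]
    by (simp add: If Ig pker_def)
qed

lemma dker_integrable: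
  assumes M: "M \<ge> 1"
  shows "integrable (dual_space :: ((int ^ 'n) \<times> (real ^ 'n)) measure) (\<lambda>\<xi>. complex_of_real (dker M \<xi>))"
  using dker_transform(1)[OF M, of 0] by simp

lemma pker_integral:
  fixes x :: "(real ^ 'n) \<times> (real ^ 'n)"
  assumes M: "M \<ge> 1"
  shows "integrable phase_space (\<lambda>y. pker M (x - y))" "(\<integral>y. pker M (x - y) \<partial>phase_space) = 1"
    "(\<integral>\<^sup>+y. ennreal (pker M (x - y)) \<partial>phase_space) = 1"
proof -
  define f where "f j a = complex_of_real (cosk M (fst x $ j - a))" for j a
  define h where "h j a = complex_of_real (real M * exp (- pi * (real M * (snd x $ j - a))\<^sup>2))" for j a
  have Mpos: "1 / real M > 0" "real M > 0" using M by auto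
  have h: "integrable lborel (h j)" "integral\<^sup>L lborel (h j) = 1" for j
  proof -
    have "has_bochner_integral lborel (\<lambda>a. complex_of_real (exp (- pi * (a / (1 / real M))\<^sup>2))) (of_real (1 / real M))"
      using gaussian_transform_1d[OF Mpos(1), of 0] by simp
    from has_bochner_integral_mult_right[OF this, of "of_real (real M)"]
    have "has_bochner_integral lborel (\<lambda>a. complex_of_real (real M * exp (- pi * (real M * a)\<^sup>2))) 1"
      using Mpos by (simp add: mult.commute)
    hence "has_bochner_integral lborel (\<lambda>a. complex_of_real (real M * exp (- pi * (real M * (snd x $ j + (-1) * a))\<^sup>2))) 1"
      by (subst (asm) lborel_has_bochner_integral_real_affine_iff[of "-1" _ _ "snd x $ j"]) auto
    hence "has_bochner_integral lborel (h j) 1" by (simp add: h_def[abs_def])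
    thus "integrable lborel (h j)" "integral\<^sup>L lborel (h j) = 1" by (auto simp: has_bochner_integral_iff)
  qed
  note T = torus_product_integral[of f, unfolded f_def, OF cosk_integral(1)]
  note L = vec_product_integral[of h, OF h(1)]
  have eq: "complex_of_real (pker M (x - y)) =
      (\<Prod>j\<in>UNIV. complex_of_real (cosk M (fst x $ j - fst y $ j))) * (\<Prod>j\<in>UNIV. h j (snd y $ j))" for y
    unfolding pker_def exp_norm_vec by (simp add: h_def prod.distrib)
  have 1: "integrable phase_space (\<lambda>y. complex_of_real (pker M (x - y)))"
    unfolding eq by (rule pair_product_integral(1)[OF sigma_finite_torus lborel.sigma_finite_measure_axioms T(1) L(1)])
  have 2: "(\<integral>y. complex_of_real (pker M (x - y)) \<partial>phase_space) = 1"
    unfolding eq pair_product_integral(2)[OF sigma_finite_torus lborel.sigma_finite_measure_axioms T(1) L(1)]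
    by (simp add: T(2) L(2) h cosk_integral)
  show 3: "integrable phase_space (\<lambda>y. pker M (x - y))" using 1 by (simp add: complex_of_real_integrable_eq)
  show 4: "(\<integral>y. pker M (x - y) \<partial>phase_space) = 1"
    using 2 by (metis integral_complex_of_real of_real_eq_1_iff)
  show "(\<integral>\<^sup>+y. ennreal (pker M (x - y)) \<partial>phase_space) = 1"
    by (subst nn_integral_eq_integral[OF 3]) (auto simp: 4 pker_nonneg)
qed

section \<open>The multiplication formula and Bessel's inequality\<close>

lemma fourier_L1_bound:
  assumes f: "integrable phase_space f"
  shows "cmod (fourier_L1 f \<xi>) \<le> (\<integral>x. cmod (f x) \<partial>phase_space)"
  unfolding fourier_L1_wave
  by (rule order_trans[OF integral_norm_bound]) (simp add: norm_mult)

lemma wave_product_integrable: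
  fixes f :: "(real ^ 'n) \<times> (real ^ 'n) \<Rightarrow> complex"
  assumes f: "integrable phase_space f" and \<phi>: "integrable dual_space \<phi>"
  shows "integrable (dual_space \<Otimes>\<^sub>M phase_space) (\<lambda>(\<xi>, x). f x * \<phi> \<xi> * cnj (wave \<xi> x))"
proof (rule Bochner_Integration.integrable_bound)
  show "integrable (dual_space \<Otimes>\<^sub>M phase_space) (\<lambda>p. \<phi> (fst p) * f (snd p))"
    by (rule pair_product_integral(1)[OF sigma_finite_dual sigma_finite_phase \<phi> f])
  have [measurable]: "f \<in> borel_measurable phase_space" "\<phi> \<in> borel_measurable dual_space"
    using f \<phi> by auto
  show "(\<lambda>(\<xi>, x). f x * \<phi> \<xi> * cnj (wave \<xi> x)) \<in> borel_measurable (dual_space \<Otimes>\<^sub>M phase_space)"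
    unfolding case_prod_unfold by measurable
qed (auto simp: norm_mult)

lemma fourier_L1_measurable:
  fixes f :: "(real ^ 'n) \<times> (real ^ 'n) \<Rightarrow> complex"
  assumes f: "integrable phase_space f"
  shows "fourier_L1 f \<in> borel_measurable dual_space"
proof -
  interpret sigma_finite_measure "phase_space :: ((real ^ 'n) \<times> (real ^ 'n)) measure" by (rule sigma_finite_phase)
  have [measurable]: "f \<in> borel_measurable phase_space" using f by auto
  have "(\<lambda>\<xi>. \<integral>x. f x * cnj (wave \<xi> x) \<partial>phase_space) \<in> borel_measurable dual_space"
    by (rule borel_measurable_lebesgue_integral) (unfold case_prod_unfold, measurable)
  thus ?thesis by (simp add: fourier_L1_wave[abs_def])
qed

text \<open>Fubini's theorem moves the transform from one factor to the other.\<close>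

lemma multiplication_formula:
  fixes f :: "(real ^ 'n) \<times> (real ^ 'n) \<Rightarrow> complex"
  assumes f: "integrable phase_space f" and \<phi>: "integrable dual_space \<phi>"
  shows "(\<integral>\<xi>. fourier_L1 f \<xi> * \<phi> \<xi> \<partial>dual_space) =
         (\<integral>x. f x * (\<integral>\<xi>. \<phi> \<xi> * cnj (wave \<xi> x) \<partial>dual_space) \<partial>phase_space)"
proof -
  interpret pair_sigma_finite "dual_space :: ((int ^ 'n) \<times> (real ^ 'n)) measure" "phase_space :: ((real ^ 'n) \<times> (real ^ 'n)) measure"
    by (simp add: pair_sigma_finite_def sigma_finite_dual sigma_finite_phase)
  have "fourier_L1 f \<xi> * \<phi> \<xi> = (\<integral>x. f x * \<phi> \<xi> * cnj (wave \<xi> x) \<partial>phase_space)" for \<xi>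
  proof -
    have "fourier_L1 f \<xi> * \<phi> \<xi> = \<phi> \<xi> * (\<integral>x. f x * cnj (wave \<xi> x) \<partial>phase_space)"
      by (simp add: fourier_L1_wave)
    also have "\<dots> = (\<integral>x. \<phi> \<xi> * (f x * cnj (wave \<xi> x)) \<partial>phase_space)"
      by (rule integral_mult_right_zero[symmetric])
    finally show ?thesis by (simp add: ac_simps)
  qed
  hence "(\<integral>\<xi>. fourier_L1 f \<xi> * \<phi> \<xi> \<partial>dual_space) =
      (\<integral>\<xi>. (\<integral>x. f x * \<phi> \<xi> * cnj (wave \<xi> x) \<partial>phase_space) \<partial>dual_space)" by simp
  also have "\<dots> = (\<integral>x. (\<integral>\<xi>. f x * \<phi> \<xi> * cnj (wave \<xi> x) \<partial>dual_space) \<partial>phase_space)"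
    by (rule Fubini_integral[symmetric]) (use wave_product_integrable[OF f \<phi>] in simp)
  also have "\<dots> = (\<integral>x. f x * (\<integral>\<xi>. \<phi> \<xi> * cnj (wave \<xi> x) \<partial>dual_space) \<partial>phase_space)"
    by (simp only: mult.assoc integral_mult_right_zero)
  finally show ?thesis .
qed

lemma bounded_times_integrable:
  fixes g \<phi> :: "'a \<Rightarrow> complex"
  assumes "integrable M \<phi>" "g \<in> borel_measurable M" "\<And>x. cmod (g x) \<le> K"
  shows "integrable M (\<lambda>x. g x * \<phi> x)"
proof (rule Bochner_Integration.integrable_bound)
  show "integrable M (\<lambda>x. of_real K * \<phi> x)" using assms(1) by simp
  show "(\<lambda>x. g x * \<phi> x) \<in> borel_measurable M" using assms by measurable
  have K: "0 \<le> K" using assms(3) norm_ge_zero order_trans by blast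
  show "AE x in M. cmod (g x * \<phi> x) \<le> cmod (of_real K * \<phi> x)"
    using assms(3) K by (auto simp: norm_mult intro!: mult_right_mono)
qed

text \<open>Damping the transform by \<open>dker\<close> and inverting it is convolution with \<open>pker\<close>.\<close>

lemma smoothing_formula:
  fixes f :: "(real ^ 'n) \<times> (real ^ 'n) \<Rightarrow> complex"
  assumes f: "integrable phase_space f" and M: "M \<ge> 1"
  shows "(\<integral>\<xi>. fourier_L1 f \<xi> * (of_real (dker M \<xi>) * wave \<xi> x) \<partial>dual_space) =
         (\<integral>y. f y * of_real (pker M (x - y)) \<partial>phase_space)"
proof -
  have "(\<integral>\<xi>. of_real (dker M \<xi>) * wave \<xi> x * cnj (wave \<xi> y) \<partial>dual_space) = of_real (pker M (x - y))" for y
    using dker_transform(2)[OF M, of "x - y"] by (simp add: wave_diff mult.assoc)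
  thus ?thesis using multiplication_formula[OF f dker_transform(1)[OF M, of x]] by simp
qed

lemma norm_integral_le_nn: "ennreal (norm (integral\<^sup>L M f)) \<le> (\<integral>\<^sup>+x. ennreal (norm (f x)) \<partial>M)"
  for f :: "'a \<Rightarrow> 'b::{banach,second_countable_topology}"
  by (cases "integrable M f") (auto simp: integral_norm_bound_ennreal not_integrable_integral_eq)

text \<open>By the multiplication formula the left side is the integral of \<open>f\<close> against the
  conjugate of its convolution with \<open>pker\<close>. The inequality \<open>2 * a * b \<le> a\<^sup>2 + b\<^sup>2\<close> and
  the total mass \<open>1\<close> of the symmetric kernel bound it by the square norm of \<open>f\<close>.\<close>

lemma bessel_weighted:
  fixes f :: "(real ^ 'n) \<times> (real ^ 'n) \<Rightarrow> complex"
  assumes f: "integrable phase_space f" and M: "M \<ge> 1"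
  shows "(\<integral>\<^sup>+\<xi>. ennreal ((cmod (fourier_L1 f \<xi>))\<^sup>2 * dker M \<xi>) \<partial>dual_space) \<le>
         (\<integral>\<^sup>+x. ennreal ((cmod (f x))\<^sup>2) \<partial>phase_space)"
proof -
  let ?P = "phase_space :: ((real ^ 'n) \<times> (real ^ 'n)) measure"
  interpret PP: pair_sigma_finite ?P ?P
    by (simp add: pair_sigma_finite_def sigma_finite_phase)
  have mf [measurable]: "f \<in> borel_measurable ?P" using f by auto
  have mF [measurable]: "fourier_L1 f \<in> borel_measurable dual_space" by (rule fourier_L1_measurable[OF f])
  define \<phi> where "\<phi> \<xi> = cnj (fourier_L1 f \<xi>) * of_real (dker M \<xi>)" for \<xi>
  have \<phi>: "integrable dual_space \<phi>" unfolding \<phi>_def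
    by (rule bounded_times_integrable[OF dker_integrable[OF M]]) (use fourier_L1_bound[OF f] in auto)
  have sq: "fourier_L1 f \<xi> * \<phi> \<xi> = of_real ((cmod (fourier_L1 f \<xi>))\<^sup>2 * dker M \<xi>)" for \<xi>
    unfolding \<phi>_def mult.assoc[symmetric] complex_norm_square[symmetric] by simp
  have "integrable dual_space (\<lambda>\<xi>. fourier_L1 f \<xi> * \<phi> \<xi>)"
    by (rule bounded_times_integrable[OF \<phi> mF fourier_L1_bound[OF f]])
  hence int: "integrable dual_space (\<lambda>\<xi>. (cmod (fourier_L1 f \<xi>))\<^sup>2 * dker M \<xi>)"
    unfolding sq complex_of_real_integrable_eq .
  have conv: "(\<integral>\<xi>. \<phi> \<xi> * cnj (wave \<xi> x) \<partial>dual_space) = cnj (\<integral>y. f y * of_real (pker M (x - y)) \<partial>?P)" for x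
  proof -
    have "(\<integral>\<xi>. \<phi> \<xi> * cnj (wave \<xi> x) \<partial>dual_space) =
        (\<integral>\<xi>. cnj (fourier_L1 f \<xi> * (of_real (dker M \<xi>) * wave \<xi> x)) \<partial>dual_space)"
      by (intro Bochner_Integration.integral_cong) (auto simp: \<phi>_def)
    also have "\<dots> = cnj (\<integral>\<xi>. fourier_L1 f \<xi> * (of_real (dker M \<xi>) * wave \<xi> x) \<partial>dual_space)"
      by (rule Bochner_Integration.integral_cnj)
    finally show ?thesis unfolding smoothing_formula[OF f M] .
  qed
  have "(\<integral>\<^sup>+\<xi>. ennreal ((cmod (fourier_L1 f \<xi>))\<^sup>2 * dker M \<xi>) \<partial>dual_space) =
      ennreal (\<integral>\<xi>. (cmod (fourier_L1 f \<xi>))\<^sup>2 * dker M \<xi> \<partial>dual_space)"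
    by (rule nn_integral_eq_integral[OF int]) (auto simp: dker_bounds)
  also have "\<dots> = ennreal (cmod (\<integral>\<xi>. fourier_L1 f \<xi> * \<phi> \<xi> \<partial>dual_space))"
    unfolding sq integral_complex_of_real by (simp add: dker_bounds)
  also have "\<dots> = ennreal (cmod (\<integral>x. f x * cnj (\<integral>y. f y * of_real (pker M (x - y)) \<partial>?P) \<partial>?P))"
    unfolding multiplication_formula[OF f \<phi>] conv ..
  also have "\<dots> \<le> (\<integral>\<^sup>+x. ennreal (cmod (f x * cnj (\<integral>y. f y * of_real (pker M (x - y)) \<partial>?P))) \<partial>?P)"
    by (rule norm_integral_le_nn)
  also have "\<dots> \<le> (\<integral>\<^sup>+x. \<integral>\<^sup>+y. (ennreal ((cmod (f x))\<^sup>2) / 2 * ennreal (pker M (x - y)) +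
      ennreal ((cmod (f y))\<^sup>2) / 2 * ennreal (pker M (x - y))) \<partial>?P \<partial>?P)"
  proof (rule nn_integral_mono)
    fix x
    have [measurable]: "(\<lambda>y. pker M (x - y)) \<in> borel_measurable ?P" by (rule pker_shift_measurable)
    have "ennreal (cmod (f x * cnj (\<integral>y. f y * of_real (pker M (x - y)) \<partial>?P))) =
        ennreal (cmod (f x)) * ennreal (cmod (\<integral>y. f y * of_real (pker M (x - y)) \<partial>?P))"
      by (simp add: norm_mult ennreal_mult)
    also have "\<dots> \<le> ennreal (cmod (f x)) * (\<integral>\<^sup>+y. ennreal (cmod (f y * of_real (pker M (x - y)))) \<partial>?P)"
      by (intro mult_left_mono norm_integral_le_nn) auto
    also have "\<dots> = (\<integral>\<^sup>+y. ennreal (cmod (f x)) * ennreal (cmod (f y * of_real (pker M (x - y)))) \<partial>?P)"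
      by (rule nn_integral_cmult[symmetric]) measurable
    also have "\<dots> \<le> (\<integral>\<^sup>+y. (ennreal ((cmod (f x))\<^sup>2) / 2 * ennreal (pker M (x - y)) +
      ennreal ((cmod (f y))\<^sup>2) / 2 * ennreal (pker M (x - y))) \<partial>?P)"
    proof (rule nn_integral_mono)
      fix y
      have "cmod (f x) * cmod (f y) \<le> (cmod (f x))\<^sup>2 / 2 + (cmod (f y))\<^sup>2 / 2"
        using sum_squares_bound[of "cmod (f x)" "cmod (f y)"] by simp
      hence "(cmod (f x) * cmod (f y)) * pker M (x - y) \<le> ((cmod (f x))\<^sup>2 / 2 + (cmod (f y))\<^sup>2 / 2) * pker M (x - y)"
        by (intro mult_right_mono pker_nonneg)
      hence "ennreal ((cmod (f x) * cmod (f y)) * pker M (x - y)) \<le>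
          ennreal ((cmod (f x))\<^sup>2 / 2 * pker M (x - y) + (cmod (f y))\<^sup>2 / 2 * pker M (x - y))"
        by (intro ennreal_leI) (simp add: distrib_right)
      also have "\<dots> = ennreal ((cmod (f x))\<^sup>2) / 2 * ennreal (pker M (x - y)) +
          ennreal ((cmod (f y))\<^sup>2) / 2 * ennreal (pker M (x - y))"
        using pker_nonneg[of M "x - y"]
        by (simp add: ennreal_plus ennreal_mult divide_ennreal[symmetric] ennreal_divide_times ennreal_times_divide)
      finally show "ennreal (cmod (f x)) * ennreal (cmod (f y * of_real (pker M (x - y)))) \<le>
          ennreal ((cmod (f x))\<^sup>2) / 2 * ennreal (pker M (x - y)) +
          ennreal ((cmod (f y))\<^sup>2) / 2 * ennreal (pker M (x - y))"
        by (simp add: norm_mult pker_nonneg mult.assoc flip: ennreal_mult)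
    qed
    finally show "ennreal (cmod (f x * cnj (\<integral>y. f y * of_real (pker M (x - y)) \<partial>?P))) \<le>
      (\<integral>\<^sup>+y. (ennreal ((cmod (f x))\<^sup>2) / 2 * ennreal (pker M (x - y)) +
      ennreal ((cmod (f y))\<^sup>2) / 2 * ennreal (pker M (x - y))) \<partial>?P)" .
  qed
  also have "\<dots> = (\<integral>\<^sup>+x. ennreal ((cmod (f x))\<^sup>2) / 2 \<partial>?P) + (\<integral>\<^sup>+x. ennreal ((cmod (f x))\<^sup>2) / 2 \<partial>?P)"
  proof -
    have id2: "(\<lambda>p. pker M (fst p - snd p)) \<in> borel_measurable (?P \<Otimes>\<^sub>M ?P)"
    proof -
      have id: "(\<lambda>x. x) \<in> measurable ?P borel" by (rule phase_measurableI) simp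
      have "(\<lambda>p. fst p) \<in> measurable (?P \<Otimes>\<^sub>M ?P) borel"
        by (rule measurable_compose[OF measurable_fst id])
      moreover have "(\<lambda>p. snd p) \<in> measurable (?P \<Otimes>\<^sub>M ?P) borel"
        by (rule measurable_compose[OF measurable_snd id])
      ultimately have "(\<lambda>p. fst p - snd p) \<in> measurable (?P \<Otimes>\<^sub>M ?P) borel"
        by (rule borel_measurable_diff)
      from measurable_compose[OF this pker_measurable_borel] show ?thesis .
    qed
    have [measurable]: "(\<lambda>y. pker M (x - y)) \<in> borel_measurable ?P" for x by (rule pker_shift_measurable)
    have kern: "(\<lambda>p. ennreal ((cmod (f (snd p)))\<^sup>2) / 2 * ennreal (pker M (fst p - snd p))) \<in> borel_measurable (?P \<Otimes>\<^sub>M ?P)"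
    proof -
      have "(\<lambda>p. ennreal ((cmod (f (snd p)))\<^sup>2) / 2 * ennreal (q p)) \<in> borel_measurable (?P \<Otimes>\<^sub>M ?P)"
        if [measurable]: "q \<in> borel_measurable (?P \<Otimes>\<^sub>M ?P)" for q by measurable
      from this[OF id2] show ?thesis .
    qed
    have A: "(\<integral>\<^sup>+y. ennreal ((cmod (f x))\<^sup>2) / 2 * ennreal (pker M (x - y)) \<partial>?P) = ennreal ((cmod (f x))\<^sup>2) / 2" for x
      by (subst nn_integral_cmult) (auto simp: pker_integral(3)[OF M])
    have sym: "pker M (x - y) = pker M (y - x)" for x y :: "(real ^ 'n) \<times> (real ^ 'n)"
      using pker_minus[of M "x - y"] by simp
    have B: "(\<integral>\<^sup>+x. \<integral>\<^sup>+y. ennreal ((cmod (f y))\<^sup>2) / 2 * ennreal (pker M (x - y)) \<partial>?P \<partial>?P) =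
        (\<integral>\<^sup>+y. ennreal ((cmod (f y))\<^sup>2) / 2 \<partial>?P)"
    proof -
      have "(\<integral>\<^sup>+x. \<integral>\<^sup>+y. ennreal ((cmod (f y))\<^sup>2) / 2 * ennreal (pker M (x - y)) \<partial>?P \<partial>?P) =
          (\<integral>\<^sup>+y. \<integral>\<^sup>+x. ennreal ((cmod (f y))\<^sup>2) / 2 * ennreal (pker M (x - y)) \<partial>?P \<partial>?P)"
        by (rule PP.Fubini'[symmetric]) (use kern in \<open>simp add: case_prod_unfold\<close>)
      also have "\<dots> = (\<integral>\<^sup>+y. ennreal ((cmod (f y))\<^sup>2) / 2 \<partial>?P)"
        by (subst sym) (simp only: A)
      finally show ?thesis .
    qed
    have "(\<integral>\<^sup>+x. \<integral>\<^sup>+y. (ennreal ((cmod (f x))\<^sup>2) / 2 * ennreal (pker M (x - y)) +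
      ennreal ((cmod (f y))\<^sup>2) / 2 * ennreal (pker M (x - y))) \<partial>?P \<partial>?P) =
      (\<integral>\<^sup>+x. (ennreal ((cmod (f x))\<^sup>2) / 2 + (\<integral>\<^sup>+y. ennreal ((cmod (f y))\<^sup>2) / 2 * ennreal (pker M (x - y)) \<partial>?P)) \<partial>?P)"
      by (subst nn_integral_add) (auto simp: A)
    also have "\<dots> = (\<integral>\<^sup>+x. ennreal ((cmod (f x))\<^sup>2) / 2 \<partial>?P) +
      (\<integral>\<^sup>+x. \<integral>\<^sup>+y. ennreal ((cmod (f y))\<^sup>2) / 2 * ennreal (pker M (x - y)) \<partial>?P \<partial>?P)"
    proof (rule nn_integral_add)
      show "(\<lambda>x. \<integral>\<^sup>+y. ennreal ((cmod (f y))\<^sup>2) / 2 * ennreal (pker M (x - y)) \<partial>?P) \<in> borel_measurable ?P"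
        by (rule sigma_finite_measure.borel_measurable_nn_integral[OF sigma_finite_phase]) (use kern in \<open>simp add: case_prod_unfold\<close>)
    qed measurable
    finally show ?thesis unfolding B .
  qed
  also have "\<dots> = (\<integral>\<^sup>+x. ennreal ((cmod (f x))\<^sup>2) / 2 + ennreal ((cmod (f x))\<^sup>2) / 2 \<partial>?P)"
    by (rule nn_integral_add[symmetric]) measurable
  also have "\<dots> = (\<integral>\<^sup>+x. ennreal ((cmod (f x))\<^sup>2) \<partial>?P)"
    by (intro nn_integral_cong) (simp add: ennreal_divide_numeral flip: ennreal_plus)
  finally show ?thesis .
qed

text \<open>Fatou's lemma removes the damping.\<close>

lemma bessel:
  fixes f :: "(real ^ 'n) \<times> (real ^ 'n) \<Rightarrow> complex"
  assumes f: "integrable phase_space f"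
  shows "(\<integral>\<^sup>+\<xi>. ennreal ((cmod (fourier_L1 f \<xi>))\<^sup>2) \<partial>dual_space) \<le> (\<integral>\<^sup>+x. ennreal ((cmod (f x))\<^sup>2) \<partial>phase_space)"
proof -
  have [measurable]: "fourier_L1 f \<in> borel_measurable dual_space" by (rule fourier_L1_measurable[OF f])
  have lim: "(\<lambda>M. ennreal ((cmod (fourier_L1 f \<xi>))\<^sup>2 * dker (Suc M) \<xi>)) \<longlonglongrightarrow> ennreal ((cmod (fourier_L1 f \<xi>))\<^sup>2)" for \<xi>
    using tendsto_mult[OF tendsto_const LIMSEQ_Suc[OF dker_tendsto], of "(cmod (fourier_L1 f \<xi>))\<^sup>2" \<xi>]
    by (intro tendsto_ennrealI) simp
  have "(\<integral>\<^sup>+\<xi>. ennreal ((cmod (fourier_L1 f \<xi>))\<^sup>2) \<partial>dual_space) =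
      (\<integral>\<^sup>+\<xi>. liminf (\<lambda>M. ennreal ((cmod (fourier_L1 f \<xi>))\<^sup>2 * dker (Suc M) \<xi>)) \<partial>dual_space)"
    by (intro nn_integral_cong) (simp add: lim_imp_Liminf[OF _ lim])
  also have "\<dots> \<le> liminf (\<lambda>M. \<integral>\<^sup>+\<xi>. ennreal ((cmod (fourier_L1 f \<xi>))\<^sup>2 * dker (Suc M) \<xi>) \<partial>dual_space)"
    by (rule nn_integral_liminf) measurable
  also have "\<dots> \<le> liminf (\<lambda>M. \<integral>\<^sup>+x. ennreal ((cmod (f x))\<^sup>2) \<partial>phase_space)"
    by (intro Liminf_mono always_eventually allI bessel_weighted[OF f]) simp
  also have "\<dots> = (\<integral>\<^sup>+x. ennreal ((cmod (f x))\<^sup>2) \<partial>phase_space)" by (simp add: Liminf_const)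
  finally show ?thesis .
qed


section \<open>Limits in mean square\<close>

lemma nn_L2_triangle:
  fixes f g h :: "'a \<Rightarrow> complex"
  assumes [measurable]: "f \<in> borel_measurable M" "g \<in> borel_measurable M" "h \<in> borel_measurable M"
  shows "(\<integral>\<^sup>+x. ennreal ((cmod (f x - h x))\<^sup>2) \<partial>M) \<le>
    2 * (\<integral>\<^sup>+x. ennreal ((cmod (f x - g x))\<^sup>2) \<partial>M) + 2 * (\<integral>\<^sup>+x. ennreal ((cmod (g x - h x))\<^sup>2) \<partial>M)"
proof -
  have "(\<integral>\<^sup>+x. ennreal ((cmod (f x - h x))\<^sup>2) \<partial>M) \<le>
      (\<integral>\<^sup>+x. 2 * ennreal ((cmod (f x - g x))\<^sup>2) + 2 * ennreal ((cmod (g x - h x))\<^sup>2) \<partial>M)"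
  proof (rule nn_integral_mono)
    fix x
    define a b where "a = cmod (f x - g x)" and "b = cmod (g x - h x)"
    have "cmod (f x - h x) \<le> a + b" unfolding a_def b_def by (rule norm_diff_triangle_le) auto
    hence "(cmod (f x - h x))\<^sup>2 \<le> (a + b)\<^sup>2" by (intro power_mono) auto
    also have "\<dots> \<le> 2 * a\<^sup>2 + 2 * b\<^sup>2"
      using sum_squares_bound[of a b] by (simp add: power2_sum)
    finally have "ennreal ((cmod (f x - h x))\<^sup>2) \<le> ennreal (2 * a\<^sup>2 + 2 * b\<^sup>2)" by (rule ennreal_leI)
    thus "ennreal ((cmod (f x - h x))\<^sup>2) \<le> 2 * ennreal (a\<^sup>2) + 2 * ennreal (b\<^sup>2)"
      by (simp add: ennreal_plus ennreal_mult)
  qed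
  also have "\<dots> = 2 * (\<integral>\<^sup>+x. ennreal ((cmod (f x - g x))\<^sup>2) \<partial>M) + 2 * (\<integral>\<^sup>+x. ennreal ((cmod (g x - h x))\<^sup>2) \<partial>M)"
    by (simp add: nn_integral_add nn_integral_cmult)
  finally show ?thesis .
qed

lemma fourier_L1_diff:
  assumes "integrable phase_space f" "integrable phase_space g"
  shows "fourier_L1 (\<lambda>x. f x - g x) \<xi> = fourier_L1 f \<xi> - fourier_L1 g \<xi>"
proof -
  have "integrable phase_space (\<lambda>x. cnj (wave \<xi> x) * f x)" if "integrable phase_space f" for f
    by (rule bounded_times_integrable[OF that, where K = 1]) auto
  hence I: "integrable phase_space (\<lambda>x. f x * cnj (wave \<xi> x))" if "integrable phase_space f" for f
    using that by (simp add: mult.commute)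
  show ?thesis unfolding fourier_L1_wave
    by (simp add: left_diff_distrib Bochner_Integration.integral_diff[OF I[OF assms(1)] I[OF assms(2)]])
qed

text \<open>If two sequences converge to \<open>F\<close> in mean square, Bessel's inequality makes the difference of their
  transforms tend to zero.\<close>

lemma has_fourier_unique:
  fixes F :: "(real ^ 'n) \<times> (real ^ 'n) \<Rightarrow> complex"
  assumes "has_fourier F G" "has_fourier F G'"
  shows "AE \<xi> in dual_space. G \<xi> = G' \<xi>"
proof -
  let ?P = "phase_space :: ((real ^ 'n) \<times> (real ^ 'n)) measure"
  let ?D = "dual_space :: ((int ^ 'n) \<times> (real ^ 'n)) measure"
  obtain f f' where f: "\<And>k. integrable ?P (f k)" "L2_converges ?P f F" "L2_converges ?D (\<lambda>k. fourier_L1 (f k)) G"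
    and f': "\<And>k. integrable ?P (f' k)" "L2_converges ?P f' F" "L2_converges ?D (\<lambda>k. fourier_L1 (f' k)) G'"
    and meas [measurable]: "F \<in> borel_measurable ?P" "G \<in> borel_measurable ?D" "G' \<in> borel_measurable ?D"
    using assms by (auto simp: has_fourier_def square_integrable_def)
  have [measurable]: "f k \<in> borel_measurable ?P" "f' k \<in> borel_measurable ?P" for k
    using f(1) f'(1) by auto
  have [measurable]: "fourier_L1 (f k) \<in> borel_measurable ?D" "fourier_L1 (f' k) \<in> borel_measurable ?D" for k
    using fourier_L1_measurable f(1) f'(1) by auto
  define d where "d M u v = (\<integral>\<^sup>+x. ennreal ((cmod (u x - v x :: complex))\<^sup>2) \<partial>M)" for M :: "'z measure" and u v
  have sym: "d M u v = d M v u" for M :: "'z measure" and u v by (simp add: d_def norm_minus_commute)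
  define e where "e u v = (\<integral>\<^sup>+x. ennreal ((cmod (u x - v x :: complex))\<^sup>2) \<partial>?P)" for u v
  define \<epsilon> where "\<epsilon> u v = (\<integral>\<^sup>+x. ennreal ((cmod (u x - v x :: complex))\<^sup>2) \<partial>?D)" for u v
  have lim: "(\<lambda>k. e (f k) F) \<longlonglongrightarrow> 0" "(\<lambda>k. e (f' k) F) \<longlonglongrightarrow> 0"
    "(\<lambda>k. \<epsilon> (fourier_L1 (f k)) G) \<longlonglongrightarrow> 0" "(\<lambda>k. \<epsilon> (fourier_L1 (f' k)) G') \<longlonglongrightarrow> 0"
    using f f' by (simp_all add: e_def \<epsilon>_def L2_converges_def)
  have "\<epsilon> G G' \<le> 2 * \<epsilon> (fourier_L1 (f k)) G + 2 * (2 * (2 * e (f k) F + 2 * e (f' k) F) + 2 * \<epsilon> (fourier_L1 (f' k)) G')" for k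
  proof -
    have "\<epsilon> G G' \<le> 2 * \<epsilon> G (fourier_L1 (f k)) + 2 * \<epsilon> (fourier_L1 (f k)) G'"
      unfolding \<epsilon>_def by (rule nn_L2_triangle) measurable
    also have "\<epsilon> (fourier_L1 (f k)) G' \<le> 2 * \<epsilon> (fourier_L1 (f k)) (fourier_L1 (f' k)) + 2 * \<epsilon> (fourier_L1 (f' k)) G'"
      unfolding \<epsilon>_def by (rule nn_L2_triangle) measurable
    also have "\<epsilon> (fourier_L1 (f k)) (fourier_L1 (f' k)) \<le> e (f k) (f' k)"
      using bessel[of "\<lambda>x. f k x - f' k x"] f(1) f'(1) by (simp add: \<epsilon>_def e_def fourier_L1_diff)
    also have "e (f k) (f' k) \<le> 2 * e (f k) F + 2 * e F (f' k)"
      unfolding e_def by (rule nn_L2_triangle) measurable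
    also have "e F (f' k) = e (f' k) F" by (simp add: e_def norm_minus_commute)
    also have "\<epsilon> G (fourier_L1 (f k)) = \<epsilon> (fourier_L1 (f k)) G" by (simp add: \<epsilon>_def norm_minus_commute)
    finally show ?thesis by (simp add: mult_left_mono add_left_mono)
  qed
  moreover have "(\<lambda>k. 2 * \<epsilon> (fourier_L1 (f k)) G + 2 * (2 * (2 * e (f k) F + 2 * e (f' k) F) + 2 * \<epsilon> (fourier_L1 (f' k)) G')) \<longlonglongrightarrow>
      2 * 0 + 2 * (2 * (2 * 0 + 2 * 0) + 2 * 0)"
    by (intro tendsto_add ennreal_tendsto_cmult lim) auto
  ultimately have "\<epsilon> G G' \<le> 0" by (intro LIMSEQ_le_const[of _ _ "\<epsilon> G G'"]) auto
  hence "(\<integral>\<^sup>+x. ennreal ((cmod (G x - G' x))\<^sup>2) \<partial>?D) = 0" by (simp add: \<epsilon>_def)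
  hence "AE x in ?D. ennreal ((cmod (G x - G' x))\<^sup>2) = 0"
    by (subst (asm) nn_integral_0_iff_AE) auto
  thus ?thesis by eventually_elim (simp add: ennreal_eq_0_iff)
qed

lemma square_integrable_mult:
  assumes "square_integrable M f" "square_integrable M g"
  shows "integrable M (\<lambda>x. f x * g x)"
proof (rule Bochner_Integration.integrable_bound)
  show "integrable M (\<lambda>x. (cmod (f x))\<^sup>2 + (cmod (g x))\<^sup>2)"
    using assms by (auto simp: square_integrable_def)
  show "(\<lambda>x. f x * g x) \<in> borel_measurable M" using assms by (auto simp: square_integrable_def)
  show "AE x in M. cmod (f x * g x) \<le> norm ((cmod (f x))\<^sup>2 + (cmod (g x))\<^sup>2)"
  proof (rule AE_I2)
    fix x
    have "2 * (cmod (f x) * cmod (g x)) \<le> (cmod (f x))\<^sup>2 + (cmod (g x))\<^sup>2"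
      using sum_squares_bound[of "cmod (f x)" "cmod (g x)"] by simp
    moreover have "0 \<le> cmod (f x) * cmod (g x)" by simp
    ultimately have "cmod (f x) * cmod (g x) \<le> (cmod (f x))\<^sup>2 + (cmod (g x))\<^sup>2" by linarith
    thus "cmod (f x * g x) \<le> norm ((cmod (f x))\<^sup>2 + (cmod (g x))\<^sup>2)" by (simp add: norm_mult)
  qed
qed

text \<open>A weighted form of the Cauchy-Schwarz inequality: \<open>a * b \<le> a\<^sup>2 / c + c * b\<^sup>2\<close> with \<open>c\<close> small
  compared to the norm of \<open>h\<close>.\<close>

lemma L2_limit_integral:
  assumes conv: "L2_converges M f g" and f: "\<And>k. f k \<in> borel_measurable M" "\<And>k. integrable M (\<lambda>x. f k x * h x)"
    and g: "square_integrable M g" and h: "square_integrable M h"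
  shows "(\<lambda>k. \<integral>x. f k x * h x \<partial>M) \<longlonglongrightarrow> (\<integral>x. g x * h x \<partial>M)"
proof (rule tendstoI)
  fix e :: real assume e: "e > 0"
  have [measurable]: "f k \<in> borel_measurable M" "g \<in> borel_measurable M" "h \<in> borel_measurable M" for k
    using f g h by (auto simp: square_integrable_def)
  define H where "H = (\<integral>x. (cmod (h x))\<^sup>2 \<partial>M)"
  have H0: "H \<ge> 0" by (simp add: H_def)
  have nnH: "(\<integral>\<^sup>+x. ennreal ((cmod (h x))\<^sup>2) \<partial>M) = ennreal H"
    unfolding H_def by (rule nn_integral_eq_integral) (use h in \<open>auto simp: square_integrable_def\<close>)
  define c where "c = e / (2 * (H + 1))"
  have c: "c > 0" using e H0 by (simp add: c_def)
  have "eventually (\<lambda>k. (\<integral>\<^sup>+x. ennreal ((cmod (f k x - g x))\<^sup>2) \<partial>M) < ennreal (c * e / 2)) sequentially"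
    using conv c e unfolding L2_converges_def by (intro order_tendstoD) auto
  thus "eventually (\<lambda>k. dist (\<integral>x. f k x * h x \<partial>M) (\<integral>x. g x * h x \<partial>M) < e) sequentially"
  proof eventually_elim
    case (elim k)
    have "(\<integral>x. f k x * h x \<partial>M) - (\<integral>x. g x * h x \<partial>M) = (\<integral>x. (f k x - g x) * h x \<partial>M)"
      using Bochner_Integration.integral_diff[OF f(2) square_integrable_mult[OF g h]]
      by (simp add: left_diff_distrib)
    hence "ennreal (dist (\<integral>x. f k x * h x \<partial>M) (\<integral>x. g x * h x \<partial>M)) = ennreal (cmod (\<integral>x. (f k x - g x) * h x \<partial>M))"
      by (simp add: dist_norm)
    also have "\<dots> \<le> (\<integral>\<^sup>+x. ennreal (cmod ((f k x - g x) * h x)) \<partial>M)" by (rule norm_integral_le_nn)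
    also have "\<dots> \<le> (\<integral>\<^sup>+x. ennreal (1 / c) * ennreal ((cmod (f k x - g x))\<^sup>2) + ennreal c * ennreal ((cmod (h x))\<^sup>2) \<partial>M)"
    proof (rule nn_integral_mono)
      fix x
      define a b where "a = cmod (f k x - g x)" and "b = cmod (h x)"
      have ab: "a \<ge> 0" "b \<ge> 0" by (auto simp: a_def b_def)
      have "2 * (a * b) * c \<le> a\<^sup>2 + (c * b)\<^sup>2" using sum_squares_bound[of a "c * b"] by (simp add: ac_simps)
      moreover have "0 \<le> a * b * c" using ab c by simp
      ultimately have "(a * b) * c \<le> a\<^sup>2 + (c * b)\<^sup>2" by linarith
      hence "a * b \<le> 1 / c * a\<^sup>2 + c * b\<^sup>2" using c by (simp add: field_simps power2_eq_square)
      hence "ennreal (a * b) \<le> ennreal (1 / c * a\<^sup>2 + c * b\<^sup>2)" by (rule ennreal_leI)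
      also have "\<dots> = ennreal (1 / c) * ennreal (a\<^sup>2) + ennreal c * ennreal (b\<^sup>2)"
        using c by (subst ennreal_plus) (auto simp flip: ennreal_mult)
      finally show "ennreal (cmod ((f k x - g x) * h x)) \<le> ennreal (1 / c) * ennreal (a\<^sup>2) + ennreal c * ennreal (b\<^sup>2)"
        by (simp add: a_def b_def norm_mult)
    qed
    also have "\<dots> = ennreal (1 / c) * (\<integral>\<^sup>+x. ennreal ((cmod (f k x - g x))\<^sup>2) \<partial>M) + ennreal c * ennreal H"
      unfolding nnH[symmetric] by (simp add: nn_integral_add nn_integral_cmult)
    also have "\<dots> \<le> ennreal (1 / c) * ennreal (c * e / 2) + ennreal c * ennreal H"
      using elim by (intro add_right_mono mult_left_mono) auto
    also have "\<dots> = ennreal (e / 2 + c * H)"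
      using c e H0 by (simp add: ennreal_plus ennreal_mult[symmetric])
    finally have "dist (\<integral>x. f k x * h x \<partial>M) (\<integral>x. g x * h x \<partial>M) \<le> e / 2 + c * H"
      using e c H0 by (subst (asm) ennreal_le_iff) auto
    also have "c * H < e / 2" using e H0 by (simp add: c_def field_simps)
    finally show ?case by simp
  qed
qed

section \<open>Fourier inversion\<close>

lemma cosk_le_const: "M \<ge> 1 \<Longrightarrow> cosk M \<theta> \<le> 2 * real M"
proof -
  assume M: "M \<ge> 1"
  have "(cos (pi * \<theta>))\<^sup>2 \<le> 1" by (simp add: abs_square_le_1)
  from power_le_one[OF zero_le_power2 this] have "(cos (pi * \<theta>))\<^sup>2 ^ M \<le> 1" .
  hence "2 * real M * (cos (pi * \<theta>))\<^sup>2 ^ M \<le> 2 * real M * 1" by (intro mult_left_mono) auto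
  thus ?thesis using cosk_le[OF M, of \<theta>] by simp
qed

lemma cosk_prod_le:
  fixes \<theta> :: "real ^ 'n"
  assumes M: "M \<ge> 1"
  shows "(\<Prod>j\<in>UNIV. cosk M (\<theta> $ j)) \<le> (2 * real M) ^ CARD('n)"
  using prod_mono[of UNIV "\<lambda>j. cosk M (\<theta> $ j)" "\<lambda>_. 2 * real M"] cosk_nonneg cosk_le_const[OF M] by simp

lemma cosk_prod_le_at:
  fixes \<theta> :: "real ^ 'n"
  assumes M: "M \<ge> 1" and j: "(cos (pi * \<theta> $ j))\<^sup>2 \<le> q"
  shows "(\<Prod>j\<in>UNIV. cosk M (\<theta> $ j)) \<le> (2 * real M) ^ CARD('n) * q ^ M"
proof -
  have "(\<Prod>j\<in>UNIV. cosk M (\<theta> $ j)) = cosk M (\<theta> $ j) * (\<Prod>i\<in>UNIV - {j}. cosk M (\<theta> $ i))"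
    by (rule prod.remove) auto
  also have "\<dots> \<le> (2 * real M * q ^ M) * (\<Prod>i\<in>UNIV - {j}. 2 * real M)"
  proof (rule mult_mono)
    have "cosk M (\<theta> $ j) \<le> 2 * real M * (cos (pi * \<theta> $ j))\<^sup>2 ^ M" by (rule cosk_le[OF M])
    also have "\<dots> \<le> 2 * real M * q ^ M" using j by (intro mult_left_mono power_mono) auto
    finally show "cosk M (\<theta> $ j) \<le> 2 * real M * q ^ M" .
    show "(\<Prod>i\<in>UNIV - {j}. cosk M (\<theta> $ i)) \<le> (\<Prod>i\<in>UNIV - {j}. 2 * real M)"
      by (rule prod_mono) (use cosk_nonneg cosk_le_const[OF M] in auto)
    have "0 \<le> q" using j order_trans zero_le_power2 by blast
    thus "0 \<le> 2 * real M * q ^ M" by simp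
  qed (auto intro!: prod_nonneg cosk_nonneg)
  also have "\<dots> = (2 * real M) * (2 * real M) ^ (CARD('n) - 1) * q ^ M" by (simp add: card_Diff_singleton)
  also have "(2 * real M) * (2 * real M) ^ (CARD('n) - 1) = (2 * real M) ^ CARD('n)"
    by (simp add: power_eq_if)
  finally show ?thesis .
qed

lemma pker_le:
  fixes x :: "(real ^ 'n) \<times> (real ^ 'n)"
  assumes M: "M \<ge> 1"
  shows "pker M x \<le> (2 * real M) ^ CARD('n) * real M ^ CARD('n)"
proof -
  have "exp (- pi * (real M * norm (snd x))\<^sup>2) \<le> 1" by simp
  hence "real M ^ CARD('n) * exp (- pi * (real M * norm (snd x))\<^sup>2) \<le> real M ^ CARD('n) * 1"
    by (intro mult_left_mono) auto
  thus ?thesis unfolding pker_def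
    using cosk_prod_le[OF M, of "fst x"] by (intro mult_mono) auto
qed

lemma square_integrable_bounded:
  fixes g :: "'a \<Rightarrow> complex"
  assumes g: "integrable M g" and K: "\<And>x. cmod (g x) \<le> K"
  shows "square_integrable M g"
proof -
  have "integrable M (\<lambda>x. (cmod (g x))\<^sup>2)"
  proof (rule Bochner_Integration.integrable_bound)
    show "integrable M (\<lambda>x. K * cmod (g x))" using g by simp
    have "0 \<le> K" using K norm_ge_zero order_trans by blast
    thus "AE x in M. norm ((cmod (g x))\<^sup>2) \<le> norm (K * cmod (g x))"
      using K by (auto simp: power2_eq_square abs_mult intro!: mult_right_mono)
  qed (use g in auto)
  thus ?thesis using g by (auto simp: square_integrable_def)
qed

lemma square_integrable_pker:
  assumes M: "M \<ge> 1"
  shows "square_integrable phase_space (\<lambda>y. complex_of_real (pker M (x - y)))"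
proof (rule square_integrable_bounded)
  show "integrable phase_space (\<lambda>y. complex_of_real (pker M (x - y)))"
    unfolding complex_of_real_integrable_eq by (rule pker_integral(1)[OF M])
  show "cmod (complex_of_real (pker M (x - y))) \<le> (2 * real M) ^ CARD('a) * real M ^ CARD('a)" for y
    using pker_le[OF M, of "x - y"] pker_nonneg[of M "x - y"] by simp
qed

text \<open>The smoothing formula for integrable functions passes to mean square limits, since \<open>pker\<close> and
  \<open>dker\<close> are square integrable.\<close>

lemma smoothing_L2:
  fixes F :: "(real ^ 'n) \<times> (real ^ 'n) \<Rightarrow> complex"
  assumes F: "has_fourier F G" and M: "M \<ge> 1"
  shows "(\<integral>\<xi>. G \<xi> * (of_real (dker M \<xi>) * wave \<xi> x) \<partial>dual_space) =
         (\<integral>y. F y * of_real (pker M (x - y)) \<partial>phase_space)"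
proof -
  let ?P = "phase_space :: ((real ^ 'n) \<times> (real ^ 'n)) measure"
  let ?D = "dual_space :: ((int ^ 'n) \<times> (real ^ 'n)) measure"
  obtain f where f: "\<And>k. integrable ?P (f k)" "\<And>k. square_integrable ?P (f k)" "L2_converges ?P f F"
      "L2_converges ?D (\<lambda>k. fourier_L1 (f k)) G"
    and sq: "square_integrable ?P F" "square_integrable ?D G"
    using F by (auto simp: has_fourier_def)
  have "(\<lambda>k. \<integral>y. f k y * of_real (pker M (x - y)) \<partial>?P) \<longlonglongrightarrow> (\<integral>y. F y * of_real (pker M (x - y)) \<partial>?P)"
    by (rule L2_limit_integral[OF f(3) _ _ sq(1) square_integrable_pker[OF M]])
      (use f square_integrable_mult[OF f(2) square_integrable_pker[OF M]] in auto)
  moreover have "(\<lambda>k. \<integral>\<xi>. fourier_L1 (f k) \<xi> * (of_real (dker M \<xi>) * wave \<xi> x) \<partial>?D) \<longlonglongrightarrow>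
      (\<integral>\<xi>. G \<xi> * (of_real (dker M \<xi>) * wave \<xi> x) \<partial>?D)"
  proof (rule L2_limit_integral[OF f(4) _ _ sq(2)])
    show "square_integrable ?D (\<lambda>\<xi>. of_real (dker M \<xi>) * wave \<xi> x)"
      by (rule square_integrable_bounded[OF dker_transform(1)[OF M], where K = 1])
        (auto simp: norm_mult dker_bounds abs_of_nonneg)
    show m: "fourier_L1 (f k) \<in> borel_measurable ?D" for k by (rule fourier_L1_measurable[OF f(1)])
    show "integrable ?D (\<lambda>\<xi>. fourier_L1 (f k) \<xi> * (of_real (dker M \<xi>) * wave \<xi> x))" for k
      by (rule bounded_times_integrable[OF dker_transform(1)[OF M] m fourier_L1_bound[OF f(1)]])
  qed
  ultimately show ?thesis
    unfolding smoothing_formula[OF f(1) M] by (rule LIMSEQ_unique[rotated])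
qed

lemma gaussian_shift_integrable:
  fixes a :: "real ^ 'n"
  shows "integrable lborel (\<lambda>s. exp (- pi * (norm (a - s))\<^sup>2))"
proof -
  have 1: "integrable lborel (\<lambda>b. exp (- pi * (1 * (a $ j - b))\<^sup>2))" for j
  proof -
    have "integrable lborel (\<lambda>b :: real. complex_of_real (exp (- pi * b\<^sup>2)))"
      using gaussian_transform_1d[of 1 0] by (simp add: has_bochner_integral_iff)
    hence "integrable lborel (\<lambda>b :: real. exp (- pi * b\<^sup>2))" by (simp add: complex_of_real_integrable_eq)
    from lborel_integrable_real_affine[OF this, of "- 1" "a $ j"] show ?thesis by simp
  qed
  have "exp (- pi * (norm (a - s))\<^sup>2) = (\<Prod>j\<in>UNIV. exp (- pi * (1 * (a $ j - s $ j))\<^sup>2))" for s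
    using exp_norm_vec[of 1 "a - s"] by simp
  thus ?thesis using vec_product_integral(1)[of "\<lambda>j b. exp (- pi * (1 * (a $ j - b))\<^sup>2)", OF 1] by simp
qed

lemma square_integrable_gaussian:
  fixes x :: "(real ^ 'n) \<times> (real ^ 'n)"
  shows "integrable phase_space (\<lambda>y. complex_of_real (exp (- pi * (norm (snd (x - y)))\<^sup>2)))"
    and "square_integrable phase_space (\<lambda>y. complex_of_real (exp (- pi * (norm (snd (x - y)))\<^sup>2)))"
proof -
  interpret finite_measure "torus :: (real ^ 'n) measure" by (rule finite_measure_torus)
  have "integrable phase_space (\<lambda>y :: (real ^ 'n) \<times> (real ^ 'n). (1 :: real) * exp (- pi * (norm (snd x - snd y))\<^sup>2))"
    using pair_product_integral(1)[OF sigma_finite_torus lborel.sigma_finite_measure_axioms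
        integrable_const[of "1 :: real"] gaussian_shift_integrable[of "snd x"]] by simp
  thus 1: "integrable phase_space (\<lambda>y. complex_of_real (exp (- pi * (norm (snd (x - y)))\<^sup>2)))"
    unfolding complex_of_real_integrable_eq by simp
  show "square_integrable phase_space (\<lambda>y. complex_of_real (exp (- pi * (norm (snd (x - y)))\<^sup>2)))"
    by (rule square_integrable_bounded[OF 1, where K = 1]) simp
qed

lemma cos_gt_near_integer:
  assumes "0 < \<delta>" "\<delta> < 1 / 2" "(cos (pi * \<delta>))\<^sup>2 < (cos (pi * a))\<^sup>2"
  shows "\<exists>k :: int. \<bar>a - of_int k\<bar> < \<delta>"
proof -
  define b where "b = \<bar>a - of_int (round a)\<bar>"
  have b: "0 \<le> b" "b \<le> 1 / 2" using of_int_round_abs_le[of a] by (auto simp: b_def abs_minus_commute)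
  have "(cos (pi * (a - of_int k)))\<^sup>2 = (cos (pi * a))\<^sup>2" for k :: int
    by (simp add: right_diff_distrib cos_diff mult.commute power_mult_distrib)
  from this[of "round a"] have cb: "(cos (pi * a))\<^sup>2 = (cos (pi * b))\<^sup>2"
    unfolding b_def by (cases "a - of_int (round a) \<ge> 0") (simp_all only: abs_of_nonneg abs_of_neg not_le cos_minus mult_minus_right)
  have "cos (pi * \<delta>) < cos (pi * b)"
  proof (rule power2_less_imp_less)
    have "0 \<le> pi * b" "pi * b \<le> pi * (1 / 2)" using b by (auto intro!: mult_left_mono)
    thus "0 \<le> cos (pi * b)" using pi_gt_zero by (intro cos_ge_zero) linarith+
  qed (use assms cb in auto)
  hence "pi * b < pi * \<delta>"
    using b assms by (subst (asm) cos_mono_less_eq) (auto simp: field_simps)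
  hence "b < \<delta>" by simp
  thus ?thesis unfolding b_def by blast
qed

lemma torus_periodic_int:
  assumes F: "torus_periodic F"
  shows "F (\<theta> + (\<chi> j. of_int (m j)), s) = F (\<theta>, s)"
proof -
  have nat: "F (\<theta> + real k *\<^sub>R axis j 1, s) = F (\<theta>, s)" for k j \<theta>
  proof (induction k)
    case (Suc k)
    have eq: "\<theta> + real (Suc k) *\<^sub>R axis j 1 = (\<theta> + real k *\<^sub>R axis j 1) + axis j 1"
      by (simp add: algebra_simps)
    show ?case unfolding eq using F Suc unfolding torus_periodic_def by metis
  qed simp
  have int: "F (\<theta> + real_of_int k *\<^sub>R axis j 1, s) = F (\<theta>, s)" for k j \<theta>
  proof (cases "k \<ge> 0")
    case True
    thus ?thesis using nat[of \<theta> "nat k" j] by simp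
  next
    case False
    thus ?thesis using nat[of "\<theta> + real_of_int k *\<^sub>R axis j 1" "nat (- k)" j] by (simp add: scaleR_left.minus)
  qed
  have "F (\<theta> + (\<Sum>j\<in>J. real_of_int (m j) *\<^sub>R axis j 1), s) = F (\<theta>, s)" if "finite J" for J
    using that
  proof (induction J)
    case (insert i J)
    have eq: "\<theta> + (\<Sum>j\<in>insert i J. real_of_int (m j) *\<^sub>R axis j 1) =
        (\<theta> + (\<Sum>j\<in>J. real_of_int (m j) *\<^sub>R axis j 1)) + real_of_int (m i) *\<^sub>R axis i 1"
      using insert by (simp add: algebra_simps)
    show ?case unfolding eq int by (rule insert.IH)
  qed simp
  moreover have "(\<Sum>j\<in>UNIV. real_of_int (m j) *\<^sub>R axis j (1 :: real)) = (\<chi> j. of_int (m j))"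
    by (simp add: vec_eq_iff axis_def if_distrib cong: if_cong)
  ultimately show ?thesis using finite_class.finite_UNIV by metis
qed

text \<open>Away from the lattice \<open>Z^N \<times> {0}\<close> either one cosine factor is small, or the Gaussian is; in
  both cases a fixed Gaussian remains, which is needed for the integration against a square
  integrable function.\<close>

lemma pker_far:
  fixes x :: "(real ^ 'n) \<times> (real ^ 'n)"
  assumes M: "M \<ge> 1" and q: "0 \<le> q" and \<delta>: "0 \<le> \<delta>"
    and far: "(\<exists>j. (cos (pi * fst x $ j))\<^sup>2 \<le> q) \<or> \<delta> \<le> norm (snd x)"
  shows "pker M x \<le> (2 * real M ^ 2) ^ CARD('n) * (q ^ M + exp (- pi * \<delta>\<^sup>2 * (real M ^ 2 - 1))) * exp (- pi * (norm (snd x))\<^sup>2)"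
proof -
  let ?n = "norm (snd x)"
  have M1: "real M ^ 2 \<ge> 1" using M by simp
  have pw: "(2 * real M) ^ CARD('n) * real M ^ CARD('n) = (2 * real M ^ 2) ^ CARD('n)"
    by (subst power_mult_distrib[symmetric]) (simp only: power2_eq_square mult.assoc)
  have split: "exp (- pi * (real M * ?n)\<^sup>2) = exp (- pi * ?n\<^sup>2 * (real M ^ 2 - 1)) * exp (- pi * ?n\<^sup>2)"
    unfolding exp_add[symmetric] by (rule arg_cong[where f = exp]) (simp add: algebra_simps power_mult_distrib)
  have E1: "exp (- pi * ?n\<^sup>2 * (real M ^ 2 - 1)) \<le> 1" using M1 by simp
  show ?thesis
  proof (cases "\<exists>j. (cos (pi * fst x $ j))\<^sup>2 \<le> q")
    case True
    then obtain j where "(cos (pi * fst x $ j))\<^sup>2 \<le> q" ..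
    from cosk_prod_le_at[OF M this]
    have "pker M x \<le> ((2 * real M) ^ CARD('n) * q ^ M) * (real M ^ CARD('n) * (1 * exp (- pi * ?n\<^sup>2)))"
      unfolding pker_def split using q by (intro mult_mono E1) (auto intro!: mult_nonneg_nonneg)
    also have "\<dots> = (2 * real M ^ 2) ^ CARD('n) * q ^ M * exp (- pi * ?n\<^sup>2)" unfolding pw[symmetric] by simp
    also have "\<dots> \<le> (2 * real M ^ 2) ^ CARD('n) * (q ^ M + exp (- pi * \<delta>\<^sup>2 * (real M ^ 2 - 1))) * exp (- pi * ?n\<^sup>2)"
      by (intro mult_right_mono mult_left_mono) auto
    finally show ?thesis .
  next
    case False
    hence n: "\<delta>\<^sup>2 \<le> ?n\<^sup>2" using far \<delta> by (auto intro: power_mono)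
    have E2: "exp (- pi * ?n\<^sup>2 * (real M ^ 2 - 1)) \<le> exp (- pi * \<delta>\<^sup>2 * (real M ^ 2 - 1))"
      using n M1 by (auto intro!: mult_right_mono)
    have "pker M x \<le> (2 * real M) ^ CARD('n) * (real M ^ CARD('n) * (exp (- pi * \<delta>\<^sup>2 * (real M ^ 2 - 1)) * exp (- pi * ?n\<^sup>2)))"
      unfolding pker_def split by (intro mult_mono E2 cosk_prod_le[OF M]) auto
    also have "\<dots> = (2 * real M ^ 2) ^ CARD('n) * exp (- pi * \<delta>\<^sup>2 * (real M ^ 2 - 1)) * exp (- pi * ?n\<^sup>2)"
      unfolding pw[symmetric] by simp
    also have "\<dots> \<le> (2 * real M ^ 2) ^ CARD('n) * (q ^ M + exp (- pi * \<delta>\<^sup>2 * (real M ^ 2 - 1))) * exp (- pi * ?n\<^sup>2)"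
      using q by (intro mult_right_mono mult_left_mono) auto
    finally show ?thesis .
  qed
qed

lemma far_factor_tendsto:
  assumes "0 < q" "q < 1" "\<delta> > 0"
  shows "(\<lambda>M. (2 * real M ^ 2) ^ N * (q ^ M + exp (- pi * \<delta>\<^sup>2 * (real M ^ 2 - 1)))) \<longlonglongrightarrow> 0"
proof -
  define c where "c = min (- ln q) (pi * \<delta>\<^sup>2)"
  have c: "c > 0" using assms by (simp add: c_def)
  have "(\<lambda>M. 2 * ((2 * real M ^ 2) ^ N * exp (- c * (real M - 1)))) \<longlonglongrightarrow> 0"
  proof -
    have "((\<lambda>x :: real. x ^ (2 * N) / exp x) \<longlongrightarrow> 0) at_top" by (rule tendsto_power_div_exp_0)
    moreover have "filterlim (\<lambda>M. c * real M) at_top sequentially"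
      using c by (intro filterlim_tendsto_pos_mult_at_top[OF tendsto_const]) (auto simp: filterlim_real_sequentially)
    ultimately have "(\<lambda>M. (c * real M) ^ (2 * N) / exp (c * real M)) \<longlonglongrightarrow> 0"
      by (rule filterlim_compose)
    moreover have "(2 * 2 ^ N * exp c / c ^ (2 * N)) * ((c * real M) ^ (2 * N) / exp (c * real M)) =
        2 * ((2 * real M ^ 2) ^ N * exp (- c * (real M - 1)))" for M
    proof -
      have 1: "(c * real M) ^ (2 * N) = c ^ (2 * N) * (real M ^ 2) ^ N"
        by (simp only: power_mult_distrib power_mult)
      have 2: "exp (- c * (real M - 1)) = exp c / exp (c * real M)"
        unfolding exp_diff[symmetric] by (rule arg_cong[where f = exp]) (simp add: algebra_simps)
      have 3: "(2 * real M ^ 2) ^ N = 2 ^ N * (real M ^ 2) ^ N" by (rule power_mult_distrib)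
      show ?thesis unfolding 1 2 3 using c by simp
    qed
    ultimately show ?thesis
      using tendsto_mult_right_zero[of "\<lambda>M. (c * real M) ^ (2 * N) / exp (c * real M)" sequentially "2 * 2 ^ N * exp c / c ^ (2 * N)"]
      by simp
  qed
  moreover have "eventually (\<lambda>M. norm ((2 * real M ^ 2) ^ N * (q ^ M + exp (- pi * \<delta>\<^sup>2 * (real M ^ 2 - 1)))) \<le>
      2 * ((2 * real M ^ 2) ^ N * exp (- c * (real M - 1)))) sequentially"
    using eventually_ge_at_top[of 1]
  proof eventually_elim
    case (elim M)
    have "q ^ M = exp (real M * ln q)" using assms by (simp add: exp_of_nat_mult)
    also have "real M * ln q \<le> - c * (real M - 1)"
    proof -
      have "c * (real M - 1) \<le> c * real M" using c by simp
      also have "\<dots> \<le> - ln q * real M" by (intro mult_right_mono) (auto simp: c_def)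
      finally show ?thesis by (simp add: mult.commute)
    qed
    finally have 1: "q ^ M \<le> exp (- c * (real M - 1))" by simp
    have "c * (real M - 1) \<le> pi * \<delta>\<^sup>2 * (real M ^ 2 - 1)"
      using elim c by (intro mult_mono) (auto simp: c_def power2_eq_square)
    hence 2: "exp (- pi * \<delta>\<^sup>2 * (real M ^ 2 - 1)) \<le> exp (- c * (real M - 1))" by simp
    have "(2 * real M ^ 2) ^ N * (q ^ M + exp (- pi * \<delta>\<^sup>2 * (real M ^ 2 - 1))) \<le>
        (2 * real M ^ 2) ^ N * (2 * exp (- c * (real M - 1)))"
    proof (rule mult_left_mono)
      show "q ^ M + exp (- pi * \<delta>\<^sup>2 * (real M ^ 2 - 1)) \<le> 2 * exp (- c * (real M - 1))"
        using 1 2 by linarith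
    qed simp
    thus ?case using assms by simp
  qed
  ultimately show ?thesis by (rule Lim_null_comparison[rotated])
qed

text \<open>Near \<open>x\<close>, up to integer translations of the angles, continuity applies. Far away the kernel is
  at most a null sequence times a fixed Gaussian, and \<open>F\<close> times a Gaussian is integrable because
  \<open>F\<close> is square integrable.\<close>

lemma approximate_identity:
  fixes F :: "(real ^ 'n) \<times> (real ^ 'n) \<Rightarrow> complex"
  assumes per: "torus_periodic F" and cont: "continuous_on UNIV F" and sq: "square_integrable phase_space F"
  shows "(\<lambda>M. \<integral>y. F y * of_real (pker M (x - y)) \<partial>phase_space) \<longlonglongrightarrow> F x"
proof (rule LIMSEQ_I)
  let ?P = "phase_space :: ((real ^ 'n) \<times> (real ^ 'n)) measure"
  fix r :: real assume r: "r > 0"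
  define e where "e = r / 2"
  have e: "e > 0" using r by (simp add: e_def)
  define \<Gamma> where "\<Gamma> y = exp (- pi * (norm (snd (x - y)))\<^sup>2)" for y
  have "isCont F x" using cont continuous_on_eq_continuous_at[of UNIV F] by blast
  then obtain d where d: "d > 0" "\<And>y. dist y x < d \<Longrightarrow> dist (F y) (F x) < e"
    using e unfolding continuous_at_eps_delta by blast
  define \<delta> where "\<delta> = min (1 / 4) (d / (2 * (real CARD('n) + 1)))"
  have \<delta>: "0 < \<delta>" "\<delta> < 1 / 2" using d by (auto simp: \<delta>_def)
  have \<delta>d: "(real CARD('n) + 1) * \<delta> < d"
  proof -
    have "(real CARD('n) + 1) * \<delta> \<le> (real CARD('n) + 1) * (d / (2 * (real CARD('n) + 1)))"
      by (intro mult_left_mono) (auto simp: \<delta>_def)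
    also have "\<dots> = d / 2" by (simp add: field_simps)
    finally show ?thesis using d by linarith
  qed
  \<comment> \<open>The squared cosine exceeds \<open>q\<close> exactly at distance less than \<open>\<delta>\<close> from an integer.\<close>
  define q where "q = (cos (pi * \<delta>))\<^sup>2"
  have cp: "0 < cos (pi * \<delta>)" using \<delta> by (intro cos_gt_zero_pi) (auto simp: field_simps intro: less_trans[of _ 0])
  have "cos (pi * \<delta>) < cos 0" using \<delta> by (subst cos_mono_less_eq) auto
  hence q: "0 < q" "q < 1" using cp by (auto simp: q_def power_less_one_iff abs_square_less_1)
  define \<sigma> where "\<sigma> M = (2 * real M ^ 2) ^ CARD('n) * (q ^ M + exp (- pi * \<delta>\<^sup>2 * (real M ^ 2 - 1)))" for M
  have \<sigma>: "\<sigma> \<longlonglongrightarrow> 0" unfolding \<sigma>_def by (rule far_factor_tendsto[OF q \<delta>(1)])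
  have \<sigma>0: "\<sigma> M \<ge> 0" for M using q by (simp add: \<sigma>_def)
  have near: "cmod (F y - F x) < e"
    if n: "\<And>j. q < (cos (pi * fst (x - y) $ j))\<^sup>2" "norm (snd (x - y)) < \<delta>" for y
  proof -
    have "\<exists>k :: int. \<bar>fst (x - y) $ j - of_int k\<bar> < \<delta>" for j
      using cos_gt_near_integer[OF \<delta>, of "fst (x - y) $ j"] n(1)[of j] by (simp add: q_def)
    then obtain k :: "'n \<Rightarrow> int" where k: "\<And>j. \<bar>fst (x - y) $ j - of_int (k j)\<bar> < \<delta>" by metis
    \<comment> \<open>The translate of \<open>y\<close> by integers that is close to \<open>x\<close>.\<close>
  define y' where "y' = (fst y + (\<chi> j. of_int (k j)), snd y)"
    have "F y' = F y" unfolding y'_def using torus_periodic_int[OF per, of "fst y" k "snd y"] by simp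
    moreover have "dist y' x < d"
    proof -
      have "norm (fst y' - fst x) \<le> (\<Sum>j\<in>UNIV. \<bar>(fst y' - fst x) $ j\<bar>)" by (rule norm_le_l1_cart)
      also have "\<dots> \<le> (\<Sum>j\<in>(UNIV :: 'n set). \<delta>)"
      proof (rule sum_mono)
        fix j show "\<bar>(fst y' - fst x) $ j\<bar> \<le> \<delta>" using k[of j] by (simp add: y'_def abs_minus_commute algebra_simps)
      qed
      finally have 1: "norm (fst y' - fst x) \<le> real CARD('n) * \<delta>" by simp
      have 2: "norm (snd y' - snd x) < \<delta>" using n(2) by (simp add: y'_def norm_minus_commute)
      have "dist y' x \<le> norm (fst y' - fst x) + norm (snd y' - snd x)"
        unfolding dist_norm using norm_Pair_le[of "fst y' - fst x" "snd y' - snd x"] by (simp add: minus_prod_def)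
      thus ?thesis using 1 2 \<delta>d by (simp add: algebra_simps)
    qed
    ultimately show ?thesis using d(2)[of y'] by (simp add: dist_norm)
  qed
  define K where "K = (\<integral>y. (cmod (F y) + cmod (F x)) * \<Gamma> y \<partial>?P)"
  have intG: "integrable ?P (\<lambda>y. (cmod (F y) + cmod (F x)) * \<Gamma> y)"
  proof -
    have "integrable ?P (\<lambda>y. norm (F y * complex_of_real (\<Gamma> y)))"
      using square_integrable_mult[OF sq square_integrable_gaussian(2)[of x]] by (simp add: \<Gamma>_def)
    hence "integrable ?P (\<lambda>y. cmod (F y) * \<Gamma> y)" by (simp add: norm_mult \<Gamma>_def)
    moreover have "integrable ?P \<Gamma>"
      using square_integrable_gaussian(1)[of x] unfolding complex_of_real_integrable_eq by (simp add: \<Gamma>_def[abs_def])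
    ultimately show ?thesis by (simp add: distrib_right)
  qed
  have "(\<lambda>M. \<sigma> M * K) \<longlonglongrightarrow> 0 * K" by (intro tendsto_mult \<sigma> tendsto_const)
  hence "eventually (\<lambda>M. \<sigma> M * K < e) sequentially" using e by (intro order_tendstoD) auto
  hence "eventually (\<lambda>M. norm ((\<integral>y. F y * of_real (pker M (x - y)) \<partial>?P) - F x) < r) sequentially"
    using eventually_ge_at_top[of 1]
  proof eventually_elim
    case (elim M)
    have intF: "integrable ?P (\<lambda>y. F y * of_real (pker M (x - y)))"
      by (rule square_integrable_mult[OF sq square_integrable_pker[OF elim(2)]])
    have intp: "integrable ?P (\<lambda>y. complex_of_real (pker M (x - y)))"
      unfolding complex_of_real_integrable_eq by (rule pker_integral(1)[OF elim(2)])
    have "(\<integral>y. complex_of_real (pker M (x - y)) \<partial>?P) = 1"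
      unfolding integral_complex_of_real pker_integral(2)[OF elim(2)] by simp
    hence "(\<integral>y. F y * of_real (pker M (x - y)) \<partial>?P) - F x =
        (\<integral>y. F y * of_real (pker M (x - y)) \<partial>?P) - (\<integral>y. F x * of_real (pker M (x - y)) \<partial>?P)" by simp
    also have "\<dots> = (\<integral>y. (F y - F x) * of_real (pker M (x - y)) \<partial>?P)"
      by (subst Bochner_Integration.integral_diff[OF intF, symmetric]) (use intp in \<open>auto simp: left_diff_distrib\<close>)
    finally have "norm ((\<integral>y. F y * of_real (pker M (x - y)) \<partial>?P) - F x) \<le>
        (\<integral>y. norm ((F y - F x) * of_real (pker M (x - y))) \<partial>?P)" by simp
    also have "\<dots> \<le> (\<integral>y. e * pker M (x - y) + \<sigma> M * ((cmod (F y) + cmod (F x)) * \<Gamma> y) \<partial>?P)"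
    proof (rule integral_mono)
      have "integrable ?P (\<lambda>y. F y * of_real (pker M (x - y)) - F x * of_real (pker M (x - y)))"
        using intF intp by auto
      thus "integrable ?P (\<lambda>y. norm ((F y - F x) * of_real (pker M (x - y))))"
        by (intro integrable_norm) (simp add: left_diff_distrib)
      show "integrable ?P (\<lambda>y. e * pker M (x - y) + \<sigma> M * ((cmod (F y) + cmod (F x)) * \<Gamma> y))"
        by (intro Bochner_Integration.integrable_add integrable_mult_right intG pker_integral(1)[OF elim(2)])
      fix y
      have p0: "pker M (x - y) \<ge> 0" by (rule pker_nonneg)
      have eq: "norm ((F y - F x) * of_real (pker M (x - y))) = cmod (F y - F x) * pker M (x - y)"
        using p0 by (simp add: norm_mult)
      show "norm ((F y - F x) * of_real (pker M (x - y))) \<le> e * pker M (x - y) + \<sigma> M * ((cmod (F y) + cmod (F x)) * \<Gamma> y)"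
      proof (cases "(\<exists>j. (cos (pi * fst (x - y) $ j))\<^sup>2 \<le> q) \<or> \<delta> \<le> norm (snd (x - y))")
        case True
        have "pker M (x - y) \<le> \<sigma> M * \<Gamma> y"
          unfolding \<sigma>_def \<Gamma>_def using pker_far[OF elim(2) _ _ True] q \<delta> by simp
        moreover have "cmod (F y - F x) \<le> cmod (F y) + cmod (F x)" by (rule norm_triangle_ineq4)
        ultimately have "cmod (F y - F x) * pker M (x - y) \<le> (cmod (F y) + cmod (F x)) * (\<sigma> M * \<Gamma> y)"
          using p0 by (intro mult_mono) auto
        moreover have "0 \<le> e * pker M (x - y)" using e p0 by simp
        ultimately show ?thesis unfolding eq by (simp add: ac_simps)
      next
        case False
        hence "cmod (F y - F x) < e" by (intro near) (auto simp: not_le)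
        hence "cmod (F y - F x) * pker M (x - y) \<le> e * pker M (x - y)" using p0 by (intro mult_right_mono) auto
        moreover have "0 \<le> \<sigma> M * ((cmod (F y) + cmod (F x)) * \<Gamma> y)"
          using \<sigma>0 by (auto simp: \<Gamma>_def intro!: mult_nonneg_nonneg add_nonneg_nonneg)
        ultimately show ?thesis unfolding eq by linarith
      qed
    qed
    also have "\<dots> = e + \<sigma> M * K"
      using pker_integral(1,2)[OF elim(2), of x] intG by (simp add: K_def)
    also have "\<dots> < r" using elim(1) by (simp add: e_def)
    finally show ?case .
  qed
  thus "\<exists>no. \<forall>n\<ge>no. norm ((\<integral>y. F y * of_real (pker n (x - y)) \<partial>?P) - F x) < r"
    by (simp add: eventually_sequentially)
qed

text \<open>The damped inversion formula converges to \<open>F x\<close> by the approximate identity, and to the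
  integral of \<open>G\<close> by dominated convergence.\<close>

theorem fourier_inversion:
  fixes F :: "(real ^ 'n) \<times> (real ^ 'n) \<Rightarrow> complex"
  assumes per: "torus_periodic F" and cont: "continuous_on UNIV F"
    and F: "has_fourier F G" and G: "integrable dual_space G"
  shows "F x = (\<integral>\<xi>. G \<xi> * wave \<xi> x \<partial>dual_space)"
proof -
  let ?D = "dual_space :: ((int ^ 'n) \<times> (real ^ 'n)) measure"
  have sq: "square_integrable phase_space F" using F by (simp add: has_fourier_def)
  have [measurable]: "G \<in> borel_measurable ?D" using G by auto
  have lim: "(\<lambda>M. \<integral>\<xi>. G \<xi> * (of_real (dker M \<xi>) * wave \<xi> x) \<partial>?D) \<longlonglongrightarrow> (\<integral>\<xi>. G \<xi> * (1 * wave \<xi> x) \<partial>?D)"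
  proof (rule integral_dominated_convergence[where w = "\<lambda>\<xi>. cmod (G \<xi>)"])
    show "AE \<xi> in ?D. (\<lambda>M. G \<xi> * (of_real (dker M \<xi>) * wave \<xi> x)) \<longlonglongrightarrow> G \<xi> * (1 * wave \<xi> x)"
    proof (rule AE_I2)
      fix \<xi> :: "(int ^ 'n) \<times> (real ^ 'n)"
      have "(\<lambda>M. complex_of_real (dker M \<xi>)) \<longlonglongrightarrow> of_real 1" by (intro tendsto_of_real dker_tendsto)
      thus "(\<lambda>M. G \<xi> * (of_real (dker M \<xi>) * wave \<xi> x)) \<longlonglongrightarrow> G \<xi> * (1 * wave \<xi> x)"
        by (intro tendsto_mult tendsto_const) simp
    qed
    show "AE \<xi> in ?D. norm (G \<xi> * (of_real (dker M \<xi>) * wave \<xi> x)) \<le> cmod (G \<xi>)" for M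
    proof (rule AE_I2)
      fix \<xi> :: "(int ^ 'n) \<times> (real ^ 'n)"
      show "norm (G \<xi> * (of_real (dker M \<xi>) * wave \<xi> x)) \<le> cmod (G \<xi>)"
        using dker_bounds[of M \<xi>] by (simp add: norm_mult mult_left_le)
    qed
  qed (use G in auto)
  have ev: "eventually (\<lambda>M. (\<integral>y. F y * of_real (pker M (x - y)) \<partial>phase_space) =
      (\<integral>\<xi>. G \<xi> * (of_real (dker M \<xi>) * wave \<xi> x) \<partial>?D)) sequentially"
    using eventually_ge_at_top[of 1] by eventually_elim (simp add: smoothing_L2[OF F])
  have "(\<lambda>M. \<integral>\<xi>. G \<xi> * (of_real (dker M \<xi>) * wave \<xi> x) \<partial>?D) \<longlonglongrightarrow> F x"
    by (rule Lim_transform_eventually[OF approximate_identity[OF per cont sq, of x] ev])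
  with lim have "F x = (\<integral>\<xi>. G \<xi> * (1 * wave \<xi> x) \<partial>?D)"
    by (intro LIMSEQ_unique)
  thus ?thesis by simp
qed


section \<open>The upper bound\<close>

text \<open>A wave at a point of the orbit is the direction of a character value, twisted by a phase that
  depends on the moduli alone.\<close>

lemma wave_at_point:
  fixes \<alpha> :: "complex ^ 'n"
  assumes "\<And>j. \<alpha> $ j \<noteq> 0"
  shows "wave (n, t) (angles \<alpha>, log_moduli \<alpha>) = sgn (monomial_char n \<alpha>) * cis (2 * pi * (t \<bullet> log_moduli \<alpha>))"
proof -
  have "sgn (monomial_char n \<alpha>) = (\<Prod>j\<in>UNIV. sgn (\<alpha> $ j) powi (n $ j))"
  proof -
    have sp: "sgn (z powi k) = sgn z powi k" if "z \<noteq> 0" for z :: complex and k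
      using that by (simp add: sgn_div_norm norm_power_int scaleR_conv_of_real power_int_mult_distrib power_int_inverse of_real_power_int)
    have "sgn (\<Prod>j\<in>J. \<alpha> $ j powi (n $ j)) = (\<Prod>j\<in>J. sgn (\<alpha> $ j) powi (n $ j))" for J :: "'n set"
      by (induction J rule: infinite_finite_induct) (auto simp: sgn_mult sp assms)
    thus ?thesis by (simp add: monomial_char_def)
  qed
  also have "\<dots> = (\<Prod>j\<in>UNIV. cis (2 * pi * (real_of_int (n $ j) * angles \<alpha> $ j)))"
  proof (rule prod.cong)
    fix j
    have "sgn (\<alpha> $ j) = cis (Arg (\<alpha> $ j))" using assms by (simp add: cis_Arg)
    thus "sgn (\<alpha> $ j) powi (n $ j) = cis (2 * pi * (real_of_int (n $ j) * angles \<alpha> $ j))"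
      by (simp add: angles_def cis_power_int)
  qed simp
  finally show ?thesis
    by (simp add: wave_def distrib_left sum_distrib_left cis_sum[symmetric] flip: cis_mult)
qed

lemma torus_wave_integral:
  fixes \<xi> :: "(int ^ 'n) \<times> (real ^ 'n)"
  shows "(\<integral>\<theta>. wave \<xi> (\<theta>, 0) \<partial>torus) = (if fst \<xi> = 0 then 1 else 0)"
proof -
  have eq: "wave \<xi> (\<theta>, 0) = (\<Prod>j\<in>UNIV. 1 * cis (2 * pi * (real_of_int (fst \<xi> $ j) * \<theta> $ j)))" for \<theta>
    using wave_split[of "fst \<xi>" "snd \<xi>" \<theta> 0] by simp
  have "(\<integral>\<theta>. wave \<xi> (\<theta>, 0) \<partial>torus) = (\<Prod>j\<in>UNIV. if fst \<xi> $ j = 0 then 1 else 0)"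
    unfolding eq by (subst torus_product_integral(2)[OF integral_wave_1d(1)]) (simp add: integral_wave_1d(2))
  also have "\<dots> = (if fst \<xi> = 0 then 1 else 0)"
  proof (cases "fst \<xi> = 0")
    case False
    then obtain j where "fst \<xi> $ j \<noteq> 0" by (auto simp: vec_eq_iff)
    hence "(\<Prod>j\<in>UNIV. if fst \<xi> $ j = 0 then 1 else 0 :: complex) = 0" by (intro prod_zero bexI[of _ j]) auto
    thus ?thesis using False by simp
  qed simp
  finally show ?thesis .
qed

lemma torus_average_of_inversion:
  fixes G :: "(int ^ 'n) \<times> (real ^ 'n) \<Rightarrow> complex"
  assumes G: "integrable dual_space G"
  shows "(\<integral>\<theta>. (\<integral>\<xi>. G \<xi> * wave \<xi> (\<theta>, 0) \<partial>dual_space) \<partial>torus) =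
         (\<integral>\<xi>. G \<xi> * (if fst \<xi> = 0 then 1 else 0) \<partial>dual_space)"
proof -
  let ?T = "torus :: (real ^ 'n) measure" and ?D = "dual_space :: ((int ^ 'n) \<times> (real ^ 'n)) measure"
  interpret finite_measure ?T by (rule finite_measure_torus)
  interpret TD: pair_sigma_finite ?D ?T
    by (simp add: pair_sigma_finite_def sigma_finite_torus sigma_finite_dual)
  have [measurable]: "G \<in> borel_measurable ?D" using G by auto
  have "(\<lambda>p. wave (fst p) (snd p, 0)) \<in> borel_measurable (?D \<Otimes>\<^sub>M ?T)"
  proof -
    have "(\<lambda>p. (fst p, (snd p, 0))) \<in> measurable (?D \<Otimes>\<^sub>M ?T) (?D \<Otimes>\<^sub>M (phase_space :: ((real ^ 'n) \<times> (real ^ 'n)) measure))"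
      by measurable
    from measurable_compose[OF this wave_measurable] show ?thesis by simp
  qed
  hence m: "(\<lambda>(\<xi>, \<theta>). G \<xi> * wave \<xi> (\<theta>, 0)) \<in> borel_measurable (?D \<Otimes>\<^sub>M ?T)"
    unfolding case_prod_unfold by measurable
  have "integrable (?D \<Otimes>\<^sub>M ?T) (\<lambda>p. G (fst p) * 1)"
    by (rule pair_product_integral(1)[OF sigma_finite_dual sigma_finite_torus G integrable_const])
  hence "integrable (?D \<Otimes>\<^sub>M ?T) (\<lambda>(\<xi>, \<theta>). G \<xi> * wave \<xi> (\<theta>, 0))"
    by (rule Bochner_Integration.integrable_bound[OF _ m]) (auto simp: norm_mult)
  from TD.Fubini_integral[OF this]
  have "(\<integral>\<theta>. (\<integral>\<xi>. G \<xi> * wave \<xi> (\<theta>, 0) \<partial>?D) \<partial>?T) = (\<integral>\<xi>. (\<integral>\<theta>. G \<xi> * wave \<xi> (\<theta>, 0) \<partial>?T) \<partial>?D)" .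
  thus ?thesis by (simp only: integral_mult_right_zero torus_wave_integral)
qed

lemma norm_cis_minus_one_le: "cmod (cis y - 1) \<le> \<bar>y\<bar>"
proof -
  have "cmod (cis y - 1) = 2 * \<bar>sin (y / 2)\<bar>" using dist_exp_i_1[of y] by (simp add: cis_conv_exp)
  also have "\<dots> \<le> 2 * \<bar>y / 2\<bar>" by (intro mult_left_mono abs_sin_x_le_abs_x) auto
  finally show ?thesis by simp
qed

text \<open>The two terms of the weight in the bound correspond to the twist and to the
  character: replacing the twist \<open>cis y\<close> by \<open>1\<close> costs at most \<open>\<bar>y\<bar>\<close> and at most \<open>2\<close>, and the
  average of the character is small unless \<open>n = 0\<close>.\<close>

lemma wave_average_bound:
  fixes \<xi> :: "complex ^ 'n"
  assumes \<xi>: "torus_point \<xi>" and \<gamma>: "0 < \<gamma>" "\<gamma> \<le> 1 / 2"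
  defines "S \<equiv> galois_orbit \<xi>"
  shows "cmod ((\<Sum>\<alpha>\<in>S. wave (n, t) (angles \<alpha>, log_moduli \<alpha>)) / of_nat (card S) - (if n = 0 then 1 else 0)) \<le>
    (2 * (8 * pi) powr \<gamma> * infnorm t powr \<gamma> + 24 powr \<gamma> * real_of_int (l1_norm n) powr \<gamma>) * height_D \<xi> powr \<gamma>"
proof -
  define M where "M = real (card S)"
  have M: "M > 0" using card_galois_orbit_pos[OF \<xi>] by (simp add: M_def S_def)
  have hD: "height_D \<xi> > 0" by (rule height_D_pos[OF \<xi>])
  define c where "c \<alpha> = cis (2 * pi * (t \<bullet> log_moduli \<alpha>))" for \<alpha> :: "complex ^ 'n"
  define z where "z \<alpha> = sgn (monomial_char n \<alpha>)" for \<alpha> :: "complex ^ 'n"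
  have w: "wave (n, t) (angles \<alpha>, log_moduli \<alpha>) = z \<alpha> + z \<alpha> * (c \<alpha> - 1)" if "\<alpha> \<in> S" for \<alpha>
    using wave_at_point[of \<alpha> n t] orbit_coord_nz[OF \<xi>] that by (simp add: z_def c_def S_def algebra_simps)
  have zn: "cmod (z \<alpha>) \<le> 1" for \<alpha> by (simp add: z_def norm_sgn)
  have "(\<Sum>\<alpha>\<in>S. wave (n, t) (angles \<alpha>, log_moduli \<alpha>)) / of_nat (card S) - (if n = 0 then 1 else 0) =
      ((\<Sum>\<alpha>\<in>S. z \<alpha>) / of_nat (card S) - (if n = 0 then 1 else 0)) + (\<Sum>\<alpha>\<in>S. z \<alpha> * (c \<alpha> - 1)) / of_nat (card S)"
    using w by (simp add: sum.distrib add_divide_distrib)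
  also have "cmod \<dots> \<le> cmod ((\<Sum>\<alpha>\<in>S. z \<alpha>) / of_nat (card S) - (if n = 0 then 1 else 0)) +
      cmod ((\<Sum>\<alpha>\<in>S. z \<alpha> * (c \<alpha> - 1)) / of_nat (card S))" by (rule norm_triangle_ineq)
  also have "cmod ((\<Sum>\<alpha>\<in>S. z \<alpha>) / of_nat (card S) - (if n = 0 then 1 else 0)) \<le>
      24 powr \<gamma> * real_of_int (l1_norm n) powr \<gamma> * height_D \<xi> powr \<gamma>"
  proof (cases "n = 0")
    case True
    have "(\<Sum>\<alpha>\<in>S. z \<alpha>) / of_nat (card S) = 1" using M True by (simp add: z_def monomial_char_def M_def)
    thus ?thesis using True by simp
  next
    case False
    have "0 \<le> real_of_int (l1_norm n)" using l1_norm_pos[OF False] by simp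
    thus ?thesis
      using character_average_bound[OF \<xi> False \<gamma>] False hD by (simp add: z_def S_def powr_mult)
  qed
  also have "cmod ((\<Sum>\<alpha>\<in>S. z \<alpha> * (c \<alpha> - 1)) / of_nat (card S)) \<le> 2 * ((8 * pi * infnorm t * height_D \<xi>) powr \<gamma>)"
  proof -
    define Z where "Z = 8 * pi * infnorm t * height_D \<xi>"
    have Z0: "Z \<ge> 0" using hD by (simp add: Z_def infnorm_pos_le)
    have "cmod (z \<alpha> * (c \<alpha> - 1)) \<le> cmod (c \<alpha> - 1)" for \<alpha>
      using zn[of \<alpha>] by (simp add: norm_mult mult_left_le_one_le)
    hence le: "cmod (\<Sum>\<alpha>\<in>S. z \<alpha> * (c \<alpha> - 1)) \<le> (\<Sum>\<alpha>\<in>S. cmod (c \<alpha> - 1))" by (intro sum_norm_le)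
    have "(\<Sum>\<alpha>\<in>S. cmod (c \<alpha> - 1)) \<le> (\<Sum>\<alpha>\<in>S. 2)"
      using norm_triangle_ineq4[of "c _" 1] by (intro sum_mono) (simp add: c_def order_trans[OF norm_triangle_ineq4])
    hence b1: "cmod ((\<Sum>\<alpha>\<in>S. z \<alpha> * (c \<alpha> - 1)) / of_nat (card S)) \<le> 2"
      using le M by (simp add: norm_divide M_def divide_le_eq)
    have "(\<Sum>\<alpha>\<in>S. cmod (c \<alpha> - 1)) \<le> (\<Sum>\<alpha>\<in>S. 2 * pi * infnorm t * (\<Sum>j\<in>UNIV. \<bar>log_moduli \<alpha> $ j\<bar>))"
    proof (rule sum_mono)
      fix \<alpha> :: "complex ^ 'n"
      have "cmod (c \<alpha> - 1) \<le> \<bar>2 * pi * (t \<bullet> log_moduli \<alpha>)\<bar>" unfolding c_def by (rule norm_cis_minus_one_le)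
      also have "\<dots> = 2 * pi * \<bar>\<Sum>j\<in>UNIV. t $ j * log_moduli \<alpha> $ j\<bar>" by (simp add: abs_mult inner_vec_def)
      also have "\<bar>\<Sum>j\<in>UNIV. t $ j * log_moduli \<alpha> $ j\<bar> \<le> (\<Sum>j\<in>UNIV. infnorm t * \<bar>log_moduli \<alpha> $ j\<bar>)"
        by (rule order_trans[OF sum_abs])
          (auto simp: abs_mult intro!: sum_mono mult_right_mono component_le_infnorm_cart)
      finally show "cmod (c \<alpha> - 1) \<le> 2 * pi * infnorm t * (\<Sum>j\<in>UNIV. \<bar>log_moduli \<alpha> $ j\<bar>)"
        by (simp add: sum_distrib_left mult.assoc)
    qed
    also have "\<dots> = 2 * pi * infnorm t * (\<Sum>\<alpha>\<in>S. \<Sum>j\<in>UNIV. \<bar>log_moduli \<alpha> $ j\<bar>)" by (simp add: sum_distrib_left)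
    also have "\<dots> \<le> 2 * pi * infnorm t * (2 * M * height \<xi>)"
      using average_log_moduli[OF \<xi>] by (intro mult_left_mono) (auto simp: S_def M_def infnorm_pos_le)
    also have "\<dots> \<le> 2 * pi * infnorm t * (2 * M * height_D \<xi>)"
    proof -
      have "height \<xi> \<le> height_D \<xi>" using gen_degree_pos[OF \<xi>] by (simp add: height_D_def)
      thus ?thesis using M by (intro mult_left_mono) (auto simp: infnorm_pos_le)
    qed
    finally have "(\<Sum>\<alpha>\<in>S. cmod (c \<alpha> - 1)) \<le> M * Z"
    proof -
      assume a: "(\<Sum>\<alpha>\<in>S. cmod (c \<alpha> - 1)) \<le> 2 * pi * infnorm t * (2 * M * height_D \<xi>)"
      have "2 * pi * infnorm t * (2 * M * height_D \<xi>) = M * Z / 2" by (simp add: Z_def)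
      moreover have "0 \<le> M * Z" using M Z0 by simp
      ultimately show ?thesis using a by linarith
    qed
    hence b2: "cmod ((\<Sum>\<alpha>\<in>S. z \<alpha> * (c \<alpha> - 1)) / of_nat (card S)) \<le> Z"
      using le M by (simp add: norm_divide M_def divide_le_eq mult.commute)
    show ?thesis unfolding Z_def[symmetric]
    proof (cases "Z \<le> 1")
      case True
      have "Z \<le> Z powr \<gamma>"
      proof (cases "Z = 0")
        case False
        hence "Z powr 1 \<le> Z powr \<gamma>" using Z0 True \<gamma> by (intro powr_mono') auto
        thus ?thesis using Z0 False by simp
      qed simp
      also have "\<dots> \<le> 2 * Z powr \<gamma>" by simp
      finally show "cmod ((\<Sum>\<alpha>\<in>S. z \<alpha> * (c \<alpha> - 1)) / of_nat (card S)) \<le> 2 * Z powr \<gamma>" using b2 by linarith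
    next
      case False
      hence "1 \<le> Z powr \<gamma>" using \<gamma> by (intro ge_one_powr_ge_zero) auto
      thus "cmod ((\<Sum>\<alpha>\<in>S. z \<alpha> * (c \<alpha> - 1)) / of_nat (card S)) \<le> 2 * Z powr \<gamma>" using b1 by linarith
    qed
  qed
  also have "2 * ((8 * pi * infnorm t * height_D \<xi>) powr \<gamma>) = 2 * (8 * pi) powr \<gamma> * infnorm t powr \<gamma> * height_D \<xi> powr \<gamma>"
    using hD by (simp add: powr_mult infnorm_pos_le)
  finally show ?thesis by (simp add: algebra_simps)
qed

lemma fourier_test_function:
  assumes "F \<in> test_functions"
  shows "has_fourier F (fourier F)" "integrable dual_space (fourier F)"
proof -
  obtain G where G: "has_fourier F G" "integrable dual_space G" using assms by (auto simp: test_functions_def)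
  show h: "has_fourier F (fourier F)" unfolding fourier_def using G(1) by (rule someI[of "has_fourier F"])
  have "AE \<xi> in dual_space. G \<xi> = fourier F \<xi>" by (rule has_fourier_unique[OF G(1) h])
  thus "integrable dual_space (fourier F)"
    using G(2) h integrable_cong_AE[of G dual_space "fourier F"]
    by (auto simp: has_fourier_def square_integrable_def)
qed

lemma count_lborel_nn_integral:
  fixes f :: "(int ^ 'n) \<times> (real ^ 'n) \<Rightarrow> ennreal"
  assumes "f \<in> borel_measurable dual_space"
  shows "(\<integral>\<^sup>+n. (\<integral>\<^sup>+t. f (n, t) \<partial>lborel) \<partial>count_space UNIV) = (\<integral>\<^sup>+\<xi>. f \<xi> \<partial>dual_space)"
  by (rule lborel.nn_integral_fst[OF assms])

lemma bound_weight_measurable: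
  "(\<lambda>\<xi> :: (int ^ 'n) \<times> (real ^ 'n). 2 * (8 * pi) powr \<gamma> * infnorm (snd \<xi>) powr \<gamma> + 24 powr \<gamma> * real_of_int (l1_norm (fst \<xi>)) powr \<gamma>)
     \<in> borel_measurable dual_space"
proof -
  have [measurable]: "(infnorm :: real ^ 'n \<Rightarrow> real) \<in> borel_measurable borel"
    by (intro borel_measurable_continuous_onI continuous_on_infnorm continuous_on_id)
  have 1: "(\<lambda>n :: int ^ 'n. real_of_int (l1_norm n)) \<in> borel_measurable (count_space UNIV)" by simp
  have [measurable]: "(\<lambda>\<xi>. real_of_int (l1_norm (fst \<xi>))) \<in> borel_measurable (dual_space :: ((int ^ 'n) \<times> (real ^ 'n)) measure)"
    using 1 by measurable
  show ?thesis by measurable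
qed

text \<open>Inversion reduces the claim to a single wave, for which the integral over the unit polycircle
  is \<open>1\<close> or \<open>0\<close> according to whether \<open>n = 0\<close>.\<close>

theorem equidistribution_upper_bound:
  fixes \<xi> :: "complex ^ 'n"
  assumes \<xi>: "torus_point \<xi>" and \<gamma>: "0 < \<gamma>" "\<gamma> \<le> 1 / 2" and F: "F \<in> test_functions"
  shows "ennreal (equidist_error F \<xi>) \<le> bound_const \<gamma> F * ennreal (height_D \<xi> powr \<gamma>)"
proof -
  let ?D = "dual_space :: ((int ^ 'n) \<times> (real ^ 'n)) measure"
  define G where "G = fourier F"
  define S where "S = galois_orbit \<xi>"
  define x where "x \<alpha> = (angles \<alpha>, log_moduli \<alpha>)" for \<alpha> :: "complex ^ 'n"
  define W where "W \<zeta> = 2 * (8 * pi) powr \<gamma> * infnorm (snd \<zeta>) powr \<gamma> + 24 powr \<gamma> * real_of_int (l1_norm (fst \<zeta>)) powr \<gamma>"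
    for \<zeta> :: "(int ^ 'n) \<times> (real ^ 'n)"
  have hf: "has_fourier F G" and G: "integrable ?D G" unfolding G_def by (rule fourier_test_function[OF F])+
  have mG [measurable]: "G \<in> borel_measurable ?D" using G by auto
  have mW [measurable]: "W \<in> borel_measurable ?D" unfolding W_def by (rule bound_weight_measurable)
  have inv: "F y = (\<integral>\<zeta>. G \<zeta> * wave \<zeta> y \<partial>?D)" for y
    using F hf G by (intro fourier_inversion) (auto simp: test_functions_def)
  have int: "integrable ?D (\<lambda>\<zeta>. G \<zeta> * wave \<zeta> y)" for y
    using bounded_times_integrable[OF G wave_measurable_dual[of y], of 1] by (simp add: mult.commute)
  have int0: "integrable ?D (\<lambda>\<zeta>. G \<zeta> * (if fst \<zeta> = 0 then 1 else 0))"
  proof -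
    have 1: "(\<lambda>n :: int ^ 'n. if n = 0 then 1 else 0 :: complex) \<in> borel_measurable (count_space UNIV)" by simp
    have "(\<lambda>\<zeta>. if fst \<zeta> = 0 then 1 else 0 :: complex) \<in> borel_measurable ?D"
      by (rule measurable_compose[OF measurable_fst 1])
    from bounded_times_integrable[OF G this, of 1] show ?thesis by (simp add: mult.commute)
  qed
  define A where "A \<zeta> = (\<Sum>\<alpha>\<in>S. wave \<zeta> (x \<alpha>)) / of_nat (card S) - (if fst \<zeta> = 0 then 1 else 0)" for \<zeta>
  have e1: "1 / of_nat (card S) * (\<Sum>\<alpha>\<in>S. F (x \<alpha>)) = (\<integral>\<zeta>. (\<Sum>\<alpha>\<in>S. G \<zeta> * wave \<zeta> (x \<alpha>)) / of_nat (card S) \<partial>?D)"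
    unfolding inv by (subst Bochner_Integration.integral_sum[symmetric]) (auto intro: int)
  have e2: "(LINT \<theta>|torus. F (\<theta>, 0)) = (\<integral>\<zeta>. G \<zeta> * (if fst \<zeta> = 0 then 1 else 0) \<partial>?D)"
    unfolding inv by (rule torus_average_of_inversion[OF G])
  have "equidist_error F \<xi> = cmod ((\<integral>\<zeta>. (\<Sum>\<alpha>\<in>S. G \<zeta> * wave \<zeta> (x \<alpha>)) / of_nat (card S) \<partial>?D) -
      (\<integral>\<zeta>. G \<zeta> * (if fst \<zeta> = 0 then 1 else 0) \<partial>?D))"
    unfolding equidist_error_def S_def[symmetric] x_def[symmetric] e1 e2 ..
  also have "\<dots> = cmod (\<integral>\<zeta>. G \<zeta> * A \<zeta> \<partial>?D)"
    by (subst Bochner_Integration.integral_diff[symmetric])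
      (auto simp: A_def right_diff_distrib sum_distrib_left intro!: int int0 integrable_divide Bochner_Integration.integrable_sum)
  finally have "ennreal (equidist_error F \<xi>) \<le> (\<integral>\<^sup>+\<zeta>. ennreal (cmod (G \<zeta> * A \<zeta>)) \<partial>?D)"
    using norm_integral_le_nn[of ?D "\<lambda>\<zeta>. G \<zeta> * A \<zeta>"] by simp
  also have "\<dots> \<le> (\<integral>\<^sup>+\<zeta>. ennreal (cmod (G \<zeta>) * W \<zeta>) * ennreal (height_D \<xi> powr \<gamma>) \<partial>?D)"
  proof (rule nn_integral_mono)
    fix \<zeta> :: "(int ^ 'n) \<times> (real ^ 'n)"
    have "cmod (A \<zeta>) \<le> W \<zeta> * height_D \<xi> powr \<gamma>"
      using wave_average_bound[OF \<xi> \<gamma>, of "fst \<zeta>" "snd \<zeta>"] by (simp add: A_def W_def S_def x_def)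
    hence "cmod (G \<zeta> * A \<zeta>) \<le> cmod (G \<zeta>) * W \<zeta> * height_D \<xi> powr \<gamma>"
      by (simp add: norm_mult mult.assoc mult_left_mono)
    hence "ennreal (cmod (G \<zeta> * A \<zeta>)) \<le> ennreal (cmod (G \<zeta>) * W \<zeta> * height_D \<xi> powr \<gamma>)" by (rule ennreal_leI)
    also have "\<dots> = ennreal (cmod (G \<zeta>) * W \<zeta>) * ennreal (height_D \<xi> powr \<gamma>)"
      by (rule ennreal_mult) (auto simp: W_def)
    finally show "ennreal (cmod (G \<zeta> * A \<zeta>)) \<le> ennreal (cmod (G \<zeta>) * W \<zeta>) * ennreal (height_D \<xi> powr \<gamma>)" .
  qed
  also have "\<dots> = (\<integral>\<^sup>+\<zeta>. ennreal (cmod (G \<zeta>) * W \<zeta>) \<partial>?D) * ennreal (height_D \<xi> powr \<gamma>)"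
    by (rule nn_integral_multc) measurable
  also have "(\<integral>\<^sup>+\<zeta>. ennreal (cmod (G \<zeta>) * W \<zeta>) \<partial>?D) = bound_const \<gamma> F"
    unfolding bound_const_def G_def[symmetric]
    by (subst count_lborel_nn_integral[symmetric]) (measurable, simp add: W_def)
  finally show ?thesis .
qed


section \<open>Radical points\<close>

text \<open>The points \<open>(q\<^sub>j\<^bsup>1/p\<^esup>)\<close> for distinct primes \<open>q j\<close>. Their conjugates all have the same
  moduli, at distance about \<open>1 / p\<close> from the unit polycircle, while their \<open>height_D\<close> is at
  most of the order \<open>ln p / p\<close>.\<close>

definition radical_point :: "('n \<Rightarrow> nat) \<Rightarrow> nat \<Rightarrow> complex ^ 'n" where
  "radical_point q p = (\<chi> j. of_real (root p (real (q j))))"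

context
  fixes q :: "'n::finite \<Rightarrow> nat" and p :: nat
  assumes q: "\<And>j. prime (q j)" "inj q" and p: "prime p"
begin

lemma radical_power: "(radical_point q p $ j) ^ p = of_nat (q j)"
proof -
  have "root p (real (q j)) ^ p = real (q j)" using p by (intro real_root_pow_pos2) (auto simp: prime_gt_0_nat)
  thus ?thesis unfolding radical_point_def by (simp flip: of_real_power)
qed

lemma radical_nonzero: "radical_point q p $ j \<noteq> 0"
  using radical_power[of j] q(1)[of j] p by (auto simp: prime_gt_0_nat power_0_left)

lemma radical_annihilator: "poly (complex_poly (monom 1 p - [:int (q j):])) y = y ^ p - of_nat (q j)"
  by (simp add: complex_poly_diff map_poly_monom map_poly_pCons poly_monom)

lemma radical_annihilator_monic: "monom 1 p - [:int (q j):] \<noteq> 0" "lead_coeff (monom 1 p - [:int (q j):]) = 1"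
proof -
  have p0: "p > 0" using p by (simp add: prime_gt_0_nat)
  have c: "coeff (monom 1 p - [:int (q j):]) p = 1" using p0 by (simp add: coeff_pCons split: nat.splits)
  moreover have "degree (monom 1 p - [:int (q j):]) = p"
  proof (rule antisym)
    show "degree (monom 1 p - [:int (q j):]) \<le> p" by (intro degree_diff_le) (auto simp: degree_monom_le)
    show "p \<le> degree (monom 1 p - [:int (q j):])" using c by (intro le_degree) simp
  qed
  ultimately show "lead_coeff (monom 1 p - [:int (q j):]) = 1" by simp
  thus "monom 1 p - [:int (q j):] \<noteq> 0" by force
qed

lemma radical_algebraic: "algebraic (radical_point q p $ j)"
proof (rule algebraicI)
  show "complex_poly (monom 1 p - [:int (q j):]) \<noteq> 0" using radical_annihilator_monic(1) by simp
  show "poly (complex_poly (monom 1 p - [:int (q j):])) (radical_point q p $ j) = 0"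
    unfolding radical_annihilator radical_power by simp
qed simp

lemma torus_point_radical: "torus_point (radical_point q p)"
  using radical_algebraic radical_nonzero by (simp add: torus_point_def)

lemma ln_cmod_of_power:
  assumes "y ^ p = of_nat (q j)"
  shows "ln (cmod y) = ln (real (q j)) / real p"
proof -
  have p0: "p > 0" using p by (simp add: prime_gt_0_nat)
  have "y \<noteq> 0" using assms q(1)[of j] p0 by (auto simp: power_0_left)
  have "cmod y ^ p = real (q j)" using arg_cong[OF assms, of cmod] by (simp add: norm_power)
  hence "ln (real (q j)) = real p * ln (cmod y)" using \<open>y \<noteq> 0\<close> by (metis ln_realpow zero_less_norm_iff)
  thus ?thesis using p0 by simp
qed

text \<open>The minimal polynomial divides the monic polynomial \<open>X^p - q j\<close>, so it is monic, and all its roots have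
  the same modulus.\<close>

lemma weil_height_radical: "weil_height (radical_point q p $ j) = ln (real (q j)) / real p"
proof -
  let ?x = "radical_point q p $ j" and ?f = "monom 1 p - [:int (q j):]"
  note alg = radical_algebraic[of j]
  have q1: "real (q j) \<ge> 1" using prime_ge_1_nat[OF q(1)[of j]] by simp
  have dvd: "int_minpoly ?x dvd ?f"
    by (rule minpoly_dvd[OF int_minpoly[OF alg]]) (simp only: radical_annihilator radical_power diff_self)
  then obtain g where g: "?f = int_minpoly ?x * g" by (auto elim: dvdE)
  have "lead_coeff (int_minpoly ?x) * lead_coeff g = 1"
    using radical_annihilator_monic(2)[of j] unfolding g lead_coeff_mult .
  hence lc: "lead_coeff (int_minpoly ?x) = 1"
    using lead_coeff_int_minpoly_pos[OF alg] by (metis zmult_eq_1_iff not_numeral_less_zero zero_less_one not_less_iff_gr_or_eq neg_0_less_iff_less)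
  have "log_plus (cmod y) = ln (real (q j)) / real p" if "y \<in> conjugates ?x" for y
  proof -
    have "poly (complex_poly ?f) y = 0"
      using that unfolding g complex_poly_mult by (simp add: conjugates_def)
    hence "y ^ p = of_nat (q j)" unfolding radical_annihilator by simp
    thus ?thesis using ln_cmod_of_power q1 by (simp add: log_plus_def)
  qed
  hence "real (alg_degree ?x) * weil_height ?x = real (alg_degree ?x) * (ln (real (q j)) / real p)"
    unfolding weil_height_conjugates[OF alg] lc by (simp add: card_conjugates[OF alg])
  moreover have "real (alg_degree ?x) \<noteq> 0" using alg_degree_pos[OF alg] by simp
  ultimately show ?thesis unfolding mult_left_cancel[OF \<open>real (alg_degree ?x) \<noteq> 0\<close>] by blast
qed

lemma log_moduli_radical_orbit:
  assumes "\<alpha> \<in> galois_orbit (radical_point q p)"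
  shows "log_moduli \<alpha> = (\<chi> j. ln (real (q j)) / real p)"
proof -
  obtain \<sigma> where \<sigma>: "\<sigma> \<in> gal_Qbar" "\<alpha> = gal_act \<sigma> (radical_point q p)"
    using assms by (auto simp: galois_orbit_eq)
  have "(\<alpha> $ j) ^ p = of_nat (q j)" for j
  proof -
    have "(\<alpha> $ j) ^ p = \<sigma> ((radical_point q p $ j) ^ p)"
      using gal_power[OF \<sigma>(1) radical_algebraic[of j], of p] by (simp add: \<sigma>(2) gal_act_def)
    thus ?thesis unfolding radical_power by (simp add: gal_rat[OF \<sigma>(1)])
  qed
  thus ?thesis by (simp add: log_moduli_def vec_eq_iff ln_cmod_of_power)
qed

text \<open>All conjugates of a monomial \<open>\<eta>\<close> in the radicals have the same modulus, so \<open>\<bar>\<eta>\<bar>\<^sup>d\<close> is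
  rational for the degree \<open>d\<close> of \<open>\<eta>\<close>. Comparing powers of \<open>q j\<close> in its \<open>p\<close>-th power
  shows that \<open>p\<close> divides \<open>d\<close> times the \<open>j\<close>-th exponent.\<close>

lemma prime_dvd_radical_degree:
  "int p dvd int (alg_degree (monomial_char n (radical_point q p))) * (n $ j)"
proof -
  define \<eta> where "\<eta> = monomial_char n (radical_point q p)"
  define d where "d = alg_degree \<eta>"
  define a where "a i = nat (n $ i)" for i
  define b where "b i = nat (- (n $ i))" for i
  define Qa where "Qa = (\<Prod>i\<in>UNIV. q i ^ a i)"
  define Qb where "Qb = (\<Prod>i\<in>UNIV. q i ^ b i)"
  have p0: "p > 0" using p by (simp add: prime_gt_0_nat)
  have q0: "q i > 0" for i using q(1)[of i] by (simp add: prime_gt_0_nat)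
  have alg: "algebraic \<eta>" unfolding \<eta>_def by (rule monomial_algebraic[OF torus_point_radical])
  have pw: "z powi k * z ^ nat (- k) = z ^ nat k" if "z \<noteq> 0" for z :: complex and k
    using that by (auto simp: power_int_def power_inverse)
  have "\<eta> ^ p * of_nat Qb = of_nat Qa"
  proof -
    have "\<eta> ^ p * of_nat Qb = (\<Prod>i\<in>UNIV. ((radical_point q p $ i) powi (n $ i) * (radical_point q p $ i) ^ b i) ^ p)"
    proof -
      have "of_nat Qb = (\<Prod>i\<in>UNIV. ((radical_point q p $ i) ^ b i) ^ p)"
        unfolding Qb_def power_mult[symmetric] mult.commute[of _ p] by (simp add: power_mult radical_power)
      thus ?thesis by (simp add: \<eta>_def monomial_char_def prod_power_distrib power_mult_distrib prod.distrib)
    qed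
    also have "\<dots> = (\<Prod>i\<in>UNIV. ((radical_point q p $ i) ^ a i) ^ p)"
      using pw[OF radical_nonzero] by (simp add: a_def b_def)
    also have "\<dots> = of_nat Qa"
      unfolding Qa_def power_mult[symmetric] mult.commute[of _ p] by (simp add: power_mult radical_power)
    finally show ?thesis .
  qed
  hence cj: "cmod y ^ p * real Qb = real Qa" if yC: "y \<in> conjugates \<eta>" for y
  proof -
    assume eq: "\<eta> ^ p * of_nat Qb = of_nat Qa"
    obtain \<sigma> where \<sigma>: "\<sigma> \<in> gal_Qbar" "\<sigma> \<eta> = y" using galois_transitive[OF alg yC] by blast
    have "algebraic (\<eta> ^ p)" using is_subring_power[OF is_subring_Qbar] alg by simp
    hence "\<sigma> (\<eta> ^ p * of_nat Qb) = y ^ p * of_nat Qb"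
      using \<sigma> alg by (simp add: gal_mult gal_power gal_rat)
    hence "y ^ p * of_nat Qb = of_nat Qa" unfolding eq by (simp add: gal_rat[OF \<sigma>(1)])
    from arg_cong[OF this, of cmod] show ?thesis by (simp add: norm_mult norm_power)
  qed
  let ?m = "int_minpoly \<eta>"
  have "of_int (coeff ?m 0) = coeff (smult (of_int (lead_coeff ?m)) (\<Prod>y\<in>conjugates \<eta>. [:- y, 1:])) 0"
    using int_minpoly_decompose[OF alg] by (metis coeff_complex_poly)
  also have "\<dots> = of_int (lead_coeff ?m) * (\<Prod>y\<in>conjugates \<eta>. - y)"
    by (simp add: poly_0_coeff_0[symmetric] poly_prod)
  finally have c0: "(\<Prod>y\<in>conjugates \<eta>. cmod y) * \<bar>real_of_int (lead_coeff ?m)\<bar> = \<bar>real_of_int (coeff ?m 0)\<bar>"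
    by (metis (no_types, lifting) mult.commute norm_mult norm_of_int prod_norm norm_minus_cancel prod.cong)
  define c where "c = nat \<bar>lead_coeff ?m\<bar>"
  define e where "e = nat \<bar>coeff ?m 0\<bar>"
  have c: "c > 0" using lead_coeff_int_minpoly_pos[OF alg] by (simp add: c_def)
  have Q0: "Qa > 0" "Qb > 0" using q0 by (auto simp: Qa_def Qb_def)
  have "real (e ^ p * Qb ^ d) = ((\<Prod>y\<in>conjugates \<eta>. cmod y) * real c) ^ p * (\<Prod>y\<in>conjugates \<eta>. real Qb)"
    using c0 by (simp add: e_def c_def card_conjugates[OF alg] d_def)
  also have "\<dots> = real c ^ p * (\<Prod>y\<in>conjugates \<eta>. cmod y ^ p * real Qb)"
    by (simp add: power_mult_distrib prod.distrib prod_power_distrib)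
  also have "\<dots> = real (c ^ p * Qa ^ d)"
    using cj by (simp add: card_conjugates[OF alg] d_def)
  finally have eq: "e ^ p * Qb ^ d = c ^ p * Qa ^ d" by (simp only: of_nat_eq_iff)
  have e: "e > 0"
  proof (rule ccontr)
    assume "\<not> e > 0"
    hence "c ^ p * Qa ^ d = 0" using eq p0 by (simp add: power_0_left)
    thus False using c Q0 by simp
  qed
  have mult: "multiplicity (q j) (\<Prod>i\<in>UNIV. q i ^ f i) = f j" for f
  proof -
    have "multiplicity (q j) (\<Prod>i\<in>UNIV. q i ^ f i) = (\<Sum>i\<in>UNIV. multiplicity (q j) (q i ^ f i))"
      using q0 q(1)[of j] by (intro prime_elem_multiplicity_prod_distrib) (auto simp: image_iff)
    also have "\<dots> = (\<Sum>i\<in>UNIV. if i = j then f j else 0)"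
    proof (rule sum.cong)
      fix i
      have "multiplicity (q j) (q i) = (if i = j then 1 else 0)"
      proof (cases "i = j")
        case False
        hence "q j \<noteq> q i" using q(2) by (auto dest: injD)
        thus ?thesis using False prime_multiplicity_other[OF q(1)[of j] q(1)[of i]] by simp
      qed (use q(1)[of j] in simp)
      thus "multiplicity (q j) (q i ^ f i) = (if i = j then f j else 0)"
        using q0[of i] q(1)[of j] by (simp add: prime_elem_multiplicity_power_distrib)
    qed simp
    finally show ?thesis by simp
  qed
  have pe: "prime_elem (q j)" using q(1)[of j] by simp
  have pm: "multiplicity (q j) (x ^ p * y ^ d) = p * multiplicity (q j) x + d * multiplicity (q j) y"
    if "x > 0" "y > 0" for x y
    using that pe by (simp add: prime_elem_multiplicity_mult_distrib prime_elem_multiplicity_power_distrib)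
  have "multiplicity (q j) Qa = a j" "multiplicity (q j) Qb = b j" unfolding Qa_def Qb_def by (rule mult)+
  hence "p * multiplicity (q j) e + d * b j = p * multiplicity (q j) c + d * a j"
    using arg_cong[OF eq, of "multiplicity (q j)"] pm[OF e Q0(2)] pm[OF c Q0(1)] by simp
  hence "int d * (int (a j) - int (b j)) = int p * (int (multiplicity (q j) e) - int (multiplicity (q j) c))"
    by (simp add: algebra_simps flip: of_nat_mult of_nat_add)
  moreover have "int (a j) - int (b j) = n $ j" by (simp add: a_def b_def)
  ultimately show ?thesis by (simp add: d_def \<eta>_def)
qed

text \<open>If \<open>p\<close> divides all exponents, one of them is at least \<open>p\<close> in absolute value. Otherwise \<open>p\<close>
  divides the degree of the monomial.\<close>

lemma gen_degree_radical_ge: "p \<le> gen_degree (radical_point q p)"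
  unfolding gen_degree_def
proof (rule cINF_greatest)
  have "axis undefined 1 \<in> - {0 :: int ^ 'n}" by (simp add: axis_eq_0_iff)
  thus "- {0 :: int ^ 'n} \<noteq> {}" by blast
  fix n :: "int ^ 'n" assume "n \<in> - {0}"
  hence n: "n \<noteq> 0" by simp
  let ?d = "alg_degree (monomial_char n (radical_point q p))"
  have d: "?d \<ge> 1" using alg_degree_pos[OF monomial_algebraic[OF torus_point_radical], of n] by simp
  have l: "nat (l1_norm n) \<ge> 1" using l1_norm_pos[OF n] by simp
  show "p \<le> nat (l1_norm n) * ?d"
  proof (cases "\<forall>j. int p dvd n $ j")
    case True
    obtain j where j: "n $ j \<noteq> 0" using n by (auto simp: vec_eq_iff)
    have "int p \<le> \<bar>n $ j\<bar>" using dvd_imp_le_int[OF j, of "int p"] True by simp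
    also have "\<dots> \<le> l1_norm n" unfolding l1_norm_def by (rule member_le_sum) auto
    finally have "p \<le> nat (l1_norm n)" by simp
    also have "\<dots> \<le> nat (l1_norm n) * ?d" using d by simp
    finally show ?thesis .
  next
    case False
    then obtain j where "\<not> int p dvd n $ j" by blast
    hence "int p dvd int ?d"
      using prime_dvd_radical_degree[of n j] p by (simp add: prime_dvd_mult_iff)
    hence "p dvd ?d" by simp
    hence "p \<le> ?d" using d by (intro dvd_imp_le) auto
    also have "\<dots> \<le> nat (l1_norm n) * ?d" using l by simp
    finally show ?thesis .
  qed
qed

lemma height_D_radical_le:
  "height_D (radical_point q p) \<le> ((\<Sum>j\<in>UNIV. ln (real (q j))) + ln (2 * real p)) / real p"
proof -
  have "height (radical_point q p) = (\<Sum>j\<in>UNIV. ln (real (q j))) / real p"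
    by (simp add: height_def weil_height_radical sum_divide_distrib)
  moreover have "ln (2 * real (gen_degree (radical_point q p))) / real (gen_degree (radical_point q p)) \<le> ln (2 * real p) / real p"
    using gen_degree_radical_ge prime_ge_1_nat[OF p] by (intro ln_div_antimono) auto
  moreover have "0 \<le> ln (2 * real p) / real p" using prime_ge_1_nat[OF p] by simp
  ultimately show ?thesis by (simp add: height_D_def add_divide_distrib)
qed

end


section \<open>Lacunary Gaussian test functions\<close>

text \<open>A Gaussian times a superposition of oscillations in one logarithmic modulus. The coefficients
  \<open>c\<close> and frequencies \<open>\<tau>\<close> are chosen later so that the \<open>c\<close> are just summable with the
  weights \<open>(1 + \<tau>) powr \<gamma>\<close>.\<close>

definition lacunary :: "(nat \<Rightarrow> real) \<Rightarrow> (nat \<Rightarrow> real) \<Rightarrow> 'n \<Rightarrow> real ^ 'n \<Rightarrow> complex" where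
  "lacunary c \<tau> j s = of_real (exp (- pi * (norm s)\<^sup>2)) * (\<Sum>i. of_real (c i) * cis (2 * pi * (\<tau> i * s $ j)))"

lemma wave_at_angle_moduli: "wave (n, t) (\<theta>, s) = wave (n, t) (\<theta>, 0) * cis (2 * pi * (t \<bullet> s))"
  by (simp add: wave_def cis_mult distrib_left)

lemma one_plus_times_gaussian_le: "0 \<le> x \<Longrightarrow> (1 + x) * exp (- pi * x\<^sup>2) \<le> 2 * exp (- pi * x\<^sup>2 / 2)"
proof -
  assume x: "0 \<le> (x :: real)"
  have "2 * x \<le> x\<^sup>2 + 1"
    using zero_le_power2[of "x - 1"] by (simp add: power2_eq_square algebra_simps)
  moreover have "2 * x\<^sup>2 \<le> pi * x\<^sup>2" using pi_ge_two by (intro mult_right_mono) auto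
  ultimately have "1 + x \<le> 2 + pi * x\<^sup>2" using zero_le_power2[of x] by linarith
  also have "\<dots> = 2 * (1 + pi * x\<^sup>2 / 2)" by (simp add: algebra_simps)
  also have "\<dots> \<le> 2 * exp (pi * x\<^sup>2 / 2)" by (intro mult_left_mono exp_ge_add_one_self) auto
  finally have "(1 + x) * exp (- pi * x\<^sup>2) \<le> 2 * exp (pi * x\<^sup>2 / 2) * exp (- pi * x\<^sup>2)"
    by (intro mult_right_mono) auto
  also have "\<dots> = 2 * exp (- pi * x\<^sup>2 / 2)" by (simp add: mult.assoc flip: exp_add)
  finally show ?thesis .
qed

lemma gaussian_half_nn:
  fixes a :: "real ^ 'n"
  shows "(\<integral>\<^sup>+t. ennreal (exp (- pi * (norm (t - a))\<^sup>2 / 2)) \<partial>lborel) = (\<integral>\<^sup>+t. ennreal (exp (- pi * (norm (t :: real ^ 'n))\<^sup>2 / 2)) \<partial>lborel)"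
    and "(\<integral>\<^sup>+t. ennreal (exp (- pi * (norm (t :: real ^ 'n))\<^sup>2 / 2)) \<partial>lborel) < \<infinity>"
proof -
  have [measurable]: "(\<lambda>t :: real ^ 'n. ennreal (exp (- pi * (norm t)\<^sup>2 / 2))) \<in> borel_measurable borel" by measurable
  have "(\<integral>\<^sup>+t. ennreal (exp (- pi * (norm (t :: real ^ 'n))\<^sup>2 / 2)) \<partial>lborel) =
      (\<integral>\<^sup>+t. ennreal (exp (- pi * (norm (t :: real ^ 'n))\<^sup>2 / 2)) \<partial>distr lborel borel ((+) (- a)))"
    by (simp only: lborel_distr_plus)
  also have "\<dots> = (\<integral>\<^sup>+t. ennreal (exp (- pi * (norm (- a + t))\<^sup>2 / 2)) \<partial>lborel)"
    by (rule nn_integral_distr) measurable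
  finally show "(\<integral>\<^sup>+t. ennreal (exp (- pi * (norm (t - a))\<^sup>2 / 2)) \<partial>lborel) = (\<integral>\<^sup>+t. ennreal (exp (- pi * (norm (t :: real ^ 'n))\<^sup>2 / 2)) \<partial>lborel)"
    by (simp add: add.commute)
  have "integrable lborel (\<lambda>t :: real ^ 'n. complex_of_real (exp (- pi * (norm t / sqrt 2)\<^sup>2)))"
    using gaussian_transform[of "sqrt 2" "0 :: real ^ 'n"] by (simp add: has_bochner_integral_iff)
  hence "integrable lborel (\<lambda>t :: real ^ 'n. exp (- pi * (norm t)\<^sup>2 / 2))"
    unfolding complex_of_real_integrable_eq by (simp add: power_divide)
  from this[THEN nn_integral_eq_integral] show "(\<integral>\<^sup>+t. ennreal (exp (- pi * (norm (t :: real ^ 'n))\<^sup>2 / 2)) \<partial>lborel) < \<infinity>"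
    by simp
qed

context
  fixes c \<tau> :: "nat \<Rightarrow> real" and \<gamma> :: real and j :: "'n::finite"
  assumes c: "\<And>i. c i \<ge> 0" and \<tau>: "\<And>i. \<tau> i \<ge> 0" and \<gamma>: "0 < \<gamma>" "\<gamma> \<le> 1 / 2"
    and sum: "summable (\<lambda>i. c i * (1 + \<tau> i) powr \<gamma>)"
begin

lemma lacunary_summable_coeff: "summable c"
proof (rule summable_comparison_test[OF _ sum])
  have "c i * 1 \<le> c i * (1 + \<tau> i) powr \<gamma>" for i
    using \<tau>[of i] \<gamma> by (intro mult_left_mono c ge_one_powr_ge_zero) auto
  thus "\<exists>N. \<forall>n\<ge>N. norm (c n) \<le> c n * (1 + \<tau> n) powr \<gamma>" using c by simp
qed

lemma lacunary_summable: "summable (\<lambda>i. norm (complex_of_real (c i) * cis (f i)))"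
  using lacunary_summable_coeff c by (simp add: norm_mult)

lemma lacunary_norm_le: "cmod (lacunary c \<tau> j s) \<le> suminf c * exp (- pi * (norm s)\<^sup>2)"
proof -
  have "cmod (\<Sum>i. of_real (c i) * cis (2 * pi * (\<tau> i * s $ j))) \<le> (\<Sum>i. cmod (of_real (c i) * cis (2 * pi * (\<tau> i * s $ j))))"
    by (rule summable_norm[OF lacunary_summable])
  also have "\<dots> = suminf c" using c by (simp add: norm_mult)
  finally show ?thesis by (simp add: lacunary_def norm_mult mult.commute mult_right_mono)
qed

lemma lacunary_continuous: "continuous_on UNIV (lacunary c \<tau> j)"
proof -
  have "uniform_limit UNIV (\<lambda>n s. \<Sum>i<n. complex_of_real (c i) * cis (2 * pi * (\<tau> i * s $ j)))
      (\<lambda>s. \<Sum>i. of_real (c i) * cis (2 * pi * (\<tau> i * s $ j))) sequentially"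
    by (rule Weierstrass_m_test[OF _ lacunary_summable_coeff]) (use c in \<open>auto simp: norm_mult\<close>)
  hence "continuous_on UNIV (\<lambda>s :: real ^ 'n. \<Sum>i. complex_of_real (c i) * cis (2 * pi * (\<tau> i * s $ j)))"
    by (rule uniform_limit_theorem[rotated]) (auto intro!: always_eventually continuous_intros)
  thus ?thesis unfolding lacunary_def by (intro continuous_intros)
qed

lemma lacunary_phase_measurable: "(\<lambda>x :: (real ^ 'n) \<times> (real ^ 'n). lacunary c \<tau> j (snd x)) \<in> borel_measurable phase_space"
proof (rule phase_measurableI)
  have "continuous_on UNIV (\<lambda>x :: (real ^ 'n) \<times> (real ^ 'n). lacunary c \<tau> j (snd x))"
    by (rule continuous_on_compose2[OF lacunary_continuous]) (auto intro: continuous_intros)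
  thus "(\<lambda>x :: (real ^ 'n) \<times> (real ^ 'n). lacunary c \<tau> j (snd x)) \<in> borel_measurable borel"
    by (rule borel_measurable_continuous_onI)
qed

lemma lacunary_integrable: "integrable phase_space (\<lambda>x :: (real ^ 'n) \<times> (real ^ 'n). lacunary c \<tau> j (snd x))"
proof (rule Bochner_Integration.integrable_bound[OF _ lacunary_phase_measurable])
  show "integrable phase_space (\<lambda>x :: (real ^ 'n) \<times> (real ^ 'n). of_real (suminf c) * complex_of_real (exp (- pi * (norm (snd (0 - x)))\<^sup>2)))"
    by (intro integrable_mult_right square_integrable_gaussian(1))
  show "AE x in phase_space. cmod (lacunary c \<tau> j (snd x)) \<le> cmod (of_real (suminf c) * complex_of_real (exp (- pi * (norm (snd (0 - x)))\<^sup>2)))"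
  proof (rule AE_I2)
    fix x :: "(real ^ 'n) \<times> (real ^ 'n)"
    have "0 \<le> suminf c" using c lacunary_summable_coeff by (intro suminf_nonneg) auto
    thus "cmod (lacunary c \<tau> j (snd x)) \<le> cmod (of_real (suminf c) * complex_of_real (exp (- pi * (norm (snd (0 - x)))\<^sup>2)))"
      using lacunary_norm_le[of "snd x"] by (simp add: norm_mult)
  qed
qed

lemma lacunary_square_integrable: "square_integrable phase_space (\<lambda>x :: (real ^ 'n) \<times> (real ^ 'n). lacunary c \<tau> j (snd x))"
proof (rule square_integrable_bounded[OF lacunary_integrable])
  fix x :: "(real ^ 'n) \<times> (real ^ 'n)"
  have "0 \<le> suminf c" using c lacunary_summable_coeff by (intro suminf_nonneg) auto
  hence "suminf c * exp (- pi * (norm (snd x))\<^sup>2) \<le> suminf c * 1" by (intro mult_left_mono) auto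
  thus "cmod (lacunary c \<tau> j (snd x)) \<le> suminf c" using lacunary_norm_le[of "snd x"] by simp
qed

abbreviation "center i \<equiv> \<tau> i *\<^sub>R (axis j 1 :: real ^ 'n)"

abbreviation "bump i t \<equiv> exp (- pi * (norm (t - center i))\<^sup>2)"

lemma lacunary_transform_line:
  shows "(\<integral>s. lacunary c \<tau> j s * cis (- (2 * pi * (t \<bullet> s))) \<partial>lborel) = of_real (\<Sum>i. c i * bump i t)"
    and "integrable lborel (\<lambda>s. lacunary c \<tau> j s * cis (- (2 * pi * (t \<bullet> s))))"
proof -
  define u where "u i = center i - t" for i
  define h where "h i s = of_real (c i) * (of_real (exp (- pi * (norm s / 1)\<^sup>2)) * (\<Prod>k\<in>UNIV. cis (2 * pi * (s $ k * u i $ k))))"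
    for i and s :: "real ^ 'n"
  have G: "has_bochner_integral lborel (h i) (of_real (c i * bump i t))" for i
  proof -
    have "has_bochner_integral lborel (h i) (of_real (c i) * of_real (1 ^ CARD('n) * exp (- pi * (1 * norm (u i))\<^sup>2)))"
      unfolding h_def by (intro has_bochner_integral_mult_right gaussian_transform) auto
    thus ?thesis by (simp add: u_def norm_minus_commute)
  qed
  have hn: "cmod (h i s) = c i * exp (- pi * (norm s)\<^sup>2)" for i s
    using c[of i] by (simp add: h_def norm_mult prod_norm[symmetric])
  have hsum: "lacunary c \<tau> j s * cis (- (2 * pi * (t \<bullet> s))) = (\<Sum>i. h i s)" for s
  proof -
    define \<Gamma> where "\<Gamma> = complex_of_real (exp (- pi * (norm s)\<^sup>2))"
    define a where "a i = complex_of_real (c i) * cis (2 * pi * (\<tau> i * s $ j))" for i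
    define e where "e = cis (- (2 * pi * (t \<bullet> s)))"
    have "h i s = of_real (exp (- pi * (norm s)\<^sup>2)) * ((of_real (c i) * cis (2 * pi * (\<tau> i * s $ j))) * cis (- (2 * pi * (t \<bullet> s))))" for i
    proof -
      have "(\<Sum>k\<in>UNIV. s $ k * u i $ k) = s \<bullet> u i" by (simp add: inner_vec_def)
      also have "\<dots> = \<tau> i * s $ j - t \<bullet> s" by (simp add: u_def inner_diff_right inner_axis inner_commute)
      finally have "(\<Prod>k\<in>UNIV. cis (2 * pi * (s $ k * u i $ k))) = cis (2 * pi * (\<tau> i * s $ j - t \<bullet> s))"
        unfolding cis_sum[symmetric] sum_distrib_left[symmetric] by simp
      also have "\<dots> = cis (2 * pi * (\<tau> i * s $ j)) * cis (- (2 * pi * (t \<bullet> s)))"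
        by (simp add: cis_mult right_diff_distrib)
      finally show ?thesis by (simp add: h_def ac_simps)
    qed
    hence h: "h i s = \<Gamma> * (a i * e)" for i unfolding \<Gamma>_def a_def e_def by simp
    have a: "summable a" unfolding a_def by (rule summable_norm_cancel[OF lacunary_summable])
    have "lacunary c \<tau> j s * cis (- (2 * pi * (t \<bullet> s))) = \<Gamma> * (suminf a * e)"
      unfolding lacunary_def \<Gamma>_def a_def[abs_def] e_def by (simp only: mult.assoc)
    also have "\<dots> = (\<Sum>i. \<Gamma> * (a i * e))"
      by (simp only: suminf_mult2[OF a] suminf_mult[OF summable_mult2[OF a]])
    finally show ?thesis unfolding h .
  qed
  have int: "integrable lborel (h i)" for i using G[of i] by (simp add: has_bochner_integral_iff)
  have E: "(\<integral>s. cmod (h i s) \<partial>lborel) = c i * (\<integral>s. exp (- pi * (norm (s :: real ^ 'n))\<^sup>2) \<partial>lborel)" for i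
    unfolding hn by simp
  have AE: "AE s in lborel. summable (\<lambda>i. cmod (h i s))"
    using lacunary_summable_coeff by (simp add: hn summable_mult2)
  have S: "summable (\<lambda>i. \<integral>s. cmod (h i s) \<partial>lborel)"
    using lacunary_summable_coeff by (simp add: E summable_mult2)
  show "integrable lborel (\<lambda>s. lacunary c \<tau> j s * cis (- (2 * pi * (t \<bullet> s))))"
    unfolding hsum by (rule integrable_suminf[OF int AE S])
  have sb: "summable (\<lambda>i. c i * bump i t)"
    using c by (intro summable_comparison_test[OF _ lacunary_summable_coeff]) (auto simp: mult_left_le)
  have "(\<integral>s. lacunary c \<tau> j s * cis (- (2 * pi * (t \<bullet> s))) \<partial>lborel) = (\<Sum>i. integral\<^sup>L lborel (h i))"
    unfolding hsum by (rule integral_suminf[OF int AE S])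
  also have "\<dots> = (\<Sum>i. of_real (c i * bump i t))"
    using G by (simp add: has_bochner_integral_iff)
  also have "\<dots> = of_real (\<Sum>i. c i * bump i t)" by (rule suminf_of_real[OF sb, symmetric])
  finally show "(\<integral>s. lacunary c \<tau> j s * cis (- (2 * pi * (t \<bullet> s))) \<partial>lborel) = of_real (\<Sum>i. c i * bump i t)" .
qed

lemma bump_summable: "summable (\<lambda>i. c i * bump i t)"
  using c by (intro summable_comparison_test[OF _ lacunary_summable_coeff]) (auto simp: mult_left_le)

text \<open>Nothing depends on the angles, so only \<open>n = 0\<close> contributes; there the transform is a
  superposition of Gaussian bumps centred at the frequencies.\<close>

lemma lacunary_fourier:
  "fourier_L1 (\<lambda>x. lacunary c \<tau> j (snd x)) (n, t) = (if n = 0 then of_real (\<Sum>i. c i * bump i t) else 0)"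
proof -
  define f where "f \<theta> = cnj (wave (n, t) (\<theta>, 0))" for \<theta>
  define g where "g s = lacunary c \<tau> j s * cis (- (2 * pi * (t \<bullet> s)))" for s
  have If: "integral\<^sup>L torus f = (if n = 0 then 1 else 0)"
    unfolding f_def Bochner_Integration.integral_cnj torus_wave_integral by simp
  interpret finite_measure "torus :: (real ^ 'n) measure" by (rule finite_measure_torus)
  have "(\<lambda>\<theta>. (\<theta>, 0)) \<in> measurable torus (phase_space :: ((real ^ 'n) \<times> (real ^ 'n)) measure)" by measurable
  from measurable_compose[OF this wave_measurable_phase] have "f \<in> borel_measurable torus"
    unfolding f_def by measurable
  hence intf: "integrable torus f"
    by (rule integrable_const_bound[where B = 1, rotated]) (auto simp: f_def)
  have "lacunary c \<tau> j (snd x) * cnj (wave (n, t) x) = f (fst x) * g (snd x)" for x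
    using wave_at_angle_moduli[of n t "fst x" "snd x"] by (simp add: f_def g_def cis_cnj)
  hence "fourier_L1 (\<lambda>x. lacunary c \<tau> j (snd x)) (n, t) = integral\<^sup>L torus f * integral\<^sup>L lborel g"
    unfolding fourier_L1_wave
    using pair_product_integral(2)[OF sigma_finite_torus lborel.sigma_finite_measure_axioms intf lacunary_transform_line(2)[of t, folded g_def]]
    by simp
  thus ?thesis using If lacunary_transform_line(1)[of t, folded g_def] by simp
qed

text \<open>The weight at \<open>t\<close> is at most the weight at the centre of the bump times a linear factor, which a
  part of the Gaussian absorbs.\<close>

lemma bump_weight_le:
  "bump i t * (1 + norm t) powr \<gamma> \<le> 2 * (1 + \<tau> i) powr \<gamma> * exp (- pi * (norm (t - center i))\<^sup>2 / 2)"
proof -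
  define u where "u = norm (t - center i)"
  have u: "0 \<le> u" by (simp add: u_def)
  have "norm t \<le> u + norm (center i)"
    unfolding u_def using norm_triangle_sub[of t "center i"] by simp
  hence "norm t \<le> u + \<tau> i" using \<tau>[of i] by simp
  moreover have "0 \<le> u * \<tau> i" using u \<tau>[of i] by simp
  ultimately have "1 + norm t \<le> (1 + u) * (1 + \<tau> i)" by (simp add: algebra_simps)
  hence "(1 + norm t) powr \<gamma> \<le> ((1 + u) * (1 + \<tau> i)) powr \<gamma>" using \<gamma> by (intro powr_mono2) auto
  also have "\<dots> = (1 + u) powr \<gamma> * (1 + \<tau> i) powr \<gamma>" using u \<tau>[of i] by (simp add: powr_mult)
  also have "\<dots> \<le> (1 + u) powr 1 * (1 + \<tau> i) powr \<gamma>" using u \<gamma> by (intro mult_right_mono powr_mono) auto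
  finally have "(1 + norm t) powr \<gamma> \<le> (1 + u) * (1 + \<tau> i) powr \<gamma>" using u by simp
  hence "exp (- pi * u\<^sup>2) * (1 + norm t) powr \<gamma> \<le> exp (- pi * u\<^sup>2) * ((1 + u) * (1 + \<tau> i) powr \<gamma>)"
    by (intro mult_left_mono) auto
  also have "\<dots> = ((1 + u) * exp (- pi * u\<^sup>2)) * (1 + \<tau> i) powr \<gamma>" by simp
  also have "\<dots> \<le> (2 * exp (- pi * u\<^sup>2 / 2)) * (1 + \<tau> i) powr \<gamma>"
    by (intro mult_right_mono one_plus_times_gaussian_le u) auto
  finally show ?thesis by (simp add: u_def ac_simps)
qed

lemma lacunary_weighted_finite:
  "(\<integral>\<^sup>+t. ennreal ((\<Sum>i. c i * bump i t) * (1 + norm t) powr \<gamma>) \<partial>lborel) < \<infinity>"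
proof -
  define K where "K = (\<integral>\<^sup>+t. ennreal (exp (- pi * (norm (t :: real ^ 'n))\<^sup>2 / 2)) \<partial>lborel)"
  define d where "d i = 2 * (c i * (1 + \<tau> i) powr \<gamma>)" for i
  have d: "d i \<ge> 0" for i using c by (simp add: d_def)
  have "(\<integral>\<^sup>+t. ennreal ((\<Sum>i. c i * bump i t) * (1 + norm t) powr \<gamma>) \<partial>lborel) \<le>
      (\<integral>\<^sup>+t. (\<Sum>i. ennreal (d i) * ennreal (exp (- pi * (norm (t - center i))\<^sup>2 / 2))) \<partial>lborel)"
  proof (rule nn_integral_mono)
    fix t :: "real ^ 'n"
    have "ennreal ((\<Sum>i. c i * bump i t) * (1 + norm t) powr \<gamma>) = ennreal (\<Sum>i. c i * bump i t * (1 + norm t) powr \<gamma>)"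
      by (subst suminf_mult2[OF bump_summable]) simp
    also have "\<dots> = (\<Sum>i. ennreal (c i * bump i t * (1 + norm t) powr \<gamma>))"
      by (rule suminf_ennreal2[symmetric]) (use c bump_summable summable_mult2 in auto)
    also have "\<dots> \<le> (\<Sum>i. ennreal (d i) * ennreal (exp (- pi * (norm (t - center i))\<^sup>2 / 2)))"
    proof (intro suminf_le summableI)
      fix i
      have "c i * (bump i t * (1 + norm t) powr \<gamma>) \<le> c i * (2 * (1 + \<tau> i) powr \<gamma> * exp (- pi * (norm (t - center i))\<^sup>2 / 2))"
        by (intro mult_left_mono bump_weight_le c)
      also have "\<dots> = d i * exp (- pi * (norm (t - center i))\<^sup>2 / 2)" by (simp add: d_def)
      finally show "ennreal (c i * bump i t * (1 + norm t) powr \<gamma>) \<le>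
          ennreal (d i) * ennreal (exp (- pi * (norm (t - center i))\<^sup>2 / 2))"
        using d[of i] by (subst ennreal_mult[symmetric]) (auto simp: mult.assoc intro: ennreal_leI)
    qed
    finally show "ennreal ((\<Sum>i. c i * bump i t) * (1 + norm t) powr \<gamma>) \<le>
      (\<Sum>i. ennreal (d i) * ennreal (exp (- pi * (norm (t - center i))\<^sup>2 / 2)))" .
  qed
  also have "\<dots> = (\<Sum>i. \<integral>\<^sup>+t. ennreal (d i) * ennreal (exp (- pi * (norm (t - center i))\<^sup>2 / 2)) \<partial>lborel)"
    by (rule nn_integral_suminf) measurable
  also have "\<dots> = (\<Sum>i. ennreal (d i) * K)"
  proof (rule suminf_cong)
    fix i
    show "(\<integral>\<^sup>+t. ennreal (d i) * ennreal (exp (- pi * (norm (t - center i))\<^sup>2 / 2)) \<partial>lborel) = ennreal (d i) * K"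
      unfolding K_def gaussian_half_nn(1)[of "center i", symmetric] by (rule nn_integral_cmult) measurable
  qed
  also have "\<dots> = (\<Sum>i. ennreal (d i)) * K" by simp
  also have "(\<Sum>i. ennreal (d i)) = ennreal (suminf d)"
    by (rule suminf_ennreal2) (use d sum in \<open>auto simp: d_def summable_mult\<close>)
  also have "\<dots> * K < \<infinity>" using gaussian_half_nn(2)[where 'n = 'n] unfolding K_def[symmetric] by (simp add: ennreal_mult_less_top)
  finally show ?thesis .
qed

lemma lacunary_dual_finite:
  fixes W :: "(int ^ 'n) \<times> (real ^ 'n) \<Rightarrow> real"
  assumes W: "W \<in> borel_measurable dual_space" "\<And>t. 0 \<le> W (0, t)" "\<And>t. W (0, t) \<le> B * (1 + norm t) powr \<gamma>"
  shows "(\<integral>\<^sup>+\<zeta>. ennreal (cmod (fourier_L1 (\<lambda>x. lacunary c \<tau> j (snd x)) \<zeta>) * W \<zeta>) \<partial>dual_space) < \<infinity>"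
proof -
  let ?f = "fourier_L1 (\<lambda>x. lacunary c \<tau> j (snd x))"
  have [measurable]: "?f \<in> borel_measurable dual_space" by (rule fourier_L1_measurable[OF lacunary_integrable])
  note W(1)[measurable]
  define I where "I = (\<integral>\<^sup>+t. ennreal ((\<Sum>i. c i * bump i t) * W (0, t)) \<partial>lborel)"
  have pos: "0 \<le> (\<Sum>i. c i * bump i t)" for t using c by (intro suminf_nonneg bump_summable) auto
  have B: "0 \<le> B" using W(2)[of 0] W(3)[of 0] by simp
  have "(\<integral>\<^sup>+\<zeta>. ennreal (cmod (?f \<zeta>) * W \<zeta>) \<partial>dual_space) =
      (\<integral>\<^sup>+n. (\<integral>\<^sup>+t. ennreal (cmod (?f (n, t)) * W (n, t)) \<partial>lborel) \<partial>count_space UNIV)"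
    by (intro count_lborel_nn_integral[symmetric]) measurable
  also have "\<dots> = (\<integral>\<^sup>+n. I * indicator {0 :: int ^ 'n} n \<partial>count_space UNIV)"
  proof (rule nn_integral_cong)
    fix n :: "int ^ 'n"
    show "(\<integral>\<^sup>+t. ennreal (cmod (?f (n, t)) * W (n, t)) \<partial>lborel) = I * indicator {0} n"
      using pos by (cases "n = 0") (simp_all add: lacunary_fourier I_def)
  qed
  also have "\<dots> = I" by (subst nn_integral_cmult_indicator) auto
  also have "\<dots> \<le> (\<integral>\<^sup>+t. ennreal B * ennreal ((\<Sum>i. c i * bump i t) * (1 + norm t) powr \<gamma>) \<partial>lborel)"
    unfolding I_def
  proof (rule nn_integral_mono)
    fix t :: "real ^ 'n"
    have "(\<Sum>i. c i * bump i t) * W (0, t) \<le> (\<Sum>i. c i * bump i t) * (B * (1 + norm t) powr \<gamma>)"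
      by (intro mult_left_mono W(3) pos)
    hence "ennreal ((\<Sum>i. c i * bump i t) * W (0, t)) \<le> ennreal (B * ((\<Sum>i. c i * bump i t) * (1 + norm t) powr \<gamma>))"
      by (intro ennreal_leI) (simp add: ac_simps)
    thus "ennreal ((\<Sum>i. c i * bump i t) * W (0, t)) \<le> ennreal B * ennreal ((\<Sum>i. c i * bump i t) * (1 + norm t) powr \<gamma>)"
      using B pos[of t] by (subst ennreal_mult[symmetric]) auto
  qed
  also have "\<dots> = ennreal B * (\<integral>\<^sup>+t. ennreal ((\<Sum>i. c i * bump i t) * (1 + norm t) powr \<gamma>) \<partial>lborel)"
    by (rule nn_integral_cmult) measurable
  also have "\<dots> < \<infinity>" using lacunary_weighted_finite by (simp add: ennreal_mult_less_top)
  finally show ?thesis .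
qed

lemma lacunary_has_fourier:
  "has_fourier (\<lambda>x. lacunary c \<tau> j (snd x)) (fourier_L1 (\<lambda>x. lacunary c \<tau> j (snd x)))"
proof -
  let ?F = "\<lambda>x :: (real ^ 'n) \<times> (real ^ 'n). lacunary c \<tau> j (snd x)"
  have m [measurable]: "fourier_L1 ?F \<in> borel_measurable dual_space" by (rule fourier_L1_measurable[OF lacunary_integrable])
  have "(\<integral>\<^sup>+\<xi>. ennreal ((cmod (fourier_L1 ?F \<xi>))\<^sup>2) \<partial>dual_space) \<le> (\<integral>\<^sup>+x. ennreal ((cmod (?F x))\<^sup>2) \<partial>phase_space)"
    by (rule bessel[OF lacunary_integrable])
  also have "\<dots> < \<infinity>"
    using lacunary_square_integrable by (subst nn_integral_eq_integral) (auto simp: square_integrable_def)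
  finally have "square_integrable dual_space (fourier_L1 ?F)"
    unfolding square_integrable_def integrable_iff_bounded using m by auto
  thus ?thesis
    unfolding has_fourier_def
    using lacunary_square_integrable lacunary_integrable
    by (intro conjI exI[of _ "\<lambda>_. ?F"]) (auto simp: L2_converges_def)
qed

lemma lacunary_test_function: "(\<lambda>x. lacunary c \<tau> j (snd x)) \<in> test_functions"
proof -
  let ?F = "\<lambda>x :: (real ^ 'n) \<times> (real ^ 'n). lacunary c \<tau> j (snd x)"
  have m: "fourier_L1 ?F \<in> borel_measurable dual_space" by (rule fourier_L1_measurable[OF lacunary_integrable])
  have "(\<integral>\<^sup>+\<zeta>. ennreal (cmod (fourier_L1 ?F \<zeta>) * 1) \<partial>dual_space) < \<infinity>"
    using \<gamma> by (intro lacunary_dual_finite[where B = 1]) (auto intro!: ge_one_powr_ge_zero)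
  hence "integrable dual_space (fourier_L1 ?F)" using m by (simp add: integrable_iff_bounded)
  moreover have "continuous_on UNIV ?F"
    by (rule continuous_on_compose2[OF lacunary_continuous]) (auto intro: continuous_intros)
  ultimately show ?thesis
    using lacunary_has_fourier lacunary_square_integrable
    by (auto simp: test_functions_def torus_periodic_def)
qed

lemma lacunary_bound_const: "bound_const \<gamma> (\<lambda>x. lacunary c \<tau> j (snd x)) < \<infinity>"
proof -
  let ?F = "\<lambda>x :: (real ^ 'n) \<times> (real ^ 'n). lacunary c \<tau> j (snd x)"
  let ?D = "dual_space :: ((int ^ 'n) \<times> (real ^ 'n)) measure"
  define W where "W \<zeta> = 2 * (8 * pi) powr \<gamma> * infnorm (snd \<zeta>) powr \<gamma> + 24 powr \<gamma> * real_of_int (l1_norm (fst \<zeta>)) powr \<gamma>"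
    for \<zeta> :: "(int ^ 'n) \<times> (real ^ 'n)"
  have mW [measurable]: "W \<in> borel_measurable ?D" unfolding W_def by (rule bound_weight_measurable)
  have mF [measurable]: "fourier ?F \<in> borel_measurable ?D"
    using fourier_test_function(2)[OF lacunary_test_function] by auto
  have "bound_const \<gamma> ?F = (\<integral>\<^sup>+\<zeta>. ennreal (cmod (fourier ?F \<zeta>) * W \<zeta>) \<partial>?D)"
    unfolding bound_const_def by (subst count_lborel_nn_integral[symmetric]) (measurable, simp add: W_def)
  also have "\<dots> = (\<integral>\<^sup>+\<zeta>. ennreal (cmod (fourier_L1 ?F \<zeta>) * W \<zeta>) \<partial>?D)"
  proof (rule nn_integral_cong_AE)
    have "AE \<zeta> in ?D. fourier ?F \<zeta> = fourier_L1 ?F \<zeta>"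
      by (rule has_fourier_unique[OF fourier_test_function(1)[OF lacunary_test_function] lacunary_has_fourier])
    thus "AE \<zeta> in ?D. ennreal (cmod (fourier ?F \<zeta>) * W \<zeta>) = ennreal (cmod (fourier_L1 ?F \<zeta>) * W \<zeta>)"
      by eventually_elim simp
  qed
  also have "\<dots> < \<infinity>"
  proof (rule lacunary_dual_finite[OF mW, where B = "2 * (8 * pi) powr \<gamma>"])
    fix t :: "real ^ 'n"
    show "0 \<le> W (0, t)" by (simp add: W_def)
    have "infnorm t powr \<gamma> \<le> (1 + norm t) powr \<gamma>"
      using \<gamma> infnorm_le_norm[of t] by (intro powr_mono2) (auto simp: infnorm_pos_le)
    thus "W (0, t) \<le> 2 * (8 * pi) powr \<gamma> * (1 + norm t) powr \<gamma>"
      by (simp add: W_def l1_norm_def mult_left_mono)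
  qed
  finally show ?thesis .
qed

text \<open>At half a period of the \<open>k\<close>-th oscillation the \<open>k\<close>-th cosine is \<open>- 1\<close>, while the other terms and
  the Gaussian factor can only decrease the value at \<open>0\<close>.\<close>

lemma lacunary_gap:
  assumes k: "2 * \<tau> k * s $ j = 1"
  shows "c k \<le> cmod (lacunary c \<tau> j s - lacunary c \<tau> j 0)"
proof -
  define C where "C = suminf c"
  define R where "R = (\<Sum>i. c i * cos (2 * pi * (\<tau> i * s $ j)))"
  have sR: "summable (\<lambda>i. c i * cos (2 * pi * (\<tau> i * s $ j)))"
    using c by (intro summable_comparison_test[OF _ lacunary_summable_coeff]) (auto simp: abs_mult mult_left_le)
  have l0: "lacunary c \<tau> j 0 = of_real C"
    using suminf_of_real[OF lacunary_summable_coeff, where 'a = complex] by (simp add: lacunary_def C_def)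
  have "Re (\<Sum>i. of_real (c i) * cis (2 * pi * (\<tau> i * s $ j))) = R"
    using Re_suminf[OF summable_norm_cancel[OF lacunary_summable[of "\<lambda>i. 2 * pi * (\<tau> i * s $ j)"]]] by (simp add: R_def)
  hence ls: "Re (lacunary c \<tau> j s) = exp (- pi * (norm s)\<^sup>2) * R" by (simp add: lacunary_def)
  have "c k * (1 - cos (2 * pi * (\<tau> k * s $ j))) \<le> (\<Sum>i. c i - c i * cos (2 * pi * (\<tau> i * s $ j)))"
    using sum_le_suminf[OF summable_diff[OF lacunary_summable_coeff sR], of "{k}"] c
    by (auto simp: mult_left_le right_diff_distrib)
  also have "\<dots> = C - R" unfolding C_def R_def by (rule suminf_diff[OF lacunary_summable_coeff sR, symmetric])
  also have "2 * pi * (\<tau> k * s $ j) = pi" using k by (simp add: algebra_simps)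
  finally have CR: "2 * c k \<le> C - R" by simp
  have Ck: "c k \<le> C" unfolding C_def using sum_le_suminf[OF lacunary_summable_coeff, of "{k}"] c by auto
  have "exp (- pi * (norm s)\<^sup>2) * R \<le> max 0 R"
    by (cases "R \<ge> 0") (auto simp: mult_left_le_one_le mult_le_0_iff)
  hence "c k \<le> C - exp (- pi * (norm s)\<^sup>2) * R" using CR Ck c[of k] by (auto simp: max_def split: if_splits)
  also have "\<dots> = Re (lacunary c \<tau> j 0 - lacunary c \<tau> j s)" by (simp add: l0 ls)
  also have "\<dots> \<le> cmod (lacunary c \<tau> j 0 - lacunary c \<tau> j s)" by (rule complex_Re_le_cmod)
  finally show ?thesis by (simp add: norm_minus_commute)
qed

end


section \<open>Sharpness of the exponent\<close>

lemma torus_integral_const: "(LINT \<theta>|(torus :: (real ^ 'n) measure). z) = (z :: complex)"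
proof -
  have "(LINT \<theta>|(torus :: (real ^ 'n) measure). z) = z * (LINT \<theta>|(torus :: (real ^ 'n) measure). 1)"
    by (simp only: mult_1_right flip: integral_mult_right_zero)
  also have "(LINT \<theta>|(torus :: (real ^ 'n) measure). (1 :: complex)) = 1"
    using torus_wave_integral[of "0 :: (int ^ 'n) \<times> (real ^ 'n)"] by (simp add: wave_def zero_prod_def)
  finally show ?thesis by simp
qed

text \<open>For a function of the logarithmic moduli alone, the orbit of a radical point acts as a single
  point.\<close>

lemma equidist_error_radical:
  fixes q :: "'n::finite \<Rightarrow> nat"
  assumes q: "\<And>j. prime (q j)" "inj q" and p: "prime p"
  shows "equidist_error (\<lambda>x. g (snd x)) (radical_point q p) = cmod (g (\<chi> j. ln (real (q j)) / real p) - g 0)"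
proof -
  let ?\<xi> = "radical_point q p"
  note tp = torus_point_radical[OF q p]
  have "(\<Sum>\<alpha>\<in>galois_orbit ?\<xi>. g (log_moduli \<alpha>)) = (\<Sum>\<alpha>\<in>galois_orbit ?\<xi>. g (\<chi> j. ln (real (q j)) / real p))"
    by (intro sum.cong) (simp_all add: log_moduli_radical_orbit[OF q p])
  moreover have "card (galois_orbit ?\<xi>) > 0" by (rule card_galois_orbit_pos[OF tp])
  ultimately show ?thesis
    unfolding equidist_error_def snd_conv torus_integral_const by simp
qed

text \<open>The size assumptions make \<open>\<bar>ln h\<bar>\<close> at least half of \<open>ln P\<close> and the iterated logarithm at least
  \<open>2\<close>. The logarithm in the denominator of the target then leaves a factor \<open>(ln P) powr (\<gamma> - 1)\<close>,
  and \<open>\<gamma> \<le> 1 / 2\<close> turns it into \<open>1 / sqrt (ln P)\<close>.\<close>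

lemma radical_rate:
  fixes h P B \<gamma> :: real
  assumes h: "0 < h" "h \<le> B * ln P / P" and P: "1 < P" and B: "0 < B" and \<gamma>: "0 < \<gamma>" "\<gamma> \<le> 1 / 2"
    and big: "ln B + ln (ln P) \<le> ln P / 2" "exp 2 \<le> ln P / 2"
  shows "ln \<bar>ln h\<bar> \<noteq> 0"
    and "h powr \<gamma> / (\<bar>ln h\<bar> * (ln \<bar>ln h\<bar>)\<^sup>2) \<le> 2 * B powr \<gamma> * P powr (- \<gamma>) / sqrt (ln P)"
proof -
  define l where "l = ln P"
  have l1: "1 \<le> l" using big(2) exp_ge_add_one_self[of 2] by (simp add: l_def)
  have "ln h \<le> ln (B * l / P)" using h l1 P B by (subst ln_le_cancel_iff) (auto simp: l_def)
  also have "\<dots> = ln B + ln l - l" using P B l1 by (simp add: ln_div ln_mult l_def)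
  finally have "ln h \<le> - (l / 2)" using big(1) by (simp add: l_def)
  hence A: "l / 2 \<le> \<bar>ln h\<bar>" by linarith
  have "exp 2 \<le> \<bar>ln h\<bar>" using big(2) A by (simp add: l_def)
  moreover from this have "0 < \<bar>ln h\<bar>" by (rule less_le_trans[OF exp_gt_zero])
  ultimately have LL: "2 \<le> ln \<bar>ln h\<bar>" by (simp only: ln_ge_iff)
  thus "ln \<bar>ln h\<bar> \<noteq> 0" by simp
  have "(l / 2) * 1 \<le> \<bar>ln h\<bar> * (ln \<bar>ln h\<bar>)\<^sup>2"
    using A LL l1 by (intro mult_mono) (auto intro: one_le_power)
  hence "h powr \<gamma> / (\<bar>ln h\<bar> * (ln \<bar>ln h\<bar>)\<^sup>2) \<le> h powr \<gamma> / (l / 2)"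
    using l1 by (intro divide_left_mono mult_pos_pos) auto
  also have "\<dots> \<le> (B * l / P) powr \<gamma> / (l / 2)"
    using h \<gamma> l1 by (intro divide_right_mono powr_mono2) (auto simp: l_def)
  also have "(B * l / P) powr \<gamma> = B powr \<gamma> * l powr \<gamma> * P powr (- \<gamma>)"
    using B P l1 by (simp add: powr_divide powr_mult powr_minus_divide)
  also have "B powr \<gamma> * l powr \<gamma> * P powr (- \<gamma>) / (l / 2) = 2 * B powr \<gamma> * P powr (- \<gamma>) * (l powr \<gamma> / l)"
    by simp
  also have "\<dots> \<le> 2 * B powr \<gamma> * P powr (- \<gamma>) * (1 / sqrt l)"
  proof (intro mult_left_mono)
    have "l powr \<gamma> \<le> l powr (1 / 2)" using l1 \<gamma> by (intro powr_mono) auto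
    hence "l powr \<gamma> / l \<le> sqrt l / l" using l1 by (simp add: powr_half_sqrt divide_right_mono)
    thus "l powr \<gamma> / l \<le> 1 / sqrt l" using l1 by (simp add: sqrt_divide_self_eq inverse_eq_divide)
  qed auto
  finally show "h powr \<gamma> / (\<bar>ln h\<bar> * (ln \<bar>ln h\<bar>)\<^sup>2) \<le> 2 * B powr \<gamma> * P powr (- \<gamma>) / sqrt (ln P)"
    by (simp add: l_def)
qed

lemma rapidly_growing_primes:
  fixes K :: real
  obtains p where "\<And>k. prime (p k :: nat)" "\<And>k. exp (4 ^ k) \<le> real (p k)"
    "\<And>k. K + ln (ln (real (p k))) \<le> ln (real (p k)) / 2" "\<And>k. exp 2 \<le> ln (real (p k)) / 2"
proof -
  have "\<exists>n. prime n \<and> exp (4 ^ k) \<le> real n \<and> K + ln (ln (real n)) \<le> ln (real n) / 2 \<and> exp 2 \<le> ln (real n) / 2" for k :: nat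
  proof -
    have 1: "\<forall>\<^sub>F n in sequentially. exp (4 ^ k) \<le> real n" by real_asymp
    have 2: "\<forall>\<^sub>F n in sequentially. K + ln (ln (real n)) \<le> ln (real n) / 2" by real_asymp
    have 3: "\<forall>\<^sub>F n in sequentially. exp 2 \<le> ln (real n) / 2" by real_asymp
    obtain N where N: "\<And>n. n \<ge> N \<Longrightarrow> exp (4 ^ k) \<le> real n \<and> K + ln (ln (real n)) \<le> ln (real n) / 2 \<and> exp 2 \<le> ln (real n) / 2"
      using eventually_conj[OF 1 eventually_conj[OF 2 3]] unfolding eventually_sequentially by blast
    obtain n where "prime n" "n > N" using bigger_prime by blast
    thus ?thesis using N[of n] by (intro exI[of _ n]) auto
  qed
  then obtain p where "\<And>k. prime (p k) \<and> exp (4 ^ k) \<le> real (p k) \<and> K + ln (ln (real (p k))) \<le> ln (real (p k)) / 2 \<and> exp 2 \<le> ln (real (p k)) / 2"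
    by metis
  thus thesis by (intro that[of p]) auto
qed

lemma distinct_primes_family:
  obtains q :: "'n::finite \<Rightarrow> nat" where "\<And>j. prime (q j)" "inj q"
proof -
  obtain Q where Q: "finite Q" "card Q = CARD('n)" "Q \<subseteq> {p :: nat. prime p}"
    using infinite_arbitrarily_large[OF primes_infinite, of "CARD('n)"] by blast
  then obtain q where "bij_betw q (UNIV :: 'n set) Q" using finite_same_card_bij[of "UNIV :: 'n set" Q] by auto
  thus thesis using Q(3) by (intro that[of q]) (auto simp: bij_betw_def)
qed

text \<open>The factor \<open>1 / sqrt (ln (P k))\<close>, at most \<open>2\<close> to the power \<open>- k\<close>, is what remains of the coefficient
  after the weight has been compensated.\<close>

lemma lacunary_coefficients_summable:
  fixes P :: "nat \<Rightarrow> real"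
  assumes P: "\<And>k. exp (4 ^ k) \<le> P k" and "0 \<le> A" "0 < b" "0 < \<gamma>"
  shows "summable (\<lambda>k. A * P k powr (- \<gamma>) / sqrt (ln (P k)) * (1 + P k / b) powr \<gamma>)"
proof (rule summable_comparison_test)
  show "summable (\<lambda>k. A * (1 + 1 / b) powr \<gamma> * (1 / 2) ^ k)"
    by (intro summable_mult summable_geometric) simp
  have "norm (A * P k powr (- \<gamma>) / sqrt (ln (P k)) * (1 + P k / b) powr \<gamma>) \<le> A * (1 + 1 / b) powr \<gamma> * (1 / 2) ^ k" for k
  proof -
    have P1: "1 \<le> P k" using P[of k] one_le_exp_iff[of "4 ^ k"] by (meson order_trans zero_le_power zero_le_numeral)
    have "(4::real) ^ k \<le> ln (P k)" using P[of k] P1 by (simp add: ln_ge_iff)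
    hence "sqrt (4 ^ k) \<le> sqrt (ln (P k))" by simp
    moreover have "sqrt (4 ^ k) = 2 ^ k" by (simp add: real_sqrt_power)
    ultimately have s: "2 ^ k \<le> sqrt (ln (P k))" by simp
    have "(1 + P k / b) powr \<gamma> \<le> (P k * (1 + 1 / b)) powr \<gamma>"
      using P1 assms by (intro powr_mono2) (auto simp: distrib_left)
    also have "\<dots> = P k powr \<gamma> * (1 + 1 / b) powr \<gamma>" using P1 assms by (simp add: powr_mult)
    finally have "P k powr (- \<gamma>) * (1 + P k / b) powr \<gamma> \<le> P k powr (- \<gamma>) * (P k powr \<gamma> * (1 + 1 / b) powr \<gamma>)"
      by (intro mult_left_mono) auto
    also have "\<dots> = (1 + 1 / b) powr \<gamma>" using P1 by (simp add: powr_minus field_simps)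
    finally have w: "P k powr (- \<gamma>) * (1 + P k / b) powr \<gamma> \<le> (1 + 1 / b) powr \<gamma>" .
    have "A * P k powr (- \<gamma>) / sqrt (ln (P k)) * (1 + P k / b) powr \<gamma> = A * (P k powr (- \<gamma>) * (1 + P k / b) powr \<gamma>) / sqrt (ln (P k))"
      by simp
    also have "\<dots> \<le> A * (1 + 1 / b) powr \<gamma> / 2 ^ k"
      using assms w s by (intro frac_le mult_left_mono mult_nonneg_nonneg) auto
    finally show ?thesis using assms P1 by (simp add: power_one_over)
  qed
  thus "\<exists>N. \<forall>k\<ge>N. norm (A * P k powr (- \<gamma>) / sqrt (ln (P k)) * (1 + P k / b) powr \<gamma>) \<le> A * (1 + 1 / b) powr \<gamma> * (1 / 2) ^ k"
    by blast
qed

text \<open>The coefficients dominate the claimed lower bound along the radical points for the primes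
  \<open>p k\<close>, and the frequencies make each of these points the half period of its own oscillation. The
  primes grow so fast that the weighted coefficients are summable.\<close>

proposition exponent_sharp:
  fixes \<gamma> :: real
  assumes \<gamma>: "0 < \<gamma>" "\<gamma> \<le> 1 / 2"
  obtains F :: "(real ^ 'n) \<times> (real ^ 'n) \<Rightarrow> complex" and \<xi> :: "nat \<Rightarrow> complex ^ 'n"
  where "F \<in> test_functions" "bound_const \<gamma> F < \<infinity>" "\<And>k. torus_point (\<xi> k)" "(\<lambda>k. height_D (\<xi> k)) \<longlonglongrightarrow> 0"
    "\<And>k. ln \<bar>ln (height_D (\<xi> k))\<bar> \<noteq> 0"
    "\<And>k. height_D (\<xi> k) powr \<gamma> / (\<bar>ln (height_D (\<xi> k))\<bar> * (ln \<bar>ln (height_D (\<xi> k))\<bar>)\<^sup>2) \<le> equidist_error F (\<xi> k)"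
proof -
  obtain q :: "'n \<Rightarrow> nat" where q: "\<And>j. prime (q j)" "inj q" by (metis distinct_primes_family)
  \<comment> \<open>The height is at most \<open>B * ln p / p\<close>; the summand \<open>2\<close> accounts for \<open>ln (2 * p) \<le> 2 * ln p\<close>.\<close>
  define B where "B = (\<Sum>j\<in>UNIV. ln (real (q j))) + 2"
  define j0 :: 'n where "j0 = undefined"
  \<comment> \<open>Then \<open>2 * \<tau> k * s $ j0 = 1\<close> for \<open>\<tau> k = p k / b\<close> and the common logarithmic moduli \<open>s\<close> of the orbit.\<close>
  define b where "b = 2 * ln (real (q j0))"
  have b: "0 < b" using prime_gt_1_nat[OF q(1)[of j0]] by (simp add: b_def)
  have "0 \<le> (\<Sum>j\<in>UNIV. ln (real (q j)))" using prime_ge_1_nat[OF q(1)] by (intro sum_nonneg ln_ge_zero) simp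
  hence B: "0 < B" "0 \<le> B - 2" by (simp_all add: B_def)
  obtain p where p: "\<And>k. prime (p k)" "\<And>k. exp (4 ^ k) \<le> real (p k)"
    "\<And>k. ln B + ln (ln (real (p k))) \<le> ln (real (p k)) / 2" "\<And>k. exp 2 \<le> ln (real (p k)) / 2"
    using rapidly_growing_primes[of "ln B"] by metis
  define \<xi> where "\<xi> k = radical_point q (p k)" for k
  define c where "c k = 2 * B powr \<gamma> * real (p k) powr (- \<gamma>) / sqrt (ln (real (p k)))" for k
  define \<tau> where "\<tau> k = real (p k) / b" for k
  define F where "F = (\<lambda>x :: (real ^ 'n) \<times> (real ^ 'n). lacunary c \<tau> j0 (snd x))"
  have tp: "torus_point (\<xi> k)" for k unfolding \<xi>_def by (rule torus_point_radical[OF q p(1)])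
  have pg: "1 < real (p k)" for k using prime_gt_1_nat[OF p(1)[of k]] by simp
  have c0: "0 \<le> c k" for k using pg[of k] by (simp add: c_def)
  have \<tau>0: "0 \<le> \<tau> k" for k using b by (simp add: \<tau>_def)
  have sum: "summable (\<lambda>k. c k * (1 + \<tau> k) powr \<gamma>)"
    unfolding c_def \<tau>_def by (rule lacunary_coefficients_summable) (use p(2) b \<gamma> in auto)
  have F: "F \<in> test_functions" "bound_const \<gamma> F < \<infinity>"
    unfolding F_def using lacunary_test_function[OF c0 \<tau>0 \<gamma> sum] lacunary_bound_const[OF c0 \<tau>0 \<gamma> sum] by auto
  have h0: "0 < height_D (\<xi> k)" for k by (rule height_D_pos[OF tp])
  have h: "height_D (\<xi> k) \<le> B * ln (real (p k)) / real (p k)" for k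
  proof -
    have l: "1 \<le> ln (real (p k))" using p(4)[of k] exp_ge_add_one_self[of 2] by simp
    have "(B - 2) * 1 \<le> (B - 2) * ln (real (p k))" using l B by (intro mult_left_mono) auto
    moreover have "ln (2 * real (p k)) \<le> 2 * ln (real (p k))"
    proof -
      have "2 \<le> p k" using prime_ge_2_nat[OF p(1)] .
      hence "ln 2 \<le> ln (real (p k))" by simp
      thus ?thesis using pg[of k] by (simp add: ln_mult)
    qed
    ultimately have "B - 2 + ln (2 * real (p k)) \<le> B * ln (real (p k))" by (simp add: left_diff_distrib)
    hence "(B - 2 + ln (2 * real (p k))) / real (p k) \<le> B * ln (real (p k)) / real (p k)"
      by (intro divide_right_mono) auto
    thus ?thesis using height_D_radical_le[OF q p(1)[of k]] by (simp add: \<xi>_def B_def)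
  qed
  have lim: "(\<lambda>k. height_D (\<xi> k)) \<longlonglongrightarrow> 0"
  proof (rule tendsto_sandwich[of "\<lambda>_. 0" _ _ "\<lambda>k. B * ln (real (p k)) / real (p k)"])
    have "filterlim (\<lambda>k. real (p k)) at_top sequentially"
    proof (rule filterlim_at_top_mono)
      show "filterlim (\<lambda>k :: nat. exp (4 ^ k) :: real) at_top sequentially" by real_asymp
    qed (use p(2) in auto)
    moreover have "((\<lambda>x. B * ln x / x) \<longlongrightarrow> 0) at_top" by real_asymp
    ultimately show "(\<lambda>k. B * ln (real (p k)) / real (p k)) \<longlonglongrightarrow> 0" by (rule filterlim_compose[rotated])
  qed (use h less_imp_le[OF h0] in auto)
  have gap: "c k \<le> equidist_error F (\<xi> k)" for k
  proof -
    have "2 * \<tau> k * (\<chi> j. ln (real (q j)) / real (p k)) $ j0 = 1"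
      using b pg[of k] by (simp add: \<tau>_def b_def)
    from lacunary_gap[OF c0 \<tau>0 \<gamma> sum this] show ?thesis
      unfolding F_def \<xi>_def equidist_error_radical[OF q p(1)] .
  qed
  note rate = radical_rate[OF h0 h pg B(1) \<gamma> p(3) p(4), folded c_def]
  show thesis
    by (rule that[OF F, of \<xi>], rule tp, rule lim, rule rate(1), rule order_trans[OF rate(2) gap])
qed

theorem corollary3:
  fixes \<gamma> :: real
  assumes "0 < \<gamma>" and "\<gamma> \<le> 1 / 2"
  shows "(\<forall>(\<xi> :: complex ^ 'n) F.
            (\<forall>j. algebraic (\<xi> $ j) \<and> \<xi> $ j \<noteq> 0) \<and> F \<in> test_functions \<longrightarrow>
            ennreal (equidist_error F \<xi>) \<le> bound_const \<gamma> F * ennreal (height_D \<xi> powr \<gamma>))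
       \<and> (\<exists>(F :: (real ^ 'n) \<times> (real ^ 'n) \<Rightarrow> complex) (\<xi> :: nat \<Rightarrow> complex ^ 'n).
            F \<in> test_functions \<and> bound_const \<gamma> F < \<infinity> \<and>
            (\<forall>k\<ge>1. \<forall>j. algebraic (\<xi> k $ j) \<and> \<xi> k $ j \<noteq> 0) \<and>
            (\<lambda>k. height_D (\<xi> k)) \<longlonglongrightarrow> 0 \<and>
            (\<forall>k\<ge>1. ln \<bar>ln (height_D (\<xi> k))\<bar> \<noteq> 0 \<and>
                    equidist_error F (\<xi> k) \<ge>
                      height_D (\<xi> k) powr \<gamma> /
                        (\<bar>ln (height_D (\<xi> k))\<bar> * (ln \<bar>ln (height_D (\<xi> k))\<bar>)\<^sup>2)))"
proof (intro conjI allI impI)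
  fix \<xi> :: "complex ^ 'n" and F :: "(real ^ 'n) \<times> (real ^ 'n) \<Rightarrow> complex"
  assume "(\<forall>j. algebraic (\<xi> $ j) \<and> \<xi> $ j \<noteq> 0) \<and> F \<in> test_functions"
  hence "torus_point \<xi>" "F \<in> test_functions" by (simp_all add: torus_point_def)
  thus "ennreal (equidist_error F \<xi>) \<le> bound_const \<gamma> F * ennreal (height_D \<xi> powr \<gamma>)"
    by (intro equidistribution_upper_bound assms)
next
  obtain F :: "(real ^ 'n) \<times> (real ^ 'n) \<Rightarrow> complex" and \<xi> :: "nat \<Rightarrow> complex ^ 'n"
    where F: "F \<in> test_functions" "bound_const \<gamma> F < \<infinity>" and tp: "\<And>k. torus_point (\<xi> k)"
      and lim: "(\<lambda>k. height_D (\<xi> k)) \<longlonglongrightarrow> 0"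
      and sharp: "\<And>k. ln \<bar>ln (height_D (\<xi> k))\<bar> \<noteq> 0"
        "\<And>k. height_D (\<xi> k) powr \<gamma> / (\<bar>ln (height_D (\<xi> k))\<bar> * (ln \<bar>ln (height_D (\<xi> k))\<bar>)\<^sup>2) \<le> equidist_error F (\<xi> k)"
    using exponent_sharp[OF assms] by metis
  show "\<exists>(F :: (real ^ 'n) \<times> (real ^ 'n) \<Rightarrow> complex) (\<xi> :: nat \<Rightarrow> complex ^ 'n).
            F \<in> test_functions \<and> bound_const \<gamma> F < \<infinity> \<and>
            (\<forall>k\<ge>1. \<forall>j. algebraic (\<xi> k $ j) \<and> \<xi> k $ j \<noteq> 0) \<and>
            (\<lambda>k. height_D (\<xi> k)) \<longlonglongrightarrow> 0 \<and>
            (\<forall>k\<ge>1. ln \<bar>ln (height_D (\<xi> k))\<bar> \<noteq> 0 \<and>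
                    equidist_error F (\<xi> k) \<ge>
                      height_D (\<xi> k) powr \<gamma> /
                        (\<bar>ln (height_D (\<xi> k))\<bar> * (ln \<bar>ln (height_D (\<xi> k))\<bar>)\<^sup>2))"
    using F tp lim sharp by (intro exI[of _ F] exI[of _ \<xi>]) (simp add: torus_point_def)
qed

end
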